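(* Let $L>0$, $\Omega_x=(-L,L)$, let $\Omega_y$ be $(0,\pi)$, $\mathbb{S}^1$ or $\mathbb{R}$, and $\Omega=\Omega_x\times\Omega_y$. Let $\gamma\ge1$ be an integer and let $q\in C^\infty([-L,L])$ be real-valued with $q^{(k)}(0)=0$ for $0\le k\le\gamma-1$, $q^{(\gamma)}(0)>0$, and $q(x)\ne0$ for all $x\neq0$. Let $r\in C^\infty(\Omega_y)$ with $r>0$, and $r\equiv1$ if $\Omega_y=\mathbb{R}$. Let $V\in L^\infty(\Omega_x)$ be real-valued. Let $\tilde\omega=\tilde\omega_x\times\Omega_y$, where $\tilde\omega_x\subset\Omega_x$ is a nonempty open set with $\operatorname{dist}(\tilde\omega_x,0)>0$. For $T>0$ consider the control system $$\partial_tf-\partial_x^2f-q(x)^2\partial_y(r(y)^2\partial_yf)+V(x)f=u\,\mathbf 1_{\tilde\omega}\ \text{ in }(0,T)\times\Omega,\qquad f=0\ \text{ on }(0,T)\times\partial\Omega,\qquad f(0,\cdot)=f_0 .$$ Let $d_{\operatorname{agm}}(x)=\int_{\min(0,x)}^{\max(0,x)}|q(s)|\,ds$ and $d_{\operatorname{agm}}(\tilde\omega_x)=\inf_{x\in\tilde\omega_x}d_{\operatorname{agm}}(x)$. (i) If $\gamma=1$, then for every $T>0$ with $T<\dfrac{d_{\operatorname{agm}}(\tilde\omega_x)}{q'(0)}$ there exists $f_0\in D\big(G_V^{1/2}\big)$ that cannot be steered to $0$ in $L^2(\Omega)$ in time $T$ by means of a control in $L^2((0,T)\times\tilde\omega)$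 (i.e. for every such control $u$, the solution satisfies $f(T)\ne0$). (ii) If $\gamma>1$, then for every $T>0$ there exists $f_0\in D\big(G_V^{1/2}\big)$ that cannot be steered to $0$ in $L^2(\Omega)$ in time $T$ by means of a control in $L^2((0,T)\times\tilde\omega)$.
   Context: $G_V=-\partial_x^2-q(x)^2\partial_y(r(y)^2\partial_y)+V(x)$ denotes the Friedrichs extension on $L^2(\Omega,dx\,dy)$ of the operator defined on $C_c^\infty(\Omega)$. Its form domain $D(G_V^{1/2})$ is the completion of $C_c^\infty(\Omega)$ for the norm associated with the quadratic form $\int_\Omega|\partial_xf|^2+q(x)^2r(y)^2|\partial_yf|^2+V(x)|f|^2\,dx\,dy$ (to which a large enough multiple of $\|f\|_{L^2(\Omega)}^2$ is added if needed to make it a norm, $V$ being bounded but possibly negative). Solutions are those given by the Duhamel formula for the semigroup generated by $-G_V$ on $L^2(\Omega)$. *)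

theory Defs
  imports "HOL-Analysis.Analysis"
begin

section \<open>Complex square-integrable functions and semigroups\<close>

text \<open>Elements of the Hilbert space \<open>L\<^sup>2(M)\<close> are represented by functions; equality in
  \<open>L\<^sup>2(M)\<close> is equality almost everywhere.\<close>

definition L2 :: "'a measure \<Rightarrow> ('a \<Rightarrow> complex) set" where
  "L2 M = {f. f \<in> borel_measurable M \<and> integrable M (\<lambda>p. (cmod (f p))\<^sup>2)}"

definition L2_inner :: "'a measure \<Rightarrow> ('a \<Rightarrow> complex) \<Rightarrow> ('a \<Rightarrow> complex) \<Rightarrow> complex" where
  "L2_inner M f g = (LINT p|M. f p * cnj (g p))"

definition L2_norm :: "'a measure \<Rightarrow> ('a \<Rightarrow> complex) \<Rightarrow> real" where
  "L2_norm M f = sqrt (LINT p|M. (cmod (f p))\<^sup>2)"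

text \<open>The \<open>L\<^sup>2(M)\<close>-valued Bochner integral, following the definition of
  \<^const>\<open>has_bochner_integral\<close> (which is not applicable, as \<open>L\<^sup>2(M)\<close> is not a type here):
  the function \<open>g\<close> is approximated in mean by simple functions
  \<open>\<Sum>i<k n. indicator (A n i) \<cdot> v n i\<close> whose integrals converge to \<open>I\<close>.\<close>

definition has_L2_integral ::
  "'t measure \<Rightarrow> 'a measure \<Rightarrow> ('t \<Rightarrow> 'a \<Rightarrow> complex) \<Rightarrow> ('a \<Rightarrow> complex) \<Rightarrow> bool" where
  "has_L2_integral N M g I \<longleftrightarrow> I \<in> L2 M \<and>
     (\<exists>(k :: nat \<Rightarrow> nat) A v.
        (\<forall>n. \<forall>i<k n. A n i \<in> sets N \<and> emeasure N (A n i) < \<infinity> \<and> v n i \<in> L2 M) \<and>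
        (\<forall>n. (\<lambda>t. L2_norm M (\<lambda>p. g t p - (\<Sum>i<k n. indicator (A n i) t * v n i p)))
              \<in> borel_measurable N) \<and>
        (\<lambda>n. \<integral>\<^sup>+ t. L2_norm M (\<lambda>p. g t p - (\<Sum>i<k n. indicator (A n i) t * v n i p)) \<partial>N)
          \<longlonglongrightarrow> 0 \<and>
        (\<lambda>n. L2_norm M (\<lambda>p. I p - (\<Sum>i<k n. measure N (A n i) *\<^sub>R v n i p))) \<longlonglongrightarrow> 0)"

definition C0_semigroup ::
  "'a measure \<Rightarrow> (real \<Rightarrow> ('a \<Rightarrow> complex) \<Rightarrow> 'a \<Rightarrow> complex) \<Rightarrow> bool" where
  "C0_semigroup M S \<longleftrightarrow>
     (\<forall>t\<ge>0. \<forall>f\<in>L2 M. S t f \<in> L2 M) \<and>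
     (\<forall>t\<ge>0. \<forall>f\<in>L2 M. \<forall>g\<in>L2 M. \<forall>a b.
        AE p in M. S t (\<lambda>p. a * f p + b * g p) p = a * S t f p + b * S t g p) \<and>
     (\<forall>t\<ge>0. \<exists>C. \<forall>f\<in>L2 M. L2_norm M (S t f) \<le> C * L2_norm M f) \<and>
     (\<forall>f\<in>L2 M. AE p in M. S 0 f p = f p) \<and>
     (\<forall>s\<ge>0. \<forall>t\<ge>0. \<forall>f\<in>L2 M. AE p in M. S (s + t) f p = S s (S t f) p) \<and>
     (\<forall>f\<in>L2 M. ((\<lambda>t. L2_norm M (\<lambda>p. S t f p - f p)) \<longlongrightarrow> 0) (at_right 0))"

text \<open>Unbounded operators are represented by their graphs: \<open>A f h\<close> means that \<open>f\<close> belongs to the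
  domain of \<open>A\<close> and \<open>A f = h\<close>.\<close>

definition semigroup_generator ::
  "'a measure \<Rightarrow> (real \<Rightarrow> ('a \<Rightarrow> complex) \<Rightarrow> 'a \<Rightarrow> complex) \<Rightarrow>
     ('a \<Rightarrow> complex) \<Rightarrow> ('a \<Rightarrow> complex) \<Rightarrow> bool" where
  "semigroup_generator M S f h \<longleftrightarrow> f \<in> L2 M \<and> h \<in> L2 M \<and>
     ((\<lambda>t. L2_norm M (\<lambda>p. (S t f p - f p) / of_real t - h p)) \<longlongrightarrow> 0) (at_right 0)"

text \<open>\<open>S\<close> is the semigroup generated by \<open>-G\<close>.\<close>

definition semigroup_generated_by_minus ::
  "'a measure \<Rightarrow> (('a \<Rightarrow> complex) \<Rightarrow> ('a \<Rightarrow> complex) \<Rightarrow> bool) \<Rightarrow>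
     (real \<Rightarrow> ('a \<Rightarrow> complex) \<Rightarrow> 'a \<Rightarrow> complex) \<Rightarrow> bool" where
  "semigroup_generated_by_minus M G S \<longleftrightarrow>
     C0_semigroup M S \<and> (\<forall>f h. semigroup_generator M S f h \<longleftrightarrow> G f (\<lambda>p. - h p))"

section \<open>The domain, its test functions and coefficients\<close>

text \<open>\<open>Circle\<close> stands for \<open>\<real>/2\<pi>\<int>\<close>: functions of \<open>y\<close> which have to be differentiated are
  \<open>2\<pi>\<close>-periodic functions on \<open>\<real>\<close>, and integration is over the fundamental domain \<open>[0, 2\<pi>)\<close>.\<close>

datatype y_domain = Interval | Circle | Line

fun Omega_y :: "y_domain \<Rightarrow> real set" where
  "Omega_y Interval = {0<..<pi}"
| "Omega_y Circle = {0..<2 * pi}"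
| "Omega_y Line = UNIV"

definition Omega :: "real \<Rightarrow> y_domain \<Rightarrow> (real \<times> real) set" where
  "Omega L Y = {-L<..<L} \<times> Omega_y Y"

abbreviation Omega_measure :: "real \<Rightarrow> y_domain \<Rightarrow> (real \<times> real) measure" where
  "Omega_measure L Y \<equiv> restrict_space lborel (Omega L Y)"

text \<open>\<open>f \<in> C\<^sup>\<infinity>(A)\<close>; derivatives are one-sided at the end points of a closed interval.\<close>

definition smooth_fun_on :: "real set \<Rightarrow> (real \<Rightarrow> real) \<Rightarrow> bool" where
  "smooth_fun_on A f \<longleftrightarrow> (\<exists>D :: nat \<Rightarrow> real \<Rightarrow> real.
     (\<forall>x\<in>A. D 0 x = f x) \<and>
     (\<forall>k. \<forall>x\<in>A. (D k has_real_derivative D (Suc k) x) (at x within A)))"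

text \<open>In the following definition, \<open>D i j\<close> is the partial derivative of order \<open>(i, j)\<close>.\<close>

definition smooth_plane :: "(real \<times> real \<Rightarrow> complex) \<Rightarrow> bool" where
  "smooth_plane \<phi> \<longleftrightarrow> (\<exists>D :: nat \<Rightarrow> nat \<Rightarrow> real \<times> real \<Rightarrow> complex. D 0 0 = \<phi> \<and>
     (\<forall>i j p. (D i j has_derivative (\<lambda>(h, k). h *\<^sub>R D (Suc i) j p + k *\<^sub>R D i (Suc j) p)) (at p)))"

text \<open>\<open>C\<^sub>c\<^sup>\<infinity>(\<Omega>)\<close>, extended by zero from \<open>\<Omega>\<close> to the plane, respectively (for \<open>Circle\<close>) to the
  strip \<open>\<real> \<times> \<real>/2\<pi>\<int>\<close>.\<close>

fun test_functions :: "real \<Rightarrow> y_domain \<Rightarrow> (real \<times> real \<Rightarrow> complex) set" where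
  "test_functions L Circle = {\<phi>. smooth_plane \<phi> \<and> (\<forall>x y. \<phi> (x, y + 2 * pi) = \<phi> (x, y)) \<and>
     (\<exists>K. compact K \<and> K \<subseteq> {-L<..<L} \<and> (\<forall>x y. x \<notin> K \<longrightarrow> \<phi> (x, y) = 0))}"
| "test_functions L Y = {\<phi>. smooth_plane \<phi> \<and>
     (\<exists>K. compact K \<and> K \<subseteq> Omega L Y \<and> (\<forall>p. p \<notin> K \<longrightarrow> \<phi> p = 0))}"

fun admissible_r :: "y_domain \<Rightarrow> (real \<Rightarrow> real) \<Rightarrow> bool" where
  "admissible_r Interval r \<longleftrightarrow> smooth_fun_on {0<..<pi} r \<and> (\<forall>y\<in>{0<..<pi}. r y > 0)"
| "admissible_r Circle r \<longleftrightarrow>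
     smooth_fun_on UNIV r \<and> (\<forall>y. r (y + 2 * pi) = r y) \<and> (\<forall>y. r y > 0)"
| "admissible_r Line r \<longleftrightarrow> (\<forall>y. r y = 1)"

definition essentially_bounded_on :: "real set \<Rightarrow> (real \<Rightarrow> real) \<Rightarrow> bool" where
  "essentially_bounded_on A V \<longleftrightarrow> V \<in> borel_measurable (restrict_space lborel A) \<and>
     (\<exists>C. AE x in restrict_space lborel A. \<bar>V x\<bar> \<le> C)"

section \<open>The operator\<close>

definition partial_x :: "(real \<times> real \<Rightarrow> complex) \<Rightarrow> real \<times> real \<Rightarrow> complex" where
  "partial_x \<phi> = (\<lambda>(x, y). vector_derivative (\<lambda>s. \<phi> (s, y)) (at x))"

definition partial_y :: "(real \<times> real \<Rightarrow> complex) \<Rightarrow> real \<times> real \<Rightarrow> complex" where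
  "partial_y \<phi> = (\<lambda>(x, y). vector_derivative (\<lambda>s. \<phi> (x, s)) (at y))"

definition grushin_operator :: "(real \<Rightarrow> real) \<Rightarrow> (real \<Rightarrow> real) \<Rightarrow> (real \<Rightarrow> real) \<Rightarrow>
    (real \<times> real \<Rightarrow> complex) \<Rightarrow> real \<times> real \<Rightarrow> complex" where
  "grushin_operator q r V \<phi> = (\<lambda>(x, y).
     - partial_x (partial_x \<phi>) (x, y)
     - of_real ((q x)\<^sup>2) * partial_y (\<lambda>(x', y'). of_real ((r y')\<^sup>2) * partial_y \<phi> (x', y')) (x, y)
     + of_real (V x) * \<phi> (x, y))"

definition grushin_form :: "real \<Rightarrow> y_domain \<Rightarrow> (real \<Rightarrow> real) \<Rightarrow> (real \<Rightarrow> real) \<Rightarrow> (real \<Rightarrow> real) \<Rightarrow>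
    (real \<times> real \<Rightarrow> complex) \<Rightarrow> real" where
  "grushin_form L Y q r V \<phi> = (LINT (x, y)|Omega_measure L Y.
     (cmod (partial_x \<phi> (x, y)))\<^sup>2 + (q x)\<^sup>2 * (r y)\<^sup>2 * (cmod (partial_y \<phi> (x, y)))\<^sup>2
       + V x * (cmod (\<phi> (x, y)))\<^sup>2)"

definition form_norm :: "real \<Rightarrow> y_domain \<Rightarrow> (real \<Rightarrow> real) \<Rightarrow> (real \<Rightarrow> real) \<Rightarrow> (real \<Rightarrow> real) \<Rightarrow>
    real \<Rightarrow> (real \<times> real \<Rightarrow> complex) \<Rightarrow> real" where
  "form_norm L Y q r V c \<phi> =
     sqrt (grushin_form L Y q r V \<phi> + c * (L2_norm (Omega_measure L Y) \<phi>)\<^sup>2)"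

text \<open>The form domain \<open>D(G\<^sub>V\<^sup>1\<^sup>/\<^sup>2)\<close>. The form is closable, so that the completion of the test
  functions for the form norm is identified with the set of the \<open>L\<^sup>2\<close>-limits of sequences of test
  functions which are Cauchy for the form norm. All constants \<open>c\<close> for which the form norm
  controls the \<open>L\<^sup>2\<close>-norm give equivalent norms, hence the same space.\<close>

definition form_domain :: "real \<Rightarrow> y_domain \<Rightarrow> (real \<Rightarrow> real) \<Rightarrow> (real \<Rightarrow> real) \<Rightarrow> (real \<Rightarrow> real) \<Rightarrow>
    (real \<times> real \<Rightarrow> complex) set" where
  "form_domain L Y q r V = {f \<in> L2 (Omega_measure L Y). \<exists>c (\<phi> :: nat \<Rightarrow> real \<times> real \<Rightarrow> complex).
     (\<forall>\<psi>\<in>test_functions L Y. grushin_form L Y q r V \<psi> + c * (L2_norm (Omega_measure L Y) \<psi>)\<^sup>2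
        \<ge> (L2_norm (Omega_measure L Y) \<psi>)\<^sup>2) \<and>
     (\<forall>n. \<phi> n \<in> test_functions L Y) \<and>
     (\<forall>e>0. \<exists>N. \<forall>m\<ge>N. \<forall>n\<ge>N. form_norm L Y q r V c (\<lambda>p. \<phi> m p - \<phi> n p) < e) \<and>
     (\<lambda>n. L2_norm (Omega_measure L Y) (\<lambda>p. \<phi> n p - f p)) \<longlonglongrightarrow> 0}"

text \<open>The Friedrichs extension \<open>G\<^sub>V\<close>: the restriction to the form domain of the adjoint of the
  operator on the test functions. The second conjunct says that \<open>f\<close> is in the domain of the
  adjoint, with image \<open>h\<close>.\<close>

definition friedrichs_extension :: "real \<Rightarrow> y_domain \<Rightarrow> (real \<Rightarrow> real) \<Rightarrow> (real \<Rightarrow> real) \<Rightarrow>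
    (real \<Rightarrow> real) \<Rightarrow> (real \<times> real \<Rightarrow> complex) \<Rightarrow> (real \<times> real \<Rightarrow> complex) \<Rightarrow> bool" where
  "friedrichs_extension L Y q r V f h \<longleftrightarrow> f \<in> form_domain L Y q r V \<and>
     (h \<in> L2 (Omega_measure L Y) \<and>
      (\<forall>\<psi>\<in>test_functions L Y. L2_inner (Omega_measure L Y) f (grushin_operator q r V \<psi>)
         = L2_inner (Omega_measure L Y) h \<psi>))"

section \<open>The control system\<close>

definition controls :: "y_domain \<Rightarrow> real set \<Rightarrow> real \<Rightarrow> (real \<times> real \<times> real \<Rightarrow> complex) set" where
  "controls Y \<omega>x T = L2 (restrict_space lborel ({0<..<T} \<times> (\<omega>x \<times> Omega_y Y)))"

text \<open>\<open>f\<close> is the solution on \<open>[0, T]\<close> with initial state \<open>f0\<close> and control \<open>u\<close>, given by the Duhamel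
  formula \<open>f(t) = S(t) f0 + \<integral>\<^sub>0\<^sup>t S(t - s) (u(s) 1\<^sub>\<omega>) ds\<close>. Time carries the completed
  (Lebesgue) measure because \<open>u(s)\<close> is in \<open>L\<^sup>2\<close> only for almost every \<open>s\<close>.\<close>

definition duhamel_solution :: "real \<Rightarrow> y_domain \<Rightarrow>
    (real \<Rightarrow> (real \<times> real \<Rightarrow> complex) \<Rightarrow> real \<times> real \<Rightarrow> complex) \<Rightarrow> real set \<Rightarrow> real \<Rightarrow>
    (real \<times> real \<Rightarrow> complex) \<Rightarrow> (real \<times> real \<times> real \<Rightarrow> complex) \<Rightarrow>
    (real \<Rightarrow> real \<times> real \<Rightarrow> complex) \<Rightarrow> bool" where
  "duhamel_solution L Y S \<omega>x T f0 u f \<longleftrightarrow> (\<forall>t\<in>{0..T}. f t \<in> L2 (Omega_measure L Y) \<and>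
     (\<exists>I. has_L2_integral (lebesgue_on {0..t}) (Omega_measure L Y)
            (\<lambda>s. S (t - s) (\<lambda>p. indicator (\<omega>x \<times> Omega_y Y) p * u (s, p))) I \<and>
          (AE p in Omega_measure L Y. f t p = S t f0 p + I p)))"

definition cannot_be_steered_to_zero :: "real \<Rightarrow> y_domain \<Rightarrow>
    (real \<Rightarrow> (real \<times> real \<Rightarrow> complex) \<Rightarrow> real \<times> real \<Rightarrow> complex) \<Rightarrow> real set \<Rightarrow> real \<Rightarrow>
    (real \<times> real \<Rightarrow> complex) \<Rightarrow> bool" where
  "cannot_be_steered_to_zero L Y S \<omega>x T f0 \<longleftrightarrow> (\<forall>u\<in>controls Y \<omega>x T. \<forall>f.
     duhamel_solution L Y S \<omega>x T f0 u f \<longrightarrow> \<not> (AE p in Omega_measure L Y. f T p = 0))"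

definition d_agm :: "(real \<Rightarrow> real) \<Rightarrow> real \<Rightarrow> real" where
  "d_agm q x = integral {min 0 x..max 0 x} (\<lambda>s. \<bar>q s\<bar>)"

definition d_agm_set :: "(real \<Rightarrow> real) \<Rightarrow> real set \<Rightarrow> real" where
  "d_agm_set q A = (INF x\<in>A. d_agm q x)"

end

(* If f0 is steered to 0 in time T, then for every g with G g = l g up to a small error delta,
   exp (- l T) |<f0, g>| is at most a constant (depending on f0 and on the control) times the sum of
   delta and the norm of g on the control region. The g used are real products psi(x) phi(y):
   phi is an approximate eigenfunction of - d/dy (r^2 d/dy) for a large n^2, obtained from the
   spectral theorem for bounded quadratic forms, and psi nearly minimises the form of
   - d^2/dx^2 + n^2 q^2 + V. A Gaussian trial function bounds l by (q'(0) + o(1)) n, and Agmon's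
   estimate bounds the mass of psi on the control region by exp (- 2 n (d_agm - o(1))). When
   T q'(0) < d_agm, these g are therefore not observable uniformly, and f0 is obtained as a rapidly
   convergent series of them. *)

theory Submission
  imports Defs
begin

section \<open>The Hilbert space of square-integrable functions\<close>

text \<open>Eigenfunctions may be missing: on the line \<open>- d/dy (r^2 d/dy)\<close> has
  continuous spectrum, on \<open>(0,\<pi>)\<close> the coefficient \<open>r\<close> may degenerate
  or blow up at the ends, and a merely bounded \<open>V\<close> spoils smoothness in
  \<open>x\<close>. Every \<open>g\<close> is therefore a test function, and
  \<open>G g = l g\<close> is read weakly against elements of the domain, with an error measured by
  the form.

  The error \<open>\<delta>\<close> competes with \<open>exp (l T)\<close>, and \<open>l\<close>
  grows with the frequency \<open>n\<close>. Hence the spectral value \<open>n^2\<close> is fixed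
  before the accuracy, and quasimodes of every accuracy are wanted at that one value; this explains
  the order of quantifiers in \<open>approx_eigenvector\<close> and \<open>y_quasimode\<close>.

  The constant in the duality bound depends on the state and on the control. The pairings of one
  state are therefore made to exceed every multiple of the observation; this takes the place of a
  uniform control cost. Both claims are one estimate with \<open>\<beta> = q'(0)\<close>, which is 0
  if \<open>\<gamma> > 1\<close>, under the condition \<open>T \<beta> < d_agm\<close>.\<close>

lemma L2D: "f \<in> L2 M \<Longrightarrow> f \<in> borel_measurable M" "f \<in> L2 M \<Longrightarrow> integrable M (\<lambda>p. (cmod (f p))\<^sup>2)"
  by (auto simp: L2_def)

lemma abs_inner_le_sum_squares: "\<bar>a \<bullet> b\<bar> \<le> (cmod a)\<^sup>2 + (cmod b)\<^sup>2"
proof -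
  have "\<bar>a \<bullet> b\<bar> \<le> cmod a * cmod b" by (rule Cauchy_Schwarz_ineq2)
  also have "\<dots> \<le> (cmod a)\<^sup>2 + (cmod b)\<^sup>2"
    using sum_squares_bound[of "cmod a" "cmod b"] mult_nonneg_nonneg[OF norm_ge_zero[of a] norm_ge_zero[of b]]
    by linarith
  finally show ?thesis .
qed

lemma L2_inner_integrable:
  assumes "f \<in> L2 M" "g \<in> L2 M"
  shows "integrable M (\<lambda>p. f p \<bullet> g p)"
proof (rule Bochner_Integration.integrable_bound)
  show "integrable M (\<lambda>p. (cmod (f p))\<^sup>2 + (cmod (g p))\<^sup>2)"
    using assms by (auto simp: L2_def)
  show "(\<lambda>p. f p \<bullet> g p) \<in> borel_measurable M"
    using assms by (auto simp: L2_def)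
  show "AE p in M. norm (f p \<bullet> g p) \<le> norm ((cmod (f p))\<^sup>2 + (cmod (g p))\<^sup>2)"
    using abs_inner_le_sum_squares by (intro AE_I2) (simp add: )
qed

lemma L2_add:
  assumes "f \<in> L2 M" "g \<in> L2 M"
  shows "(\<lambda>p. f p + g p) \<in> L2 M"
proof -
  have "(cmod (f p + g p))\<^sup>2 = (cmod (f p))\<^sup>2 + 2 * (f p \<bullet> g p) + (cmod (g p))\<^sup>2" for p
    by (simp add: power2_norm_eq_inner inner_add inner_commute)
  with assms L2_inner_integrable[OF assms] show ?thesis
    by (auto simp: L2_def)
qed

lemma L2_cmult: "f \<in> L2 M \<Longrightarrow> (\<lambda>p. c * f p) \<in> L2 M"
  by (auto simp: L2_def norm_mult power_mult_distrib)

lemma L2_scaleR: "f \<in> L2 M \<Longrightarrow> (\<lambda>p. c *\<^sub>R f p) \<in> L2 M"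
  by (auto simp: L2_def power_mult_distrib)

lemma L2_zero: "(\<lambda>p. 0) \<in> L2 M"
  by (auto simp: L2_def)

lemma L2_diff: "f \<in> L2 M \<Longrightarrow> g \<in> L2 M \<Longrightarrow> (\<lambda>p. f p - g p) \<in> L2 M"
  using L2_add[of f M "\<lambda>p. (-1) *\<^sub>R g p"] L2_scaleR[of g M "-1"] by simp

lemma L2_sum: "(\<And>i. i \<in> I \<Longrightarrow> f i \<in> L2 M) \<Longrightarrow> (\<lambda>p. \<Sum>i\<in>I. f i p) \<in> L2 M"
  by (induction I rule: infinite_finite_induct) (auto simp: L2_zero L2_add)

lemma L2_norm_cong_AE:
  assumes "AE p in M. f p = g p" "f \<in> borel_measurable M" "g \<in> borel_measurable M"
  shows "L2_norm M f = L2_norm M g"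
  unfolding L2_norm_def using assms by (intro arg_cong[where f=sqrt] integral_cong_AE) auto

\<comment> \<open>A type of classes is formed, so that completeness, bounded linear maps and vector
  derivatives become available for the semigroup. The measure is fixed to \<open>lborel\<close> on a
  whole Euclidean space because a type cannot depend on \<Omega>; functions on \<Omega> enter
  through extension by zero.\<close>
quotient_type (overloaded) 'a l2 = "'a::euclidean_space \<Rightarrow> complex" / partial:
  "\<lambda>f g. f \<in> L2 lborel \<and> g \<in> L2 lborel \<and> (AE p in lborel. f p = g p)"
proof (rule part_equivpI)
  show "\<exists>x::'a \<Rightarrow> complex. x \<in> L2 lborel \<and> x \<in> L2 lborel \<and> (AE p in lborel. x p = x p)"
    using L2_zero by auto
  show "symp (\<lambda>f g::'a \<Rightarrow> complex. f \<in> L2 lborel \<and> g \<in> L2 lborel \<and> (AE p in lborel. f p = g p))"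
    by (auto simp: symp_def elim!: eventually_mono)
  show "transp (\<lambda>f g::'a \<Rightarrow> complex. f \<in> L2 lborel \<and> g \<in> L2 lborel \<and> (AE p in lborel. f p = g p))"
    unfolding transp_def
  proof (intro allI impI, elim conjE)
    fix x y z :: "'a \<Rightarrow> complex"
    assume "AE p in lborel. x p = y p" "AE p in lborel. y p = z p" "x \<in> L2 lborel" "z \<in> L2 lborel"
    moreover have "AE p in lborel. x p = z p" using calculation(1,2) by eventually_elim simp
    ultimately show "x \<in> L2 lborel \<and> z \<in> L2 lborel \<and> (AE p in lborel. x p = z p)" by simp
  qed
qed

instantiation l2 :: (euclidean_space) real_vector
begin

lift_definition zero_l2 :: "'a l2" is "\<lambda>p. 0" by (simp add: L2_zero)
lift_definition plus_l2 :: "'a l2 \<Rightarrow> 'a l2 \<Rightarrow> 'a l2" is "\<lambda>f g p. f p + g p"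
  by (auto simp: L2_add elim: eventually_elim2)
lift_definition minus_l2 :: "'a l2 \<Rightarrow> 'a l2 \<Rightarrow> 'a l2" is "\<lambda>f g p. f p - g p"
  by (auto simp: L2_diff elim: eventually_elim2)
lift_definition scaleR_l2 :: "real \<Rightarrow> 'a l2 \<Rightarrow> 'a l2" is "\<lambda>c f p. c *\<^sub>R f p"
  by (auto simp: L2_scaleR elim: eventually_mono)
lift_definition uminus_l2 :: "'a l2 \<Rightarrow> 'a l2" is "\<lambda>f p. - f p"
  using L2_scaleR[of _ lborel "-1"] by (auto elim: eventually_mono)

instance
proof
  fix a b c :: "'a l2" and x y :: real
  show "a + b + c = a + (b + c)" by transfer (auto simp: L2_add add.assoc)
  show "a + b = b + a" by transfer (auto simp: L2_add add.commute)
  show "0 + a = a" by transfer (auto simp: )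
  show "- a + a = 0"
    by transfer (use L2_scaleR[of _ lborel "-1"] in \<open>auto simp: L2_zero\<close>)
  show "a - b = a + - b"
    by transfer (use L2_scaleR[of _ lborel "-1"] in \<open>auto simp: L2_diff\<close>)
  show "x *\<^sub>R (a + b) = x *\<^sub>R a + x *\<^sub>R b" by transfer (auto simp: L2_add L2_scaleR scaleR_add_right)
  show "(x + y) *\<^sub>R a = x *\<^sub>R a + y *\<^sub>R a"
  proof (transfer fixing: x y)
    fix a :: "'a \<Rightarrow> complex"
    assume "a \<in> L2 lborel \<and> a \<in> L2 lborel \<and> (AE p in lborel. a p = a p)"
    then show "(\<lambda>p. (x + y) *\<^sub>R a p) \<in> L2 lborel \<and> (\<lambda>p. x *\<^sub>R a p + y *\<^sub>R a p) \<in> L2 lborel \<and>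
      (AE p in lborel. (x + y) *\<^sub>R a p = x *\<^sub>R a p + y *\<^sub>R a p)"
      using L2_scaleR[of a lborel "x + y"] by (simp add: scaleR_add_left)
  qed
  show "x *\<^sub>R y *\<^sub>R a = (x * y) *\<^sub>R a"
  proof (transfer fixing: x y)
    fix a :: "'a \<Rightarrow> complex"
    assume "a \<in> L2 lborel \<and> a \<in> L2 lborel \<and> (AE p in lborel. a p = a p)"
    then show "(\<lambda>p. x *\<^sub>R y *\<^sub>R a p) \<in> L2 lborel \<and> (\<lambda>p. (x * y) *\<^sub>R a p) \<in> L2 lborel \<and>
      (AE p in lborel. x *\<^sub>R y *\<^sub>R a p = (x * y) *\<^sub>R a p)"
      using L2_scaleR[of a lborel "x * y"] by (simp only: scaleR_scaleR) auto
  qed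
  show "1 *\<^sub>R a = a" by transfer auto
qed

end

instantiation l2 :: (euclidean_space) real_inner
begin

text \<open>On the complex numbers \<open>\<bullet>\<close> is \<open>Re (a * cnj b)\<close>, so
  complex \<open>L2\<close> is treated as a real Hilbert space. The real part of a pairing is enough
  to keep a state away from 0.\<close>

lift_definition inner_l2 :: "'a l2 \<Rightarrow> 'a l2 \<Rightarrow> real" is "\<lambda>f g. LINT p|lborel. f p \<bullet> g p"
proof -
  fix f f' g g' :: "'a \<Rightarrow> complex"
  assume a: "f \<in> L2 lborel \<and> f' \<in> L2 lborel \<and> (AE p in lborel. f p = f' p)"
    "g \<in> L2 lborel \<and> g' \<in> L2 lborel \<and> (AE p in lborel. g p = g' p)"
  then have "AE p in lborel. f p \<bullet> g p = f' p \<bullet> g' p"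
    by (auto elim: eventually_elim2)
  then show "(LINT p|lborel. f p \<bullet> g p) = (LINT p|lborel. f' p \<bullet> g' p)"
    using a by (intro integral_cong_AE) (auto simp: L2_def)
qed

definition "norm_l2 (f :: 'a l2) = sqrt (f \<bullet> f)"
definition "sgn_l2 (f :: 'a l2) = f /\<^sub>R norm f"
definition "dist_l2 (f :: 'a l2) g = norm (f - g)"
definition "uniformity_l2 = (INF e\<in>{0<..}. principal {(x :: 'a l2, y). dist x y < e})"
definition "open_l2 (U :: 'a l2 set) \<longleftrightarrow> (\<forall>x\<in>U. eventually (\<lambda>(x', y). x' = x \<longrightarrow> y \<in> U) uniformity)"

instance
proof
  fix f g h :: "'a l2" and c :: real and U :: "'a l2 set"
  show "dist f g = norm (f - g)" by (rule dist_l2_def)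
  show "sgn f = f /\<^sub>R norm f" by (rule sgn_l2_def)
  show "uniformity = (INF e\<in>{0<..}. principal {(x :: 'a l2, y). dist x y < e})" by (rule uniformity_l2_def)
  show "open U \<longleftrightarrow> (\<forall>x\<in>U. eventually (\<lambda>(x', y). x' = x \<longrightarrow> y \<in> U) uniformity)" by (rule open_l2_def)
  show "norm f = sqrt (f \<bullet> f)" by (rule norm_l2_def)
  show "f \<bullet> g = g \<bullet> f" by transfer (simp add: inner_commute)
  show "(f + g) \<bullet> h = f \<bullet> h + g \<bullet> h"
    by transfer (simp add: inner_add_left L2_inner_integrable)
  show "(c *\<^sub>R f) \<bullet> h = c * (f \<bullet> h)" by transfer simp
  show "0 \<le> f \<bullet> f" by transfer (simp add: integral_nonneg_AE)
  show "f \<bullet> f = 0 \<longleftrightarrow> f = 0"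
  proof transfer
    fix f :: "'a \<Rightarrow> complex"
    assume "f \<in> L2 lborel \<and> f \<in> L2 lborel \<and> (AE p in lborel. f p = f p)"
    then have f: "f \<in> L2 lborel" by simp
    have "(LINT p|lborel. f p \<bullet> f p) = 0 \<longleftrightarrow> (AE p in lborel. f p \<bullet> f p = 0)"
      using L2_inner_integrable[OF f f] by (intro integral_nonneg_eq_0_iff_AE) auto
    with f show "((LINT p|lborel. f p \<bullet> f p) = 0) =
      (f \<in> L2 lborel \<and> (\<lambda>p. 0) \<in> L2 lborel \<and> (AE p in lborel. f p = 0))"
      by (simp add: L2_zero)
  qed
qed

end

definition l2_of :: "('a::euclidean_space \<Rightarrow> complex) \<Rightarrow> 'a l2" where "l2_of = abs_l2"

lemma rep_l2_L2: "rep_l2 F \<in> L2 lborel"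
  using Quotient_rep_reflp[OF Quotient_l2, of F] by (rule conjunct1)

lemma l2_of_rep: "l2_of (rep_l2 F) = F"
  unfolding l2_of_def by (rule Quotient_abs_rep[OF Quotient_l2])

lemma l2_of_eq_iff:
  assumes "f \<in> L2 lborel" "g \<in> L2 lborel"
  shows "l2_of f = l2_of g \<longleftrightarrow> (AE p in lborel. f p = g p)"
  using Quotient_rel[OF Quotient_l2, of f g] assms by (simp add: l2_of_def)

lemma l2_of_add:
  assumes "f \<in> L2 lborel" "g \<in> L2 lborel"
  shows "l2_of f + l2_of g = l2_of (\<lambda>p. f p + g p)"
  unfolding l2_of_def by (rule plus_l2.abs_eq) (use assms in simp_all)

lemma l2_of_diff:
  assumes "f \<in> L2 lborel" "g \<in> L2 lborel"
  shows "l2_of f - l2_of g = l2_of (\<lambda>p. f p - g p)"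
  unfolding l2_of_def by (rule minus_l2.abs_eq) (use assms in simp_all)

lemma l2_of_inner:
  assumes "f \<in> L2 lborel" "g \<in> L2 lborel"
  shows "l2_of f \<bullet> l2_of g = (LINT p|lborel. f p \<bullet> g p)"
  unfolding l2_of_def by (rule inner_l2.abs_eq) (use assms in simp_all)

lemma l2_of_scaleR:
  assumes "f \<in> L2 lborel"
  shows "c *\<^sub>R l2_of f = l2_of (\<lambda>p. c *\<^sub>R f p)"
  unfolding l2_of_def by (rule scaleR_l2.abs_eq) (use assms in simp_all)

lemma l2_of_norm:
  assumes "f \<in> L2 lborel"
  shows "norm (l2_of f) = L2_norm lborel f"
  unfolding norm_l2_def l2_of_inner[OF assms assms] L2_norm_def by (simp add: dot_square_norm)

text \<open>Riesz--Fischer: by the weighted Cauchy--Schwarz inequality a pointwise series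
  \<open>\<Sum> d\<^sub>k\<close> is dominated by \<open>\<Sum> 2\<^sup>k |d\<^sub>k|\<^sup>2\<close>, which is integrable for a fast Cauchy sequence.\<close>

lemma norm_suminf_weighted:
  fixes d :: "nat \<Rightarrow> complex"
  assumes s: "summable (\<lambda>k. 2 ^ k * (cmod (d k))\<^sup>2)"
  shows "summable d" and "(cmod (suminf d))\<^sup>2 \<le> 2 * (\<Sum>k. 2 ^ k * (cmod (d k))\<^sup>2)"
proof -
  let ?w = "\<lambda>k::nat. (1/2) ^ k :: real"
  have sw: "summable ?w" by (simp add: summable_geometric)
  have *: "cmod (d k) \<le> ?w k + 2 ^ k * (cmod (d k))\<^sup>2" for k
  proof -
    \<comment> \<open>Since \<open>2 ^ k * ?w k = 1\<close>, the cross term of this weighted square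
      is \<open>2 * cmod (d k)\<close>.\<close>
    have "0 \<le> 2 ^ k * (cmod (d k) - ?w k)\<^sup>2" by simp
    also have "\<dots> = 2 ^ k * (cmod (d k))\<^sup>2 - 2 * cmod (d k) * (2 ^ k * ?w k) + (2 ^ k * ?w k) * ?w k"
      by (simp add: power2_eq_square algebra_simps)
    also have "2 ^ k * ?w k = 1" by (simp add: power_one_over)
    finally have "2 * cmod (d k) \<le> ?w k + 2 ^ k * (cmod (d k))\<^sup>2" by simp
    moreover have "cmod (d k) \<ge> 0" by simp
    ultimately show ?thesis by linarith
  qed
  have "summable (\<lambda>k. cmod (d k))"
    by (rule summable_comparison_test'[OF summable_add[OF sw s]]) (use * in auto)
  then show sum: "summable d" by (rule summable_norm_cancel)
  have part: "(cmod (\<Sum>k<n. d k))\<^sup>2 \<le> 2 * (\<Sum>k. 2 ^ k * (cmod (d k))\<^sup>2)" for n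
  proof -
    have "cmod (\<Sum>k<n. d k) \<le> (\<Sum>k<n. cmod (d k))" by (rule norm_sum)
    then have "(cmod (\<Sum>k<n. d k))\<^sup>2 \<le> (\<Sum>k<n. cmod (d k))\<^sup>2" by (intro power_mono) auto
    also have "(\<Sum>k<n. cmod (d k)) = (\<Sum>k<n. sqrt (?w k) * (sqrt (2 ^ k) * cmod (d k)))"
    proof (rule sum.cong[OF refl])
      fix k
      have "sqrt (?w k) * sqrt (2 ^ k) = 1"
        by (metis power_mult_distrib real_sqrt_mult real_sqrt_one power_one nonzero_eq_divide_eq zero_neq_numeral)
      then show "cmod (d k) = sqrt (?w k) * (sqrt (2 ^ k) * cmod (d k))" by (simp add: mult.assoc[symmetric])
    qed
    also have "(\<Sum>k<n. sqrt (?w k) * (sqrt (2 ^ k) * cmod (d k)))\<^sup>2 \<le>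
      (\<Sum>k<n. (sqrt (?w k))\<^sup>2) * (\<Sum>k<n. (sqrt (2 ^ k) * cmod (d k))\<^sup>2)"
      by (rule Cauchy_Schwarz_ineq_sum)
    also have "\<dots> = (\<Sum>k<n. ?w k) * (\<Sum>k<n. 2 ^ k * (cmod (d k))\<^sup>2)"
      by (simp add: power_mult_distrib)
    also have "\<dots> \<le> 2 * (\<Sum>k. 2 ^ k * (cmod (d k))\<^sup>2)"
    proof (rule mult_mono)
      have "(\<Sum>k<n. ?w k) \<le> suminf ?w" by (intro sum_le_suminf sw) auto
      also have "suminf ?w = 2" by (subst suminf_geometric) auto
      finally show "(\<Sum>k<n. ?w k) \<le> 2" .
      show "(\<Sum>k<n. 2 ^ k * (cmod (d k))\<^sup>2) \<le> (\<Sum>k. 2 ^ k * (cmod (d k))\<^sup>2)"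
        by (intro sum_le_suminf s) auto
    qed (auto intro: sum_nonneg)
    finally show ?thesis .
  qed
  have "(\<lambda>n. (cmod (\<Sum>k<n. d k))\<^sup>2) \<longlonglongrightarrow> (cmod (suminf d))\<^sup>2"
    by (intro tendsto_intros summable_LIMSEQ sum)
  then show "(cmod (suminf d))\<^sup>2 \<le> 2 * (\<Sum>k. 2 ^ k * (cmod (d k))\<^sup>2)"
    by (rule LIMSEQ_le_const2) (use part in auto)
qed

text \<open>The weight \<open>2 ^ k\<close> against squared norms of at most
  \<open>(1/4) ^ k\<close> leaves \<open>(1/2) ^ k\<close>, so the weighted square sum
  \<open>W\<close> is integrable. Up to the factor 2 it dominates the squares of the sum and of all
  remainders at once, which is what dominated convergence requires.\<close>

lemma L2_fast_series:
  fixes d :: "nat \<Rightarrow> 'a \<Rightarrow> complex"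
  assumes d: "\<And>k. d k \<in> L2 M" and small: "\<And>k. (LINT p|M. (cmod (d k p))\<^sup>2) \<le> (1/4) ^ k"
  shows "\<exists>D\<in>L2 M. (\<lambda>n. L2_norm M (\<lambda>p. (\<Sum>k<n. d k p) - D p)) \<longlonglongrightarrow> 0"
proof -
  let ?e = "\<lambda>k p. 2 ^ k * (cmod (d k p))\<^sup>2"
  have ie: "integrable M (?e k)" for k using d by (auto simp: L2_def)
  have "(\<integral>\<^sup>+p. (\<Sum>k. ennreal (?e k p)) \<partial>M) = (\<Sum>k. \<integral>\<^sup>+p. ennreal (?e k p) \<partial>M)"
    using ie by (intro nn_integral_suminf) auto
  also have "\<dots> \<le> (\<Sum>k. ennreal ((1/2) ^ k))"
  proof (intro suminf_le allI)
    fix k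
    have "(\<integral>\<^sup>+p. ennreal (?e k p) \<partial>M) = ennreal (2 ^ k * (LINT p|M. (cmod (d k p))\<^sup>2))"
      using ie by (subst nn_integral_eq_integral) auto
    also have "\<dots> \<le> ennreal (2 ^ k * (1/4) ^ k)"
      using small by (intro ennreal_leI mult_left_mono) auto
    also have "2 ^ k * (1/4::real) ^ k = (1/2) ^ k" by (simp add: power_mult_distrib[symmetric])
    finally show "(\<integral>\<^sup>+p. ennreal (?e k p) \<partial>M) \<le> ennreal ((1/2) ^ k)" .
  qed auto
  also have "\<dots> = ennreal 2"
    by (subst suminf_ennreal2) (auto simp: summable_geometric suminf_geometric)
  finally have fin: "(\<integral>\<^sup>+p. (\<Sum>k. ennreal (?e k p)) \<partial>M) < \<infinity>"
    by (simp add: order_le_less_trans)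
  then have "AE p in M. (\<Sum>k. ennreal (?e k p)) \<noteq> \<infinity>"
    using ie by (intro nn_integral_PInf_AE) auto
  then have sm: "AE p in M. summable (\<lambda>k. ?e k p)"
    by eventually_elim (rule summable_suminf_not_top, auto)
  define W where "W p = (\<Sum>k. ?e k p)" for p
  have Wm: "W \<in> borel_measurable M" unfolding W_def using ie by (intro borel_measurable_suminf) auto
  have W0: "W p \<ge> 0" if "summable (\<lambda>k. ?e k p)" for p
    unfolding W_def by (rule suminf_nonneg[OF that]) auto
  have iW: "integrable M W"
  proof (rule integrableI_bounded[OF Wm])
    have "AE p in M. ennreal (norm (W p)) = (\<Sum>k. ennreal (?e k p))"
      using sm by eventually_elim (subst suminf_ennreal2, auto simp: W0, simp add: W_def)
    then have "(\<integral>\<^sup>+p. ennreal (norm (W p)) \<partial>M) = (\<integral>\<^sup>+p. (\<Sum>k. ennreal (?e k p)) \<partial>M)"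
      by (rule nn_integral_cong_AE)
    with fin show "(\<integral>\<^sup>+p. ennreal (norm (W p)) \<partial>M) < \<infinity>" by simp
  qed
  define D where "D p = (\<Sum>k. d k p)" for p
  have Dm: "D \<in> borel_measurable M" unfolding D_def using d by (intro borel_measurable_suminf) (auto simp: L2_def)
  have DW: "AE p in M. (cmod (D p))\<^sup>2 \<le> 2 * W p"
    using sm by eventually_elim (simp add: D_def W_def norm_suminf_weighted)
  have DL: "D \<in> L2 M" unfolding L2_def
  proof (intro CollectI conjI Dm)
    show "integrable M (\<lambda>p. (cmod (D p))\<^sup>2)"
      by (rule Bochner_Integration.integrable_bound[of M "\<lambda>p. 2 * W p"])
        (use iW Dm DW in \<open>auto elim!: eventually_mono\<close>)
  qed
  have tail: "(cmod ((\<Sum>k<n. d k p) - D p))\<^sup>2 \<le> 2 * W p" if s: "summable (\<lambda>k. ?e k p)" for n p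
  proof -
    \<comment> \<open>Replacing the first \<open>n\<close> terms by zero makes the remainder a full
      series, to which the weighted bound applies with a weighted sum of at most
      \<open>W p\<close>.\<close>
    let ?d = "\<lambda>k. if k < n then 0 else d k p"
    have s': "summable (\<lambda>k. 2 ^ k * (cmod (?d k))\<^sup>2)"
      by (rule summable_comparison_test'[OF s]) (auto simp: power2_eq_square)
    have sd: "summable (\<lambda>k. d k p)" by (rule norm_suminf_weighted[OF s])
    have sfin: "(\<lambda>k. if k < n then d k p else 0) sums (\<Sum>k<n. d k p)"
      using sums_If_finite_set[of "{..<n}" "\<lambda>k. d k p"] by simp
    have "(\<lambda>k. d k p - (if k < n then d k p else 0)) sums (D p - (\<Sum>k<n. d k p))"
      unfolding D_def by (intro sums_diff summable_sums sd sfin)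
    moreover have "(\<lambda>k. d k p - (if k < n then d k p else 0)) = ?d" by auto
    ultimately have "suminf ?d = D p - (\<Sum>k<n. d k p)" by (simp add: sums_iff)
    then have "(cmod ((\<Sum>k<n. d k p) - D p))\<^sup>2 = (cmod (suminf ?d))\<^sup>2" by (simp add: norm_minus_commute)
    also have "\<dots> \<le> 2 * (\<Sum>k. 2 ^ k * (cmod (?d k))\<^sup>2)" by (rule norm_suminf_weighted[OF s'])
    also have "(\<Sum>k. 2 ^ k * (cmod (?d k))\<^sup>2) \<le> W p" unfolding W_def
      by (rule suminf_le[OF _ s' s]) auto
    finally show ?thesis by simp
  qed
  have "(\<lambda>n. LINT p|M. (cmod ((\<Sum>k<n. d k p) - D p))\<^sup>2) \<longlonglongrightarrow> (LINT p|M. 0)"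
  proof (rule integral_dominated_convergence[where w="\<lambda>p. 2 * W p"])
    show "AE p in M. (\<lambda>n. (cmod ((\<Sum>k<n. d k p) - D p))\<^sup>2) \<longlonglongrightarrow> 0"
      using sm
    proof eventually_elim
      case (elim p)
      have "(\<lambda>n. \<Sum>k<n. d k p) \<longlonglongrightarrow> D p" unfolding D_def
        by (rule summable_LIMSEQ[OF norm_suminf_weighted(1)[OF elim]])
      then have "(\<lambda>n. (cmod ((\<Sum>k<n. d k p) - D p))\<^sup>2) \<longlonglongrightarrow> (cmod (D p - D p))\<^sup>2"
        by (intro tendsto_intros)
      then show ?case by simp
    qed
    show "AE p in M. norm ((cmod ((\<Sum>k<n. d k p) - D p))\<^sup>2) \<le> 2 * W p" for n
      using sm by eventually_elim (use tail in auto)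
    show "(\<lambda>p. (cmod ((\<Sum>k<n. d k p) - D p))\<^sup>2) \<in> borel_measurable M" for n
      using L2D(1)[OF d] Dm by measurable
  qed (use iW in auto)
  then have "(\<lambda>n. L2_norm M (\<lambda>p. (\<Sum>k<n. d k p) - D p)) \<longlonglongrightarrow> sqrt 0"
    unfolding L2_norm_def by (intro tendsto_real_sqrt) simp
  with DL show ?thesis by auto
qed

instance l2 :: (euclidean_space) complete_space
proof
  fix X :: "nat \<Rightarrow> 'a l2"
  assume C: "Cauchy X"
  have "\<exists>N. \<forall>m\<ge>N. \<forall>n\<ge>N. norm (X m - X n) < (1/2) ^ k" for k
    using C unfolding Cauchy_iff by simp
  then obtain N where N: "\<And>k m n. m \<ge> N k \<Longrightarrow> n \<ge> N k \<Longrightarrow> norm (X m - X n) < (1/2) ^ k"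
    by metis
  \<comment> \<open>\<open>R k\<close> lies beyond \<open>N 0, ..., N k\<close>, so the
    \<open>k\<close>-th increment of the subsequence is below \<open>(1/2) ^ k\<close>; the summand
    \<open>k\<close> makes \<open>R\<close> exceed any given index, as the passage to the whole
    sequence requires.\<close>
  define R where "R k = Max (N ` {..k}) + k" for k
  have RN: "R k \<ge> N j" if "j \<le> k" for j k
    unfolding R_def by (meson Max_ge finite_atMost finite_imageI image_eqI atMost_iff that trans_le_add1)
  define f where "f k = rep_l2 (X (R k))" for k
  have f: "f k \<in> L2 lborel" "l2_of (f k) = X (R k)" for k
    by (simp_all add: f_def rep_l2_L2 l2_of_rep)
  define d where "d k p = f (Suc k) p - f k p" for k p
  have dL: "d k \<in> L2 lborel" for k unfolding d_def by (intro L2_diff f)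
  have "(LINT p|lborel. (cmod (d k p))\<^sup>2) \<le> (1/4) ^ k" for k
  proof -
    have "l2_of (d k) = X (R (Suc k)) - X (R k)"
      using l2_of_diff[OF f(1) f(1), of "Suc k" k] by (simp add: f d_def[abs_def])
    then have "L2_norm lborel (d k) < (1/2) ^ k"
      using N[of k "R (Suc k)" "R k"] RN[of k "Suc k"] RN[of k k] l2_of_norm[OF dL, of k] by simp
    then have "(L2_norm lborel (d k))\<^sup>2 \<le> ((1/2) ^ k)\<^sup>2"
      by (intro power_mono) (auto simp: L2_norm_def)
    moreover have "(L2_norm lborel (d k))\<^sup>2 = (LINT p|lborel. (cmod (d k p))\<^sup>2)"
      by (simp add: L2_norm_def integral_nonneg_AE)
    moreover have "((1/2::real) ^ k)\<^sup>2 = (1/4) ^ k"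
      by (simp add: power2_eq_square power_mult_distrib[symmetric])
    ultimately show ?thesis by (simp only:)
  qed
  from L2_fast_series[OF dL this] obtain D where D: "D \<in> L2 lborel"
    "(\<lambda>n. L2_norm lborel (\<lambda>p. (\<Sum>k<n. d k p) - D p)) \<longlonglongrightarrow> 0" by auto
  let ?F = "\<lambda>p. f 0 p + D p"
  have FL: "?F \<in> L2 lborel" by (intro L2_add f D)
  have "norm (X (R n) - l2_of ?F) = L2_norm lborel (\<lambda>p. (\<Sum>k<n. d k p) - D p)" for n
  proof -
    have "(\<lambda>p. f n p - ?F p) = (\<lambda>p. (\<Sum>k<n. d k p) - D p)"
    proof
      fix p
      show "f n p - ?F p = (\<Sum>k<n. d k p) - D p"
        using sum_lessThan_telescope[of "\<lambda>k. f k p" n] by (simp add: d_def)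
    qed
    moreover have "norm (X (R n) - l2_of ?F) = L2_norm lborel (\<lambda>p. f n p - ?F p)"
      using f(2)[of n] l2_of_diff[OF f(1) FL, of n] l2_of_norm[OF L2_diff[OF f(1) FL]] by metis
    ultimately show ?thesis by simp
  qed
  with D(2) have sub: "(\<lambda>n. X (R n)) \<longlonglongrightarrow> l2_of ?F"
    by - (rule LIM_zero_cancel, rule tendsto_norm_zero_cancel, simp)
  have "X \<longlonglongrightarrow> l2_of ?F"
  proof (rule LIMSEQ_I)
    fix e :: real assume e: "e > 0"
    obtain M where M: "\<And>m n. m \<ge> M \<Longrightarrow> n \<ge> M \<Longrightarrow> norm (X m - X n) < e / 2"
      using C e unfolding Cauchy_iff by (meson half_gt_zero)
    obtain K where K: "\<And>n. n \<ge> K \<Longrightarrow> norm (X (R n) - l2_of ?F) < e / 2"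
      using LIMSEQ_D[OF sub, of "e/2"] e by auto
    let ?n = "max K M"
    have "R ?n \<ge> M" by (simp add: R_def)
    show "\<exists>no. \<forall>n\<ge>no. norm (X n - l2_of ?F) < e"
    proof (intro exI allI impI)
      fix n assume "n \<ge> M"
      then have "norm (X n - X (R ?n)) < e / 2" using M \<open>R ?n \<ge> M\<close> by auto
      moreover have "norm (X (R ?n) - l2_of ?F) < e / 2" using K by auto
      ultimately show "norm (X n - l2_of ?F) < e"
        using norm_triangle_ineq[of "X n - X (R ?n)" "X (R ?n) - l2_of ?F"] by simp
    qed
  qed
  then show "convergent X" by (auto simp: convergent_def)
qed

instance l2 :: (euclidean_space) banach ..

section \<open>Strongly continuous semigroups\<close>

text \<open>The ratio 1/3 is calibrated: what follows after a step is at most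
  \<open>3/2 * 1/3 = 1/2\<close> of the bound for that step, so later corrections cannot undo it.
  Uniform boundedness and the gliding hump both rest on this.\<close>

lemma geometric_Cauchy_limit:
  fixes x :: "nat \<Rightarrow> 'a::banach"
  assumes step: "\<And>n. norm (x (Suc n) - x n) \<le> a n" and third: "\<And>n. a (Suc n) \<le> a n / 3"
  shows "\<exists>l. x \<longlonglongrightarrow> l \<and> (\<forall>n. norm (l - x n) \<le> 3 / 2 * a n)"
proof -
  have a0: "a n \<ge> 0" for n using step[of n] norm_ge_zero order_trans by blast
  have geo: "a (n + k) \<le> a n * (1/3) ^ k" for n k
  proof (induction k)
    case (Suc k)
    have "a (n + Suc k) \<le> a (n + k) / 3" using third[of "n + k"] by simp
    with Suc show ?case by simp
  qed simp
  have part: "norm (x (n + k) - x n) \<le> 3/2 * a n * (1 - (1/3) ^ k)" for n k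
  proof (induction k)
    case (Suc k)
    have "norm (x (n + Suc k) - x n) \<le> norm (x (Suc (n + k)) - x (n + k)) + norm (x (n + k) - x n)"
      using norm_triangle_ineq[of "x (Suc (n + k)) - x (n + k)" "x (n + k) - x n"] by simp
    also have "\<dots> \<le> a n * (1/3) ^ k + 3/2 * a n * (1 - (1/3) ^ k)"
      using step[of "n + k"] geo[of n k] Suc by linarith
    also have "\<dots> = 3/2 * a n * (1 - (1/3) ^ Suc k)" by (simp add: field_simps)
    finally show ?case .
  qed simp
  have bound: "norm (x m - x n) \<le> 3/2 * a n" if "m \<ge> n" for m n
  proof -
    have "norm (x m - x n) \<le> 3/2 * a n * (1 - (1/3) ^ (m - n))" using part[of n "m - n"] that by simp
    also have "\<dots> \<le> 3/2 * a n * 1" using a0 by (intro mult_left_mono) auto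
    finally show ?thesis by simp
  qed
  have "Cauchy x"
  proof (rule metric_CauchyI)
    fix e :: real assume "e > 0"
    have "(\<lambda>k. 3 * (a 0 * (1/3) ^ k)) \<longlonglongrightarrow> 3 * (a 0 * 0)"
      by (intro tendsto_intros LIMSEQ_power_zero) auto
    then have "\<forall>\<^sub>F k in sequentially. 3 * (a 0 * (1/3) ^ k) < e"
      using \<open>e > 0\<close> by (intro order_tendstoD(2)) auto
    then obtain k where "3 * (a 0 * (1/3) ^ k) < e" by (auto simp: eventually_sequentially)
    then have k: "3 * a k < e" using geo[of 0 k] by simp
    have "dist (x m) (x n) < e" if "m \<ge> k" "n \<ge> k" for m n
    proof -
      have "dist (x m) (x n) \<le> dist (x m) (x k) + dist (x n) (x k)" by (rule dist_triangle2)
      also have "\<dots> \<le> 3/2 * a k + 3/2 * a k"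
        unfolding dist_norm using bound that by (intro add_mono) auto
      finally show ?thesis using k by simp
    qed
    then show "\<exists>M. \<forall>m\<ge>M. \<forall>n\<ge>M. dist (x m) (x n) < e" by blast
  qed
  then obtain l where l: "x \<longlonglongrightarrow> l" using Cauchy_convergent convergent_def by blast
  have "norm (l - x n) \<le> 3/2 * a n" for n
  proof (rule LIMSEQ_le_const2)
    show "(\<lambda>m. norm (x m - x n)) \<longlonglongrightarrow> norm (l - x n)" by (intro tendsto_intros l)
    show "\<exists>N. \<forall>m\<ge>N. norm (x m - x n) \<le> 3/2 * a n" using bound by blast
  qed
  with l show ?thesis by auto
qed

text \<open>The uniform boundedness principle, by Sokal's argument: one of \<open>x \<plusminus> \<xi>\<close> has an image at least as
  large as that of \<open>\<xi>\<close>.\<close>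

lemma uniform_boundedness:
  fixes T :: "nat \<Rightarrow> 'a::banach \<Rightarrow> 'b::real_normed_vector"
  assumes lin: "\<And>k. bounded_linear (T k)" and pw: "\<And>x. \<exists>B. \<forall>k. norm (T k x) \<le> B"
  shows "\<exists>C. \<forall>k x. norm (T k x) \<le> C * norm x"
proof (rule ccontr)
  assume neg: "\<not> ?thesis"
  \<comment> \<open>Norms above \<open>4 ^ n\<close> against displacements \<open>(1/3) ^ n\<close>:
    the images grow like \<open>(4/3) ^ n\<close>.\<close>
  have "\<exists>k. onorm (T k) > 4 ^ n" for n
  proof (rule ccontr)
    assume "\<nexists>k. onorm (T k) > 4 ^ n"
    then have "norm (T k x) \<le> 4 ^ n * norm x" for k x
      using onorm[OF lin, of k x] by (meson mult_right_mono norm_ge_zero not_less order_trans)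
    with neg show False by blast
  qed
  then obtain k where k: "\<And>n. onorm (T (k n)) > 4 ^ n" by metis
  have "\<exists>x'. norm (x' - x) \<le> (1/3) ^ n \<and> 2/3 * (1/3) ^ n * onorm (T (k n)) \<le> norm (T (k n) x')" for n x
  proof -
    interpret bounded_linear "T (k n)" by (rule lin)
    have pos: "onorm (T (k n)) > 0" using k[of n] zero_less_power[of "4::real" n] by linarith
    obtain z where z: "norm (T (k n) z) > 2/3 * onorm (T (k n)) * norm z"
    proof (rule ccontr)
      assume "\<not> thesis"
      then have "\<And>z. norm (T (k n) z) \<le> 2/3 * onorm (T (k n)) * norm z"
        using that not_less by blast
      then have "onorm (T (k n)) \<le> 2/3 * onorm (T (k n))" using pos by (intro onorm_bound) auto
      with pos show False by simp
    qed
    then have z0: "z \<noteq> 0" using zero by auto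
    define \<xi> where "\<xi> = ((1/3) ^ n / norm z) *\<^sub>R z"
    have n\<xi>: "norm \<xi> = (1/3) ^ n" using z0 by (simp add: \<xi>_def)
    have "norm (T (k n) \<xi>) = (1/3) ^ n / norm z * norm (T (k n) z)"
      using z0 by (simp add: \<xi>_def scaleR)
    also have "\<dots> \<ge> (1/3) ^ n / norm z * (2/3 * onorm (T (k n)) * norm z)"
      using z by (intro mult_left_mono) auto
    finally have T\<xi>: "2/3 * (1/3) ^ n * onorm (T (k n)) \<le> norm (T (k n) \<xi>)" using z0 by simp
    have "2 * norm (T (k n) \<xi>) = norm (T (k n) (x + \<xi>) - T (k n) (x - \<xi>))"
      by (simp add: add diff scaleR_2[symmetric])
    also have "\<dots> \<le> norm (T (k n) (x + \<xi>)) + norm (T (k n) (x - \<xi>))" by (rule norm_triangle_ineq4)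
    finally have "norm (T (k n) \<xi>) \<le> norm (T (k n) (x + \<xi>)) \<or> norm (T (k n) \<xi>) \<le> norm (T (k n) (x - \<xi>))"
      by linarith
    then show ?thesis
    proof
      assume "norm (T (k n) \<xi>) \<le> norm (T (k n) (x + \<xi>))"
      then show ?thesis using T\<xi> n\<xi> by (intro exI[of _ "x + \<xi>"]) auto
    next
      assume "norm (T (k n) \<xi>) \<le> norm (T (k n) (x - \<xi>))"
      then show ?thesis using T\<xi> n\<xi> by (intro exI[of _ "x - \<xi>"]) auto
    qed
  qed
  note ex = this
  define st where "st n x = (SOME x'. norm (x' - x) \<le> (1/3) ^ n \<and>
    2/3 * (1/3) ^ n * onorm (T (k n)) \<le> norm (T (k n) x'))" for n x
  have st: "norm (st n x - x) \<le> (1/3) ^ n"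
    "2/3 * (1/3) ^ n * onorm (T (k n)) \<le> norm (T (k n) (st n x))" for n x
    using someI_ex[OF ex[of x n]] unfolding st_def by blast+
  define x where "x = rec_nat 0 st"
  have xS: "x (Suc n) = st n (x n)" for n by (simp add: x_def)
  obtain l where l: "\<And>n. norm (l - x n) \<le> 3/2 * (1/3) ^ n"
    using geometric_Cauchy_limit[of x "\<lambda>n. (1/3) ^ n"] st(1) xS by auto
  obtain B where B: "\<And>k. norm (T k l) \<le> B" using pw[of l] by blast
  have "(1/6) * (4/3) ^ n \<le> B" for n
  proof -
    interpret bounded_linear "T (k n)" by (rule lin)
    have "norm (T (k n) (l - x (Suc n))) \<le> onorm (T (k n)) * norm (l - x (Suc n))" by (rule onorm[OF lin])
    \<comment> \<open>The image of \<open>x (Suc n)\<close> is at least \<open>2/3\<close> of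
      \<open>(1/3) ^ n * onorm (T (k n))\<close>, and all later displacements remove at most
      \<open>1/2\<close> of it; \<open>1/6\<close> remains.\<close>
    also have "\<dots> \<le> onorm (T (k n)) * (1/2 * (1/3) ^ n)"
      using l[of "Suc n"] by (intro mult_left_mono onorm_pos_le lin) auto
    finally have "norm (T (k n) (x (Suc n))) - 1/2 * (1/3) ^ n * onorm (T (k n)) \<le> norm (T (k n) l)"
      using norm_triangle_ineq2[of "T (k n) (x (Suc n))" "T (k n) l"] by (simp add: diff norm_minus_commute algebra_simps)
    then have "1/6 * ((1/3) ^ n * onorm (T (k n))) \<le> B"
      using st(2)[of n "x n"] B[of "k n"] unfolding xS by (simp add: algebra_simps)
    moreover have "(1/3) ^ n * 4 ^ n \<le> (1/3) ^ n * onorm (T (k n))"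
      using k[of n] by (intro mult_left_mono) auto
    moreover have "(1/3::real) ^ n * 4 ^ n = (4/3) ^ n" by (simp add: power_mult_distrib[symmetric])
    ultimately show ?thesis by simp
  qed
  then have "(4/3) ^ n \<le> 6 * B" for n by (simp add: field_simps)
  moreover obtain n where "6 * B < (4/3::real) ^ n" using real_arch_pow[of "4/3" "6 * B"] by auto
  ultimately show False by (meson not_less)
qed

section \<open>Orbits of a semigroup and its generator\<close>

lemma has_vector_derivative_quotient:
  "(f has_vector_derivative D) (at x within S) \<longleftrightarrow> ((\<lambda>y. (f y - f x) /\<^sub>R (y - x)) \<longlongrightarrow> D) (at x within S)"
proof -
  have "(f has_vector_derivative D) (at x within S) \<longleftrightarrow>
     ((\<lambda>y. norm (f y - f x - (y - x) *\<^sub>R D) / norm (y - x)) \<longlongrightarrow> 0) (at x within S)"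
    unfolding has_vector_derivative_def has_derivative_iff_norm by (simp add: bounded_linear_scaleR_left)
  also have "\<dots> \<longleftrightarrow> ((\<lambda>y. norm ((f y - f x) /\<^sub>R (y - x) - D)) \<longlongrightarrow> 0) (at x within S)"
  proof (rule filterlim_cong[OF refl refl])
    show "\<forall>\<^sub>F y in at x within S. norm (f y - f x - (y - x) *\<^sub>R D) / norm (y - x) = norm ((f y - f x) /\<^sub>R (y - x) - D)"
      unfolding eventually_at_filter
    proof (intro always_eventually allI impI)
      fix y assume "y \<noteq> x"
      then have "(f y - f x) /\<^sub>R (y - x) - D = (f y - f x - (y - x) *\<^sub>R D) /\<^sub>R (y - x)"
        by (simp add: scaleR_diff_right)
      then show "norm (f y - f x - (y - x) *\<^sub>R D) / norm (y - x) = norm ((f y - f x) /\<^sub>R (y - x) - D)"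
        by (simp add: divide_inverse_commute)
    qed
  qed
  also have "\<dots> \<longleftrightarrow> ((\<lambda>y. (f y - f x) /\<^sub>R (y - x)) \<longlongrightarrow> D) (at x within S)"
    by (simp add: tendsto_norm_zero_iff LIM_zero_iff)
  finally show ?thesis .
qed

text \<open>\<open>U 0\<close> is only required to be a projection, so that a semigroup on a closed subspace can be
  extended by zero to the orthogonal complement.\<close>

locale degenerate_semigroup =
  fixes U :: "real \<Rightarrow> 'a::{real_inner, banach} \<Rightarrow> 'a"
  assumes lin: "t \<ge> 0 \<Longrightarrow> bounded_linear (U t)"
    and semi: "s \<ge> 0 \<Longrightarrow> t \<ge> 0 \<Longrightarrow> U (s + t) f = U s (U t f)"
    and cont0: "((\<lambda>t. U t f) \<longlongrightarrow> U 0 f) (at_right 0)"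
begin

definition gen :: "'a \<Rightarrow> 'a \<Rightarrow> bool" where
  "gen v w \<longleftrightarrow> U 0 v = v \<and> ((\<lambda>t. (U t v - v) /\<^sub>R t) \<longlongrightarrow> w) (at_right 0)"

lemma U_0_absorb: "t \<ge> 0 \<Longrightarrow> U t (U 0 f) = U t f" "t \<ge> 0 \<Longrightarrow> U 0 (U t f) = U t f"
  using semi[of t 0 f] semi[of 0 t f] by auto

lemma cont0_closed: "((\<lambda>t. U t f) \<longlongrightarrow> U 0 f) (at 0 within {0..})"
  using cont0[of f] by (simp add: at_within_Ici_at_right)

text \<open>Otherwise there are times \<open>t n\<close> tending to 0 at which the operators have
  norms above \<open>n\<close>. Strong continuity at 0 makes each orbit bounded along these times,
  contrary to uniform boundedness.\<close>

lemma bounded_near_0: "\<exists>\<tau>>0. \<exists>C. \<forall>t\<in>{0..\<tau>}. \<forall>f. norm (U t f) \<le> C * norm f"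
proof (rule ccontr)
  assume "\<not> ?thesis"
  then have "\<exists>t f. t \<in> {0..1 / real (Suc n)} \<and> norm (U t f) > real n * norm f" for n
    by (metis not_less of_nat_0_less_iff zero_less_Suc zero_less_divide_1_iff)
  then obtain t f where t: "\<And>n. t n \<in> {0..1 / real (Suc n)}" and f: "\<And>n. norm (U (t n) (f n)) > real n * norm (f n)"
    by metis
  have t0: "t \<longlonglongrightarrow> 0"
  proof (rule tendsto_sandwich[of "\<lambda>_. 0"])
    show "(\<lambda>n. 1 / real (Suc n)) \<longlonglongrightarrow> 0" by (rule LIMSEQ_Suc[OF lim_1_over_n])
  qed (use t in auto)
  have pw: "\<exists>B. \<forall>k. norm (U (t k) x) \<le> B" for x
  proof -
    have "(\<lambda>k. U (t k) x) \<longlonglongrightarrow> U 0 x"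
    proof -
      have "continuous (at 0 within {0..}) (\<lambda>s. U s x)"
        using cont0_closed by (simp add: continuous_within)
      then show ?thesis
        by (rule continuous_within_tendsto_compose) (use t t0 in auto)
    qed
    then have "Bseq (\<lambda>k. U (t k) x)" by (rule convergent_imp_Bseq[OF convergentI])
    then show ?thesis unfolding Bseq_def by blast
  qed
  obtain C where C: "\<And>k x. norm (U (t k) x) \<le> C * norm x"
    using uniform_boundedness[of "\<lambda>k. U (t k)"] lin t pw by auto
  obtain n where n: "real n > C" using reals_Archimedean2 by blast
  have "norm (U (t n) (f n)) \<le> C * norm (f n)" by (rule C)
  also have "\<dots> \<le> real n * norm (f n)" using n by (intro mult_right_mono) auto
  finally show False using f[of n] by simp
qed

text \<open>Each step of length \<open>\<tau>\<close> multiplies the bound by \<open>C\<close>;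
  taking \<open>C \<ge> 1\<close> makes the powers increase with the number of steps.\<close>

lemma bounded_on_Icc: "\<exists>C\<ge>1. \<forall>t\<in>{0..T}. \<forall>f. norm (U t f) \<le> C * norm f"
proof -
  obtain \<tau> C0 where \<tau>: "\<tau> > 0" and C0: "\<And>t f. t \<in> {0..\<tau>} \<Longrightarrow> norm (U t f) \<le> C0 * norm f"
    using bounded_near_0 by blast
  define C where "C = max 1 C0"
  have C: "norm (U t f) \<le> C * norm f" if "t \<in> {0..\<tau>}" for t f
    using C0[OF that, of f] mult_right_mono[of C0 C "norm f"] by (simp add: C_def)
  have C1: "C \<ge> 1" by (simp add: C_def)
  have *: "norm (U t f) \<le> C ^ Suc n * norm f" if "0 \<le> t" "t \<le> real (Suc n) * \<tau>" for n t f
    using that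
  proof (induction n arbitrary: t f)
    case 0
    then show ?case using C by simp
  next
    case (Suc n)
    show ?case
    proof (cases "t \<le> \<tau>")
      case True
      then have "norm (U t f) \<le> C * norm f" using C Suc by auto
      also have "\<dots> \<le> C ^ Suc (Suc n) * norm f"
        using C1 power_increasing[of 1 "Suc (Suc n)" C] by (intro mult_right_mono) auto
      finally show ?thesis .
    next
      case False
      then have "U t f = U \<tau> (U (t - \<tau>) f)" using semi[of \<tau> "t - \<tau>" f] \<tau> by simp
      then have "norm (U t f) \<le> C * norm (U (t - \<tau>) f)" using C \<tau> by simp
      also have "\<dots> \<le> C * (C ^ Suc n * norm f)"
        using Suc.prems False C1 by (intro mult_left_mono Suc.IH) (auto simp: algebra_simps)
      finally show ?thesis by simp
    qed
  qed
  obtain n where "T / \<tau> < real n" using reals_Archimedean2 by blast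
  then have "T < real n * \<tau>" using \<tau> by (simp add: field_simps)
  also have "\<dots> \<le> real (Suc n) * \<tau>" using \<tau> by (intro mult_right_mono) auto
  finally have "T \<le> real (Suc n) * \<tau>" by simp
  then have "\<forall>t\<in>{0..T}. \<forall>f. norm (U t f) \<le> C ^ Suc n * norm f" using *[of _ n] by auto
  moreover have "C ^ Suc n \<ge> 1" using C1 by (rule one_le_power)
  ultimately show ?thesis by blast
qed

lemma continuous_on_U: "continuous_on {0..} (\<lambda>t. U t f)"
proof -
  have "continuous_on {0..T} (\<lambda>t. U t f)" for T
    unfolding continuous_on_iff
  proof (intro ballI allI impI)
    fix t e :: real assume t: "t \<in> {0..T}" and e: "e > 0"
    obtain C where C: "C \<ge> 1" "\<And>t f. t \<in> {0..T} \<Longrightarrow> norm (U t f) \<le> C * norm f"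
      using bounded_on_Icc by blast
    have "\<forall>\<^sub>F h in at 0 within {0..}. dist (U h f) (U 0 f) < e / C"
      using tendstoD[OF cont0_closed, of "e / C" f] e C(1) by simp
    then obtain d where d: "d > 0" "\<And>h. h \<ge> 0 \<Longrightarrow> h < d \<Longrightarrow> h \<noteq> 0 \<Longrightarrow> norm (U h f - U 0 f) < e / C"
      unfolding eventually_at dist_norm by auto
    \<comment> \<open>Both directions of continuity come from the earlier of the two times: a
      forward increment is carried by \<open>U s\<close>, whose norm is bounded by \<open>C\<close>
      on the interval.\<close>
    have key: "norm (U (s + h) f - U s f) < e" if "s \<in> {0..T}" "0 \<le> h" "h < d" for s h
    proof (cases "h = 0")
      case False
      have "U (s + h) f - U s f = U s (U h f - U 0 f)"
        using that semi[of s h f] U_0_absorb(1)[of s f] linear_diff[OF bounded_linear.linear[OF lin[of s]]] by simp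
      then have "norm (U (s + h) f - U s f) \<le> C * norm (U h f - U 0 f)" using C(2) that by simp
      also have "\<dots> < C * (e / C)" using d(2)[of h] that False C(1) by (intro mult_strict_left_mono) auto
      finally show ?thesis using C(1) by simp
    qed (use e in simp)
    show "\<exists>d>0. \<forall>s\<in>{0..T}. dist s t < d \<longrightarrow> dist (U s f) (U t f) < e"
    proof (intro exI conjI ballI impI)
      fix s assume s: "s \<in> {0..T}" "dist s t < d"
      show "dist (U s f) (U t f) < e"
      proof (cases "s \<le> t")
        case True
        then show ?thesis using key[of s "t - s"] s by (auto simp: dist_norm norm_minus_commute)
      next
        case False
        then show ?thesis using key[of t "s - t"] s t by (auto simp: dist_norm)
      qed
    qed (use d in simp)
  qed
  note fin = this
  show ?thesis unfolding continuous_on_eq_continuous_within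
  proof
    fix t :: real assume t: "t \<in> {0..}"
    have "continuous (at t within {0..t+1}) (\<lambda>t. U t f)"
      using fin[of "t + 1"] t by (simp add: continuous_on_eq_continuous_within)
    moreover have "at t within {0..t+1} = at t within {0..}"
      by (rule at_within_nhd[of _ "{..<t+1}"]) auto
    ultimately show "continuous (at t within {0..}) (\<lambda>t. U t f)" by simp
  qed
qed

text \<open>Left and right difference quotients are both \<open>U (min s t)\<close> applied to the
  quotient \<open>d\<close> at time \<open>\<bar>s - t\<bar>\<close>, which tends to
  \<open>w\<close>; local boundedness of the operators lets the limit pass through.\<close>

lemma has_vector_derivative_U:
  assumes g: "gen v w" and t: "t \<ge> 0"
  shows "((\<lambda>s. U s v) has_vector_derivative U t w) (at t within {0..})"
  unfolding has_vector_derivative_quotient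
proof -
  have lim: "((\<lambda>t. (U t v - v) /\<^sub>R t) \<longlongrightarrow> w) (at_right 0)"
    using g by (auto simp: gen_def)
  obtain C where C: "C \<ge> 1" "\<And>s f. s \<in> {0..t} \<Longrightarrow> norm (U s f) \<le> C * norm f"
    using bounded_on_Icc by blast
  define d where "d h = (U h v - v) /\<^sub>R h" for h
  have quot: "(U s v - U t v) /\<^sub>R (s - t) = U (min s t) (d \<bar>s - t\<bar>)" if "s \<ge> 0" "s \<noteq> t" for s
  proof -
    have *: "(U (r + h) v - U r v) /\<^sub>R h = U r (d h)" if "r \<ge> 0" "h > 0" for r h
    proof -
      interpret bounded_linear "U r" by (rule lin[OF that(1)])
      show ?thesis using that semi[of r h v] by (simp add: d_def scaleR diff)
    qed
    show ?thesis
    proof (cases "s < t")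
      case True
      have "(U s v - U t v) /\<^sub>R (s - t) = (- (U t v - U s v)) /\<^sub>R (- (t - s))" by simp
      also have "\<dots> = (U t v - U s v) /\<^sub>R (t - s)"
        by (simp only: inverse_minus_eq scaleR_minus_left scaleR_minus_right minus_minus)
      finally have "(U s v - U t v) /\<^sub>R (s - t) = (U t v - U s v) /\<^sub>R (t - s)" .
      with *[of s "t - s"] True that show ?thesis by simp
    next
      case False
      with *[of t "s - t"] t that show ?thesis by simp
    qed
  qed
  have dlim: "((\<lambda>s. d \<bar>s - t\<bar>) \<longlongrightarrow> w) (at t within {0..})"
  proof -
    have "filterlim (\<lambda>s. \<bar>s - t\<bar>) (at_right 0) (at t within {0..})"
      unfolding filterlim_at
    proof
      show "((\<lambda>s. \<bar>s - t\<bar>) \<longlongrightarrow> 0) (at t within {0..})"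
        by (rule tendsto_eq_intros | simp)+
      show "\<forall>\<^sub>F s in at t within {0..}. \<bar>s - t\<bar> \<in> {0<..} \<and> \<bar>s - t\<bar> \<noteq> 0"
        by (auto simp: eventually_at_filter)
    qed
    then show ?thesis using lim unfolding d_def by (rule filterlim_compose[rotated])
  qed
  have e0: "((\<lambda>s. U (min s t) (d \<bar>s - t\<bar> - w)) \<longlongrightarrow> 0) (at t within {0..})"
  proof (rule Lim_null_comparison)
    show "\<forall>\<^sub>F s in at t within {0..}. norm (U (min s t) (d \<bar>s - t\<bar> - w)) \<le> C * norm (d \<bar>s - t\<bar> - w)"
      unfolding eventually_at_filter by (intro always_eventually) (use C(2) t in auto)
    show "((\<lambda>s. C * norm (d \<bar>s - t\<bar> - w)) \<longlongrightarrow> 0) (at t within {0..})"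
      using dlim by (auto intro!: tendsto_mult_right_zero tendsto_norm_zero simp: LIM_zero_iff)
  qed
  have e1: "((\<lambda>s. U (min s t) w) \<longlongrightarrow> U t w) (at t within {0..})"
  proof -
    have "continuous_on {0..} (\<lambda>s. U (min s t) w)"
      by (rule continuous_on_compose2[OF continuous_on_U]) (use t in \<open>auto intro!: continuous_intros\<close>)
    then show ?thesis using t unfolding continuous_on_def by (drule_tac bspec[of _ _ t]) auto
  qed
  have "((\<lambda>s. U (min s t) (d \<bar>s - t\<bar> - w) + U (min s t) w) \<longlongrightarrow> 0 + U t w) (at t within {0..})"
    by (intro tendsto_add e0 e1)
  moreover have "\<forall>\<^sub>F s in at t within {0..}. U (min s t) (d \<bar>s - t\<bar> - w) + U (min s t) w = (U s v - U t v) /\<^sub>R (s - t)"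
    unfolding eventually_at_filter
  proof (intro always_eventually allI impI)
    fix s assume "s \<noteq> t" "s \<in> {0..}"
    then show "U (min s t) (d \<bar>s - t\<bar> - w) + U (min s t) w = (U s v - U t v) /\<^sub>R (s - t)"
      using t quot[of s] linear_diff[OF bounded_linear.linear[OF lin[of "min s t"]]] by simp
  qed
  ultimately have "((\<lambda>y. (U y v - U t v) /\<^sub>R (y - t)) \<longlongrightarrow> 0 + U t w) (at t within {0..})"
    by (rule Lim_transform_eventually)
  then show "((\<lambda>y. (U y v - U t v) /\<^sub>R (y - t)) \<longlongrightarrow> U t w) (at t within {0..})" by simp
qed

lemma gen_U:
  assumes "gen v w" "t \<ge> 0"
  shows "gen (U t v) (U t w)"
proof -
  interpret bounded_linear "U t" by (rule lin[OF assms(2)])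
  have "((\<lambda>h. U t ((U h v - v) /\<^sub>R h)) \<longlongrightarrow> U t w) (at_right 0)"
    by (rule tendsto) (use assms in \<open>simp add: gen_def\<close>)
  moreover have "\<forall>\<^sub>F h in at_right 0. U t ((U h v - v) /\<^sub>R h) = (U h (U t v) - U t v) /\<^sub>R h"
    unfolding eventually_at_filter
  proof (intro always_eventually allI impI)
    fix h :: real assume "h \<in> {0<..}"
    then show "U t ((U h v - v) /\<^sub>R h) = (U h (U t v) - U t v) /\<^sub>R h"
      using semi[of t h v] semi[of h t v] assms by (simp add: scaleR diff add.commute)
  qed
  ultimately have "((\<lambda>h. (U h (U t v) - U t v) /\<^sub>R h) \<longlongrightarrow> U t w) (at_right 0)"
    by (rule Lim_transform_eventually)
  then show ?thesis using assms U_0_absorb(2) by (simp add: gen_def)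
qed

text \<open>The averages of an orbit over \<open>[0, h]\<close> belong to the domain, since moving
  an average along the semigroup only changes the ends of the interval, and they converge to
  \<open>U 0 v\<close>.\<close>

lemma gen_dense: "\<exists>A B. (\<forall>n. gen (A n) (B n)) \<and> A \<longlonglongrightarrow> U 0 (v :: 'a)"
proof -
  define \<Phi> where "\<Phi> t = integral {0..t} (\<lambda>s. U s v)" for t
  have int: "(\<lambda>s. U s v) integrable_on {a..b}" if "0 \<le> a" for a b
    by (rule integrable_continuous_real[OF continuous_on_subset[OF continuous_on_U]]) (use that in auto)
  have d\<Phi>: "((\<lambda>h. (\<Phi> (t + h) - \<Phi> t) /\<^sub>R h) \<longlongrightarrow> U t v) (at_right 0)" if t: "t \<ge> 0" for t
  proof -
    have "(\<Phi> has_vector_derivative U t v) (at t within {0..t+1})"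
      unfolding \<Phi>_def
      by (rule integral_has_vector_derivative[OF continuous_on_subset[OF continuous_on_U]]) (use t in auto)
    then have "(\<Phi> has_vector_derivative U t v) (at t within {t<..<t+1})"
      by (rule has_vector_derivative_within_subset) (use t in auto)
    moreover have "at t within {t<..<t+1} = at_right t"
      by (rule at_within_nhd[of _ "{..<t+1}"]) auto
    ultimately have "((\<lambda>y. (\<Phi> y - \<Phi> t) /\<^sub>R (y - t)) \<longlongrightarrow> U t v) (at_right t)"
      by (simp add: has_vector_derivative_quotient)
    then show ?thesis
      unfolding at_right_to_0[of t] filterlim_filtermap by (simp add: add.commute)
  qed
  have shift: "U \<tau> (\<Phi> h) = \<Phi> (\<tau> + h) - \<Phi> \<tau>" if "\<tau> \<ge> 0" "h \<ge> 0" for \<tau> h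
  proof -
    have "U \<tau> (\<Phi> h) = integral {0..h} (U \<tau> \<circ> (\<lambda>s. U s v))"
      unfolding \<Phi>_def using integral_linear[OF int lin[OF that(1)], of 0 h] by simp
    also have "\<dots> = integral {0..h} (\<lambda>s. U (s + \<tau>) v)"
      by (rule integral_cong) (use semi[of \<tau>, symmetric] that in \<open>simp add: add.commute\<close>)
    also have "\<dots> = integral {\<tau>..\<tau> + h} (\<lambda>s. U s v)"
      using integral_shift_real_ivl[of \<tau> \<tau> "\<tau> + h" "\<lambda>s. U s v"] by simp
    also have "\<dots> = \<Phi> (\<tau> + h) - \<Phi> \<tau>"
      unfolding \<Phi>_def using Henstock_Kurzweil_Integration.integral_combine[of 0 \<tau> "\<tau> + h" "\<lambda>s. U s v"] int that
      by (simp add: algebra_simps)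
    finally show ?thesis .
  qed
  have \<Phi>0: "\<Phi> 0 = 0" by (simp add: \<Phi>_def)
  have genh: "gen (\<Phi> h /\<^sub>R h) ((U h v - U 0 v) /\<^sub>R h)" if h: "h > 0" for h
    unfolding gen_def
  proof
    interpret U0: bounded_linear "U 0" by (rule lin) simp
    show U0: "U 0 (\<Phi> h /\<^sub>R h) = \<Phi> h /\<^sub>R h" using shift[of 0 h] h \<Phi>0 by (simp add: U0.scaleR)
    have "((\<lambda>t. ((\<Phi> (h + t) - \<Phi> h) /\<^sub>R t - (\<Phi> (0 + t) - \<Phi> 0) /\<^sub>R t) /\<^sub>R h) \<longlongrightarrow> (U h v - U 0 v) /\<^sub>R h) (at_right 0)"
      by (intro tendsto_intros d\<Phi>) (use h in auto)
    moreover have "\<forall>\<^sub>F t in at_right 0. ((\<Phi> (h + t) - \<Phi> h) /\<^sub>R t - (\<Phi> (0 + t) - \<Phi> 0) /\<^sub>R t) /\<^sub>R h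
        = (U t (\<Phi> h /\<^sub>R h) - \<Phi> h /\<^sub>R h) /\<^sub>R t"
      unfolding eventually_at_filter
    proof (intro always_eventually allI impI)
      fix t :: real assume t: "t \<in> {0<..}"
      interpret Ut: bounded_linear "U t" by (rule lin) (use t in simp)
      show "((\<Phi> (h + t) - \<Phi> h) /\<^sub>R t - (\<Phi> (0 + t) - \<Phi> 0) /\<^sub>R t) /\<^sub>R h = (U t (\<Phi> h /\<^sub>R h) - \<Phi> h /\<^sub>R h) /\<^sub>R t"
        using t h \<Phi>0 by (simp add: Ut.scaleR shift algebra_simps)
    qed
    ultimately show "((\<lambda>t. (U t (\<Phi> h /\<^sub>R h) - \<Phi> h /\<^sub>R h) /\<^sub>R t) \<longlongrightarrow> (U h v - U 0 v) /\<^sub>R h) (at_right 0)"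
      by (rule Lim_transform_eventually)
  qed
  define h where "h n = 1 / real (Suc n)" for n
  have h: "filterlim h (at_right 0) sequentially"
    unfolding filterlim_at h_def using LIMSEQ_Suc[OF lim_1_over_n] by (auto simp del: of_nat_Suc)
  have "((\<lambda>h. \<Phi> h /\<^sub>R h) \<longlongrightarrow> U 0 v) (at_right 0)" using d\<Phi>[of 0] \<Phi>0 by simp
  from filterlim_compose[OF this h] have "(\<lambda>n. \<Phi> (h n) /\<^sub>R h n) \<longlonglongrightarrow> U 0 v" .
  moreover have "gen (\<Phi> (h n) /\<^sub>R h n) ((U (h n) v - U 0 v) /\<^sub>R h n)" for n
    by (rule genh) (simp add: h_def)
  ultimately show ?thesis
    by (intro exI[of _ "\<lambda>n. \<Phi> (h n) /\<^sub>R h n"] exI[of _ "\<lambda>n. (U (h n) v - U 0 v) /\<^sub>R h n"]) simp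
qed

text \<open>The error in the weak eigenvector equation is measured by the energy \<open>c |f|\<^sup>2 - f \<bullet> h\<close>, whose
  integral along an orbit is controlled by the decay of \<open>|U t f|\<^sup>2\<close>; hence no regularity of the
  initial state enters the final bound.\<close>

lemma weak_eigenvector_upper:
  assumes dis: "\<And>f h. gen f h \<Longrightarrow> 0 \<le> c * (f \<bullet> f) - f \<bullet> h"
    and eig: "\<And>f h. gen f h \<Longrightarrow> h \<bullet> g + l * (f \<bullet> g) \<le> \<delta> * (1 + (c * (f \<bullet> f) - f \<bullet> h))"
    and c: "c \<ge> 0" "- c \<le> l" and \<delta>: "\<delta> \<ge> 0" and t: "t \<ge> 0" and v: "gen v w" "norm v = 1"
  shows "U t v \<bullet> g - exp (- l * t) * (v \<bullet> g) \<le> \<delta> * (exp (c * t) * (1/2 + (1 + c * exp (2 * c * t)) * t))"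
proof -
  have vd: "((\<lambda>s. U s v) has_vector_derivative U s w) (at s)" if "s > 0" for s
  proof -
    have "((\<lambda>s. U s v) has_vector_derivative U s w) (at s within {0..})"
      using has_vector_derivative_U[OF v(1)] that by simp
    moreover have "at s within {0..} = at s" by (rule at_within_interior) (use that in \<open>simp add: interior_Ici[of "-1" 0]\<close>)
    ultimately show ?thesis by simp
  qed
  have gs: "gen (U s v) (U s w)" if "s \<ge> 0" for s using gen_U[OF v(1) that] .
  have U0: "U 0 v = v" using v(1) by (simp add: gen_def)
  define m where "m s = U s v \<bullet> g" for s
  define N where "N s = U s v \<bullet> U s v" for s
  have dm: "(m has_real_derivative U s w \<bullet> g) (at s)" if "s > 0" for s
    using bounded_linear.has_vector_derivative[OF bounded_linear_inner_left[of g] vd[OF that]]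
    unfolding m_def has_real_derivative_iff_has_vector_derivative .
  have dN: "(N has_real_derivative 2 * (U s v \<bullet> U s w)) (at s)" if "s > 0" for s
  proof -
    have "((\<lambda>s. U s v \<bullet> U s v) has_derivative (\<lambda>h. U s v \<bullet> (h *\<^sub>R U s w) + (h *\<^sub>R U s w) \<bullet> U s v)) (at s)"
      using vd[OF that] unfolding has_vector_derivative_def by (intro has_derivative_inner)
    then show ?thesis unfolding N_def has_field_derivative_def
      by (rule has_derivative_eq_rhs) (auto simp: fun_eq_iff inner_commute algebra_simps)
  qed
  have cm: "continuous_on {0..r} m" and cN: "continuous_on {0..r} N" for r
    unfolding m_def N_def by (intro continuous_intros continuous_on_subset[OF continuous_on_U]; auto)+
  have N0: "N 0 = 1" using v(2) U0 by (simp add: N_def dot_square_norm)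
  \<comment> \<open>Gronwall: the dissipativity assumption says that
    \<open>N' \<le> 2 c N\<close>.\<close>
  have Nb: "N s \<le> exp (2 * c * t)" if "0 \<le> s" "s \<le> t" for s
  proof -
    have "exp (- (2 * c * s)) * N s \<le> exp (- (2 * c * 0)) * N 0"
    proof (rule DERIV_nonpos_imp_decreasing_open[where f="\<lambda>s. exp (- (2 * c * s)) * N s"])
      fix x assume x: "0 < x" "x < s"
      have "((\<lambda>s. exp (- (2 * c * s)) * N s) has_real_derivative
          exp (- (2 * c * x)) * (2 * (U x v \<bullet> U x w) - 2 * c * N x)) (at x)"
        by (rule derivative_eq_intros dN x refl | simp add: algebra_simps)+
      moreover have "2 * (U x v \<bullet> U x w) - 2 * c * N x \<le> 0"
        using dis[OF gs[of x]] x by (simp add: N_def)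
      ultimately show "\<exists>y. ((\<lambda>s. exp (- (2 * c * s)) * N s) has_real_derivative y) (at x) \<and> y \<le> 0"
        by (meson exp_ge_zero mult_nonneg_nonpos)
    qed (use that in \<open>auto intro!: continuous_intros cN\<close>)
    then have "exp (- (2 * c * s)) * N s \<le> 1" using N0 by simp
    then have "N s \<le> exp (2 * c * s)" by (simp add: exp_minus field_simps)
    also have "\<dots> \<le> exp (2 * c * t)" using that c by (simp add: mult_left_mono)
    finally show ?thesis .
  qed
  define M where "M = exp (2 * c * t)"
  \<comment> \<open>The derivative of the first term is the weighted defect in the eigenvector
    equation. That of \<open>N s / 2\<close> is \<open>c * N s\<close> minus the energy, which
    cancels the energy part of the defect, and the linear term absorbs \<open>1 + c * N s\<close>.
    The factor \<open>exp (c * t)\<close> bounds \<open>exp (l * (s - t))\<close> because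
    \<open>l \<ge> - c\<close>. Hence \<open>B\<close> decreases.\<close>
  define B where "B s = exp (l * (s - t)) * m s + exp (c * t) * \<delta> * (N s / 2 - (1 + c * M) * s)" for s
  have "B t \<le> B 0"
  proof (rule DERIV_nonpos_imp_decreasing_open[OF t])
    fix s assume s: "0 < s" "s < t"
    let ?E = "c * N s - U s v \<bullet> U s w"
    have "(B has_real_derivative exp (l * (s - t)) * (U s w \<bullet> g + l * m s)
        + exp (c * t) * \<delta> * (U s v \<bullet> U s w - (1 + c * M))) (at s)"
      unfolding B_def
      by (rule derivative_eq_intros dN dm s refl | simp add: algebra_simps)+
    moreover have "exp (l * (s - t)) * (U s w \<bullet> g + l * m s) \<le> exp (c * t) * (\<delta> * (1 + ?E))"
    proof -
      have E: "?E \<ge> 0" using dis[OF gs[of s]] s by (simp add: N_def)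
      have "(- l) * (t - s) \<le> c * (t - s)" using c s by (intro mult_right_mono) auto
      also have "\<dots> \<le> c * t" using c s by (intro mult_left_mono) auto
      finally have "exp (l * (s - t)) \<le> exp (c * t)" by (simp add: algebra_simps)
      moreover have "U s w \<bullet> g + l * m s \<le> \<delta> * (1 + ?E)"
        using eig[OF gs[of s]] s by (simp add: m_def N_def)
      moreover have "0 \<le> \<delta> * (1 + ?E)" using E \<delta> by simp
      ultimately show ?thesis
        by (meson exp_ge_zero mult_left_mono mult_right_mono order_trans)
    qed
    moreover have "exp (c * t) * (\<delta> * (1 + ?E)) + exp (c * t) * \<delta> * (U s v \<bullet> U s w - (1 + c * M)) \<le> 0"
    proof -
      have "c * N s \<le> c * M" using Nb[of s] s c unfolding M_def by (intro mult_left_mono) auto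
      then have "exp (c * t) * \<delta> * (c * N s - c * M) \<le> 0"
        using \<delta> by (intro mult_nonneg_nonpos) auto
      then show ?thesis by (simp add: algebra_simps)
    qed
    ultimately show "\<exists>y. (B has_real_derivative y) (at s) \<and> y \<le> 0" by (meson add_mono order_refl order_trans)
  next
    show "continuous_on {0..t} B" unfolding B_def by (intro continuous_intros cm cN) auto
  qed
  moreover have "B t \<ge> m t - exp (c * t) * \<delta> * ((1 + c * M) * t)"
  proof -
    have "0 \<le> exp (c * t) * \<delta> * (N t / 2)" using \<delta> by (simp add: N_def)
    then show ?thesis by (simp add: B_def algebra_simps)
  qed
  moreover have "B 0 = exp (- l * t) * (v \<bullet> g) + exp (c * t) * \<delta> * (1 / 2)"
    using N0 U0 by (simp add: B_def m_def)
  ultimately show ?thesis by (simp add: m_def M_def algebra_simps)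
qed

text \<open>The error \<open>1 + energy\<close> is not homogeneous, so the estimate is made for unit
  vectors of the domain and scaled afterwards. Using \<open>g\<close> and \<open>- g\<close> gives
  the absolute value, and density of the domain in the range of \<open>U 0\<close> gives all
  \<open>v\<close>. As only \<open>norm (U 0 v)\<close> survives, the bound also covers states of
  infinite energy, such as the values of a control.\<close>

lemma weak_eigenvector:
  assumes dis: "\<And>f h. gen f h \<Longrightarrow> 0 \<le> c * (f \<bullet> f) - f \<bullet> h"
    and eig: "\<And>f h. gen f h \<Longrightarrow> \<bar>h \<bullet> g + l * (f \<bullet> g)\<bar> \<le> \<delta> * (1 + (c * (f \<bullet> f) - f \<bullet> h))"
    and c: "c \<ge> 0" "- c \<le> l" and \<delta>: "\<delta> \<ge> 0" and t: "0 \<le> t" "t \<le> T"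
  shows "\<bar>U t v \<bullet> g - exp (- l * t) * (U 0 v \<bullet> g)\<bar>
    \<le> \<delta> * (exp (c * T) * (1/2 + (1 + c * exp (2 * c * T)) * T)) * norm (U 0 v)"
proof -
  define K where "K s = exp (c * s) * (1/2 + (1 + c * exp (2 * c * s)) * s)" for s
  have Kmono: "K t \<le> K T" unfolding K_def
    using c t by (intro mult_mono add_mono) (auto intro!: mult_left_mono add_nonneg_nonneg mult_nonneg_nonneg)
  have unit: "\<bar>U t v \<bullet> g - exp (- l * t) * (v \<bullet> g)\<bar> \<le> \<delta> * K t" if "gen v w" "norm v = 1" for v w
  proof -
    have "U t v \<bullet> g - exp (- l * t) * (v \<bullet> g) \<le> \<delta> * K t"
      unfolding K_def by (rule weak_eigenvector_upper[OF dis _ c \<delta> t(1) that]) (use eig in \<open>auto simp: abs_le_iff\<close>)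
    moreover have "U t v \<bullet> (- g) - exp (- l * t) * (v \<bullet> (- g)) \<le> \<delta> * K t"
      unfolding K_def by (rule weak_eigenvector_upper[OF dis _ c \<delta> t(1) that]) (use eig in \<open>auto simp: abs_le_iff\<close>)
    ultimately show ?thesis by (simp add: abs_le_iff)
  qed
  interpret Ut: bounded_linear "U t" by (rule lin[OF t(1)])
  have dom: "\<bar>U t v \<bullet> g - exp (- l * t) * (v \<bullet> g)\<bar> \<le> \<delta> * K t * norm v" if "gen v w" for v w
  proof (cases "v = 0")
    case False
    let ?u = "v /\<^sub>R norm v"
    have "gen ?u (w /\<^sub>R norm v)"
    proof -
      interpret U0: bounded_linear "U 0" by (rule lin) simp
      have "((\<lambda>t. ((U t v - v) /\<^sub>R t) /\<^sub>R norm v) \<longlongrightarrow> w /\<^sub>R norm v) (at_right 0)"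
        using that by (intro tendsto_intros) (simp add: gen_def)
      moreover have "\<forall>\<^sub>F t in at_right 0. ((U t v - v) /\<^sub>R t) /\<^sub>R norm v = (U t ?u - ?u) /\<^sub>R t"
        unfolding eventually_at_filter
      proof (intro always_eventually allI impI)
        fix t :: real assume t: "t \<in> {0<..}"
        interpret Ut: bounded_linear "U t" by (rule lin) (use t in simp)
        show "((U t v - v) /\<^sub>R t) /\<^sub>R norm v = (U t ?u - ?u) /\<^sub>R t"
          by (simp add: Ut.scaleR scaleR_diff_right mult.commute)
      qed
      ultimately have "((\<lambda>t. (U t ?u - ?u) /\<^sub>R t) \<longlongrightarrow> w /\<^sub>R norm v) (at_right 0)"
        by (rule Lim_transform_eventually)
      with that show ?thesis by (simp add: gen_def U0.scaleR)
    qed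
    from unit[OF this] False have "\<bar>U t ?u \<bullet> g - exp (- l * t) * (?u \<bullet> g)\<bar> \<le> \<delta> * K t" by simp
    then have "\<bar>U t ?u \<bullet> g - exp (- l * t) * (?u \<bullet> g)\<bar> * norm v \<le> \<delta> * K t * norm v"
      by (rule mult_right_mono) simp
    moreover have "\<bar>U t ?u \<bullet> g - exp (- l * t) * (?u \<bullet> g)\<bar> * norm v =
        \<bar>(U t ?u \<bullet> g - exp (- l * t) * (?u \<bullet> g)) * norm v\<bar>" by (simp add: abs_mult)
    moreover have "(U t ?u \<bullet> g - exp (- l * t) * (?u \<bullet> g)) * norm v = U t v \<bullet> g - exp (- l * t) * (v \<bullet> g)"
      using False by (simp add: Ut.scaleR field_simps)
    ultimately show ?thesis by simp
  qed (simp add: Ut.zero)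
  obtain A B where A: "\<And>n. gen (A n) (B n)" "A \<longlonglongrightarrow> U 0 v" using gen_dense by blast
  have "\<bar>U t (U 0 v) \<bullet> g - exp (- l * t) * (U 0 v \<bullet> g)\<bar> \<le> \<delta> * K t * norm (U 0 v)"
  proof (rule LIMSEQ_le)
    show "(\<lambda>n. \<bar>U t (A n) \<bullet> g - exp (- l * t) * (A n \<bullet> g)\<bar>) \<longlonglongrightarrow>
      \<bar>U t (U 0 v) \<bullet> g - exp (- l * t) * (U 0 v \<bullet> g)\<bar>"
      by (intro tendsto_intros Ut.tendsto A)
    show "(\<lambda>n. \<delta> * K t * norm (A n)) \<longlonglongrightarrow> \<delta> * K t * norm (U 0 v)" by (intro tendsto_intros A)
  qed (use dom[OF A(1)] in auto)
  also have "\<dots> \<le> \<delta> * K T * norm (U 0 v)"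
    using Kmono \<delta> by (intro mult_right_mono mult_left_mono) auto
  finally show ?thesis using U_0_absorb(1)[OF t(1)] by (simp add: K_def)
qed

end

section \<open>Smooth functions on the line\<close>

text \<open>Derivatives are supplied as witnesses, which turns closure under sums, products and
  composition into inductions on \<open>n\<close>; on open sets \<open>deriv\<close> is such a
  witness.\<close>

primrec ck :: "nat \<Rightarrow> real set \<Rightarrow> (real \<Rightarrow> real) \<Rightarrow> bool" where
  "ck 0 A f = True"
| "ck (Suc n) A f = (\<exists>f'. (\<forall>x\<in>A. (f has_real_derivative f' x) (at x)) \<and> ck n A f')"

definition smooth :: "real set \<Rightarrow> (real \<Rightarrow> real) \<Rightarrow> bool" where
  "smooth A f \<longleftrightarrow> (\<forall>n. ck n A f)"

lemma ck_SucD: "ck (Suc n) A f \<Longrightarrow> ck n A f"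
  by (induction n arbitrary: f) (simp, metis ck.simps(2))

lemma ck_cong:
  assumes "open A" "\<And>x. x \<in> A \<Longrightarrow> f x = g x" "ck n A f"
  shows "ck n A g"
proof (cases n)
  case (Suc m)
  with assms(3) obtain f' where f': "\<And>x. x \<in> A \<Longrightarrow> (f has_real_derivative f' x) (at x)" "ck m A f'" by auto
  have "(g has_real_derivative f' x) (at x)" if "x \<in> A" for x
    using has_field_derivative_transform_within_open[OF f'(1) assms(1), of x g] that assms(2) by auto
  with f'(2) Suc show ?thesis by auto
qed simp

lemma ck_Suc_deriv:
  assumes "open A" "ck (Suc n) A f"
  shows "x \<in> A \<Longrightarrow> (f has_real_derivative deriv f x) (at x)" and "ck n A (deriv f)"
proof -
  from assms(2) obtain f' where f': "\<And>x. x \<in> A \<Longrightarrow> (f has_real_derivative f' x) (at x)" "ck n A f'" by auto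
  have eq: "deriv f x = f' x" if "x \<in> A" for x using DERIV_imp_deriv[OF f'(1)[OF that]] .
  show "x \<in> A \<Longrightarrow> (f has_real_derivative deriv f x) (at x)" using f'(1) eq by simp
  show "ck n A (deriv f)" by (rule ck_cong[OF assms(1) _ f'(2)]) (simp add: eq)
qed

lemma ck_const: "ck n A (\<lambda>x. c)"
  by (induction n arbitrary: c) (auto intro!: exI[of _ "\<lambda>x. 0"])

lemma ck_ident: "ck n A (\<lambda>x. x)"
  by (cases n) (auto intro!: exI[of _ "\<lambda>x. 1"] ck_const)

lemma ck_add: "ck n A f \<Longrightarrow> ck n A g \<Longrightarrow> ck n A (\<lambda>x. f x + g x)"
proof (induction n arbitrary: f g)
  case (Suc n)
  then obtain f' g' where "\<forall>x\<in>A. (f has_real_derivative f' x) (at x)" "ck n A f'"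
    "\<forall>x\<in>A. (g has_real_derivative g' x) (at x)" "ck n A g'" by auto
  with Suc.IH[of f' g'] show ?case by (auto intro!: exI[of _ "\<lambda>x. f' x + g' x"] DERIV_add)
qed simp

lemma ck_mult: "ck n A f \<Longrightarrow> ck n A g \<Longrightarrow> ck n A (\<lambda>x. f x * g x)"
proof (induction n arbitrary: f g)
  case (Suc n)
  then obtain f' g' where *: "\<forall>x\<in>A. (f has_real_derivative f' x) (at x)" "ck n A f'"
    "\<forall>x\<in>A. (g has_real_derivative g' x) (at x)" "ck n A g'" by auto
  have "ck n A (\<lambda>x. f' x * g x + f x * g' x)"
    using * Suc.prems[THEN ck_SucD] by (intro ck_add Suc.IH)
  with * show ?case by (auto intro!: exI[of _ "\<lambda>x. f' x * g x + f x * g' x"] derivative_eq_intros)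
qed simp

lemma ck_compose: "ck n B h \<Longrightarrow> ck n A f \<Longrightarrow> f ` A \<subseteq> B \<Longrightarrow> ck n A (\<lambda>x. h (f x))"
proof (induction n arbitrary: h)
  case (Suc n)
  then obtain f' h' where *: "\<forall>x\<in>A. (f has_real_derivative f' x) (at x)" "ck n A f'"
    "\<forall>x\<in>B. (h has_real_derivative h' x) (at x)" "ck n B h'" by auto
  have "ck n A (\<lambda>x. h' (f x) * f' x)"
    by (rule ck_mult[OF Suc.IH[OF *(4) ck_SucD[OF Suc.prems(2)] Suc.prems(3)] *(2)])
  moreover have "((\<lambda>x. h (f x)) has_real_derivative h' (f x) * f' x) (at x)" if "x \<in> A" for x
    using DERIV_chain2[of h "h' (f x)" f x "f' x"] * that Suc.prems(3) by auto
  ultimately show ?case unfolding ck.simps by (intro exI[of _ "\<lambda>x. h' (f x) * f' x"] conjI ballI)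
qed simp

lemma ck_subset: "ck n A f \<Longrightarrow> B \<subseteq> A \<Longrightarrow> ck n B f"
proof (induction n arbitrary: f)
  case (Suc n)
  then obtain f' where "\<forall>x\<in>A. (f has_real_derivative f' x) (at x)" "ck n A f'" by auto
  with Suc show ?case unfolding ck.simps by (intro exI[of _ f']) auto
qed simp

text \<open>Smoothness is local. This permits gluing a product with the zero function outside a
  compact support when the other factor is smooth only on a smaller set.\<close>

lemma ck_Un:
  assumes "open A" "open B"
  shows "ck n A f \<Longrightarrow> ck n B f \<Longrightarrow> ck n (A \<union> B) f"
proof (induction n arbitrary: f)
  case (Suc n)
  then show ?case
    using ck_Suc_deriv[OF assms(1) Suc.prems(1)] ck_Suc_deriv[OF assms(2) Suc.prems(2)]
    by (auto intro!: exI[of _ "deriv f"])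
qed simp

lemma smooth_const: "smooth A (\<lambda>x. c)" and smooth_ident: "smooth A (\<lambda>x. x)"
  by (auto simp: smooth_def ck_const ck_ident)

lemma smooth_add: "smooth A f \<Longrightarrow> smooth A g \<Longrightarrow> smooth A (\<lambda>x. f x + g x)"
  and smooth_mult: "smooth A f \<Longrightarrow> smooth A g \<Longrightarrow> smooth A (\<lambda>x. f x * g x)"
  and smooth_compose: "smooth B h \<Longrightarrow> smooth A f \<Longrightarrow> f ` A \<subseteq> B \<Longrightarrow> smooth A (\<lambda>x. h (f x))"
  and smooth_subset: "smooth A f \<Longrightarrow> B \<subseteq> A \<Longrightarrow> smooth B f"
  by (auto simp: smooth_def intro: ck_add ck_mult ck_compose ck_subset)

lemma smooth_minus: "smooth A f \<Longrightarrow> smooth A (\<lambda>x. - f x)"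
  using smooth_mult[OF smooth_const[of A "-1"], of f] by simp

lemma smooth_power: "smooth A f \<Longrightarrow> smooth A (\<lambda>x. f x ^ n)"
  by (induction n) (auto intro: smooth_const smooth_mult)

lemma smooth_Un: "open A \<Longrightarrow> open B \<Longrightarrow> smooth A f \<Longrightarrow> smooth B f \<Longrightarrow> smooth (A \<union> B) f"
  by (auto simp: smooth_def ck_Un)

lemma smooth_cong: "open A \<Longrightarrow> (\<And>x. x \<in> A \<Longrightarrow> f x = g x) \<Longrightarrow> smooth A f \<Longrightarrow> smooth A g"
  unfolding smooth_def using ck_cong by blast

lemma smooth_DERIV: "smooth A f \<Longrightarrow> open A \<Longrightarrow> x \<in> A \<Longrightarrow> (f has_real_derivative deriv f x) (at x)"
  and smooth_deriv: "smooth A f \<Longrightarrow> open A \<Longrightarrow> smooth A (deriv f)"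
  by (auto simp: smooth_def intro: ck_Suc_deriv)

lemma smooth_continuous_on: "smooth A f \<Longrightarrow> open A \<Longrightarrow> continuous_on A f"
  by (meson DERIV_continuous continuous_at_imp_continuous_on smooth_DERIV)

lemma smooth_antideriv:
  assumes "\<And>x. x \<in> A \<Longrightarrow> (f has_real_derivative f' x) (at x)" "smooth A f'"
  shows "smooth A f"
  unfolding smooth_def
proof
  fix n show "ck n A f" using assms by (cases n) (auto simp: smooth_def)
qed

lemma smooth_higher_deriv: "smooth UNIV f \<Longrightarrow> smooth UNIV ((deriv ^^ k) f)"
  by (induction k) (auto intro: smooth_deriv)

lemma smooth_fun_on_imp_smooth:
  assumes "smooth_fun_on A f" "open B" "B \<subseteq> A"
  shows "smooth B f"
proof -
  obtain D where D: "\<And>x. x \<in> A \<Longrightarrow> D 0 x = f x"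
    "\<And>k x. x \<in> A \<Longrightarrow> (D k has_real_derivative D (Suc k) x) (at x within A)"
    using assms(1) unfolding smooth_fun_on_def by blast
  have D': "(D k has_real_derivative D (Suc k) x) (at x)" if "x \<in> B" for k x
    using has_field_derivative_subset[OF D(2) assms(3), of x k] that assms(3)
      at_within_open[OF that assms(2)] by auto
  have "ck n B (D k)" for n k
  proof (induction n arbitrary: k)
    case (Suc n)
    with D' show ?case unfolding ck.simps by (intro exI[of _ "D (Suc k)"] conjI ballI)
  qed simp
  then have "smooth B (D 0)" by (simp add: smooth_def)
  then show ?thesis by (rule smooth_cong[OF assms(2), rotated]) (use D(1) assms(3) in auto)
qed

lemma smooth_exp: "smooth A exp"
proof -
  have "ck n A exp" for n by (induction n) (auto intro!: exI[of _ exp] DERIV_exp)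
  then show ?thesis by (simp add: smooth_def)
qed

lemma smooth_sin: "smooth A sin" and smooth_cos: "smooth A cos"
proof -
  have "ck n A (\<lambda>x. c * sin x + d * cos x)" for n c d
  proof (induction n arbitrary: c d)
    case (Suc n)
    have "((\<lambda>x. c * sin x + d * cos x) has_real_derivative (- d) * sin x + c * cos x) (at x)" for x
      by (auto intro!: derivative_eq_intros)
    with Suc[of "- d" c] show ?case
      unfolding ck.simps by (intro exI[of _ "\<lambda>x. (- d) * sin x + c * cos x"] conjI ballI)
  qed simp
  from this[of _ 1 0] this[of _ 0 1] show "smooth A sin" "smooth A cos" by (auto simp: smooth_def)
qed

section \<open>Flat functions and bumps\<close>

definition flat :: "nat \<Rightarrow> real \<Rightarrow> real" where
  "flat k t = (if t > 0 then (1 / t) ^ k * exp (- (1 / t)) else 0)"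

text \<open>The index \<open>k\<close> keeps derivatives within the span of the family, so the
  smoothness of all members follows by one induction. At 0 the difference quotient of
  \<open>flat k\<close> is \<open>flat (Suc k)\<close> itself.\<close>

lemma DERIV_flat: "(flat k has_real_derivative - real k * flat (Suc k) t + flat (Suc (Suc k)) t) (at t)"
proof -
  consider "t > 0" | "t < 0" | "t = 0" by linarith
  then show ?thesis
  proof cases
    case 1
    have "((\<lambda>t. (1 / t) ^ k * exp (- (1 / t))) has_real_derivative
      - real k * flat (Suc k) t + flat (Suc (Suc k)) t) (at t)"
    proof -
      have "((\<lambda>t. (1 / t) ^ k * exp (- (1 / t))) has_real_derivative
        (real k * (1 / t) ^ (k - 1) * (- (1 / t^2))) * exp (- (1 / t)) + (1 / t) ^ k * (exp (- (1 / t)) * (1 / t^2))) (at t)"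
      proof -
        have inv: "((\<lambda>t. 1 / t) has_real_derivative - (1 / t^2)) (at t)"
          using 1 by (auto intro!: derivative_eq_intros simp: power2_eq_square)
        have "((\<lambda>t. exp (- (1 / t))) has_real_derivative exp (- (1 / t)) * (1 / t^2)) (at t)"
          using DERIV_chain2[OF DERIV_exp DERIV_minus[OF inv]] by simp
        from DERIV_mult[OF DERIV_power[OF inv, of k] this] show ?thesis
          by (rule DERIV_cong) (simp add: algebra_simps)
      qed
      moreover have "(real k * (1 / t) ^ (k - 1) * (- (1 / t^2))) * exp (- (1 / t)) + (1 / t) ^ k * (exp (- (1 / t)) * (1 / t^2))
        = - real k * flat (Suc k) t + flat (Suc (Suc k)) t"
        using 1 by (cases k) (auto simp: flat_def power2_eq_square field_simps)
      ultimately show ?thesis by simp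
    qed
    then show ?thesis
      by (rule has_field_derivative_transform_within_open[of _ _ _ "{0<..}"]) (use 1 in \<open>auto simp: flat_def\<close>)
  next
    case 2
    have "((\<lambda>t. 0) has_real_derivative - real k * flat (Suc k) t + flat (Suc (Suc k)) t) (at t)"
      using 2 by (simp add: flat_def)
    then show ?thesis
      by (rule has_field_derivative_transform_within_open[of _ _ _ "{..<0}"]) (use 2 in \<open>auto simp: flat_def\<close>)
  next
    case 3
    have "((\<lambda>h. flat (Suc k) h) \<longlongrightarrow> 0) (at 0)"
    proof (rule filterlim_split_at)
      have "\<forall>\<^sub>F h in at_left (0::real). flat (Suc k) h = 0"
        by (auto simp: eventually_at_filter flat_def)
      then show "((\<lambda>h. flat (Suc k) h) \<longlongrightarrow> 0) (at_left 0)"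
        by (rule tendsto_eventually)
      have "((\<lambda>h. inverse h ^ Suc k / exp (inverse h)) \<longlongrightarrow> (0::real)) (at_right 0)"
        by (rule filterlim_compose[OF tendsto_power_div_exp_0 filterlim_inverse_at_top_right])
      moreover have "\<forall>\<^sub>F h in at_right (0::real). inverse h ^ Suc k / exp (inverse h) = flat (Suc k) h"
        by (auto simp: eventually_at_filter flat_def exp_minus field_simps)
      ultimately show "((\<lambda>h. flat (Suc k) h) \<longlongrightarrow> 0) (at_right 0)"
        by (rule Lim_transform_eventually)
    qed
    moreover have "\<forall>\<^sub>F h in at 0. flat (Suc k) h = (flat k (0 + h) - flat k 0) / h"
      by (auto simp: eventually_at_filter flat_def)
    ultimately have "((\<lambda>h. (flat k (0 + h) - flat k 0) / h) \<longlongrightarrow> 0) (at 0)"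
      by (rule Lim_transform_eventually)
    then show ?thesis using 3 by (simp add: DERIV_def flat_def)
  qed
qed

lemma smooth_flat: "smooth A (flat k)"
proof -
  have "ck n A (flat k)" for n
  proof (induction n arbitrary: k)
    case (Suc n)
    have "ck n A (\<lambda>t. - real k * flat (Suc k) t + flat (Suc (Suc k)) t)"
      by (intro ck_add ck_mult ck_const Suc)
    with DERIV_flat[of k] show ?case
      unfolding ck.simps by (intro exI[of _ "\<lambda>t. - real k * flat (Suc k) t + flat (Suc (Suc k)) t"] conjI ballI)
  qed simp
  then show ?thesis by (simp add: smooth_def)
qed

definition bump :: "real \<Rightarrow> real \<Rightarrow> real \<Rightarrow> real" where
  "bump l u x = flat 0 ((x - l) * (u - x))"

lemma smooth_bump: "smooth A (bump l u)"
  unfolding bump_def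
  by (rule smooth_compose[OF smooth_flat[of UNIV]])
    (auto intro!: smooth_mult smooth_add smooth_minus smooth_ident smooth_const simp: diff_conv_add_uminus simp del: add_uminus_conv_diff)

lemma bump_pos: "l < x \<Longrightarrow> x < u \<Longrightarrow> bump l u x > 0"
  by (auto simp: bump_def flat_def)

lemma bump_eq_0:
  assumes "l < u" "x \<notin> {l..u}"
  shows "bump l u x = 0"
proof -
  have "(x - l) * (u - x) \<le> 0" using assms by (cases "x < l") (auto simp: mult_le_0_iff)
  then show ?thesis by (simp add: bump_def flat_def)
qed

definition bump_tests :: "real set \<Rightarrow> (real \<Rightarrow> real) set" where
  "bump_tests A = {u. smooth UNIV u \<and> (\<exists>K. compact K \<and> K \<subseteq> A \<and> (\<forall>x. x \<notin> K \<longrightarrow> u x = 0))}"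

section \<open>Approximate eigenvectors of a pair of quadratic forms\<close>

text \<open>Besides Cauchy-Schwarz inequalities, this yields first-order conditions at approximate
  extrema: if no displacement \<open>s\<close> improves a quadratic functional by more than
  \<open>A\<close>, half the first variation is at most the square root of
  \<open>A * C\<close>.\<close>

lemma discriminant_bound:
  fixes A B C :: real
  assumes "\<And>s. 0 \<le> A + 2 * s * B + s\<^sup>2 * C" "C \<ge> 0"
  shows "B\<^sup>2 \<le> A * C"
proof (cases "C = 0")
  case True
  have "B = 0"
  proof (rule ccontr)
    assume "B \<noteq> 0"
    then show False using assms(1)[of "- (A + 1) / (2 * B)"] True by (simp add: field_simps)
  qed
  with True show ?thesis by simp
next
  case False
  with assms have C: "C > 0" by simp
  have "0 \<le> A + 2 * (- B / C) * B + (- B / C)\<^sup>2 * C" by (rule assms)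
  also have "\<dots> = A - B\<^sup>2 / C" using C by (simp add: field_simps power2_eq_square)
  finally show ?thesis using C by (simp add: field_simps)
qed

text \<open>\<open>cmb s u v\<close> stands for \<open>u + s v\<close>. With \<open>R\<close> the operator given by \<open>p(R u, v) = b(u, v)\<close> on the
  completion for \<open>p\<close>, \<open>form_pair.sharp u\<close> below is \<open>p(R u, R u)\<close>.\<close>

locale form_pair =
  fixes X :: "'v set" and cmb :: "real \<Rightarrow> 'v \<Rightarrow> 'v \<Rightarrow> 'v" and p b :: "'v \<Rightarrow> 'v \<Rightarrow> real"
  assumes closed: "u \<in> X \<Longrightarrow> v \<in> X \<Longrightarrow> cmb s u v \<in> X"
    and p_cmb: "u \<in> X \<Longrightarrow> v \<in> X \<Longrightarrow> w \<in> X \<Longrightarrow> p (cmb s u v) w = p u w + s * p v w"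
    and b_cmb: "u \<in> X \<Longrightarrow> v \<in> X \<Longrightarrow> w \<in> X \<Longrightarrow> b (cmb s u v) w = b u w + s * b v w"
    and p_sym: "u \<in> X \<Longrightarrow> v \<in> X \<Longrightarrow> p u v = p v u"
    and b_sym: "u \<in> X \<Longrightarrow> v \<in> X \<Longrightarrow> b u v = b v u"
    and b_nonneg: "u \<in> X \<Longrightarrow> 0 \<le> b u u"
    and b_le_p: "u \<in> X \<Longrightarrow> b u u \<le> p u u"
begin

lemma p_nonneg: "u \<in> X \<Longrightarrow> 0 \<le> p u u"
  using b_nonneg b_le_p order_trans by blast

lemma p_cmb_right: "u \<in> X \<Longrightarrow> v \<in> X \<Longrightarrow> w \<in> X \<Longrightarrow> p w (cmb s u v) = p w u + s * p w v"
  and b_cmb_right: "u \<in> X \<Longrightarrow> v \<in> X \<Longrightarrow> w \<in> X \<Longrightarrow> b w (cmb s u v) = b w u + s * b w v"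
  by (simp_all add: p_sym[of w] b_sym[of w] closed p_cmb b_cmb)

lemma p_square: "u \<in> X \<Longrightarrow> v \<in> X \<Longrightarrow> p (cmb s u v) (cmb s u v) = p u u + 2 * s * p u v + s\<^sup>2 * p v v"
  and b_square: "u \<in> X \<Longrightarrow> v \<in> X \<Longrightarrow> b (cmb s u v) (cmb s u v) = b u u + 2 * s * b u v + s\<^sup>2 * b v v"
  by (simp_all add: p_cmb p_cmb_right b_cmb b_cmb_right closed p_sym[of v u] b_sym[of v u] power2_eq_square algebra_simps)

lemma p_CS: "u \<in> X \<Longrightarrow> v \<in> X \<Longrightarrow> (p u v)\<^sup>2 \<le> p u u * p v v"
  and b_CS: "u \<in> X \<Longrightarrow> v \<in> X \<Longrightarrow> (b u v)\<^sup>2 \<le> b u u * b v v"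
  by (metis (mono_tags) discriminant_bound p_square p_nonneg closed)
    (metis (mono_tags) discriminant_bound b_square b_nonneg closed)

lemma abs_p_le: "u \<in> X \<Longrightarrow> v \<in> X \<Longrightarrow> \<bar>p u v\<bar> \<le> sqrt (p u u) * sqrt (p v v)"
  using real_sqrt_le_mono[OF p_CS[of u v]] by (simp add: real_sqrt_mult)

lemma abs_b_le: "u \<in> X \<Longrightarrow> v \<in> X \<Longrightarrow> \<bar>b u v\<bar> \<le> sqrt (p u u) * sqrt (p v v)"
proof -
  assume uv: "u \<in> X" "v \<in> X"
  have "(b u v)\<^sup>2 \<le> p u u * p v v"
    using b_CS[OF uv] mult_mono[OF b_le_p[OF uv(1)] b_le_p[OF uv(2)] p_nonneg[OF uv(1)] b_nonneg[OF uv(2)]] by simp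
  from real_sqrt_le_mono[OF this] show ?thesis by (simp add: real_sqrt_mult)
qed

lemma near_minimiser:
  fixes J :: "'v \<Rightarrow> real"
  assumes "X \<noteq> {}" "\<And>w. w \<in> X \<Longrightarrow> B \<le> J w" "e > 0"
  shows "\<exists>w\<in>X. \<forall>v\<in>X. J w \<le> J v + e"
proof -
  have bdd: "bdd_below (J ` X)" using assms(2) by (auto simp: bdd_below_def)
  have "Inf (J ` X) < Inf (J ` X) + e" using assms(3) by simp
  then obtain w where w: "w \<in> X" "J w < Inf (J ` X) + e"
    using cInf_lessD[of "J ` X"] assms(1) by blast
  have "J w \<le> J v + e" if "v \<in> X" for v
    using cInf_lower[OF _ bdd, of "J v"] that w by auto
  with w show ?thesis by blast
qed

text \<open>\<open>X\<close> is not assumed complete, so the minimiser \<open>R u\<close> of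
  \<open>p w w - 2 * b u w\<close> may be missing. A near-minimiser up to \<open>e^2\<close>
  satisfies the Euler equation up to \<open>e\<close>, by the discriminant of its
  perturbations.\<close>

lemma approx_resolvent:
  assumes u: "u \<in> X" and e: "e > 0"
  shows "\<exists>w\<in>X. \<forall>v\<in>X. \<bar>b u v - p w v\<bar> \<le> e * sqrt (p v v)"
proof -
  define J where "J w = p w w - 2 * b u w" for w
  have "- b u u \<le> J w" if w: "w \<in> X" for w
  proof -
    have "0 \<le> b (cmb (-1) u w) (cmb (-1) u w)" by (rule b_nonneg[OF closed[OF u w]])
    then have "2 * b u w \<le> b u u + b w w" using b_square[OF u w, of "-1"] by simp
    then show ?thesis using b_le_p[OF w] by (simp add: J_def)
  qed
  then obtain w where w: "w \<in> X" and min: "\<And>v. v \<in> X \<Longrightarrow> J w \<le> J v + e\<^sup>2"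
    using near_minimiser[of "- b u u" J "e\<^sup>2"] u e by auto
  have "\<bar>b u v - p w v\<bar> \<le> e * sqrt (p v v)" if v: "v \<in> X" for v
  proof -
    have "0 \<le> e\<^sup>2 + 2 * s * (p w v - b u v) + s\<^sup>2 * p v v" for s
      using min[OF closed[OF w v, of s]] p_square[OF w v, of s] b_cmb_right[OF w v u, of s]
      by (simp add: J_def algebra_simps)
    then have "(p w v - b u v)\<^sup>2 \<le> e\<^sup>2 * p v v" by (rule discriminant_bound) (rule p_nonneg[OF v])
    from real_sqrt_le_mono[OF this] show ?thesis using e by (simp add: real_sqrt_mult abs_minus_commute)
  qed
  with w show ?thesis by blast
qed

definition sharp :: "'v \<Rightarrow> real" where
  "sharp u = (SUP v\<in>X. 2 * b u v - p v v)"

lemma sharp_bound: "u \<in> X \<Longrightarrow> v \<in> X \<Longrightarrow> 2 * b u v - p v v \<le> b u u"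
  using b_nonneg[OF closed, of u v "-1"] b_square[of u v "-1"] b_le_p[of v] by simp

lemma sharp_ge: "u \<in> X \<Longrightarrow> v \<in> X \<Longrightarrow> 2 * b u v - p v v \<le> sharp u"
  unfolding sharp_def by (rule cSUP_upper) (auto simp: bdd_above_def intro!: sharp_bound)

lemma sharp_le: "u \<in> X \<Longrightarrow> (\<And>v. v \<in> X \<Longrightarrow> 2 * b u v - p v v \<le> B) \<Longrightarrow> sharp u \<le> B"
  unfolding sharp_def by (rule cSUP_least) auto

text \<open>As \<open>cmb s u v\<close> is the sole vector operation, the multiple
  \<open>s u\<close> is written \<open>u + (s - 1) u\<close>.\<close>

lemma scale: "u \<in> X \<Longrightarrow> cmb (s - 1) u u \<in> X"
  "u \<in> X \<Longrightarrow> p (cmb (s - 1) u u) (cmb (s - 1) u u) = s\<^sup>2 * p u u"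
  "u \<in> X \<Longrightarrow> v \<in> X \<Longrightarrow> b v (cmb (s - 1) u u) = s * b v u"
  by (simp_all add: closed p_square b_cmb_right power2_eq_square algebra_simps)

lemma sharp_nonneg: "u \<in> X \<Longrightarrow> 0 \<le> sharp u"
  using sharp_ge[OF _ scale(1)[of u 0], of u] scale(2)[of u 0] scale(3)[of u u 0] by simp

text \<open>Testing the supremum with multiples of \<open>u\<close> gives Cauchy-Schwarz for
  \<open>p (R u) u\<close>, although \<open>R u\<close> may lie outside \<open>X\<close>.\<close>

lemma sharp_p_ge:
  assumes u: "u \<in> X"
  shows "(b u u)\<^sup>2 \<le> sharp u * p u u"
proof -
  have "0 \<le> sharp u + 2 * s * (- b u u) + s\<^sup>2 * p u u" for s
    using sharp_ge[OF u scale(1)[OF u, of s]] scale(2)[OF u, of s] scale(3)[OF u u, of s] by simp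
  then have "(- b u u)\<^sup>2 \<le> sharp u * p u u" by (rule discriminant_bound) (rule p_nonneg[OF u])
  then show ?thesis by simp
qed

text \<open>The polynomial \<open>t (\<theta> - t)\<close> of \<open>R\<close> attains a positive supremum \<open>m\<close>, which is an approximate
  eigenvalue; \<open>m - t (\<theta> - t) = (t - t\<^sub>1) (t - t\<^sub>2)\<close> then gives one of \<open>R\<close> in \<open>(0, \<theta>)\<close>.\<close>

lemma approx_eigenvector:
  assumes \<theta>: "\<theta> > 0"
    and z: "z \<in> X" "y \<in> X" "\<And>v. v \<in> X \<Longrightarrow> b y v = p z v" "b z z < \<theta> * p z z"
  shows "\<exists>t. 0 < t \<and> t < \<theta> \<and> (\<forall>\<delta>>0. \<exists>v\<in>X. p v v > 0 \<and>
    (\<forall>\<xi>\<in>X. \<bar>b v \<xi> - t * p v \<xi>\<bar> \<le> \<delta> * sqrt (p v v) * sqrt (p \<xi> \<xi>)))"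
proof -
  \<comment> \<open>\<open>F u\<close> is \<open>p ((\<theta> R - R^2) u) u\<close>; its quotient by
    \<open>p u u\<close> is at most \<open>\<theta>^2 / 4\<close>, the maximum of
    \<open>t (\<theta> - t)\<close>.\<close>
  define F where "F u = \<theta> * b u u - sharp u" for u
  have Fle: "F u \<le> \<theta>\<^sup>2 / 4 * p u u" if u: "u \<in> X" for u
  proof (cases "p u u = 0")
    case True
    then have "b u u = 0" using b_nonneg[OF u] b_le_p[OF u] by simp
    then show ?thesis using True sharp_nonneg[OF u] by (simp add: F_def)
  next
    case False
    then have pp: "p u u > 0" using p_nonneg[OF u] by simp
    have "F u * p u u \<le> \<theta> * b u u * p u u - (b u u)\<^sup>2"
      using sharp_p_ge[OF u] by (simp add: F_def algebra_simps)
    also have "\<dots> \<le> \<theta>\<^sup>2 / 4 * p u u * p u u"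
      using zero_le_power2[of "b u u - \<theta> / 2 * p u u"] by (simp add: power2_eq_square algebra_simps)
    finally show ?thesis using pp by simp
  qed
  define Q where "Q = (\<lambda>u. F u / p u u) ` {u\<in>X. p u u > 0}"
  define m where "m = Sup Q"
  have Qle: "x \<le> \<theta>\<^sup>2 / 4" if "x \<in> Q" for x
  proof -
    from that obtain u where u: "x = F u / p u u" "u \<in> X" "p u u > 0" by (auto simp: Q_def)
    with Fle[OF u(2)] show ?thesis by (simp only: pos_divide_le_eq)
  qed
  then have bdd: "bdd_above Q" unfolding bdd_above_def by blast
  \<comment> \<open>The hypotheses on \<open>z\<close> and \<open>y\<close> say that
    \<open>z = R y\<close>. As \<open>b z z / p z z\<close> is below \<open>\<theta>\<close>, the
    quadratic form \<open>F\<close> is positive at \<open>y\<close>, which makes \<open>m\<close>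
    positive.\<close>
  have y: "F y > 0" "p y y > 0"
  proof -
    have pz: "p z z > 0" using b_nonneg[OF z(1)] z(4) \<theta> by (smt (verit) mult_pos_pos zero_less_mult_pos)
    have byz: "b y z = p z z" using z by simp
    have le: "(p z z)\<^sup>2 \<le> b y y * b z z" using b_CS[OF z(2,1)] byz by simp
    have by0: "b y y > 0"
    proof (rule ccontr)
      assume "\<not> ?thesis"
      then have "b y y = 0" using b_nonneg[OF z(2)] by simp
      with le pz show False by simp
    qed
    have "b y y * b z z < b y y * (\<theta> * p z z)" using by0 z(4) by simp
    with le have "p z z * p z z < (\<theta> * b y y) * p z z" by (simp add: power2_eq_square algebra_simps)
    then have "p z z < \<theta> * b y y" using pz by simp
    moreover have "sharp y \<le> p z z"
    proof (rule sharp_le[OF z(2)])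
      fix v assume v: "v \<in> X"
      have "0 \<le> p (cmb (-1) z v) (cmb (-1) z v)" by (rule p_nonneg[OF closed[OF z(1) v]])
      then show "2 * b y v - p v v \<le> p z z" using p_square[OF z(1) v, of "-1"] z(3)[OF v] by simp
    qed
    ultimately show "F y > 0" by (simp add: F_def)
    show "p y y > 0" using by0 b_le_p[OF z(2)] by simp
  qed
  have Qy: "F y / p y y \<in> Q" using y(2) z(2) by (auto simp: Q_def)
  have m0: "m > 0" using cSup_upper[OF Qy bdd] y unfolding m_def by (smt (verit) divide_pos_pos)
  have m4: "m \<le> \<theta>\<^sup>2 / 4" unfolding m_def
    by (rule cSup_least) (use Qy Qle in auto)
  have Fm: "F u \<le> m * p u u" if u: "u \<in> X" for u
  proof (cases "p u u = 0")
    case True then show ?thesis using Fle[OF u] by simp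
  next
    case False
    then have pp: "p u u > 0" using p_nonneg[OF u] by simp
    then have "F u / p u u \<in> Q" using u by (auto simp: Q_def)
    from cSup_upper[OF this bdd] pp show ?thesis by (simp add: m_def divide_le_eq)
  qed
  define D where "D = sqrt (\<theta>\<^sup>2 - 4 * m)"
  define t1 where "t1 = (\<theta> - D) / 2"
  define t2 where "t2 = (\<theta> + D) / 2"
  have D: "D \<ge> 0" "D\<^sup>2 = \<theta>\<^sup>2 - 4 * m" using m4 by (auto simp: D_def)
  have tt: "t1 + t2 = \<theta>" "t1 * t2 = m"
    using D(2) by (auto simp: t1_def t2_def field_simps power2_eq_square)
  have t2p: "t2 > 0" using \<theta> D(1) by (simp add: t2_def)
  then have t1p: "t1 > 0" using tt(2) m0 by (metis zero_less_mult_pos2)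
  have tlt: "t1 < \<theta>" "t2 < \<theta>" using tt(1) t1p t2p by auto
  define good where "good t \<delta> \<longleftrightarrow> (\<exists>v\<in>X. p v v > 0 \<and>
    (\<forall>\<xi>\<in>X. \<bar>b v \<xi> - t * p v \<xi>\<bar> \<le> \<delta> * sqrt (p v v) * sqrt (p \<xi> \<xi>)))" for t \<delta>
  have main: "good t1 \<delta> \<or> good t2 \<delta>" if \<delta>: "\<delta> > 0" for \<delta>
  proof -
    define \<eta> where "\<eta> = \<delta> / 2"
    \<comment> \<open>The entries serve in turn: \<open>e^2 \<le> e\<close>; the resolvent error in
      the case of \<open>t2\<close>; that error, multiplied by \<open>t1 < \<theta>\<close>, in the
      case of \<open>t1\<close>; and the discriminant bound for \<open>K\<close>.\<close>
    define e where "e = Min {1, \<delta> / 2, \<delta> * \<eta> / 2 / \<theta>, (\<delta> * \<eta> / 2)\<^sup>2 / (3 * (m + 2))}"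
    have \<eta>: "\<eta> > 0" using \<delta> by (simp add: \<eta>_def)
    have e0: "e > 0" using \<delta> \<eta> \<theta> m0 by (simp add: e_def)
    have Min4: "Min {w, x, y, z} \<le> w \<and> Min {w, x, y, z} \<le> x \<and> Min {w, x, y, z} \<le> y \<and> Min {w, x, y, z} \<le> z"
      for w x y z :: real by (intro conjI Min_le) auto
    have e: "e > 0" "e \<le> 1" "e \<le> \<delta> / 2" "e \<le> \<delta> * \<eta> / 2 / \<theta>" "e \<le> (\<delta> * \<eta> / 2)\<^sup>2 / (3 * (m + 2))"
      using e0 Min4 unfolding e_def by blast+
    have e4: "\<theta> * e \<le> \<delta> * \<eta> / 2" using e(4) \<theta> by (simp add: field_simps)
    have e5: "3 * e * (m + 2) \<le> (\<delta> * \<eta> / 2)\<^sup>2"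
      using e(5) m0 by (simp add: le_divide_eq algebra_simps)
    have "m - e < Sup Q" using e(1) by (simp add: m_def)
    then obtain x where "x \<in> Q" "m - e < x" using less_cSup_iff[OF _ bdd] Qy by blast
    then obtain u where u: "u \<in> X" "p u u > 0" "m - e < F u / p u u" by (auto simp: Q_def)
    define P where "P = p u u"
    have P: "P > 0" using u by (simp add: P_def)
    have Fu: "F u \<ge> (m - e) * P" using u by (simp add: P_def less_divide_eq)
    obtain w where w: "w \<in> X" and wap: "\<And>v. v \<in> X \<Longrightarrow> \<bar>b u v - p w v\<bar> \<le> e * sqrt P * sqrt (p v v)"
      using approx_resolvent[OF u(1), of "e * sqrt P"] e P by auto
    \<comment> \<open>With \<open>w\<close> close to \<open>R u\<close>, \<open>K \<xi>\<close>
      approximates \<open>p ((R - t1) (R - t2) u) \<xi>\<close>, half the first variation of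
      \<open>m p - F\<close> at the near-maximiser \<open>u\<close>.\<close>
    define K where "K \<xi> = m * p u \<xi> - \<theta> * b u \<xi> + b w \<xi>" for \<xi>
    have K: "\<bar>K \<xi>\<bar> \<le> \<delta> * \<eta> / 2 * sqrt P * sqrt (p \<xi> \<xi>)" if \<xi>: "\<xi> \<in> X" for \<xi>
    proof -
      have "0 \<le> 3 * e * P + 2 * s * K \<xi> + s\<^sup>2 * ((m + 2) * p \<xi> \<xi>)" for s
      proof -
        let ?a = "e * sqrt P" let ?c = "\<bar>s\<bar> * sqrt (p \<xi> \<xi>)"
        have us: "cmb s u \<xi> \<in> X" by (rule closed[OF u(1) \<xi>])
        have "sharp (cmb s u \<xi>) \<le> sharp u + 2 * s * b w \<xi> + (?a + ?c)\<^sup>2"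
        proof (rule sharp_le[OF us])
          fix v assume v: "v \<in> X"
          \<comment> \<open>Writing \<open>v = w + y\<close>, the terms linear in \<open>y\<close>
            beyond those of \<open>w\<close> are at most \<open>2 (?a + ?c) Y\<close>, and
            \<open>- Y^2\<close> absorbs them by completing the square.\<close>
          define y where "y = cmb (-1) v w"
          have yX: "y \<in> X" unfolding y_def by (rule closed[OF v w])
          define Y where "Y = sqrt (p y y)"
          have Y2: "Y\<^sup>2 = p v v - 2 * p w v + p w w"
            using p_nonneg[OF yX] p_square[OF v w, of "-1"] p_sym[OF v w] by (simp add: Y_def y_def)
          have y1: "b u y - p w y = b u v - b u w - p w v + p w w"
            using b_cmb_right[OF v w u(1), of "-1"] p_cmb_right[OF v w w, of "-1"] by (simp add: y_def)
          have y2: "b \<xi> y = b \<xi> v - b \<xi> w" using b_cmb_right[OF v w \<xi>, of "-1"] by (simp add: y_def)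
          have "2 * b (cmb s u \<xi>) v - p v v =
              (2 * b u w - p w w) + 2 * s * b \<xi> w + 2 * (b u y - p w y) + 2 * (s * b \<xi> y) - Y\<^sup>2"
            unfolding y1 y2 Y2 b_cmb[OF u(1) \<xi> v] by (simp add: algebra_simps)
          also have "2 * b u w - p w w \<le> sharp u" by (rule sharp_ge[OF u(1) w])
          also have "b u y - p w y \<le> ?a * Y" using wap[OF yX] by (simp add: Y_def abs_le_iff)
          also have "s * b \<xi> y \<le> ?c * Y"
            using abs_b_le[OF \<xi> yX] mult_left_mono[of "\<bar>b \<xi> y\<bar>" "sqrt (p \<xi> \<xi>) * Y" "\<bar>s\<bar>"]
            by (simp add: Y_def abs_mult[symmetric] mult.assoc)
          also have "sharp u + 2 * s * b \<xi> w + 2 * (?a * Y) + 2 * (?c * Y) - Y\<^sup>2 \<le> sharp u + 2 * s * b w \<xi> + (?a + ?c)\<^sup>2"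
            using zero_le_power2[of "?a + ?c - Y"] b_sym[OF \<xi> w] by (simp add: power2_eq_square algebra_simps)
          finally show "2 * b (cmb s u \<xi>) v - p v v \<le> sharp u + 2 * s * b w \<xi> + (?a + ?c)\<^sup>2" by simp
        qed
        moreover have "F (cmb s u \<xi>) \<le> m * p (cmb s u \<xi>) (cmb s u \<xi>)" by (rule Fm[OF us])
        moreover have "(?a + ?c)\<^sup>2 \<le> 2 * e * P + 2 * s\<^sup>2 * p \<xi> \<xi>"
        proof -
          have "(?a + ?c)\<^sup>2 \<le> 2 * ?a\<^sup>2 + 2 * ?c\<^sup>2"
            using zero_le_power2[of "?a - ?c"] by (simp add: power2_eq_square algebra_simps)
          also have "?a\<^sup>2 = e\<^sup>2 * P" using P by (simp add: power_mult_distrib)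
          also have "?c\<^sup>2 = s\<^sup>2 * p \<xi> \<xi>" using p_nonneg[OF \<xi>] by (simp add: power_mult_distrib)
          also have "e\<^sup>2 * P \<le> e * P" using e P by (intro mult_right_mono) (auto simp: power2_eq_square)
          finally show ?thesis by simp
        qed
        moreover have "0 \<le> \<theta> * (s\<^sup>2 * b \<xi> \<xi>)" using \<theta> b_nonneg[OF \<xi>] by simp
        ultimately show ?thesis
          using Fu p_square[OF u(1) \<xi>, of s] b_square[OF u(1) \<xi>, of s]
          unfolding F_def K_def P_def[symmetric] by (simp add: algebra_simps)
      qed
      then have "(K \<xi>)\<^sup>2 \<le> 3 * e * P * ((m + 2) * p \<xi> \<xi>)"
        by (rule discriminant_bound) (use m0 p_nonneg[OF \<xi>] in simp)
      also have "\<dots> = (3 * e * (m + 2)) * (P * p \<xi> \<xi>)" by simp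
      also have "\<dots> \<le> (\<delta> * \<eta> / 2)\<^sup>2 * (P * p \<xi> \<xi>)"
        using e5 P p_nonneg[OF \<xi>] by (intro mult_right_mono) auto
      finally have "(K \<xi>)\<^sup>2 \<le> (\<delta> * \<eta> / 2)\<^sup>2 * (P * p \<xi> \<xi>)" .
      from real_sqrt_le_mono[OF this] show ?thesis using \<delta> \<eta> by (simp add: real_sqrt_mult)
    qed
    \<comment> \<open>\<open>z\<close> stands for \<open>(R - t2) u\<close>. If it is small relative
      to \<open>u\<close>, then \<open>u\<close> is an approximate eigenvector for
      \<open>t2\<close>; otherwise \<open>z\<close> is one for \<open>t1\<close>, because
      \<open>(R - t1) z\<close> is small by the bound on \<open>K\<close>.\<close>
    define z where "z = cmb (- t2) w u"
    have zX: "z \<in> X" unfolding z_def by (rule closed[OF w u(1)])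
    have pz\<xi>: "p z \<xi> = p w \<xi> - t2 * p u \<xi>" and bz\<xi>: "b z \<xi> = b w \<xi> - t2 * b u \<xi>" if "\<xi> \<in> X" for \<xi>
      using p_cmb[OF w u(1) that, of "- t2"] b_cmb[OF w u(1) that, of "- t2"] by (auto simp: z_def)
    show ?thesis
    proof (cases "sqrt (p z z) \<le> \<eta> * sqrt P")
      case True
      have "\<bar>b u \<xi> - t2 * p u \<xi>\<bar> \<le> \<delta> * sqrt (p u u) * sqrt (p \<xi> \<xi>)" if \<xi>: "\<xi> \<in> X" for \<xi>
      proof -
        have "b u \<xi> - t2 * p u \<xi> = (b u \<xi> - p w \<xi>) + p z \<xi>" using pz\<xi>[OF \<xi>] by simp
        then have "\<bar>b u \<xi> - t2 * p u \<xi>\<bar> \<le> \<bar>b u \<xi> - p w \<xi>\<bar> + \<bar>p z \<xi>\<bar>" by linarith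
        also have "\<dots> \<le> e * sqrt P * sqrt (p \<xi> \<xi>) + sqrt (p z z) * sqrt (p \<xi> \<xi>)"
          by (intro add_mono wap abs_p_le zX \<xi>)
        also have "\<dots> \<le> \<delta> / 2 * sqrt P * sqrt (p \<xi> \<xi>) + (\<eta> * sqrt P) * sqrt (p \<xi> \<xi>)"
          using True e P p_nonneg[OF \<xi>] by (intro add_mono mult_right_mono) auto
        also have "\<dots> = \<delta> * sqrt (p u u) * sqrt (p \<xi> \<xi>)" by (simp add: \<eta>_def P_def algebra_simps)
        finally show ?thesis .
      qed
      then have "good t2 \<delta>" using u by (auto simp: good_def)
      then show ?thesis ..
    next
      case False
      then have big: "\<eta> * sqrt P \<le> sqrt (p z z)" by simp
      have "sqrt (p z z) > 0" using False \<eta> P by (smt (verit) mult_pos_pos real_sqrt_gt_zero)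
      then have pz: "p z z > 0" by simp
      have "\<bar>b z \<xi> - t1 * p z \<xi>\<bar> \<le> \<delta> * sqrt (p z z) * sqrt (p \<xi> \<xi>)" if \<xi>: "\<xi> \<in> X" for \<xi>
      proof -
        have "b z \<xi> - t1 * p z \<xi> = b w \<xi> - t2 * b u \<xi> - t1 * p w \<xi> + (t1 * t2) * p u \<xi>"
          unfolding pz\<xi>[OF \<xi>] bz\<xi>[OF \<xi>] by (simp add: algebra_simps)
        also have "\<dots> = K \<xi> + t1 * (b u \<xi> - p w \<xi>)"
          unfolding K_def tt(2) tt(1)[symmetric] by (simp add: algebra_simps)
        finally have "\<bar>b z \<xi> - t1 * p z \<xi>\<bar> \<le> \<bar>K \<xi>\<bar> + t1 * \<bar>b u \<xi> - p w \<xi>\<bar>"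
          using abs_triangle_ineq[of "K \<xi>" "t1 * (b u \<xi> - p w \<xi>)"] t1p by (simp add: abs_mult)
        also have "\<dots> \<le> \<delta> * \<eta> / 2 * sqrt P * sqrt (p \<xi> \<xi>) + \<theta> * (e * sqrt P * sqrt (p \<xi> \<xi>))"
          using K[OF \<xi>] wap[OF \<xi>] t1p tlt by (intro add_mono mult_mono) auto
        also have "\<dots> = (\<delta> * \<eta> / 2 + \<theta> * e) * (sqrt P * sqrt (p \<xi> \<xi>))" by (simp add: algebra_simps)
        also have "\<dots> \<le> (\<delta> * \<eta>) * (sqrt P * sqrt (p \<xi> \<xi>))"
          using e4 P p_nonneg[OF \<xi>] by (intro mult_right_mono) auto
        also have "\<dots> = \<delta> * (\<eta> * sqrt P) * sqrt (p \<xi> \<xi>)" by simp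
        also have "\<dots> \<le> \<delta> * sqrt (p z z) * sqrt (p \<xi> \<xi>)"
          using big \<delta> p_nonneg[OF \<xi>] by (intro mult_right_mono mult_left_mono) auto
        finally show ?thesis .
      qed
      then have "good t1 \<delta>" using zX pz by (auto simp: good_def)
      then show ?thesis ..
    qed
  qed
  have mono: "good t \<delta>'" if gd: "good t \<delta>" and "\<delta> \<le> \<delta>'" for t \<delta> \<delta>'
  proof -
    obtain v where v: "v \<in> X" "p v v > 0"
      "\<And>\<xi>. \<xi> \<in> X \<Longrightarrow> \<bar>b v \<xi> - t * p v \<xi>\<bar> \<le> \<delta> * sqrt (p v v) * sqrt (p \<xi> \<xi>)"
      using gd unfolding good_def by blast
    have "\<bar>b v \<xi> - t * p v \<xi>\<bar> \<le> \<delta>' * sqrt (p v v) * sqrt (p \<xi> \<xi>)" if \<xi>: "\<xi> \<in> X" for \<xi>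
    proof -
      have "\<delta> * sqrt (p v v) * sqrt (p \<xi> \<xi>) \<le> \<delta>' * sqrt (p v v) * sqrt (p \<xi> \<xi>)"
        using \<open>\<delta> \<le> \<delta>'\<close> v(2) p_nonneg[OF \<xi>] by (intro mult_right_mono) auto
      with v(3)[OF \<xi>] show ?thesis by linarith
    qed
    with v show ?thesis by (auto simp: good_def)
  qed
  \<comment> \<open>The alternative may depend on \<open>\<delta>\<close>, but if each root failed
    at some accuracy, both would fail at the smaller one.\<close>
  have "(\<forall>\<delta>>0. good t1 \<delta>) \<or> (\<forall>\<delta>>0. good t2 \<delta>)"
  proof (rule ccontr)
    assume "\<not> ?thesis"
    then obtain d1 d2 where d: "d1 > 0" "\<not> good t1 d1" "d2 > 0" "\<not> good t2 d2" by blast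
    then show False using main[of "min d1 d2"] mono[of t1 "min d1 d2" d1] mono[of t2 "min d1 d2" d2] by auto
  qed
  then show ?thesis
    using t1p t2p tlt unfolding good_def by blast
qed

end

section \<open>Integration over the domain\<close>

lemma sigma_finite_restrict_lborel:
  "A \<in> sets borel \<Longrightarrow> sigma_finite_measure (restrict_space lborel (A :: 'a::euclidean_space set))"
  by (intro sigma_finite_measure_restrict_space lborel.sigma_finite_measure_axioms) simp

text \<open>Makes Fubini available on \<Omega>, whose measure is a restriction of the planar
  one.\<close>

lemma pair_restrict_lborel:
  fixes A B :: "real set"
  assumes [measurable]: "A \<in> sets borel" "B \<in> sets borel"
  shows "restrict_space lborel A \<Otimes>\<^sub>M restrict_space lborel B = restrict_space lborel (A \<times> B)"
proof (rule pair_measure_eqI)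
  let ?X = "restrict_space lborel A" and ?Y = "restrict_space lborel B"
  show "sigma_finite_measure ?X" "sigma_finite_measure ?Y"
    by (auto intro: sigma_finite_restrict_lborel)
  show "sets (?X \<Otimes>\<^sub>M ?Y) = sets (restrict_space lborel (A \<times> B))"
  proof (intro equalityI subsetI)
    fix E assume "E \<in> sets (?X \<Otimes>\<^sub>M ?Y)"
    then have "E \<in> sigma_sets (space ?X \<times> space ?Y) {a \<times> b |a b. a \<in> sets ?X \<and> b \<in> sets ?Y}"
      by (simp add: sets_pair_measure)
    moreover have "{a \<times> b |a b. a \<in> sets ?X \<and> b \<in> sets ?Y} \<subseteq> sets (restrict_space lborel (A \<times> B))"
    proof clarsimp
      fix a b assume "a \<in> sets ?X" "b \<in> sets ?Y"
      then obtain a' b' where "a = A \<inter> a'" "a' \<in> sets borel" "b = B \<inter> b'" "b' \<in> sets borel"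
        by (auto simp: sets_restrict_space)
      then have "a \<times> b = (A \<times> B) \<inter> (a' \<times> b')" "a' \<times> b' \<in> sets borel"
        by (auto intro: borel_Times)
      then show "a \<times> b \<in> sets (restrict_space lborel (A \<times> B))"
        by (auto simp: sets_restrict_space)
    qed
    moreover have "space ?X \<times> space ?Y = space (restrict_space lborel (A \<times> B))"
      by (simp add: space_restrict_space)
    ultimately show "E \<in> sets (restrict_space lborel (A \<times> B))"
      by (metis (no_types, lifting) sets.sigma_sets_subset subsetD)
  next
    fix E assume "E \<in> sets (restrict_space lborel (A \<times> B))"
    then obtain E' where E': "E = (A \<times> B) \<inter> E'" "E' \<in> sets borel" by (auto simp: sets_restrict_space)
    have "(\<lambda>p. (fst p, snd p)) \<in> measurable (?X \<Otimes>\<^sub>M ?Y) (borel \<Otimes>\<^sub>M borel)"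
    proof (rule measurable_Pair)
      have "(\<lambda>x. x) \<in> measurable ?X borel" "(\<lambda>x. x) \<in> measurable ?Y borel"
        by (auto intro: measurable_restrict_space1)
      then show "fst \<in> measurable (?X \<Otimes>\<^sub>M ?Y) borel" "snd \<in> measurable (?X \<Otimes>\<^sub>M ?Y) borel"
        using measurable_compose[OF measurable_fst] measurable_compose[OF measurable_snd] by fast+
    qed
    then have "(\<lambda>p. p) \<in> measurable (?X \<Otimes>\<^sub>M ?Y) borel" by (simp add: borel_prod)
    from measurable_sets[OF this E'(2)] have "E' \<inter> space (?X \<Otimes>\<^sub>M ?Y) \<in> sets (?X \<Otimes>\<^sub>M ?Y)" by simp
    then show "E \<in> sets (?X \<Otimes>\<^sub>M ?Y)" using E'(1)
      by (simp add: space_pair_measure space_restrict_space Int_commute)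
  qed
  fix a b assume "a \<in> sets ?X" "b \<in> sets ?Y"
  then have ab: "a \<in> sets borel" "b \<in> sets borel" "a \<subseteq> A" "b \<subseteq> B"
    by (auto simp: sets_restrict_space)
  then show "emeasure ?X a * emeasure ?Y b = emeasure (restrict_space lborel (A \<times> B)) (a \<times> b)"
    by (subst (1 2 3) emeasure_restrict_space)
      (auto simp: lborel_prod[symmetric] lborel.emeasure_pair_measure_Times intro!: borel_Times)
qed

text \<open>The almost-everywhere comparison of \<open>I\<close> with \<open>[a, b]\<close> covers
  both uses: an open \<open>I\<close> larger than the support of \<open>u'\<close>, and the
  half-open period of the circle.\<close>

lemma integral_derivative_zero:
  fixes u :: "real \<Rightarrow> real"
  assumes "a \<le> b" and d: "\<And>x. x \<in> {a..b} \<Longrightarrow> (u has_real_derivative u' x) (at x)"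
    and c: "continuous_on {a..b} u'" and "u a = u b"
    and I: "I \<in> sets borel" and m: "u' \<in> borel_measurable (restrict_space lborel I)"
    and ae: "AE x in lborel. indicator I x *\<^sub>R u' x = indicator {a..b} x *\<^sub>R u' x"
  shows "(LINT x|restrict_space lborel I. u' x) = 0"
proof -
  have "(LINT x|restrict_space lborel I. u' x) = (LINT x|lborel. indicator I x *\<^sub>R u' x)"
    using I by (intro integral_restrict_space) simp
  also have "\<dots> = (LINT x|lborel. indicator {a..b} x *\<^sub>R u' x)"
  proof (rule integral_cong_AE[OF _ _ ae])
    show "(\<lambda>x. indicator I x *\<^sub>R u' x) \<in> borel_measurable lborel"
      using m I by (subst borel_measurable_restrict_space_iff[symmetric]) auto
    show "(\<lambda>x. indicator {a..b} x *\<^sub>R u' x) \<in> borel_measurable lborel"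
      using borel_measurable_continuous_on_indicator[OF _ c] by simp
  qed
  also have "\<dots> = u b - u a"
    using assms(1) d c by (intro integral_FTC_Icc)
      (auto simp: has_real_derivative_iff_has_vector_derivative[symmetric] intro: has_field_derivative_at_within)
  finally show ?thesis using assms(4) by simp
qed

text \<open>All partial derivatives are carried along as one family. One index for each variable
  builds in the symmetry of mixed derivatives, and total differentiability at each point gives
  continuity of every member.\<close>

definition jet :: "(nat \<Rightarrow> nat \<Rightarrow> real \<times> real \<Rightarrow> complex) \<Rightarrow> bool" where
  "jet D \<longleftrightarrow> (\<forall>i j p. (D i j has_derivative (\<lambda>(h, k). h *\<^sub>R D (Suc i) j p + k *\<^sub>R D i (Suc j) p)) (at p))"

lemma jet_continuous_on: "jet D \<Longrightarrow> continuous_on A (D i j)"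
  unfolding jet_def by (meson continuous_at_imp_continuous_on has_derivative_continuous)

lemma jet_x:
  assumes "jet D"
  shows "((\<lambda>s. D i j (s, y)) has_vector_derivative D (Suc i) j (x, y)) (at x)"
proof -
  have "((\<lambda>s. (s, y)) has_derivative (\<lambda>h. (h, 0))) (at x)" by (auto intro!: derivative_eq_intros)
  moreover have "(D i j has_derivative (\<lambda>(h, k). h *\<^sub>R D (Suc i) j (x, y) + k *\<^sub>R D i (Suc j) (x, y))) (at (x, y))"
    using assms unfolding jet_def by blast
  ultimately have "((\<lambda>s. D i j (s, y)) has_derivative
      (\<lambda>h. (\<lambda>(h, k). h *\<^sub>R D (Suc i) j (x, y) + k *\<^sub>R D i (Suc j) (x, y)) (h, 0))) (at x)"
    by (rule has_derivative_compose)
  then show ?thesis by (simp add: has_vector_derivative_def)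
qed

lemma jet_y:
  assumes "jet D"
  shows "((\<lambda>s. D i j (x, s)) has_vector_derivative D i (Suc j) (x, y)) (at y)"
proof -
  have "((\<lambda>s. (x, s)) has_derivative (\<lambda>h. (0, h))) (at y)" by (auto intro!: derivative_eq_intros)
  moreover have "(D i j has_derivative (\<lambda>(h, k). h *\<^sub>R D (Suc i) j (x, y) + k *\<^sub>R D i (Suc j) (x, y))) (at (x, y))"
    using assms unfolding jet_def by blast
  ultimately have "((\<lambda>s. D i j (x, s)) has_derivative
      (\<lambda>h. (\<lambda>(h, k). h *\<^sub>R D (Suc i) j (x, y) + k *\<^sub>R D i (Suc j) (x, y)) (0, h))) (at y)"
    by (rule has_derivative_compose)
  then show ?thesis by (simp add: has_vector_derivative_def)
qed

text \<open>Passes the support of a test function on to all its derivatives: one differentiation at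
  a time, first in \<open>x\<close>, then in \<open>y\<close>.\<close>

lemma jet_zero_open:
  assumes D: "jet D" and U: "open U" and z: "\<And>p. p \<in> U \<Longrightarrow> D 0 0 p = 0"
  shows "p \<in> U \<Longrightarrow> D i j p = 0"
proof -
  have step: "D (Suc i) j p = 0 \<and> D i (Suc j) p = 0" if "\<And>p. p \<in> U \<Longrightarrow> D i j p = 0" "p \<in> U" for i j p
  proof -
    have d1: "(D i j has_derivative (\<lambda>(h, k). h *\<^sub>R D (Suc i) j p + k *\<^sub>R D i (Suc j) p)) (at p)"
      using D unfolding jet_def by blast
    have "(D i j has_derivative (\<lambda>_. 0)) (at p)"
      by (rule has_derivative_transform_within_open[OF _ U that(2), of "\<lambda>_. 0"]) (use that in auto)
    from has_derivative_unique[OF d1 this] have *: "(\<lambda>(h, k). h *\<^sub>R D (Suc i) j p + k *\<^sub>R D i (Suc j) p) = (\<lambda>_. 0)" .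
    from fun_cong[OF *, of "(1, 0)"] fun_cong[OF *, of "(0, 1)"] show ?thesis by simp
  qed
  have "\<forall>p\<in>U. D i 0 p = 0" for i by (induction i) (use z step in auto)
  then have "\<forall>p\<in>U. D i j p = 0" for i j by (induction j) (use step in auto)
  then show "p \<in> U \<Longrightarrow> D i j p = 0" by blast
qed

text \<open>The shifted family minus the family is again a jet, and it vanishes at order (0, 0),
  hence at every order.\<close>

lemma jet_periodic:
  assumes D: "jet D" and z: "\<And>x y. D 0 0 (x, y + c) = D 0 0 (x, y)"
  shows "D i j (x, y + c) = D i j (x, y)"
proof -
  define E where "E i j p = D i j (fst p, snd p + c) - D i j p" for i j p
  have "jet E" unfolding jet_def
  proof (intro allI)
    fix i j and p :: "real \<times> real"
    let ?p = "(fst p, snd p + c)"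
    have "((\<lambda>p. (fst p, snd p + c)) has_derivative (\<lambda>h. h)) (at p)"
      by (auto intro!: derivative_eq_intros)
    moreover have "(D i j has_derivative (\<lambda>(h, k). h *\<^sub>R D (Suc i) j ?p + k *\<^sub>R D i (Suc j) ?p)) (at ?p)"
      using D unfolding jet_def by blast
    ultimately have "((\<lambda>p. D i j (fst p, snd p + c)) has_derivative (\<lambda>(h, k). h *\<^sub>R D (Suc i) j ?p + k *\<^sub>R D i (Suc j) ?p)) (at p)"
      by (rule has_derivative_compose)
    moreover have "(D i j has_derivative (\<lambda>(h, k). h *\<^sub>R D (Suc i) j p + k *\<^sub>R D i (Suc j) p)) (at p)"
      using D unfolding jet_def by blast
    ultimately show "(E i j has_derivative (\<lambda>(h, k). h *\<^sub>R E (Suc i) j p + k *\<^sub>R E i (Suc j) p)) (at p)"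
      unfolding E_def by (rule has_derivative_eq_rhs[OF has_derivative_diff]) (auto simp: fun_eq_iff algebra_simps)
  qed
  from jet_zero_open[OF this open_UNIV, of "(x, y)" i j] z show ?thesis by (simp add: E_def)
qed

text \<open>The open set on which the coefficient \<open>r\<close> is differentiated. On the circle
  it is the whole line, as functions there are periodic on it, while integration uses the half-open
  period \<open>Omega_y Y\<close>.\<close>

definition Yo :: "y_domain \<Rightarrow> real set" where
  "Yo Y = (if Y = Interval then {0<..<pi} else UNIV)"

text \<open>On the circle periodicity replaces a compact support in \<open>y\<close>, and
  \<open>Ky\<close> becomes one closed period. In all three geometries the jet then vanishes on
  \<Omega> outside the compact set \<open>Kx \<times> Ky\<close>, which is what integrability
  uses.\<close>

definition jet_on :: "real \<Rightarrow> y_domain \<Rightarrow> (real \<times> real \<Rightarrow> complex) \<Rightarrow> (nat \<Rightarrow> nat \<Rightarrow> real \<times> real \<Rightarrow> complex) \<Rightarrow>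
    real set \<Rightarrow> real set \<Rightarrow> bool" where
  "jet_on L Y \<phi> D Kx Ky \<longleftrightarrow> D 0 0 = \<phi> \<and> jet D \<and> compact Kx \<and> Kx \<subseteq> {-L<..<L} \<and> compact Ky \<and> Ky \<subseteq> Yo Y \<and>
     (\<forall>i j x y. x \<notin> Kx \<longrightarrow> D i j (x, y) = 0) \<and>
     (Y \<noteq> Circle \<longrightarrow> (\<forall>i j x y. y \<notin> Ky \<longrightarrow> D i j (x, y) = 0)) \<and>
     (Y = Circle \<longrightarrow> Ky = {0..2 * pi} \<and> (\<forall>i j x y. D i j (x, y + 2 * pi) = D i j (x, y)))"

section \<open>The standing setting: Fubini, bounds on the coefficients, supports\<close>

locale grushin_setting =
  fixes L :: real and Y :: y_domain and q r V :: "real \<Rightarrow> real"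
  assumes L_pos: "L > 0" and q_smooth: "smooth_fun_on {-L..L} q" and r_adm: "admissible_r Y r"
    and V_bdd: "essentially_bounded_on {-L<..<L} V"
begin

abbreviation "Mx \<equiv> restrict_space lborel {-L<..<L}"
abbreviation "My \<equiv> restrict_space lborel (Omega_y Y)"
abbreviation "M \<equiv> Omega_measure L Y"

lemma Omega_y_borel [measurable]: "Omega_y Y \<in> sets borel" by (cases Y) auto
lemma open_Yo: "open (Yo Y)" by (simp add: Yo_def)
lemma Omega_y_subset: "Omega_y Y \<subseteq> (Yo Y)" by (cases Y) (auto simp: Yo_def)
lemma Omega_borel: "Omega L Y \<in> sets borel" unfolding Omega_def by (intro borel_Times) auto
lemma space_M: "space M = Omega L Y" by (simp add: space_restrict_space)
lemma space_Mx: "space Mx = {-L<..<L}" and space_My: "space My = Omega_y Y" by (auto simp: space_restrict_space)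

lemma M_eq: "Mx \<Otimes>\<^sub>M My = M"
  unfolding Omega_def by (rule pair_restrict_lborel) auto

lemma psf: "pair_sigma_finite Mx My"
  unfolding pair_sigma_finite_def by (auto intro: sigma_finite_restrict_lborel)

lemma fubini:
  fixes h :: "real \<times> real \<Rightarrow> real"
  assumes "integrable M h"
  shows "(LINT p|M. h p) = (LINT x|Mx. LINT y|My. h (x, y))" and "(LINT p|M. h p) = (LINT y|My. LINT x|Mx. h (x, y))"
    and "integrable Mx (\<lambda>x. LINT y|My. h (x, y))" and "integrable My (\<lambda>y. LINT x|Mx. h (x, y))"
proof -
  interpret pair_sigma_finite Mx My by (rule psf)
  have i: "integrable (Mx \<Otimes>\<^sub>M My) h" and i': "integrable (Mx \<Otimes>\<^sub>M My) (\<lambda>(x, y). h (x, y))" using assms by (simp_all add: M_eq)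
  show "(LINT p|M. h p) = (LINT x|Mx. LINT y|My. h (x, y))" using integral_fst'[OF i] by (simp add: M_eq)
  show "(LINT p|M. h p) = (LINT y|My. LINT x|Mx. h (x, y))" using integral_snd[OF i'] by (simp add: M_eq)
  show "integrable Mx (\<lambda>x. LINT y|My. h (x, y))" by (rule integrable_fst'[OF i])
  show "integrable My (\<lambda>y. LINT x|Mx. h (x, y))" by (rule integrable_snd[OF i'])
qed

lemma measurable_x: "w \<in> borel_measurable Mx \<Longrightarrow> (\<lambda>p. w (fst p)) \<in> borel_measurable M"
  using measurable_compose[OF measurable_fst, of w Mx borel My] by (simp only: M_eq)

lemma measurable_y: "w \<in> borel_measurable My \<Longrightarrow> (\<lambda>p. w (snd p)) \<in> borel_measurable M"
  using measurable_compose[OF measurable_snd, of w My borel Mx] by (simp only: M_eq)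

lemma borel_restrict_continuous:
  fixes f :: "'a::euclidean_space \<Rightarrow> 'b::topological_space"
  shows "continuous_on A f \<Longrightarrow> f \<in> borel_measurable (restrict_space lborel A)"
  using borel_measurable_continuous_on_restrict[of A f]
  by (simp add: measurable_cong_sets[OF sets_restrict_space_cong[OF sets_lborel]])

lemma AE_x:
  assumes "AE x in Mx. P x"
  shows "AE p in M. P (fst p)"
proof -
  interpret pair_sigma_finite Mx My by (rule psf)
  obtain N where N: "N \<in> null_sets Mx" "{x\<in>space Mx. \<not> P x} \<subseteq> N"
    using assms by (auto simp: eventually_ae_filter)
  have "emeasure (Mx \<Otimes>\<^sub>M My) (N \<times> space My) = 0"
    using N(1) sets.top[of My] by (subst M2.emeasure_pair_measure_Times) (auto simp: space_My)
  then have "N \<times> space My \<in> null_sets M" unfolding M_eq[symmetric]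
    using N(1) sets.top[of My] by (auto intro!: null_setsI simp: space_My)
  then show ?thesis
    by (rule AE_I') (use N(2) in \<open>auto simp: space_Mx space_My space_restrict_space Omega_def\<close>)
qed

lemma q_cont: "continuous_on {-L..L} q"
proof -
  obtain D where "\<And>x. x \<in> {-L..L} \<Longrightarrow> D 0 x = q x"
    "\<And>x. x \<in> {-L..L} \<Longrightarrow> (D 0 has_real_derivative D (Suc 0) x) (at x within {-L..L})"
    using q_smooth unfolding smooth_fun_on_def by blast
  then show ?thesis
    using continuous_on_cong[of "{-L..L}" "{-L..L}" "D 0" q] DERIV_continuous_on[of "{-L..L}" "D 0" "D (Suc 0)"] by auto
qed

lemma q_bounded: "\<exists>C\<ge>0. \<forall>x\<in>{-L..L}. \<bar>q x\<bar> \<le> C"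
proof -
  have "bounded (q ` {-L..L})" by (intro compact_imp_bounded compact_continuous_image q_cont) auto
  then obtain C where "\<forall>x\<in>{-L..L}. \<bar>q x\<bar> \<le> C" by (auto simp: bounded_iff)
  then show ?thesis by (intro exI[of _ "max C 0"]) auto
qed

definition Cq :: real where "Cq = (SOME C. C \<ge> 0 \<and> (\<forall>x\<in>{-L..L}. \<bar>q x\<bar> \<le> C))"

lemma Cq: "Cq \<ge> 0" "x \<in> {-L..L} \<Longrightarrow> \<bar>q x\<bar> \<le> Cq" "x \<in> {-L<..<L} \<Longrightarrow> (q x)\<^sup>2 \<le> Cq\<^sup>2"
proof -
  have *: "Cq \<ge> 0 \<and> (\<forall>x\<in>{-L..L}. \<bar>q x\<bar> \<le> Cq)" unfolding Cq_def by (rule someI_ex) (use q_bounded in blast)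
  then show "Cq \<ge> 0" "x \<in> {-L..L} \<Longrightarrow> \<bar>q x\<bar> \<le> Cq" by auto
  then show "x \<in> {-L<..<L} \<Longrightarrow> (q x)\<^sup>2 \<le> Cq\<^sup>2" using * abs_le_square_iff[of "q x" Cq] by auto
qed

lemma q_measurable: "q \<in> borel_measurable Mx"
  by (rule borel_restrict_continuous[OF continuous_on_subset[OF q_cont]]) auto

definition CV :: real where "CV = (SOME C. C \<ge> 0 \<and> (AE x in Mx. \<bar>V x\<bar> \<le> C))"
text \<open>A version of \<open>V\<close> bounded at every point and equal to it almost everywhere,
  so that estimates can be made pointwise under the integral.\<close>

definition V0 :: "real \<Rightarrow> real" where "V0 x = (if \<bar>V x\<bar> \<le> CV then V x else 0)"

lemma CV: "CV \<ge> 0" "AE x in Mx. \<bar>V x\<bar> \<le> CV"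
proof -
  obtain C where "AE x in Mx. \<bar>V x\<bar> \<le> C" using V_bdd by (auto simp: essentially_bounded_on_def)
  then have "AE x in Mx. \<bar>V x\<bar> \<le> max C 0" by eventually_elim auto
  then have "CV \<ge> 0 \<and> (AE x in Mx. \<bar>V x\<bar> \<le> CV)" unfolding CV_def by (intro someI[of "\<lambda>C. C \<ge> 0 \<and> (AE x in Mx. \<bar>V x\<bar> \<le> C)" "max C 0"] conjI) auto
  then show "CV \<ge> 0" "AE x in Mx. \<bar>V x\<bar> \<le> CV" by auto
qed

lemma V_measurable: "V \<in> borel_measurable Mx" using V_bdd by (simp add: essentially_bounded_on_def)

lemma V0: "V0 \<in> borel_measurable Mx" "\<bar>V0 x\<bar> \<le> CV" "AE p in M. V0 (fst p) = V (fst p)"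
proof -
  show "V0 \<in> borel_measurable Mx" unfolding V0_def using V_measurable by measurable
  show "\<bar>V0 x\<bar> \<le> CV" using CV(1) by (simp add: V0_def)
  show "AE p in M. V0 (fst p) = V (fst p)" by (rule AE_x) (use CV(2) in \<open>eventually_elim, simp add: V0_def\<close>)
qed

lemma r_smooth: "smooth (Yo Y) r"
proof (cases Y)
  case Interval then show ?thesis
    using r_adm by (auto simp: Yo_def intro: smooth_fun_on_imp_smooth)
next
  case Circle then show ?thesis
    using r_adm by (auto simp: Yo_def intro: smooth_fun_on_imp_smooth)
next
  case Line
  then show ?thesis using r_adm smooth_const[of UNIV 1] by (simp add: Yo_def ext[of r "\<lambda>_. 1"])
qed

lemma r_pos: "y \<in> (Yo Y) \<Longrightarrow> r y > 0" using r_adm by (cases Y) (auto simp: Yo_def)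
lemma r_periodic: "Y = Circle \<Longrightarrow> r (y + 2 * pi) = r y" using r_adm by auto

abbreviation "jet_of \<equiv> jet_on L Y"

lemmas jet_of_def = jet_on_def

lemma test_jet:
  assumes "\<phi> \<in> test_functions L Y"
  shows "\<exists>D Kx Ky. jet_of \<phi> D Kx Ky"
proof (cases "Y = Circle")
  case True
  then obtain K where K: "smooth_plane \<phi>" "\<And>x y. \<phi> (x, y + 2 * pi) = \<phi> (x, y)" "compact K" "K \<subseteq> {-L<..<L}"
    "\<And>x y. x \<notin> K \<Longrightarrow> \<phi> (x, y) = 0" using assms by auto
  obtain D where D: "D 0 0 = \<phi>" "jet D" using K(1) by (auto simp: smooth_plane_def jet_def)
  have "open ((- K) \<times> (UNIV :: real set))" using K(3) by (intro open_Times) (auto simp: compact_imp_closed)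
  then have "D i j (x, y) = 0" if "x \<notin> K" for i j x y
    using jet_zero_open[OF D(2), of "(- K) \<times> UNIV" "(x, y)"] that K(5) D(1) by auto
  then have "jet_of \<phi> D K {0..2 * pi}"
    using True D K jet_periodic[OF D(2), of "2 * pi"] by (auto simp: jet_of_def Yo_def)
  then show ?thesis by blast
next
  case False
  then obtain K where K: "smooth_plane \<phi>" "compact K" "K \<subseteq> Omega L Y" "\<And>p. p \<notin> K \<Longrightarrow> \<phi> p = 0"
    using assms by (cases Y) auto
  obtain D where D: "D 0 0 = \<phi>" "jet D" using K(1) by (auto simp: smooth_plane_def jet_def)
  have z: "D i j p = 0" if "p \<notin> K" for i j p
    using jet_zero_open[OF D(2), of "- K" p] that K(2,4) D(1) by (auto simp: compact_imp_closed open_Compl)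
  have "compact (fst ` K)" "compact (snd ` K)"
    by (auto intro!: compact_continuous_image K continuous_intros)
  moreover have "fst ` K \<subseteq> {-L<..<L}" "snd ` K \<subseteq> (Yo Y)" using K(3) Omega_y_subset by (force simp: Omega_def)+
  ultimately have "jet_of \<phi> D (fst ` K) (snd ` K)"
    using False D z unfolding jet_of_def by (auto simp: image_iff; force)
  then show ?thesis by blast
qed

lemma jet_ofD:
  assumes "jet_of \<phi> D Kx Ky"
  shows "D 0 0 = \<phi>" "jet D" "compact Kx" "Kx \<subseteq> {-L<..<L}" "compact Ky" "Ky \<subseteq> Yo Y"
    and jet_of_zero: "p \<in> Omega L Y \<Longrightarrow> p \<notin> Kx \<times> Ky \<Longrightarrow> D i j p = 0"
proof -
  show "D 0 0 = \<phi>" "jet D" "compact Kx" "Kx \<subseteq> {-L<..<L}" "compact Ky" "Ky \<subseteq> Yo Y"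
    using assms unfolding jet_of_def by blast+
  assume p: "p \<in> Omega L Y" "p \<notin> Kx \<times> Ky"
  obtain x y where xy: "p = (x, y)" by (cases p)
  show "D i j p = 0"
  proof (cases "x \<in> Kx")
    case False then show ?thesis using assms unfolding jet_of_def xy by blast
  next
    case True
    then have y: "y \<notin> Ky" using p xy by simp
    have "Y \<noteq> Circle"
    proof
      assume Y: "Y = Circle"
      then have "Ky = {0..2 * pi}" using assms unfolding jet_of_def by blast
      with y p(1) Y show False by (simp add: xy Omega_def)
    qed
    with y show ?thesis using assms unfolding jet_of_def xy by blast
  qed
qed

lemma integrable_compact_support:
  fixes h :: "real \<times> real \<Rightarrow> real"
  assumes h: "h \<in> borel_measurable M" and K: "compact Kx" "compact Ky"
    and b: "\<And>p. p \<in> Omega L Y \<Longrightarrow> p \<in> Kx \<times> Ky \<Longrightarrow> \<bar>h p\<bar> \<le> C"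
    and z: "\<And>p. p \<in> Omega L Y \<Longrightarrow> p \<notin> Kx \<times> Ky \<Longrightarrow> h p = 0"
  shows "integrable M h"
proof (rule integrableI_bounded_set[where A="Omega L Y \<inter> Kx \<times> Ky" and B=C])
  have cK: "compact (Kx \<times> Ky)" using K by (rule compact_Times)
  then have "Kx \<times> Ky \<in> sets borel" by (rule borel_compact)
  then show "Omega L Y \<inter> Kx \<times> Ky \<in> sets M" by (auto simp: sets_restrict_space)
  have "emeasure M (Omega L Y \<inter> Kx \<times> Ky) = emeasure lborel (Omega L Y \<inter> Kx \<times> Ky)"
    using Omega_borel by (intro emeasure_restrict_space) auto
  also have "\<dots> \<le> emeasure lborel (Kx \<times> Ky)"
    using \<open>Kx \<times> Ky \<in> sets borel\<close> by (intro emeasure_mono) auto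
  also have "\<dots> < \<infinity>" by (rule emeasure_compact_finite[OF cK])
  finally show "emeasure M (Omega L Y \<inter> Kx \<times> Ky) < \<infinity>" .
  show "AE p in M. p \<in> Omega L Y \<inter> Kx \<times> Ky \<longrightarrow> norm (h p) \<le> C"
    using b by (intro AE_I2) (auto simp: space_M)
  show "AE p in M. p \<notin> Omega L Y \<inter> Kx \<times> Ky \<longrightarrow> h p = 0"
    using z by (intro AE_I2) (simp add: space_M)
qed (rule h)

lemma measurable_jet: "jet D \<Longrightarrow> D i j \<in> borel_measurable M"
  by (rule borel_restrict_continuous[OF jet_continuous_on])

lemma measurable_weight_y: "continuous_on (Yo Y) w \<Longrightarrow> w \<in> borel_measurable My"
  by (rule borel_restrict_continuous[OF continuous_on_subset[OF _ Omega_y_subset]])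

text \<open>The weight in \<open>x\<close> only has to be measurable and bounded, as
  \<open>V0\<close> is; the one in \<open>y\<close> may be unbounded near the ends of the interval
  and is controlled on the compact support.\<close>

lemma weighted_integrable:
  assumes D: "jet_of \<phi> D Kx Ky" and E: "jet_of \<psi> E Kx' Ky'"
    and w1: "w1 \<in> borel_measurable Mx" "\<And>x. x \<in> {-L<..<L} \<Longrightarrow> \<bar>w1 x\<bar> \<le> C" and w2: "continuous_on (Yo Y) w2"
  shows "integrable M (\<lambda>p. w1 (fst p) * w2 (snd p) * (D i j p \<bullet> E k l p))"
proof -
  note D' = jet_ofD[OF D] and E' = jet_ofD[OF E]
  have C: "C \<ge> 0" using w1(2)[of 0] L_pos abs_ge_zero[of "w1 0"] by simp
  have "continuous_on (Kx \<times> Ky) (\<lambda>p. w2 (snd p) * (D i j p \<bullet> E k l p))"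
    by (intro continuous_intros jet_continuous_on D' E' continuous_on_compose2[OF w2]) (use D'(6) in auto)
  then have "bounded ((\<lambda>p. w2 (snd p) * (D i j p \<bullet> E k l p)) ` (Kx \<times> Ky))"
    by (intro compact_imp_bounded compact_continuous_image compact_Times D')
  then obtain B where bnd: "\<forall>z\<in>(\<lambda>p. w2 (snd p) * (D i j p \<bullet> E k l p)) ` (Kx \<times> Ky). norm z \<le> B"
    unfolding bounded_iff by blast
  have B: "\<bar>w2 (snd p) * (D i j p \<bullet> E k l p)\<bar> \<le> B" if "p \<in> Kx \<times> Ky" for p
    using bspec[OF bnd imageI[OF that]] by simp
  show ?thesis
  proof (rule integrable_compact_support[OF _ D'(3,5)])
    show "(\<lambda>p. w1 (fst p) * w2 (snd p) * (D i j p \<bullet> E k l p)) \<in> borel_measurable M"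
      using measurable_x[OF w1(1)] measurable_y[OF measurable_weight_y[OF w2]] measurable_jet[OF D'(2)] measurable_jet[OF E'(2)]
      by (intro borel_measurable_times borel_measurable_inner)
    show "\<bar>w1 (fst p) * w2 (snd p) * (D i j p \<bullet> E k l p)\<bar> \<le> C * B" if "p \<in> Omega L Y" "p \<in> Kx \<times> Ky" for p
      using mult_mono[OF w1(2) B[OF that(2)], of "fst p"] that C by (auto simp: Omega_def abs_mult mult.assoc)
    show "w1 (fst p) * w2 (snd p) * (D i j p \<bullet> E k l p) = 0" if "p \<in> Omega L Y" "p \<notin> Kx \<times> Ky" for p
      using jet_of_zero[OF D that] by simp
  qed
qed

end

section \<open>The quadratic form on test functions\<close>

lemma smooth_plane_iff_jet: "smooth_plane \<phi> \<longleftrightarrow> (\<exists>D. D 0 0 = \<phi> \<and> jet D)"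
  by (simp add: smooth_plane_def jet_def)

lemma jet_comb:
  assumes "jet D" "jet E"
  shows "jet (\<lambda>i j p. D i j p + s *\<^sub>R E i j p)"
  unfolding jet_def
proof (intro allI)
  fix i j p
  have "(D i j has_derivative (\<lambda>(h, k). h *\<^sub>R D (Suc i) j p + k *\<^sub>R D i (Suc j) p)) (at p)"
    "(E i j has_derivative (\<lambda>(h, k). h *\<^sub>R E (Suc i) j p + k *\<^sub>R E i (Suc j) p)) (at p)"
    using assms unfolding jet_def by blast+
  then show "((\<lambda>p. D i j p + s *\<^sub>R E i j p) has_derivative
      (\<lambda>(h, k). h *\<^sub>R (D (Suc i) j p + s *\<^sub>R E (Suc i) j p) + k *\<^sub>R (D i (Suc j) p + s *\<^sub>R E i (Suc j) p))) (at p)"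
    by (rule has_derivative_eq_rhs[OF has_derivative_add[OF _ has_derivative_scaleR_right]])
      (auto simp: fun_eq_iff algebra_simps)
qed

lemma partial_x_jet: "jet D \<Longrightarrow> partial_x (D i j) = D (Suc i) j"
  unfolding partial_x_def by (auto simp: fun_eq_iff intro!: vector_derivative_at jet_x)

lemma partial_y_jet: "jet D \<Longrightarrow> partial_y (D i j) = D i (Suc j)"
  unfolding partial_y_def by (auto simp: fun_eq_iff intro!: vector_derivative_at jet_y)

lemma integral_linear_comb:
  fixes f g :: "'a \<Rightarrow> real"
  assumes "integrable M f" "integrable M g"
  shows "(LINT p|M. f p) + s * (LINT p|M. g p) = (LINT p|M. f p + s * g p)"
  using assms by simp

context grushin_setting
begin

lemma test_of_jet:
  assumes "jet_of \<phi> D Kx Ky"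
  shows "\<phi> \<in> test_functions L Y"
proof -
  have sm: "smooth_plane \<phi>" using jet_ofD(1,2)[OF assms] smooth_plane_iff_jet by blast
  have z: "\<phi> (x, y) = 0" if "x \<notin> Kx" for x y
    using assms that unfolding jet_of_def by metis
  show ?thesis
  proof (cases "Y = Circle")
    case True
    then have "\<phi> (x, y + 2 * pi) = \<phi> (x, y)" for x y
      using assms unfolding jet_of_def by metis
    with True sm z jet_ofD(3,4)[OF assms] show ?thesis by auto
  next
    case False
    then have zy: "\<phi> (x, y) = 0" if "y \<notin> Ky" for x y
      using assms that unfolding jet_of_def by metis
    have "Kx \<times> Ky \<subseteq> Omega L Y"
      using jet_ofD(4,6)[OF assms] False unfolding Omega_def by (cases Y) (auto simp: Yo_def)
    moreover have "compact (Kx \<times> Ky)" using jet_ofD(3,5)[OF assms] by (rule compact_Times)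
    moreover have "\<forall>p. p \<notin> Kx \<times> Ky \<longrightarrow> \<phi> p = 0" using z zy by auto
    ultimately have "smooth_plane \<phi> \<and> (\<exists>K. compact K \<and> K \<subseteq> Omega L Y \<and> (\<forall>p. p \<notin> K \<longrightarrow> \<phi> p = 0))"
      using sm by blast
    then show ?thesis using False by (cases Y) auto
  qed
qed

lemma jet_of_comb:
  assumes D: "jet_of \<phi> D Kx Ky" and E: "jet_of \<psi> E Kx' Ky'"
  shows "jet_of (\<lambda>p. \<phi> p + s *\<^sub>R \<psi> p) (\<lambda>i j p. D i j p + s *\<^sub>R E i j p) (Kx \<union> Kx') (Ky \<union> Ky')"
  using assms jet_comb[OF jet_ofD(2)[OF D] jet_ofD(2)[OF E], of s]
  unfolding jet_of_def by (simp add: fun_eq_iff compact_Un)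

lemma test_comb: "\<phi> \<in> test_functions L Y \<Longrightarrow> \<psi> \<in> test_functions L Y \<Longrightarrow> (\<lambda>p. \<phi> p + s *\<^sub>R \<psi> p) \<in> test_functions L Y"
  using test_jet test_of_jet jet_of_comb by meson

lemma test_diff: "\<phi> \<in> test_functions L Y \<Longrightarrow> \<psi> \<in> test_functions L Y \<Longrightarrow> (\<lambda>p. \<phi> p - \<psi> p) \<in> test_functions L Y"
  using test_comb[of \<phi> \<psi> "-1"] by simp

lemma jet_of_periodic: "jet_of \<phi> D Kx Ky \<Longrightarrow> Y = Circle \<Longrightarrow> D i j (x, y + 2 * pi) = D i j (x, y)"
  unfolding jet_of_def by simp

lemma r_continuous: "continuous_on (Yo Y) r" "continuous_on (Yo Y) (deriv r)"
  by (rule smooth_continuous_on[OF r_smooth open_Yo], rule smooth_continuous_on[OF smooth_deriv[OF r_smooth open_Yo] open_Yo])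

lemma jet_integrable:
  assumes D: "jet_of \<phi> D Kx Ky" and E: "jet_of \<psi> E Kx' Ky'"
  shows "integrable M (\<lambda>p. D i j p \<bullet> E k l p)"
    and "integrable M (\<lambda>p. V0 (fst p) * (D i j p \<bullet> E k l p))"
    and "integrable M (\<lambda>p. (q (fst p))\<^sup>2 * (D i j p \<bullet> E k l p))"
    and "integrable M (\<lambda>p. (q (fst p))\<^sup>2 * (r (snd p))\<^sup>2 * (D i j p \<bullet> E k l p))"
    and "integrable M (\<lambda>p. (q (fst p))\<^sup>2 * (2 * r (snd p) * deriv r (snd p)) * (D i j p \<bullet> E k l p))"
proof -
  have cr: "continuous_on (Yo Y) (\<lambda>y. (r y)\<^sup>2)" "continuous_on (Yo Y) (\<lambda>y. 2 * r y * deriv r y)"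
    by (intro continuous_intros r_continuous)+
  have q2: "(\<lambda>x. (q x)\<^sup>2) \<in> borel_measurable Mx" using q_measurable by measurable
  have qb: "x \<in> {-L<..<L} \<Longrightarrow> \<bar>(q x)\<^sup>2\<bar> \<le> Cq\<^sup>2" for x using Cq(3) by simp
  show "integrable M (\<lambda>p. D i j p \<bullet> E k l p)"
    using weighted_integrable[OF D E, of "\<lambda>_. 1" 1 "\<lambda>_. 1" i j k l] by simp
  show "integrable M (\<lambda>p. V0 (fst p) * (D i j p \<bullet> E k l p))"
    using weighted_integrable[OF D E V0(1), of CV "\<lambda>_. 1" i j k l] V0(2) by simp
  show "integrable M (\<lambda>p. (q (fst p))\<^sup>2 * (D i j p \<bullet> E k l p))"
    using weighted_integrable[OF D E q2 qb, of "\<lambda>_. 1" i j k l] by simp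
  show "integrable M (\<lambda>p. (q (fst p))\<^sup>2 * (r (snd p))\<^sup>2 * (D i j p \<bullet> E k l p))"
    by (rule weighted_integrable[OF D E q2 qb cr(1)])
  show "integrable M (\<lambda>p. (q (fst p))\<^sup>2 * (2 * r (snd p) * deriv r (snd p)) * (D i j p \<bullet> E k l p))"
    by (rule weighted_integrable[OF D E q2 qb cr(2)])
qed

lemma jet_L2: "jet_of \<phi> D Kx Ky \<Longrightarrow> D i j \<in> L2 M"
  using jet_integrable(1)[of \<phi> D Kx Ky \<phi> D Kx Ky i j i j] measurable_jet[OF jet_ofD(2)]
  by (auto simp: L2_def dot_square_norm)

lemma test_L2: "\<phi> \<in> test_functions L Y \<Longrightarrow> \<phi> \<in> L2 M"
  using test_jet jet_L2 jet_ofD(1) by metis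

text \<open>The real part of the complex inner product; \<open>BB\<close> is likewise the real part
  of the sesquilinear form, with \<open>V0\<close> in place of \<open>V\<close>.\<close>

definition IP :: "(real \<times> real \<Rightarrow> complex) \<Rightarrow> (real \<times> real \<Rightarrow> complex) \<Rightarrow> real" where
  "IP f g = (LINT p|M. f p \<bullet> g p)"

definition BB :: "(real \<times> real \<Rightarrow> complex) \<Rightarrow> (real \<times> real \<Rightarrow> complex) \<Rightarrow> real" where
  "BB \<phi> \<psi> = (LINT p|M. partial_x \<phi> p \<bullet> partial_x \<psi> p
     + (q (fst p))\<^sup>2 * (r (snd p))\<^sup>2 * (partial_y \<phi> p \<bullet> partial_y \<psi> p) + V0 (fst p) * (\<phi> p \<bullet> \<psi> p))"

lemma BB_jet:
  assumes D: "jet_of \<phi> D Kx Ky" and E: "jet_of \<psi> E Kx' Ky'"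
  shows "BB \<phi> \<psi> = (LINT p|M. D 1 0 p \<bullet> E 1 0 p + (q (fst p))\<^sup>2 * (r (snd p))\<^sup>2 * (D 0 1 p \<bullet> E 0 1 p)
     + V0 (fst p) * (D 0 0 p \<bullet> E 0 0 p))"
    and "integrable M (\<lambda>p. D 1 0 p \<bullet> E 1 0 p + (q (fst p))\<^sup>2 * (r (snd p))\<^sup>2 * (D 0 1 p \<bullet> E 0 1 p)
     + V0 (fst p) * (D 0 0 p \<bullet> E 0 0 p))"
  using jet_ofD(1)[OF D] jet_ofD(1)[OF E] partial_x_jet[OF jet_ofD(2)[OF D], of 0 0] partial_x_jet[OF jet_ofD(2)[OF E], of 0 0]
    partial_y_jet[OF jet_ofD(2)[OF D], of 0 0] partial_y_jet[OF jet_ofD(2)[OF E], of 0 0]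
  unfolding BB_def by (auto intro!: Bochner_Integration.integrable_add jet_integrable[OF D E])

lemma IP_sym: "IP f g = IP g f" by (simp add: IP_def inner_commute)
lemma BB_sym: "BB f g = BB g f" by (simp add: BB_def inner_commute)

lemma IP_comb: "f \<in> L2 M \<Longrightarrow> g \<in> L2 M \<Longrightarrow> h \<in> L2 M \<Longrightarrow> IP (\<lambda>p. f p + s *\<^sub>R g p) h = IP f h + s * IP g h"
  unfolding IP_def by (simp add: inner_add_left L2_inner_integrable)

lemma BB_comb:
  assumes "f \<in> test_functions L Y" "g \<in> test_functions L Y" "h \<in> test_functions L Y"
  shows "BB (\<lambda>p. f p + s *\<^sub>R g p) h = BB f h + s * BB g h"
proof -
  obtain D Kx Ky E Kx' Ky' F Kx'' Ky'' where j: "jet_of f D Kx Ky" "jet_of g E Kx' Ky'" "jet_of h F Kx'' Ky''"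
    using assms test_jet by metis
  show ?thesis
    unfolding BB_jet(1)[OF jet_of_comb[OF j(1,2)] j(3)] BB_jet(1)[OF j(1,3)] BB_jet(1)[OF j(2,3)]
      integral_linear_comb[OF BB_jet(2)[OF j(1,3)] BB_jet(2)[OF j(2,3)]]
    by (intro Bochner_Integration.integral_cong refl) (simp add: inner_add_left algebra_simps)
qed

lemma V_AE_M: "AE p in M. V (fst p) = V0 (fst p)"
  using V0(3) by eventually_elim simp

lemma grushin_form_BB:
  assumes "\<phi> \<in> test_functions L Y"
  shows "grushin_form L Y q r V \<phi> = BB \<phi> \<phi>"
proof -
  obtain D Kx Ky where j: "jet_of \<phi> D Kx Ky" using test_jet[OF assms] by blast
  have D0: "D 0 0 = \<phi>" by (rule jet_ofD(1)[OF j])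
  have px: "partial_x \<phi> = D 1 0" "partial_y \<phi> = D 0 1"
    using partial_x_jet[OF jet_ofD(2)[OF j], of 0 0] partial_y_jet[OF jet_ofD(2)[OF j], of 0 0] D0 by auto
  have mV: "(\<lambda>p. V (fst p)) \<in> borel_measurable M" by (rule measurable_x[OF V_measurable])
  have mQ: "(\<lambda>p. q (fst p)) \<in> borel_measurable M" by (rule measurable_x[OF q_measurable])
  have mr: "(\<lambda>p. r (snd p)) \<in> borel_measurable M"
    by (intro measurable_y measurable_weight_y r_continuous)
  note mD = measurable_jet[OF jet_ofD(2)[OF j]]
  show ?thesis unfolding BB_jet(1)[OF j j] grushin_form_def px
  proof (rule integral_cong_AE)
    show "(\<lambda>(x, y). (cmod (D 1 0 (x, y)))\<^sup>2 + (q x)\<^sup>2 * (r y)\<^sup>2 * (cmod (D 0 1 (x, y)))\<^sup>2 + V x * (cmod (\<phi> (x, y)))\<^sup>2) \<in> borel_measurable M"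
      using mV mQ mr mD[of 1 0] mD[of 0 1] mD[of 0 0] unfolding split_beta' D0 prod.collapse by measurable
    show "(\<lambda>p. D 1 0 p \<bullet> D 1 0 p + (q (fst p))\<^sup>2 * (r (snd p))\<^sup>2 * (D 0 1 p \<bullet> D 0 1 p) + V0 (fst p) * (D 0 0 p \<bullet> D 0 0 p)) \<in> borel_measurable M"
      using BB_jet(2)[OF j j] by (rule borel_measurable_integrable)
    show "AE p in M. (case p of (x, y) \<Rightarrow> (cmod (D 1 0 (x, y)))\<^sup>2 + (q x)\<^sup>2 * (r y)\<^sup>2 * (cmod (D 0 1 (x, y)))\<^sup>2 + V x * (cmod (\<phi> (x, y)))\<^sup>2)
      = D 1 0 p \<bullet> D 1 0 p + (q (fst p))\<^sup>2 * (r (snd p))\<^sup>2 * (D 0 1 p \<bullet> D 0 1 p) + V0 (fst p) * (D 0 0 p \<bullet> D 0 0 p)"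
      using V_AE_M by eventually_elim (auto simp: dot_square_norm D0)
  qed
qed

lemma L2_norm_IP: "(L2_norm M f)\<^sup>2 = IP f f"
  by (simp add: L2_norm_def IP_def dot_square_norm integral_nonneg_AE)

section \<open>Integration by parts on the domain\<close>

lemma compact_in_open_interval:
  fixes K :: "real set"
  assumes "compact K" "K \<subseteq> I" "I = {l<..<u} \<and> l < u \<or> I = UNIV"
  shows "\<exists>a b. a < b \<and> {a..b} \<subseteq> I \<and> K \<subseteq> {a<..<b}"
proof (cases "K = {}")
  case True
  from assms(3) show ?thesis
  proof
    assume "I = {l<..<u} \<and> l < u"
    then show ?thesis using True by (intro exI[of _ "l + (u-l)/3"] exI[of _ "l + 2*(u-l)/3"]) (auto simp: field_simps)
  next
    assume "I = UNIV" then show ?thesis using True by (intro exI[of _ 0] exI[of _ 1]) auto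
  qed
next
  case False
  obtain s where s: "s \<in> K" "\<And>x. x \<in> K \<Longrightarrow> s \<le> x" using compact_attains_inf[OF assms(1) False] by blast
  obtain t where t: "t \<in> K" "\<And>x. x \<in> K \<Longrightarrow> x \<le> t" using compact_attains_sup[OF assms(1) False] by blast
  from assms(3) show ?thesis
  proof
    assume I: "I = {l<..<u} \<and> l < u"
    then have lu: "l < s" "t < u" "s \<le> t" using s t assms(2) by auto
    have "K \<subseteq> {(l + s)/2<..<(t + u)/2}"
    proof
      fix x assume "x \<in> K"
      then have "s \<le> x" "x \<le> t" using s t by auto
      then show "x \<in> {(l + s)/2<..<(t + u)/2}" using lu by (simp add: field_simps)
    qed
    moreover have "(l + s)/2 < (t + u)/2" "{(l + s)/2..(t + u)/2} \<subseteq> I" using lu I by (auto simp: field_simps)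
    ultimately show ?thesis by blast
  next
    assume I: "I = UNIV"
    have "K \<subseteq> {s - 1<..<t + 1}"
    proof
      fix x assume "x \<in> K"
      then have "s \<le> x" "x \<le> t" using s t by auto
      then show "x \<in> {s - 1<..<t + 1}" by simp
    qed
    moreover have "s - 1 < t + 1" using s(2)[OF t(1)] by simp
    ultimately show ?thesis using I by blast
  qed
qed

lemma integral_compact_derivative_zero:
  fixes u :: "real \<Rightarrow> real"
  assumes K: "compact K" "K \<subseteq> I" "I = {l<..<h} \<and> l < h \<or> I = UNIV"
    and d: "\<And>x. x \<in> I \<Longrightarrow> (u has_real_derivative u' x) (at x)" and c: "continuous_on I u'"
    and z: "\<And>x. x \<notin> K \<Longrightarrow> u x = 0" "\<And>x. x \<notin> K \<Longrightarrow> u' x = 0"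
  shows "(LINT x|restrict_space lborel I. u' x) = 0"
proof -
  obtain a b where ab: "a < b" "{a..b} \<subseteq> I" "K \<subseteq> {a<..<b}"
    using compact_in_open_interval[OF K] by blast
  have I: "I \<in> sets borel" using K(3) by auto
  show ?thesis
  proof (rule integral_derivative_zero[of a b u u'])
    have "a \<notin> K" "b \<notin> K" using ab(3) by auto
    then show "u a = u b" using z(1) by simp
    show "u' \<in> borel_measurable (restrict_space lborel I)" by (rule borel_restrict_continuous[OF c])
    have "indicator I x *\<^sub>R u' x = indicator {a..b} x *\<^sub>R u' x" for x
      using ab z(2)[of x] by (cases "x \<in> K") (auto simp: indicator_def)
    then show "AE x in lborel. indicator I x *\<^sub>R u' x = indicator {a..b} x *\<^sub>R u' x" by simp
  qed (use ab d c I in \<open>auto intro: continuous_on_subset\<close>)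
qed

lemma inner_deriv:
  fixes f g :: "real \<Rightarrow> complex"
  assumes "(f has_vector_derivative f') (at x)" "(g has_vector_derivative g') (at x)"
  shows "((\<lambda>x. f x \<bullet> g x) has_real_derivative f' \<bullet> g x + f x \<bullet> g') (at x)"
proof -
  have "((\<lambda>x. f x \<bullet> g x) has_derivative (\<lambda>h. f x \<bullet> (h *\<^sub>R g') + (h *\<^sub>R f') \<bullet> g x)) (at x)"
    using assms unfolding has_vector_derivative_def by (rule has_derivative_inner)
  then show ?thesis unfolding has_field_derivative_def
    by (rule has_derivative_eq_rhs) (auto simp: fun_eq_iff algebra_simps)
qed

lemma slice_continuous:
  assumes "jet D"
  shows "continuous_on A (\<lambda>x. D i j (x, y))" "continuous_on A (\<lambda>y. D i j (x, y))"
  by (intro continuous_on_compose2[OF jet_continuous_on[OF assms, of UNIV]] continuous_intros; simp)+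

lemma ibp_x:
  assumes D: "jet_of \<phi> D Kx Ky" and E: "jet_of \<psi> E Kx' Ky'"
  shows "(LINT p|M. D 1 0 p \<bullet> E 1 0 p + D 0 0 p \<bullet> E 2 0 p) = 0"
proof -
  note jD = jet_ofD(2)[OF D] and jE = jet_ofD(2)[OF E]
  have "(LINT p|M. D 1 0 p \<bullet> E 1 0 p + D 0 0 p \<bullet> E 2 0 p) = (LINT y|My. LINT x|Mx. D 1 0 (x, y) \<bullet> E 1 0 (x, y) + D 0 0 (x, y) \<bullet> E 2 0 (x, y))"
    by (rule fubini(2)) (intro Bochner_Integration.integrable_add jet_integrable[OF D E])
  also have "\<dots> = (LINT y|My. 0)"
  proof (rule Bochner_Integration.integral_cong[OF refl])
    fix y
    show "(LINT x|Mx. D 1 0 (x, y) \<bullet> E 1 0 (x, y) + D 0 0 (x, y) \<bullet> E 2 0 (x, y)) = 0"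
    proof (rule integral_compact_derivative_zero[where u="\<lambda>x. D 0 0 (x, y) \<bullet> E 1 0 (x, y)" and K=Kx and l="-L" and h=L])
      show "((\<lambda>x. D 0 0 (x, y) \<bullet> E 1 0 (x, y)) has_real_derivative D 1 0 (x, y) \<bullet> E 1 0 (x, y) + D 0 0 (x, y) \<bullet> E 2 0 (x, y)) (at x)" for x
        using inner_deriv[OF jet_x[OF jD, of 0 0 y x] jet_x[OF jE, of 1 0 y x]] by (simp add: numeral_2_eq_2)
      show "continuous_on {-L<..<L} (\<lambda>x. D 1 0 (x, y) \<bullet> E 1 0 (x, y) + D 0 0 (x, y) \<bullet> E 2 0 (x, y))"
        by (intro continuous_intros slice_continuous(1)[OF jD] slice_continuous(1)[OF jE])
      have "D i j (x, y) = 0" if "x \<notin> Kx" for x i j using D that unfolding jet_of_def by blast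
      then show "x \<notin> Kx \<Longrightarrow> D 0 0 (x, y) \<bullet> E 1 0 (x, y) = 0"
        "x \<notin> Kx \<Longrightarrow> D 1 0 (x, y) \<bullet> E 1 0 (x, y) + D 0 0 (x, y) \<bullet> E 2 0 (x, y) = 0" for x by simp_all
    qed (use jet_ofD(3,4)[OF D] L_pos in auto)
  qed
  finally show ?thesis by simp
qed

text \<open>For a compact support in \<open>y\<close> there are no boundary terms; on the circle
  they cancel by periodicity, and the missing end point of the period is a null set.\<close>

lemma integral_y_derivative_zero:
  fixes u :: "real \<Rightarrow> real"
  assumes K: "compact K" "K \<subseteq> Yo Y"
    and d: "\<And>y. y \<in> Yo Y \<Longrightarrow> (u has_real_derivative u' y) (at y)" and c: "continuous_on (Yo Y) u'"
    and z: "\<And>y. Y \<noteq> Circle \<Longrightarrow> y \<notin> K \<Longrightarrow> u y = 0" "\<And>y. Y \<noteq> Circle \<Longrightarrow> y \<notin> K \<Longrightarrow> u' y = 0"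
    and per: "Y = Circle \<Longrightarrow> u (2 * pi) = u 0"
  shows "(LINT y|My. u' y) = 0"
proof (cases "Y = Circle")
  case True
  then have Yo: "Yo Y = UNIV" and Om: "Omega_y Y = {0..<2 * pi}" by (auto simp: Yo_def)
  have d': "(u has_real_derivative u' y) (at y)" for y using d Yo by simp
  have c': "continuous_on A u'" for A by (rule continuous_on_subset[OF c]) (simp add: Yo)
  show ?thesis unfolding Om
  proof (rule integral_derivative_zero[of 0 "2 * pi" u u'])
    show "u' \<in> borel_measurable (restrict_space lborel {0..<2 * pi})"
      by (rule borel_restrict_continuous[OF c'])
    show "AE x in lborel. indicator {0..<2 * pi} x *\<^sub>R u' x = indicator {0..2 * pi} x *\<^sub>R u' x"
      using AE_lborel_singleton[of "2 * pi"] by eventually_elim (auto simp: indicator_def)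
  qed (use d' c' per True in auto)
next
  case False
  then have Om: "Omega_y Y = Yo Y" by (cases Y) (auto simp: Yo_def)
  show ?thesis unfolding Om
    by (rule integral_compact_derivative_zero[OF K _ d c z(1)[OF False] z(2)[OF False], of 0 pi])
      (simp_all add: Yo_def)
qed

lemma ibp_y:
  assumes D: "jet_of \<phi> D Kx Ky" and E: "jet_of \<psi> E Kx' Ky'"
  shows "(LINT p|M. (q (fst p))\<^sup>2 * (r (snd p))\<^sup>2 * (D 0 1 p \<bullet> E 0 1 p) + (q (fst p))\<^sup>2 * (r (snd p))\<^sup>2 * (D 0 0 p \<bullet> E 0 2 p)
    + (q (fst p))\<^sup>2 * (2 * r (snd p) * deriv r (snd p)) * (D 0 0 p \<bullet> E 0 1 p)) = 0" (is "integral\<^sup>L M ?h = 0")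
proof -
  note jD = jet_ofD(2)[OF D] and jE = jet_ofD(2)[OF E]
  have "integral\<^sup>L M ?h = (LINT x|Mx. LINT y|My. ?h (x, y))"
    by (rule fubini(1)) (intro Bochner_Integration.integrable_add jet_integrable[OF D E])
  also have "\<dots> = (LINT x|Mx. 0)"
  proof (rule Bochner_Integration.integral_cong[OF refl])
    fix x
    let ?u = "\<lambda>y. (q x)\<^sup>2 * ((r y)\<^sup>2 * (D 0 0 (x, y) \<bullet> E 0 1 (x, y)))"
    show "(LINT y|My. ?h (x, y)) = 0"
    proof (rule integral_y_derivative_zero[where u="?u" and K=Ky])
      show "(?u has_real_derivative ?h (x, y)) (at y)" if "y \<in> Yo Y" for y
      proof -
        have 1: "((\<lambda>y. D 0 0 (x, y) \<bullet> E 0 1 (x, y)) has_real_derivative D 0 1 (x, y) \<bullet> E 0 1 (x, y) + D 0 0 (x, y) \<bullet> E 0 2 (x, y)) (at y)"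
          using inner_deriv[OF jet_y[OF jD, of 0 0 x y] jet_y[OF jE, of 0 1 x y]] by (simp add: numeral_2_eq_2)
        have 2: "((\<lambda>y. (r y)\<^sup>2) has_real_derivative 2 * r y * deriv r y) (at y)"
          using smooth_DERIV[OF r_smooth open_Yo that] by (auto intro!: derivative_eq_intros)
        show ?thesis using DERIV_cmult[OF DERIV_mult[OF 2 1], of "(q x)\<^sup>2"]
          by (rule DERIV_cong) (simp add: algebra_simps)
      qed
      have "continuous_on (Yo Y) r" "continuous_on (Yo Y) (deriv r)"
        by (rule smooth_continuous_on[OF r_smooth open_Yo], rule smooth_continuous_on[OF smooth_deriv[OF r_smooth open_Yo] open_Yo])
      then show "continuous_on (Yo Y) (\<lambda>y. ?h (x, y))" unfolding fst_conv snd_conv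
        by (intro continuous_intros slice_continuous(2)[OF jD] slice_continuous(2)[OF jE])
      have "D i j (x, y) = 0" if "Y \<noteq> Circle" "y \<notin> Ky" for y i j using D that unfolding jet_of_def by blast
      then show "Y \<noteq> Circle \<Longrightarrow> y \<notin> Ky \<Longrightarrow> ?u y = 0" "Y \<noteq> Circle \<Longrightarrow> y \<notin> Ky \<Longrightarrow> ?h (x, y) = 0" for y by simp_all
      show "?u (2 * pi) = ?u 0" if "Y = Circle"
      proof -
        show ?thesis using r_periodic[OF that, of 0] jet_of_periodic[OF D that, of 0 0 x 0]
            jet_of_periodic[OF E that, of 0 1 x 0] by simp
      qed
    qed (use jet_ofD(5,6)[OF D] in auto)
  qed
  finally show ?thesis by simp
qed

lemma grushin_operator_jet:
  assumes E: "jet_of \<psi> E Kx Ky" and p: "p \<in> Omega L Y"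
  shows "grushin_operator q r V \<psi> p = (- 1) * E 2 0 p + of_real (- (q (fst p))\<^sup>2 * (r (snd p))\<^sup>2) * E 0 2 p
    + of_real (- (q (fst p))\<^sup>2 * (2 * r (snd p) * deriv r (snd p))) * E 0 1 p + of_real (V (fst p)) * E 0 0 p"
proof -
  obtain x y where xy: "p = (x, y)" by (cases p)
  have y: "y \<in> Yo Y" using p Omega_y_subset by (auto simp: xy Omega_def)
  note jE = jet_ofD(2)[OF E]
  have px: "partial_x (partial_x \<psi>) = E 2 0" "partial_y \<psi> = E 0 1"
    using partial_x_jet[OF jE, of 0 0] partial_x_jet[OF jE, of 1 0] partial_y_jet[OF jE, of 0 0] jet_ofD(1)[OF E]
    by (auto simp: numeral_2_eq_2)
  have "((\<lambda>s. of_real ((r s)\<^sup>2) * E 0 1 (x, s)) has_vector_derivative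
     of_real ((r y)\<^sup>2) * E 0 2 (x, y) + of_real (2 * r y * deriv r y) * E 0 1 (x, y)) (at y)"
  proof -
    have 2: "((\<lambda>y. (r y)\<^sup>2) has_real_derivative 2 * r y * deriv r y) (at y)"
      using smooth_DERIV[OF r_smooth open_Yo y] by (auto intro!: derivative_eq_intros)
    have "((\<lambda>s. (r s)\<^sup>2 *\<^sub>R E 0 1 (x, s)) has_vector_derivative
       (r y)\<^sup>2 *\<^sub>R E 0 2 (x, y) + (2 * r y * deriv r y) *\<^sub>R E 0 1 (x, y)) (at y)"
      using has_vector_derivative_scaleR[OF 2 jet_y[OF jE, of 0 1 x y]] by (simp add: numeral_2_eq_2)
    then show ?thesis by (simp add: scaleR_conv_of_real)
  qed
  then have "partial_y (\<lambda>(x', y'). of_real ((r y')\<^sup>2) * E 0 1 (x', y')) (x, y) =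
     of_real ((r y)\<^sup>2) * E 0 2 (x, y) + of_real (2 * r y * deriv r y) * E 0 1 (x, y)"
    unfolding partial_y_def by (simp add: vector_derivative_at)
  then show ?thesis
    by (simp add: grushin_operator_def px jet_ofD(1)[OF E] xy algebra_simps)
qed

lemma weighted_L2:
  assumes D: "jet_of \<phi> D Kx Ky"
    and w1: "w1 \<in> borel_measurable Mx" "\<And>x. x \<in> {-L<..<L} \<Longrightarrow> \<bar>w1 x\<bar> \<le> C" and w2: "continuous_on (Yo Y) w2"
  shows "(\<lambda>p. of_real (w1 (fst p) * w2 (snd p)) * D i j p) \<in> L2 M"
  unfolding L2_def
proof (intro CollectI conjI)
  show "(\<lambda>p. of_real (w1 (fst p) * w2 (snd p)) * D i j p) \<in> borel_measurable M"
    using measurable_x[OF w1(1)] measurable_y[OF measurable_weight_y[OF w2]] measurable_jet[OF jet_ofD(2)[OF D]]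
    by measurable
  have "integrable M (\<lambda>p. (w1 (fst p))\<^sup>2 * (w2 (snd p))\<^sup>2 * (D i j p \<bullet> D i j p))"
  proof (rule weighted_integrable[OF D D])
    show "(\<lambda>x. (w1 x)\<^sup>2) \<in> borel_measurable Mx" using w1(1) by measurable
    show "\<bar>(w1 x)\<^sup>2\<bar> \<le> C\<^sup>2" if "x \<in> {-L<..<L}" for x
      using w1(2)[OF that] by (simp add: abs_le_square_iff[symmetric])
    show "continuous_on (Yo Y) (\<lambda>y. (w2 y)\<^sup>2)" by (intro continuous_intros w2)
  qed
  then show "integrable M (\<lambda>p. (cmod (of_real (w1 (fst p) * w2 (snd p)) * D i j p))\<^sup>2)"
    by (simp add: norm_mult power_mult_distrib dot_square_norm)
qed

text \<open>Green's formula. After the derivative of \<open>r^2\<close> is expanded, the integrand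
  differs from the form density by the exact derivatives \<open>?A\<close> in \<open>x\<close> and
  \<open>?B\<close> in \<open>y\<close>. This links the adjoint in the definition of the Friedrichs
  extension to the form.\<close>

lemma
  assumes "\<psi> \<in> test_functions L Y"
  shows grushin_operator_L2: "grushin_operator q r V \<psi> \<in> L2 M"
    and IP_grushin_operator: "\<phi> \<in> test_functions L Y \<Longrightarrow> IP \<phi> (grushin_operator q r V \<psi>) = BB \<phi> \<psi>"
proof -
  obtain E Kx' Ky' where E: "jet_of \<psi> E Kx' Ky'" using test_jet[OF assms] by blast
  note mE = measurable_jet[OF jet_ofD(2)[OF E]]
  have cr: "continuous_on (Yo Y) (\<lambda>y. (r y)\<^sup>2)" "continuous_on (Yo Y) (\<lambda>y. 2 * r y * deriv r y)"
    by (intro continuous_intros r_continuous)+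
  have q2: "(\<lambda>x. - (q x)\<^sup>2) \<in> borel_measurable Mx" using q_measurable by measurable
  have qb: "x \<in> {-L<..<L} \<Longrightarrow> \<bar>- (q x)\<^sup>2\<bar> \<le> Cq\<^sup>2" for x using Cq(3) by simp
  define G where "G v p = (- 1) * E 2 0 p + of_real (- (q (fst p))\<^sup>2 * (r (snd p))\<^sup>2) * E 0 2 p
    + of_real (- (q (fst p))\<^sup>2 * (2 * r (snd p) * deriv r (snd p))) * E 0 1 p + of_real (v (fst p)) * E 0 0 p"
    for v :: "real \<Rightarrow> real" and p
  have GV0: "G V0 \<in> L2 M" unfolding G_def
  proof (intro L2_add)
    show "(\<lambda>p. (- 1) * E 2 0 p) \<in> L2 M" by (intro L2_cmult jet_L2[OF E])
    show "(\<lambda>p. of_real (- (q (fst p))\<^sup>2 * (r (snd p))\<^sup>2) * E 0 2 p) \<in> L2 M"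
      by (rule weighted_L2[OF E q2 qb cr(1)])
    show "(\<lambda>p. of_real (- (q (fst p))\<^sup>2 * (2 * r (snd p) * deriv r (snd p))) * E 0 1 p) \<in> L2 M"
      by (rule weighted_L2[OF E q2 qb cr(2)])
    show "(\<lambda>p. of_real (V0 (fst p)) * E 0 0 p) \<in> L2 M"
      using weighted_L2[OF E V0(1), of CV "\<lambda>_. 1" 0 0] V0(2) by simp
  qed
  have mV: "(\<lambda>p. V (fst p)) \<in> borel_measurable M" by (rule measurable_x[OF V_measurable])
  have mQ: "(\<lambda>p. q (fst p)) \<in> borel_measurable M" by (rule measurable_x[OF q_measurable])
  have mr: "(\<lambda>p. r (snd p)) \<in> borel_measurable M" "(\<lambda>p. deriv r (snd p)) \<in> borel_measurable M"
    by (intro measurable_y measurable_weight_y r_continuous)+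
  have GVm: "G V \<in> borel_measurable M"
    unfolding G_def using mV mQ mr mE[of 2 0] mE[of 0 2] mE[of 0 1] mE[of 0 0] by measurable
  have geq: "p \<in> space M \<Longrightarrow> grushin_operator q r V \<psi> p = G V p" for p
    unfolding G_def space_M by (rule grushin_operator_jet[OF E])
  then have gm: "grushin_operator q r V \<psi> \<in> borel_measurable M"
    using GVm by (subst measurable_cong[of M _ "G V"]) auto
  have ae: "AE p in M. grushin_operator q r V \<psi> p = G V0 p"
    using V_AE_M AE_space by eventually_elim (simp add: geq, simp add: G_def)
  show gL: "grushin_operator q r V \<psi> \<in> L2 M"
    unfolding L2_def
  proof (intro CollectI conjI gm)
    have "AE p in M. (cmod (G V0 p))\<^sup>2 = (cmod (grushin_operator q r V \<psi> p))\<^sup>2"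
      using ae by eventually_elim simp
    then show "integrable M (\<lambda>p. (cmod (grushin_operator q r V \<psi> p))\<^sup>2)"
      using L2D(2)[OF GV0] gm by (rule_tac integrable_cong_AE_imp) auto
  qed
  assume "\<phi> \<in> test_functions L Y"
  then obtain D Kx Ky where D: "jet_of \<phi> D Kx Ky" using test_jet by blast
  note int = jet_integrable[OF D E]
  have D0: "D 0 0 = \<phi>" by (rule jet_ofD(1)[OF D])
  have "IP \<phi> (grushin_operator q r V \<psi>) = (LINT p|M. D 0 0 p \<bullet> G V0 p)"
    unfolding IP_def D0[symmetric]
  proof (rule integral_cong_AE)
    show "AE p in M. D 0 0 p \<bullet> grushin_operator q r V \<psi> p = D 0 0 p \<bullet> G V0 p"
      using ae by eventually_elim simp
  qed (use gm L2D(1)[OF GV0] measurable_jet[OF jet_ofD(2)[OF D]] in auto)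
  also have "\<dots> = BB \<phi> \<psi>"
  proof -
    let ?A = "\<lambda>p. D 1 0 p \<bullet> E 1 0 p + D 0 0 p \<bullet> E 2 0 p"
    let ?B = "\<lambda>p. (q (fst p))\<^sup>2 * (r (snd p))\<^sup>2 * (D 0 1 p \<bullet> E 0 1 p) + (q (fst p))\<^sup>2 * (r (snd p))\<^sup>2 * (D 0 0 p \<bullet> E 0 2 p)
      + (q (fst p))\<^sup>2 * (2 * r (snd p) * deriv r (snd p)) * (D 0 0 p \<bullet> E 0 1 p)"
    let ?C = "\<lambda>p. D 1 0 p \<bullet> E 1 0 p + (q (fst p))\<^sup>2 * (r (snd p))\<^sup>2 * (D 0 1 p \<bullet> E 0 1 p) + V0 (fst p) * (D 0 0 p \<bullet> E 0 0 p)"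
    have iA: "integrable M ?A" and iB: "integrable M ?B" and iC: "integrable M ?C"
      by (intro Bochner_Integration.integrable_add int)+
    have mulr: "a \<bullet> (of_real c * b) = c * (a \<bullet> b)" for a b :: complex and c
      by (metis inner_scaleR_right scaleR_conv_of_real)
    have "D 0 0 p \<bullet> G V0 p = ?C p - ?A p - ?B p" for p
    proof -
      have "D 0 0 p \<bullet> ((- 1) * E 2 0 p) = - (D 0 0 p \<bullet> E 2 0 p)" by simp
      then show ?thesis unfolding G_def inner_add_right mulr by (simp add: algebra_simps)
    qed
    then have "(LINT p|M. D 0 0 p \<bullet> G V0 p) = (LINT p|M. ?C p - ?A p - ?B p)" by (simp only:)
    also have "\<dots> = (LINT p|M. ?C p) - (LINT p|M. ?A p) - (LINT p|M. ?B p)"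
      by (simp only: Bochner_Integration.integral_diff iA iB iC Bochner_Integration.integrable_diff)
    also have "\<dots> = BB \<phi> \<psi>" unfolding ibp_x[OF D E] ibp_y[OF D E] BB_jet(1)[OF D E] by simp
    finally show ?thesis .
  qed
  finally show "IP \<phi> (grushin_operator q r V \<psi>) = BB \<phi> \<psi>" .
qed

end

section \<open>The Friedrichs extension and its semigroup\<close>

context grushin_setting
begin

lemma IP_square: "f \<in> L2 M \<Longrightarrow> g \<in> L2 M \<Longrightarrow> IP (\<lambda>p. f p + s *\<^sub>R g p) (\<lambda>p. f p + s *\<^sub>R g p) = IP f f + 2 * s * IP f g + s\<^sup>2 * IP g g"
  using IP_comb[of f g "\<lambda>p. f p + s *\<^sub>R g p" s] IP_comb[of f g f s] IP_comb[of f g g s]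
    L2_add[OF _ L2_scaleR, of f M g s] IP_sym[of f "\<lambda>p. f p + s *\<^sub>R g p"] IP_sym[of g "\<lambda>p. f p + s *\<^sub>R g p"] IP_sym[of g f]
  by (simp add: power2_eq_square algebra_simps)

lemma IP_nonneg: "0 \<le> IP f f" using L2_norm_IP[of f] by (metis zero_le_power2)

lemma L2_norm_nonneg: "0 \<le> L2_norm N f" by (simp add: L2_norm_def integral_nonneg_AE)

lemma L2_norm_sqrt: "L2_norm M f = sqrt (IP f f)"
  using L2_norm_IP[of f] L2_norm_nonneg[of M f] by (metis real_sqrt_abs abs_of_nonneg)

lemma abs_IP_le:
  assumes "f \<in> L2 M" "g \<in> L2 M"
  shows "\<bar>IP f g\<bar> \<le> L2_norm M f * L2_norm M g"
proof -
  have "0 \<le> IP f f + 2 * s * IP f g + s\<^sup>2 * IP g g" for s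
    using IP_nonneg[of "\<lambda>p. f p + s *\<^sub>R g p"] IP_square[OF assms, of s] by simp
  then have "(IP f g)\<^sup>2 \<le> IP f f * IP g g" by (rule discriminant_bound) (rule IP_nonneg)
  from real_sqrt_le_mono[OF this] show ?thesis by (simp add: real_sqrt_mult L2_norm_sqrt)
qed

lemma IP_tendsto:
  assumes "\<And>n. f n \<in> L2 M" "h \<in> L2 M" "g \<in> L2 M" "(\<lambda>n. L2_norm M (\<lambda>p. f n p - h p)) \<longlonglongrightarrow> 0"
  shows "(\<lambda>n. IP (f n) g) \<longlonglongrightarrow> IP h g"
proof (rule LIM_zero_cancel, rule Lim_null_comparison)
  have "\<bar>IP (f n) g - IP h g\<bar> \<le> L2_norm M (\<lambda>p. f n p - h p) * L2_norm M g" for n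
    using abs_IP_le[OF L2_diff[OF assms(1,2)] assms(3), of n] IP_comb[OF assms(1,2,3), of n "-1"] by simp
  then show "\<forall>\<^sub>F n in sequentially. norm (IP (f n) g - IP h g) \<le> L2_norm M (\<lambda>p. f n p - h p) * L2_norm M g"
    by simp
  show "(\<lambda>n. L2_norm M (\<lambda>p. f n p - h p) * L2_norm M g) \<longlonglongrightarrow> 0"
    by (rule tendsto_mult_left_zero[OF assms(4)])
qed

text \<open>\<open>CV\<close> compensates the negative part of \<open>V\<close>, and the extra 1
  makes the shifted form \<open>Qc\<close> dominate the squared \<open>L2\<close> norm together with
  the energy without potential.\<close>

definition cc :: real where "cc = CV + 1"
definition Bc where "Bc f g = BB f g + cc * IP f g"
abbreviation Qc where "Qc f \<equiv> Bc f f"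

lemma Bc_sym: "Bc f g = Bc g f" by (simp add: Bc_def BB_sym[of f g] IP_sym[of f g])

lemma Bc_comb: "f \<in> test_functions L Y \<Longrightarrow> g \<in> test_functions L Y \<Longrightarrow> h \<in> test_functions L Y \<Longrightarrow>
    Bc (\<lambda>p. f p + s *\<^sub>R g p) h = Bc f h + s * Bc g h"
  by (simp add: Bc_def BB_comb IP_comb test_L2 algebra_simps)

lemma Qc_comb:
  assumes "f \<in> test_functions L Y" "g \<in> test_functions L Y"
  shows "Qc (\<lambda>p. f p + s *\<^sub>R g p) = Qc f + 2 * s * Bc f g + s\<^sup>2 * Qc g"
  using Bc_comb[OF assms test_comb[OF assms], of s s] Bc_comb[OF assms assms(1), of s] Bc_comb[OF assms assms(2), of s]
    Bc_sym[of f "\<lambda>p. f p + s *\<^sub>R g p"] Bc_sym[of g "\<lambda>p. f p + s *\<^sub>R g p"] Bc_sym[of g f]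
  by (simp add: power2_eq_square algebra_simps)

lemma energy_le_Qc:
  assumes D: "jet_of \<phi> D Kx Ky"
  shows "(LINT p|M. D 1 0 p \<bullet> D 1 0 p + (q (fst p))\<^sup>2 * (r (snd p))\<^sup>2 * (D 0 1 p \<bullet> D 0 1 p) + D 0 0 p \<bullet> D 0 0 p) \<le> Qc \<phi>"
proof -
  note int = jet_integrable[OF D D]
  have "Qc \<phi> = (LINT p|M. (D 1 0 p \<bullet> D 1 0 p + (q (fst p))\<^sup>2 * (r (snd p))\<^sup>2 * (D 0 1 p \<bullet> D 0 1 p) + V0 (fst p) * (D 0 0 p \<bullet> D 0 0 p)) + cc * (D 0 0 p \<bullet> D 0 0 p))"
  proof -
    have "IP \<phi> \<phi> = (LINT p|M. D 0 0 p \<bullet> D 0 0 p)" by (simp add: IP_def jet_ofD(1)[OF D])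
    then show ?thesis
      by (simp only: Bc_def BB_jet(1)[OF D D] integral_linear_comb[OF BB_jet(2)[OF D D] int(1)])
  qed
  also have "\<dots> \<ge> (LINT p|M. D 1 0 p \<bullet> D 1 0 p + (q (fst p))\<^sup>2 * (r (snd p))\<^sup>2 * (D 0 1 p \<bullet> D 0 1 p) + D 0 0 p \<bullet> D 0 0 p)"
  proof (rule integral_mono)
    show "integrable M (\<lambda>p. D 1 0 p \<bullet> D 1 0 p + (q (fst p))\<^sup>2 * (r (snd p))\<^sup>2 * (D 0 1 p \<bullet> D 0 1 p) + D 0 0 p \<bullet> D 0 0 p)"
      by (intro Bochner_Integration.integrable_add int)
    show "integrable M (\<lambda>p. (D 1 0 p \<bullet> D 1 0 p + (q (fst p))\<^sup>2 * (r (snd p))\<^sup>2 * (D 0 1 p \<bullet> D 0 1 p) + V0 (fst p) * (D 0 0 p \<bullet> D 0 0 p)) + cc * (D 0 0 p \<bullet> D 0 0 p))"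
      by (intro Bochner_Integration.integrable_add Bochner_Integration.integrable_mult_right int)
    fix p
    have "1 * (D 0 0 p \<bullet> D 0 0 p) \<le> (V0 (fst p) + cc) * (D 0 0 p \<bullet> D 0 0 p)"
      using V0(2)[of "fst p"] by (intro mult_right_mono) (auto simp: cc_def)
    then show "D 1 0 p \<bullet> D 1 0 p + (q (fst p))\<^sup>2 * (r (snd p))\<^sup>2 * (D 0 1 p \<bullet> D 0 1 p) + D 0 0 p \<bullet> D 0 0 p
      \<le> (D 1 0 p \<bullet> D 1 0 p + (q (fst p))\<^sup>2 * (r (snd p))\<^sup>2 * (D 0 1 p \<bullet> D 0 1 p) + V0 (fst p) * (D 0 0 p \<bullet> D 0 0 p)) + cc * (D 0 0 p \<bullet> D 0 0 p)"
      by (simp add: algebra_simps)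
  qed
  finally show ?thesis .
qed

lemma IP_le_Qc:
  assumes "\<phi> \<in> test_functions L Y"
  shows "IP \<phi> \<phi> \<le> Qc \<phi>"
proof -
  obtain D Kx Ky where D: "jet_of \<phi> D Kx Ky" using test_jet[OF assms] by blast
  note int = jet_integrable[OF D D]
  have "IP \<phi> \<phi> \<le> (LINT p|M. D 1 0 p \<bullet> D 1 0 p + (q (fst p))\<^sup>2 * (r (snd p))\<^sup>2 * (D 0 1 p \<bullet> D 0 1 p) + D 0 0 p \<bullet> D 0 0 p)"
    unfolding IP_def jet_ofD(1)[OF D, symmetric]
    by (rule integral_mono) (auto intro!: Bochner_Integration.integrable_add int int(4)[unfolded One_nat_def] add_nonneg_nonneg mult_nonneg_nonneg)
  with energy_le_Qc[OF D] show ?thesis by simp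
qed

lemma Qc_nonneg: "\<phi> \<in> test_functions L Y \<Longrightarrow> 0 \<le> Qc \<phi>"
  using IP_le_Qc IP_nonneg order_trans by blast

lemma abs_Bc_le:
  assumes "f \<in> test_functions L Y" "g \<in> test_functions L Y"
  shows "\<bar>Bc f g\<bar> \<le> sqrt (Qc f) * sqrt (Qc g)"
proof -
  have "0 \<le> Qc f + 2 * s * Bc f g + s\<^sup>2 * Qc g" for s
    using Qc_nonneg[OF test_comb[OF assms, of s]] Qc_comb[OF assms, of s] by simp
  then have "(Bc f g)\<^sup>2 \<le> Qc f * Qc g" by (rule discriminant_bound) (rule Qc_nonneg[OF assms(2)])
  from real_sqrt_le_mono[OF this] show ?thesis by (simp add: real_sqrt_mult)
qed

lemma sqrt_Qc_triangle:
  assumes "f \<in> test_functions L Y" "g \<in> test_functions L Y"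
  shows "sqrt (Qc f) \<le> sqrt (Qc (\<lambda>p. f p - g p)) + sqrt (Qc g)"
proof -
  let ?h = "\<lambda>p. f p - g p"
  have h: "?h \<in> test_functions L Y" by (rule test_diff[OF assms])
  have "Qc f = Qc ?h + 2 * Bc ?h g + Qc g" using Qc_comb[OF h assms(2), of 1] by simp
  also have "\<dots> \<le> Qc ?h + 2 * (sqrt (Qc ?h) * sqrt (Qc g)) + Qc g" using abs_Bc_le[OF h assms(2)] by simp
  also have "\<dots> = (sqrt (Qc ?h) + sqrt (Qc g))\<^sup>2"
    using Qc_nonneg[OF h] Qc_nonneg[OF assms(2)] by (simp add: power2_sum)
  finally have "sqrt (Qc f) \<le> sqrt ((sqrt (Qc ?h) + sqrt (Qc g))\<^sup>2)" by (rule real_sqrt_le_mono)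
  then show ?thesis using Qc_nonneg[OF h] Qc_nonneg[OF assms(2)] by simp
qed

text \<open>The constant \<open>c\<close> in the form domain is any admissible one. Admissibility
  bounds the squared \<open>L2\<close> norm by the form shifted by \<open>c\<close>, so passing to
  \<open>cc\<close> costs at most the factor \<open>1 + \<bar>cc - c\<bar>\<close>.\<close>

lemma form_domain_sequence:
  assumes "f \<in> form_domain L Y q r V"
  shows "f \<in> L2 M" "\<exists>\<phi>. (\<forall>n. \<phi> n \<in> test_functions L Y) \<and>
    (\<forall>e>0. \<exists>N. \<forall>m\<ge>N. \<forall>n\<ge>N. Qc (\<lambda>p. \<phi> m p - \<phi> n p) < e) \<and> (\<lambda>n. L2_norm M (\<lambda>p. \<phi> n p - f p)) \<longlonglongrightarrow> 0"
proof -
  obtain c \<phi> where low: "\<And>\<psi>. \<psi> \<in> test_functions L Y \<Longrightarrow> BB \<psi> \<psi> + c * IP \<psi> \<psi> \<ge> IP \<psi> \<psi>"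
    and t: "\<And>n. \<phi> n \<in> test_functions L Y"
    and C: "\<And>e. e > 0 \<Longrightarrow> \<exists>N. \<forall>m\<ge>N. \<forall>n\<ge>N. form_norm L Y q r V c (\<lambda>p. \<phi> m p - \<phi> n p) < e"
    and lim: "(\<lambda>n. L2_norm M (\<lambda>p. \<phi> n p - f p)) \<longlonglongrightarrow> 0" and f: "f \<in> L2 M"
    using assms unfolding form_domain_def by (auto simp: grushin_form_BB L2_norm_IP)
  show "f \<in> L2 M" by (rule f)
  have "\<exists>N. \<forall>m\<ge>N. \<forall>n\<ge>N. Qc (\<lambda>p. \<phi> m p - \<phi> n p) < e" if e: "e > 0" for e
  proof -
    let ?k = "1 + \<bar>cc - c\<bar>"
    obtain N where N: "\<And>m n. m \<ge> N \<Longrightarrow> n \<ge> N \<Longrightarrow> form_norm L Y q r V c (\<lambda>p. \<phi> m p - \<phi> n p) < sqrt (e / ?k)"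
      using C[of "sqrt (e / ?k)"] e by (auto simp: add_pos_nonneg)
    have "Qc (\<lambda>p. \<phi> m p - \<phi> n p) < e" if mn: "m \<ge> N" "n \<ge> N" for m n
    proof -
      let ?d = "\<lambda>p. \<phi> m p - \<phi> n p"
      have d: "?d \<in> test_functions L Y" by (rule test_diff[OF t t])
      let ?x = "BB ?d ?d + c * IP ?d ?d"
      have "sqrt ?x < sqrt (e / ?k)"
        using N[OF mn] grushin_form_BB[OF d] by (simp add: form_norm_def L2_norm_IP)
      then have x: "?x < e / ?k" by simp
      have "Qc ?d = ?x + (cc - c) * IP ?d ?d" by (simp add: Bc_def algebra_simps)
      also have "\<dots> \<le> ?x + \<bar>cc - c\<bar> * ?x"
        using low[OF d] IP_nonneg[of ?d] by (intro add_left_mono mult_mono) auto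
      also have "\<dots> = ?x * ?k" by (simp add: algebra_simps)
      also have "\<dots> < e" using x by (simp add: pos_less_divide_eq[symmetric] add_pos_nonneg)
      finally show ?thesis .
    qed
    then show ?thesis by blast
  qed
  with t lim show "\<exists>\<phi>. (\<forall>n. \<phi> n \<in> test_functions L Y) \<and>
    (\<forall>e>0. \<exists>N. \<forall>m\<ge>N. \<forall>n\<ge>N. Qc (\<lambda>p. \<phi> m p - \<phi> n p) < e) \<and> (\<lambda>n. L2_norm M (\<lambda>p. \<phi> n p - f p)) \<longlonglongrightarrow> 0"
    by blast
qed

lemma form_domainI:
  assumes f: "f \<in> L2 M" and t: "\<And>n. \<phi> n \<in> test_functions L Y"
    and C: "\<And>e. e > 0 \<Longrightarrow> \<exists>N. \<forall>m\<ge>N. \<forall>n\<ge>N. sqrt (Qc (\<lambda>p. \<phi> m p - \<phi> n p)) < e"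
    and lim: "(\<lambda>n. L2_norm M (\<lambda>p. \<phi> n p - f p)) \<longlonglongrightarrow> 0"
  shows "f \<in> form_domain L Y q r V"
proof -
  have n: "form_norm L Y q r V cc (\<lambda>p. \<phi> m p - \<phi> n p) = sqrt (Qc (\<lambda>p. \<phi> m p - \<phi> n p))" for m n
    using grushin_form_BB[OF test_diff[OF t t, of m n]] by (simp add: form_norm_def L2_norm_IP Bc_def)
  have "IP \<psi> \<psi> \<le> grushin_form L Y q r V \<psi> + cc * IP \<psi> \<psi>" if "\<psi> \<in> test_functions L Y" for \<psi>
    using IP_le_Qc[OF that] grushin_form_BB[OF that] by (simp add: Bc_def)
  then show ?thesis unfolding form_domain_def
    using f t C lim by (auto simp: L2_norm_IP n intro!: exI[of _ cc] exI[of _ \<phi>])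
qed

lemma Re_L2_inner: "f \<in> L2 M \<Longrightarrow> g \<in> L2 M \<Longrightarrow> Re (L2_inner M f g) = IP f g"
proof -
  assume fg: "f \<in> L2 M" "g \<in> L2 M"
  have "integrable M (\<lambda>p. f p * cnj (g p))"
  proof (rule Bochner_Integration.integrable_bound)
    show "integrable M (\<lambda>p. (cmod (f p))\<^sup>2 + (cmod (g p))\<^sup>2)" using fg by (auto simp: L2_def)
    show "(\<lambda>p. f p * cnj (g p)) \<in> borel_measurable M"
      using L2D(1)[OF fg(1)] L2D(1)[OF fg(2)] borel_measurable_continuous_onI[OF continuous_on_cnj[OF continuous_on_id]]
      by (intro borel_measurable_times) (auto intro: measurable_compose)
    have "cmod a * cmod b \<le> (cmod a)\<^sup>2 + (cmod b)\<^sup>2" for a b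
      using sum_squares_bound[of "cmod a" "cmod b"] mult_nonneg_nonneg[OF norm_ge_zero[of a] norm_ge_zero[of b]] by linarith
    then show "AE p in M. norm (f p * cnj (g p)) \<le> norm ((cmod (f p))\<^sup>2 + (cmod (g p))\<^sup>2)"
      by (intro AE_I2) (simp add: norm_mult)
  qed
  then have "Re (L2_inner M f g) = (LINT p|M. Re (f p * cnj (g p)))"
    unfolding L2_inner_def by (rule integral_Re[symmetric])
  then show ?thesis by (simp add: IP_def inner_complex_def)
qed

text \<open>The energy of an element of the domain is the limit of the energies of approximating test
  functions, so that estimates for test functions carry over.\<close>

lemma friedrichs_estimates:
  assumes F: "friedrichs_extension L Y q r V f h"
  shows "0 \<le> cc * IP f f + IP h f"
    and "g \<in> test_functions L Y \<Longrightarrow> (\<And>\<phi>. \<phi> \<in> test_functions L Y \<Longrightarrow> \<bar>BB \<phi> g - l * IP \<phi> g\<bar> \<le> \<delta> * (1 + Qc \<phi>)) \<Longrightarrow>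
      \<bar>IP h g - l * IP f g\<bar> \<le> \<delta> * (1 + (cc * IP f f + IP h f))"
proof -
  have fd: "f \<in> form_domain L Y q r V" and h: "h \<in> L2 M"
    and adj: "\<And>\<psi>. \<psi> \<in> test_functions L Y \<Longrightarrow> L2_inner M f (grushin_operator q r V \<psi>) = L2_inner M h \<psi>"
    using F by (auto simp: friedrichs_extension_def)
  have f: "f \<in> L2 M" using form_domain_sequence(1)[OF fd] .
  obtain \<phi> where t: "\<And>n. \<phi> n \<in> test_functions L Y"
    and C: "\<And>e. e > 0 \<Longrightarrow> \<exists>N. \<forall>m\<ge>N. \<forall>n\<ge>N. Qc (\<lambda>p. \<phi> m p - \<phi> n p) < e"
    and lim: "(\<lambda>n. L2_norm M (\<lambda>p. \<phi> n p - f p)) \<longlonglongrightarrow> 0"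
    using form_domain_sequence(2)[OF fd] by blast
  note tL = test_L2[OF t]
  \<comment> \<open>\<open>h\<close> is the image of \<open>f\<close> under the adjoint of the
    operator on test functions, so Green's formula makes the pairing with \<open>h\<close> a limit
    of values of the form.\<close>
  have hg: "(\<lambda>k. BB (\<phi> k) g) \<longlonglongrightarrow> IP h g" if g: "g \<in> test_functions L Y" for g
  proof -
    have "(\<lambda>k. IP (\<phi> k) (grushin_operator q r V g)) \<longlonglongrightarrow> IP f (grushin_operator q r V g)"
      by (rule IP_tendsto[OF tL f grushin_operator_L2[OF g] lim])
    moreover have "IP f (grushin_operator q r V g) = IP h g"
      using adj[OF g] Re_L2_inner[OF f grushin_operator_L2[OF g]] Re_L2_inner[OF h test_L2[OF g]] by simp
    ultimately show ?thesis by (simp add: IP_grushin_operator[OF g t])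
  qed
  have fg: "(\<lambda>k. IP (\<phi> k) g) \<longlonglongrightarrow> IP f g" if "g \<in> L2 M" for g
    by (rule IP_tendsto[OF tL f that lim])
  obtain N0 where N0: "\<And>m n. m \<ge> N0 \<Longrightarrow> n \<ge> N0 \<Longrightarrow> Qc (\<lambda>p. \<phi> m p - \<phi> n p) < 1" using C[of 1] by auto
  define B where "B = 1 + sqrt (Qc (\<phi> N0))"
  have Bb: "sqrt (Qc (\<phi> m)) \<le> B" if "m \<ge> N0" for m
  proof -
    have "sqrt (Qc (\<lambda>p. \<phi> m p - \<phi> N0 p)) \<le> 1" using N0[OF that order_refl] by simp
    with sqrt_Qc_triangle[OF t t, of m N0] show ?thesis unfolding B_def by linarith
  qed
  have B1: "B \<ge> 1" using Qc_nonneg[OF t, of N0] by (simp add: B_def)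
  define E where "E = cc * IP f f + IP h f"
  have Elim: "(\<lambda>m. IP h (\<phi> m) + cc * IP f (\<phi> m)) \<longlonglongrightarrow> E"
  proof -
    have e: "IP h (\<phi> m) = IP (\<phi> m) h" "IP f (\<phi> m) = IP (\<phi> m) f" "E = IP f h + cc * IP f f" for m
      by (auto simp: E_def intro: IP_sym)
    show ?thesis unfolding e by (intro tendsto_intros fg f h)
  qed
  \<comment> \<open>For fixed \<open>m\<close> the difference is the limit over \<open>k\<close> of
    \<open>Bc (\<phi> m - \<phi> k) (\<phi> m)\<close>. Cauchy-Schwarz makes it small uniformly, as
    the sequence is Cauchy for the form and \<open>B\<close> bounds its form norms.\<close>
  have Qlim: "(\<lambda>m. Qc (\<phi> m)) \<longlonglongrightarrow> E"
  proof -
    have "(\<lambda>m. Qc (\<phi> m) - (IP h (\<phi> m) + cc * IP f (\<phi> m))) \<longlonglongrightarrow> 0"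
    proof (rule LIMSEQ_I)
      fix e :: real assume e: "e > 0"
      let ?e = "(e / (2 * B))\<^sup>2"
      obtain N where N: "\<And>m n. m \<ge> N \<Longrightarrow> n \<ge> N \<Longrightarrow> Qc (\<lambda>p. \<phi> m p - \<phi> n p) < ?e"
        using C[of ?e] e B1 by auto
      have "\<bar>Qc (\<phi> m) - (IP h (\<phi> m) + cc * IP f (\<phi> m))\<bar> \<le> e / 2" if m: "m \<ge> max N N0" for m
      proof (rule LIMSEQ_le_const2)
        show "(\<lambda>k. \<bar>Qc (\<phi> m) - (BB (\<phi> k) (\<phi> m) + cc * IP (\<phi> k) (\<phi> m))\<bar>) \<longlonglongrightarrow> \<bar>Qc (\<phi> m) - (IP h (\<phi> m) + cc * IP f (\<phi> m))\<bar>"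
          by (intro tendsto_intros hg fg t tL)
        have "\<bar>Qc (\<phi> m) - (BB (\<phi> k) (\<phi> m) + cc * IP (\<phi> k) (\<phi> m))\<bar> \<le> e / 2" if k: "k \<ge> N" for k
        proof -
          let ?d = "\<lambda>p. \<phi> k p - \<phi> m p"
          have "Bc ?d (\<phi> m) = Bc (\<phi> k) (\<phi> m) - Qc (\<phi> m)" using Bc_comb[OF t[of k] t[of m] t[of m], of "-1"] by simp
          then have "\<bar>Qc (\<phi> m) - (BB (\<phi> k) (\<phi> m) + cc * IP (\<phi> k) (\<phi> m))\<bar> = \<bar>Bc ?d (\<phi> m)\<bar>"
            by (simp add: Bc_def)
          also have "\<dots> \<le> sqrt (Qc ?d) * sqrt (Qc (\<phi> m))" by (rule abs_Bc_le[OF test_diff[OF t t] t])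
          also have "\<dots> \<le> e / (2 * B) * B"
          proof (rule mult_mono)
            have "sqrt (Qc ?d) \<le> sqrt ?e" by (rule real_sqrt_le_mono, rule less_imp_le, rule N) (use k m in auto)
            then show "sqrt (Qc ?d) \<le> e / (2 * B)" using e B1 by simp
          qed (use Bb m e B1 Qc_nonneg[OF t] in auto)
          also have "\<dots> = e / 2" using B1 by simp
          finally show ?thesis .
        qed
        then show "\<exists>N. \<forall>n\<ge>N. \<bar>Qc (\<phi> m) - (BB (\<phi> n) (\<phi> m) + cc * IP (\<phi> n) (\<phi> m))\<bar> \<le> e / 2" by blast
      qed
      then have "norm (Qc (\<phi> n) - (IP h (\<phi> n) + cc * IP f (\<phi> n)) - 0) < e" if "n \<ge> max N N0" for n
        using that e by (smt (verit) real_norm_def field_sum_of_halves)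
      then show "\<exists>no. \<forall>n\<ge>no. norm (Qc (\<phi> n) - (IP h (\<phi> n) + cc * IP f (\<phi> n)) - 0) < e" by blast
    qed
    from tendsto_add[OF this Elim] show ?thesis by simp
  qed
  show "0 \<le> cc * IP f f + IP h f"
    using LIMSEQ_le_const[OF Qlim, of 0] Qc_nonneg[OF t] by (auto simp: E_def)
  assume g: "g \<in> test_functions L Y" and est: "\<And>\<phi>. \<phi> \<in> test_functions L Y \<Longrightarrow> \<bar>BB \<phi> g - l * IP \<phi> g\<bar> \<le> \<delta> * (1 + Qc \<phi>)"
  have "\<bar>IP h g - l * IP f g\<bar> \<le> \<delta> * (1 + E)"
  proof (rule LIMSEQ_le)
    show "(\<lambda>k. \<bar>BB (\<phi> k) g - l * IP (\<phi> k) g\<bar>) \<longlonglongrightarrow> \<bar>IP h g - l * IP f g\<bar>"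
      by (intro tendsto_intros hg fg g test_L2)
    show "(\<lambda>k. \<delta> * (1 + Qc (\<phi> k))) \<longlonglongrightarrow> \<delta> * (1 + E)" by (intro tendsto_intros Qlim)
  qed (use est t in auto)
  then show "\<bar>IP h g - l * IP f g\<bar> \<le> \<delta> * (1 + (cc * IP f f + IP h f))" by (simp add: E_def)
qed

end

section \<open>Transfer to the Hilbert space over the plane\<close>

context grushin_setting
begin

text \<open>Extension by zero is an isometry of \<open>L2 M\<close> onto the subspace of functions
  supported in \<Omega>; this is why the transported semigroup starts with a projection.\<close>

definition J :: "(real \<times> real \<Rightarrow> complex) \<Rightarrow> (real \<times> real) l2" where
  "J f = l2_of (\<lambda>p. indicator (Omega L Y) p *\<^sub>R f p)"

lemma ext_L2: "f \<in> L2 M \<Longrightarrow> (\<lambda>p. indicator (Omega L Y) p *\<^sub>R f p) \<in> L2 lborel"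
proof -
  assume f: "f \<in> L2 M"
  have "(\<lambda>p. indicator (Omega L Y) p *\<^sub>R f p) \<in> borel_measurable lborel"
    using L2D(1)[OF f] Omega_borel by (subst borel_measurable_restrict_space_iff[symmetric]) auto
  moreover have "integrable lborel (\<lambda>p. indicator (Omega L Y) p *\<^sub>R (cmod (f p))\<^sup>2)"
    using L2D(2)[OF f] Omega_borel by (subst integrable_restrict_space[symmetric]) auto
  moreover have "indicator (Omega L Y) p *\<^sub>R (cmod (f p))\<^sup>2 = (cmod (indicator (Omega L Y) p *\<^sub>R f p))\<^sup>2" for p
    by (simp add: indicator_def)
  ultimately show ?thesis by (simp add: L2_def)
qed

lemma J_add: "f \<in> L2 M \<Longrightarrow> g \<in> L2 M \<Longrightarrow> J (\<lambda>p. f p + g p) = J f + J g"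
  unfolding J_def by (subst l2_of_add) (auto intro: ext_L2 simp: scaleR_add_right)

lemma J_diff: "f \<in> L2 M \<Longrightarrow> g \<in> L2 M \<Longrightarrow> J (\<lambda>p. f p - g p) = J f - J g"
  unfolding J_def by (subst l2_of_diff) (auto intro: ext_L2 simp: scaleR_diff_right)

lemma J_scaleR: "f \<in> L2 M \<Longrightarrow> J (\<lambda>p. c *\<^sub>R f p) = c *\<^sub>R J f"
  unfolding J_def by (subst l2_of_scaleR) (auto intro: ext_L2 simp: mult.commute)

lemma J_inner: "f \<in> L2 M \<Longrightarrow> g \<in> L2 M \<Longrightarrow> J f \<bullet> J g = IP f g"
proof -
  assume fg: "f \<in> L2 M" "g \<in> L2 M"
  have "J f \<bullet> J g = (LINT p|lborel. indicator (Omega L Y) p *\<^sub>R (f p \<bullet> g p))"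
    unfolding J_def l2_of_inner[OF ext_L2[OF fg(1)] ext_L2[OF fg(2)]]
    by (auto intro!: Bochner_Integration.integral_cong simp: indicator_def)
  also have "\<dots> = IP f g" unfolding IP_def using Omega_borel by (subst integral_restrict_space) auto
  finally show ?thesis .
qed

lemma J_norm: "f \<in> L2 M \<Longrightarrow> norm (J f) = L2_norm M f"
  by (simp add: norm_eq_sqrt_inner J_inner L2_norm_sqrt)

lemma J_eq_iff: "f \<in> L2 M \<Longrightarrow> g \<in> L2 M \<Longrightarrow> J f = J g \<longleftrightarrow> (AE p in M. f p = g p)"
proof -
  assume fg: "f \<in> L2 M" "g \<in> L2 M"
  have "J f = J g \<longleftrightarrow> (AE p in lborel. indicator (Omega L Y) p *\<^sub>R f p = indicator (Omega L Y) p *\<^sub>R g p)"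
    unfolding J_def by (intro l2_of_eq_iff ext_L2 fg)
  also have "\<dots> \<longleftrightarrow> (AE p in lborel. p \<in> Omega L Y \<longrightarrow> f p = g p)"
    by (intro eventually_subst always_eventually) (auto simp: indicator_def)
  also have "\<dots> \<longleftrightarrow> (AE p in M. f p = g p)"
    using Omega_borel by (subst AE_restrict_space_iff) auto
  finally show ?thesis .
qed

lemma rep_L2_M: "rep_l2 F \<in> L2 M"
proof -
  have F: "rep_l2 F \<in> L2 lborel" by (rule rep_l2_L2)
  have m: "rep_l2 F \<in> borel_measurable M" using L2D(1)[OF F] by (rule measurable_restrict_space1)
  have "integrable lborel (\<lambda>p. indicator (Omega L Y) p *\<^sub>R (cmod (rep_l2 F p))\<^sup>2)"
    using L2D(2)[OF F] Omega_borel by (intro integrable_mult_indicator) auto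
  then have "integrable M (\<lambda>p. (cmod (rep_l2 F p))\<^sup>2)" using Omega_borel by (subst integrable_restrict_space) auto
  with m show ?thesis by (simp add: L2_def)
qed

lemma rep_J: "f \<in> L2 M \<Longrightarrow> AE p in M. rep_l2 (J f) p = f p"
proof -
  assume f: "f \<in> L2 M"
  have "l2_of (rep_l2 (J f)) = l2_of (\<lambda>p. indicator (Omega L Y) p *\<^sub>R f p)" by (simp add: l2_of_rep J_def)
  then have "AE p in lborel. rep_l2 (J f) p = indicator (Omega L Y) p *\<^sub>R f p"
    by (subst (asm) l2_of_eq_iff) (auto intro: rep_l2_L2 ext_L2 f)
  then have "AE p in lborel. p \<in> Omega L Y \<longrightarrow> rep_l2 (J f) p = f p"
    by eventually_elim auto
  then show ?thesis using Omega_borel by (subst AE_restrict_space_iff) auto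
qed

lemma AE_rep_comb: "AE p in M. rep_l2 (F + G) p = rep_l2 F p + rep_l2 G p"
  "AE p in M. rep_l2 (c *\<^sub>R F) p = c *\<^sub>R rep_l2 F p"
proof -
  have "l2_of (rep_l2 (F + G)) = l2_of (\<lambda>p. rep_l2 F p + rep_l2 G p)"
    by (simp add: l2_of_add[symmetric] rep_l2_L2 l2_of_rep)
  then have "AE p in lborel. rep_l2 (F + G) p = rep_l2 F p + rep_l2 G p"
    by (subst (asm) l2_of_eq_iff) (auto intro: rep_l2_L2 L2_add)
  then show "AE p in M. rep_l2 (F + G) p = rep_l2 F p + rep_l2 G p"
    using Omega_borel by (subst AE_restrict_space_iff) auto
  have "l2_of (rep_l2 (c *\<^sub>R F)) = l2_of (\<lambda>p. c *\<^sub>R rep_l2 F p)"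
    by (simp add: l2_of_scaleR[symmetric] rep_l2_L2 l2_of_rep)
  then have "AE p in lborel. rep_l2 (c *\<^sub>R F) p = c *\<^sub>R rep_l2 F p"
    by (subst (asm) l2_of_eq_iff) (auto intro: rep_l2_L2 L2_scaleR)
  then show "AE p in M. rep_l2 (c *\<^sub>R F) p = c *\<^sub>R rep_l2 F p"
    using Omega_borel by (subst AE_restrict_space_iff) auto
qed

end

locale grushin_semigroup = grushin_setting +
  fixes S :: "real \<Rightarrow> (real \<times> real \<Rightarrow> complex) \<Rightarrow> real \<times> real \<Rightarrow> complex"
  assumes S: "semigroup_generated_by_minus (Omega_measure L Y) (friedrichs_extension L Y q r V) S"
begin

lemma
  shows S_L2: "t \<ge> 0 \<Longrightarrow> f \<in> L2 M \<Longrightarrow> S t f \<in> L2 M"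
    and S_lin: "t \<ge> 0 \<Longrightarrow> f \<in> L2 M \<Longrightarrow> g \<in> L2 M \<Longrightarrow>
        AE p in M. S t (\<lambda>p. a * f p + b * g p) p = a * S t f p + b * S t g p"
    and S_bdd: "t \<ge> 0 \<Longrightarrow> \<exists>C. \<forall>f\<in>L2 M. L2_norm M (S t f) \<le> C * L2_norm M f"
    and S_0: "f \<in> L2 M \<Longrightarrow> AE p in M. S 0 f p = f p"
    and S_add: "s \<ge> 0 \<Longrightarrow> t \<ge> 0 \<Longrightarrow> f \<in> L2 M \<Longrightarrow> AE p in M. S (s + t) f p = S s (S t f) p"
    and S_cont: "f \<in> L2 M \<Longrightarrow> ((\<lambda>t. L2_norm M (\<lambda>p. S t f p - f p)) \<longlongrightarrow> 0) (at_right 0)"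
    and S_gen: "semigroup_generator M S f h \<longleftrightarrow> friedrichs_extension L Y q r V f (\<lambda>p. - h p)"
  using S unfolding semigroup_generated_by_minus_def C0_semigroup_def by blast+

lemma J_S_comb:
  assumes "t \<ge> 0" "f \<in> L2 M" "g \<in> L2 M"
  shows "J (S t (\<lambda>p. f p + c *\<^sub>R g p)) = J (S t f) + c *\<^sub>R J (S t g)"
proof -
  have "(\<lambda>p. 1 * f p + of_real c * g p) = (\<lambda>p. f p + c *\<^sub>R g p)" by (simp add: scaleR_conv_of_real)
  then have "AE p in M. S t (\<lambda>p. f p + c *\<^sub>R g p) p = S t f p + c *\<^sub>R S t g p"
    using S_lin[OF assms, of 1 "of_real c"] by (simp add: scaleR_conv_of_real)
  then have "J (S t (\<lambda>p. f p + c *\<^sub>R g p)) = J (\<lambda>p. S t f p + c *\<^sub>R S t g p)"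
    using assms by (subst J_eq_iff) (auto intro!: S_L2 L2_add L2_scaleR)
  also have "\<dots> = J (S t f) + c *\<^sub>R J (S t g)"
    using assms by (simp add: J_add J_scaleR S_L2 L2_scaleR)
  finally show ?thesis .
qed

lemma J_S_cong:
  assumes t: "t \<ge> 0" and f: "f \<in> L2 M" and g: "g \<in> L2 M" and ae: "AE p in M. f p = g p"
  shows "J (S t f) = J (S t g)"
proof -
  obtain C where C: "\<And>f. f \<in> L2 M \<Longrightarrow> L2_norm M (S t f) \<le> C * L2_norm M f" using S_bdd[OF t] by blast
  have d: "(\<lambda>p. f p - g p) \<in> L2 M" by (rule L2_diff[OF f g])
  have "L2_norm M (\<lambda>p. f p - g p) = L2_norm M (\<lambda>p. 0)"
    using ae L2D(1)[OF d] by (intro L2_norm_cong_AE) (auto elim: eventually_mono)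
  then have "L2_norm M (S t (\<lambda>p. f p - g p)) \<le> 0" using C[OF d] by (simp add: L2_norm_def)
  then have "norm (J (S t (\<lambda>p. f p - g p))) \<le> 0" using J_norm[OF S_L2[OF t d]] by simp
  then show ?thesis using J_S_comb[OF t f g, of "-1"] by simp
qed

text \<open>A representative is regarded as a function on \<Omega> before \<open>S\<close> is
  applied, so \<open>U\<close> annihilates functions living outside \<Omega>, and \<open>U 0\<close>
  is the projection onto the range of \<open>J\<close>.\<close>

definition U :: "real \<Rightarrow> (real \<times> real) l2 \<Rightarrow> (real \<times> real) l2" where
  "U t F = J (S t (rep_l2 F))"

lemma U_J: "t \<ge> 0 \<Longrightarrow> f \<in> L2 M \<Longrightarrow> U t (J f) = J (S t f)"
  unfolding U_def by (intro J_S_cong rep_L2_M rep_J)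

lemma U_0: "U 0 F = J (rep_l2 F)"
  unfolding U_def by (subst J_eq_iff) (auto intro: S_L2 rep_L2_M S_0)

sublocale sg: degenerate_semigroup U
proof (rule degenerate_semigroup.intro)
  fix t :: real assume t: "t \<ge> 0"
  obtain C where C: "\<And>f. f \<in> L2 M \<Longrightarrow> L2_norm M (S t f) \<le> C * L2_norm M f" using S_bdd[OF t] by blast
  show "bounded_linear (U t)"
  proof (rule bounded_linear_intro[where K="\<bar>C\<bar>"])
    fix F G :: "(real \<times> real) l2" and c :: real
    have "U t (F + G) = J (S t (\<lambda>p. rep_l2 F p + 1 *\<^sub>R rep_l2 G p))"
      unfolding U_def using AE_rep_comb(1)[of F G] by (intro J_S_cong t rep_L2_M L2_add L2_scaleR) auto
    then show "U t (F + G) = U t F + U t G"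
      unfolding U_def J_S_comb[OF t rep_L2_M rep_L2_M] by simp
    have z: "J (S t (\<lambda>p. 0)) = 0"
    proof -
      have "L2_norm M (S t (\<lambda>p. 0)) \<le> 0" using C[OF L2_zero] by (simp add: L2_norm_def)
      then have "norm (J (S t (\<lambda>p. 0))) \<le> 0" using J_norm[OF S_L2[OF t L2_zero]] by simp
      then show ?thesis by simp
    qed
    have "U t (c *\<^sub>R F) = J (S t (\<lambda>p. 0 + c *\<^sub>R rep_l2 F p))"
      unfolding U_def using AE_rep_comb(2)[of c F] by (intro J_S_cong t rep_L2_M L2_add L2_scaleR L2_zero) auto
    then show "U t (c *\<^sub>R F) = c *\<^sub>R U t F"
      unfolding U_def J_S_comb[OF t L2_zero rep_L2_M] z by simp
    have "norm (U t F) \<le> C * L2_norm M (rep_l2 F)"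
      unfolding U_def using J_norm[OF S_L2[OF t rep_L2_M]] C[OF rep_L2_M] by simp
    also have "\<dots> \<le> \<bar>C\<bar> * norm F"
    proof (rule mult_mono)
      have "(L2_norm M (rep_l2 F))\<^sup>2 \<le> (norm F)\<^sup>2"
      proof -
        have F: "rep_l2 F \<in> L2 lborel" by (rule rep_l2_L2)
        have "(norm F)\<^sup>2 = (LINT p|lborel. rep_l2 F p \<bullet> rep_l2 F p)"
          using l2_of_inner[OF F F] by (simp add: l2_of_rep power2_norm_eq_inner)
        moreover have "(L2_norm M (rep_l2 F))\<^sup>2 = (LINT p|lborel. indicator (Omega L Y) p *\<^sub>R (rep_l2 F p \<bullet> rep_l2 F p))"
          unfolding L2_norm_IP IP_def using Omega_borel by (subst integral_restrict_space) auto
        moreover have "\<dots> \<le> (LINT p|lborel. rep_l2 F p \<bullet> rep_l2 F p)"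
          using L2_inner_integrable[OF F F] Omega_borel
          by (intro integral_mono integrable_mult_indicator) (auto simp: indicator_def)
        ultimately show ?thesis by simp
      qed
      then show "L2_norm M (rep_l2 F) \<le> norm F" by (rule power2_le_imp_le) simp
    qed (auto simp: L2_norm_nonneg)
    finally show "norm (U t F) \<le> norm F * \<bar>C\<bar>" by (simp add: mult.commute)
  qed
next
  fix s t :: real and F :: "(real \<times> real) l2" assume st: "s \<ge> 0" "t \<ge> 0"
  have "U (s + t) F = J (S s (S t (rep_l2 F)))"
    unfolding U_def using S_add[OF st rep_L2_M] st by (subst J_eq_iff) (auto intro!: S_L2 rep_L2_M)
  also have "\<dots> = U s (U t F)" using U_J[OF st(1) S_L2[OF st(2) rep_L2_M]] by (simp add: U_def)
  finally show "U (s + t) F = U s (U t F)" .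
next
  fix F :: "(real \<times> real) l2"
  have "((\<lambda>t. norm (U t F - U 0 F)) \<longlongrightarrow> 0) (at_right 0)"
  proof (rule Lim_transform_eventually[OF S_cont[OF rep_L2_M[of F]]])
    show "\<forall>\<^sub>F t in at_right 0. L2_norm M (\<lambda>p. S t (rep_l2 F) p - rep_l2 F p) = norm (U t F - U 0 F)"
      unfolding eventually_at_filter
    proof (intro always_eventually allI impI)
      fix t :: real assume "t \<in> {0<..}"
      then have t: "t \<ge> 0" by simp
      show "L2_norm M (\<lambda>p. S t (rep_l2 F) p - rep_l2 F p) = norm (U t F - U 0 F)"
        unfolding U_0 unfolding U_def J_diff[OF S_L2[OF t rep_L2_M] rep_L2_M, symmetric]
        by (rule J_norm[symmetric]) (intro L2_diff S_L2 t rep_L2_M)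
    qed
  qed
  then show "((\<lambda>t. U t F) \<longlongrightarrow> U 0 F) (at_right 0)"
    by (simp add: tendsto_norm_zero_iff LIM_zero_iff)
qed

text \<open>The limit \<open>H\<close> lies in the range of \<open>J\<close> because
  \<open>U 0\<close> is continuous and fixes all difference quotients. The sign comes from
  \<open>S\<close> being generated by minus the Friedrichs extension.\<close>

lemma gen_friedrichs:
  assumes g: "sg.gen F H"
  shows "\<exists>f h. F = J f \<and> H = J h \<and> f \<in> L2 M \<and> h \<in> L2 M \<and> friedrichs_extension L Y q r V f (\<lambda>p. - h p)"
proof -
  define f where "f = rep_l2 F"
  define h where "h = rep_l2 H"
  have f: "f \<in> L2 M" and h: "h \<in> L2 M" by (auto simp: f_def h_def rep_L2_M)
  have lim: "((\<lambda>t. (U t F - F) /\<^sub>R t) \<longlongrightarrow> H) (at_right 0)" and F0: "U 0 F = F" using g by (auto simp: sg.gen_def)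
  have F: "F = J f" using F0 by (simp add: U_0 f_def)
  have "U 0 H = H"
  proof -
    interpret U0: bounded_linear "U 0" by (rule sg.lin) simp
    have "((\<lambda>t. U 0 ((U t F - F) /\<^sub>R t)) \<longlongrightarrow> U 0 H) (at_right 0)" by (rule U0.tendsto[OF lim])
    moreover have "\<forall>\<^sub>F t in at_right 0. U 0 ((U t F - F) /\<^sub>R t) = (U t F - F) /\<^sub>R t"
      unfolding eventually_at_filter
      by (intro always_eventually) (simp add: U0.scaleR U0.diff sg.U_0_absorb F0)
    ultimately have "((\<lambda>t. (U t F - F) /\<^sub>R t) \<longlongrightarrow> U 0 H) (at_right 0)" by (rule Lim_transform_eventually)
    from tendsto_unique[OF _ this lim] show ?thesis by simp
  qed
  then have H: "H = J h" by (simp add: U_0 h_def)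
  have "semigroup_generator M S f h" unfolding semigroup_generator_def
  proof (intro conjI f h)
    have "((\<lambda>t. norm ((U t F - F) /\<^sub>R t - H)) \<longlongrightarrow> 0) (at_right 0)"
      using lim by (simp add: tendsto_norm_zero_iff LIM_zero_iff)
    moreover have "\<forall>\<^sub>F t in at_right 0. norm ((U t F - F) /\<^sub>R t - H) = L2_norm M (\<lambda>p. (S t f p - f p) / of_real t - h p)"
      unfolding eventually_at_filter
    proof (intro always_eventually allI impI)
      fix t :: real assume "t \<in> {0<..}"
      then have t: "t \<ge> 0" by simp
      note Sf = S_L2[OF t f]
      have "(U t F - F) /\<^sub>R t - H = J (\<lambda>p. inverse t *\<^sub>R (S t f p - f p) - h p)"
        unfolding F U_J[OF t f] H using Sf f h by (simp add: J_diff J_scaleR L2_diff L2_scaleR)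
      also have "norm \<dots> = L2_norm M (\<lambda>p. inverse t *\<^sub>R (S t f p - f p) - h p)"
        by (intro J_norm L2_diff L2_scaleR Sf f h)
      also have "(\<lambda>p. inverse t *\<^sub>R (S t f p - f p) - h p) = (\<lambda>p. (S t f p - f p) / of_real t - h p)"
        by (simp add: scaleR_conv_of_real divide_inverse mult.commute of_real_inverse)
      finally show "norm ((U t F - F) /\<^sub>R t - H) = L2_norm M (\<lambda>p. (S t f p - f p) / of_real t - h p)" .
    qed
    ultimately show "((\<lambda>t. L2_norm M (\<lambda>p. (S t f p - f p) / of_real t - h p)) \<longlongrightarrow> 0) (at_right 0)"
      by (rule Lim_transform_eventually)
  qed
  with F H f h S_gen show ?thesis by blast
qed

text \<open>The constant of \<open>weak_eigenvector\<close> for \<open>c = cc\<close>.\<close>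

definition decay_const :: "real \<Rightarrow> real" where
  "decay_const T = exp (cc * T) * (1/2 + (1 + cc * exp (2 * cc * T)) * T)"

lemma cc_pos: "cc \<ge> 1" using CV(1) by (simp add: cc_def)

lemma decay_const_nonneg: "T \<ge> 0 \<Longrightarrow> decay_const T \<ge> 0"
  using cc_pos by (auto simp: decay_const_def intro!: mult_nonneg_nonneg add_nonneg_nonneg)

text \<open>For \<open>H = - G f\<close> the quantity
  \<open>cc * (F \<bullet> F) - F \<bullet> H\<close> is the shifted energy of \<open>f\<close>. An
  error bound by \<open>Qc\<close> on test functions, extended to the domain of \<open>G\<close>,
  thus has the form that \<open>weak_eigenvector\<close> accepts.\<close>

lemma semigroup_quasimode:
  assumes g: "g \<in> test_functions L Y"
    and est: "\<And>\<phi>. \<phi> \<in> test_functions L Y \<Longrightarrow> \<bar>BB \<phi> g - l * IP \<phi> g\<bar> \<le> \<delta> * (1 + Qc \<phi>)"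
    and l: "- cc \<le> l" and \<delta>: "\<delta> \<ge> 0" and t: "0 \<le> t" "t \<le> T" and v: "v \<in> L2 M"
  shows "\<bar>IP (S t v) g - exp (- l * t) * IP v g\<bar> \<le> \<delta> * decay_const T * L2_norm M v"
proof -
  have gL: "g \<in> L2 M" by (rule test_L2[OF g])
  have U0: "U 0 (J v) = J v" using U_J[OF order_refl v] S_0[OF v] J_eq_iff[OF S_L2[OF order_refl v] v] by simp
  have "\<bar>U t (J v) \<bullet> J g - exp (- l * t) * (U 0 (J v) \<bullet> J g)\<bar> \<le> \<delta> * decay_const T * norm (U 0 (J v))"
    unfolding decay_const_def
  proof (rule sg.weak_eigenvector[OF _ _ _ l \<delta> t])
    show "cc \<ge> 0" using cc_pos by simp
    fix F H assume "sg.gen F H"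
    then obtain f h where fh: "F = J f" "H = J h" "f \<in> L2 M" "h \<in> L2 M"
      "friedrichs_extension L Y q r V f (\<lambda>p. - h p)" using gen_friedrichs by blast
    have neg: "IP (\<lambda>p. - h p) w = - IP h w" for w by (simp add: IP_def)
    note est1 = friedrichs_estimates(1)[OF fh(5)] and est2 = friedrichs_estimates(2)[OF fh(5) g est]
    show "0 \<le> cc * (F \<bullet> F) - F \<bullet> H"
      using est1 fh by (simp add: J_inner neg IP_sym[of f h])
    have "\<bar>- IP h g - l * IP f g\<bar> \<le> \<delta> * (1 + (cc * IP f f - IP h f))" using est2 by (simp add: neg)
    then show "\<bar>H \<bullet> J g + l * (F \<bullet> J g)\<bar> \<le> \<delta> * (1 + (cc * (F \<bullet> F) - F \<bullet> H))"
      using fh gL by (simp add: J_inner IP_sym[of f h] abs_le_iff algebra_simps)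
  qed
  then show ?thesis unfolding U0 unfolding U_J[OF t(1) v] using v gL S_L2[OF t(1) v] by (simp add: J_inner J_norm)
qed

end

section \<open>Duality between the control and a quasimode\<close>

lemma L2_extend:
  assumes A: "A \<in> sets borel" and f: "f \<in> L2 (restrict_space lborel A)"
  shows "(\<lambda>p. indicator A p *\<^sub>R f p) \<in> L2 lborel"
proof -
  have "(\<lambda>p. indicator A p *\<^sub>R f p) \<in> borel_measurable lborel"
    using L2D(1)[OF f] A by (subst borel_measurable_restrict_space_iff[symmetric]) auto
  moreover have "integrable lborel (\<lambda>p. indicator A p *\<^sub>R (cmod (f p))\<^sup>2)"
    using L2D(2)[OF f] A by (subst integrable_restrict_space[symmetric]) auto
  moreover have "indicator A p *\<^sub>R (cmod (f p))\<^sup>2 = (cmod (indicator A p *\<^sub>R f p))\<^sup>2" for p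
    by (simp add: indicator_def)
  ultimately show ?thesis by (simp add: L2_def)
qed

context grushin_setting
begin

lemma IP_sum:
  assumes "finite I" "\<And>i. i \<in> I \<Longrightarrow> v i \<in> L2 M" "g \<in> L2 M"
  shows "IP (\<lambda>p. \<Sum>i\<in>I. c i *\<^sub>R v i p) g = (\<Sum>i\<in>I. c i * IP (v i) g)"
  unfolding IP_def inner_sum_left inner_scaleR_left
  using assms by (subst Bochner_Integration.integral_sum) (auto intro: L2_inner_integrable)

lemma IP_diff: "f \<in> L2 M \<Longrightarrow> g \<in> L2 M \<Longrightarrow> h \<in> L2 M \<Longrightarrow> IP (\<lambda>p. f p - g p) h = IP f h - IP g h"
  using IP_comb[of f g h "-1"] by simp

text \<open>Pairing with \<open>g\<close> commutes with the integrals of the approximating simple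
  functions; the approximation error costs its integral over time multiplied by the norm of
  \<open>g\<close>. The pairing is integrated through its measurable majorant
  \<open>k\<close>.\<close>

lemma has_L2_integral_inner_bound:
  assumes I: "has_L2_integral N M G I" and g: "g \<in> L2 M"
    and ae: "AE t in N. G t \<in> L2 M \<and> \<bar>IP (G t) g\<bar> \<le> k t"
    and k: "k \<in> borel_measurable N" "\<And>t. 0 \<le> k t" and fin: "(\<integral>\<^sup>+ t. ennreal (k t) \<partial>N) \<le> ennreal K" and K: "K \<ge> 0"
  shows "\<bar>IP I g\<bar> \<le> K"
proof -
  obtain m :: "nat \<Rightarrow> nat" and A v where IL: "I \<in> L2 M"
    and Av: "\<And>n i. i < m n \<Longrightarrow> A n i \<in> sets N \<and> emeasure N (A n i) < \<infinity> \<and> v n i \<in> L2 M"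
    and meas: "\<And>n. (\<lambda>t. L2_norm M (\<lambda>p. G t p - (\<Sum>i<m n. indicator (A n i) t * v n i p))) \<in> borel_measurable N"
    and l1: "(\<lambda>n. \<integral>\<^sup>+ t. L2_norm M (\<lambda>p. G t p - (\<Sum>i<m n. indicator (A n i) t * v n i p)) \<partial>N) \<longlonglongrightarrow> 0"
    and l2: "(\<lambda>n. L2_norm M (\<lambda>p. I p - (\<Sum>i<m n. measure N (A n i) *\<^sub>R v n i p))) \<longlonglongrightarrow> 0"
    using I unfolding has_L2_integral_def by blast
  define s where "s n t p = (\<Sum>i<m n. indicator (A n i) t *\<^sub>R v n i p)" for n t p
  define d where "d n t = L2_norm M (\<lambda>p. G t p - s n t p)" for n t
  define Ja where "Ja n p = (\<Sum>i<m n. measure N (A n i) *\<^sub>R v n i p)" for n p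
  have s_eq: "(\<Sum>i<m n. indicator (A n i) t * v n i p) = s n t p" for n t p
    unfolding s_def by (intro sum.cong) (auto simp: indicator_def)
  have dm: "d n \<in> borel_measurable N" for n using meas[of n] unfolding s_eq d_def by simp
  have dl: "(\<lambda>n. \<integral>\<^sup>+ t. ennreal (d n t) \<partial>N) \<longlonglongrightarrow> 0" using l1 unfolding s_eq d_def by simp
  have sL: "s n t \<in> L2 M" for n t unfolding s_def using Av by (intro L2_sum L2_scaleR) auto
  have JL: "Ja n \<in> L2 M" for n unfolding Ja_def using Av by (intro L2_sum L2_scaleR) auto
  have "(\<lambda>n. L2_norm M (\<lambda>p. Ja n p - I p)) \<longlonglongrightarrow> 0"
    using l2 unfolding Ja_def[symmetric] by (simp add: L2_norm_def norm_minus_commute)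
  then have Jlim: "(\<lambda>n. IP (Ja n) g) \<longlonglongrightarrow> IP I g" by (rule IP_tendsto[OF JL IL g])
  have "ennreal \<bar>IP (Ja n) g\<bar> \<le> ennreal K + ennreal (L2_norm M g) * (\<integral>\<^sup>+ t. ennreal (d n t) \<partial>N)" for n
  proof -
    have int: "integrable N (\<lambda>t. \<Sum>i<m n. indicator (A n i) t * IP (v n i) g)"
      using Av by (intro Bochner_Integration.integrable_sum) auto
    have "IP (Ja n) g = (\<Sum>i<m n. measure N (A n i) * IP (v n i) g)"
      unfolding Ja_def using Av by (intro IP_sum g) auto
    also have "\<dots> = (LINT t|N. (\<Sum>i<m n. indicator (A n i) t * IP (v n i) g))"
      using Av by (subst Bochner_Integration.integral_sum) (auto intro!: sum.cong simp: Int_absorb1 sets.sets_into_space)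
    also have "\<dots> = (LINT t|N. IP (s n t) g)"
      unfolding s_def using Av g by (intro Bochner_Integration.integral_cong refl) (subst IP_sum, auto)
    finally have e: "IP (Ja n) g = (LINT t|N. IP (s n t) g)" .
    have ints: "integrable N (\<lambda>t. IP (s n t) g)"
      unfolding s_def using int Av g by (subst IP_sum) auto
    have "ennreal \<bar>IP (Ja n) g\<bar> \<le> (\<integral>\<^sup>+ t. ennreal (norm (IP (s n t) g)) \<partial>N)"
      unfolding e using integral_norm_bound_ennreal[OF ints] by simp
    also have "\<dots> \<le> (\<integral>\<^sup>+ t. ennreal (k t) + ennreal (L2_norm M g) * ennreal (d n t) \<partial>N)"
    proof (rule nn_integral_mono_AE)
      show "AE t in N. ennreal (norm (IP (s n t) g)) \<le> ennreal (k t) + ennreal (L2_norm M g) * ennreal (d n t)"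
        using ae
      proof eventually_elim
        case (elim t)
        have "\<bar>IP (s n t) g\<bar> \<le> \<bar>IP (G t) g\<bar> + \<bar>IP (\<lambda>p. G t p - s n t p) g\<bar>"
          using IP_diff[OF _ sL g, of "G t" n t] elim by simp
        also have "\<dots> \<le> k t + d n t * L2_norm M g"
          unfolding d_def using elim sL g by (intro add_mono abs_IP_le L2_diff) auto
        finally have "ennreal \<bar>IP (s n t) g\<bar> \<le> ennreal (k t + L2_norm M g * d n t)"
          by (intro ennreal_leI) (simp add: mult.commute)
        then show ?case using k(2) by (simp add: ennreal_plus ennreal_mult L2_norm_nonneg d_def)
      qed
    qed
    also have "\<dots> = (\<integral>\<^sup>+ t. ennreal (k t) \<partial>N) + ennreal (L2_norm M g) * (\<integral>\<^sup>+ t. ennreal (d n t) \<partial>N)"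
      using k(1) dm[of n] by (subst nn_integral_add) (auto intro!: nn_integral_cmult arg_cong2[where f="(+)"])
    also have "\<dots> \<le> ennreal K + ennreal (L2_norm M g) * (\<integral>\<^sup>+ t. ennreal (d n t) \<partial>N)"
      by (intro add_right_mono fin)
    finally show ?thesis .
  qed
  note bnd = this
  have "ennreal \<bar>IP I g\<bar> \<le> ennreal K + ennreal (L2_norm M g) * 0"
  proof (rule LIMSEQ_le)
    show "(\<lambda>n. ennreal \<bar>IP (Ja n) g\<bar>) \<longlonglongrightarrow> ennreal \<bar>IP I g\<bar>" by (intro tendsto_ennrealI tendsto_intros Jlim)
    show "(\<lambda>n. ennreal K + ennreal (L2_norm M g) * (\<integral>\<^sup>+ t. ennreal (d n t) \<partial>N)) \<longlonglongrightarrow> ennreal K + ennreal (L2_norm M g) * 0"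
      by (intro tendsto_add tendsto_const ennreal_tendsto_cmult dl) simp
  qed (use bnd in blast)
  then show ?thesis using K by (simp add: ennreal_le_iff)
qed

end

context grushin_semigroup
begin

text \<open>If the final state is 0, the free part \<open>S T f0\<close> and the Duhamel integral
  have opposite pairings with \<open>g\<close>. The quasimode estimate evaluates both, and in the
  integral \<open>g\<close> meets the control only on the control region. \<open>K\<close> depends
  on \<open>f0\<close>, the control and \<open>T\<close>; \<open>g\<close>, \<open>l\<close> and
  \<open>\<delta>\<close> come after it.\<close>

lemma steering_bound:
  assumes T: "T > 0" and \<omega>: "\<omega>x \<subseteq> {-L<..<L}" "open \<omega>x" and f0: "f0 \<in> L2 M"
    and u: "u \<in> controls Y \<omega>x T" and f: "duhamel_solution L Y S \<omega>x T f0 u f" and z: "AE p in M. f T p = 0"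
  shows "\<exists>K\<ge>0. \<forall>g l \<delta>. g \<in> test_functions L Y \<longrightarrow>
    (\<forall>\<phi>\<in>test_functions L Y. \<bar>BB \<phi> g - l * IP \<phi> g\<bar> \<le> \<delta> * (1 + Qc \<phi>)) \<longrightarrow> - cc \<le> l \<longrightarrow> 0 \<le> \<delta> \<longrightarrow>
    exp (- l * T) * \<bar>IP f0 g\<bar> \<le> K * (\<delta> + L2_norm M (\<lambda>p. indicator (\<omega>x \<times> Omega_y Y) p *\<^sub>R g p))"
proof -
  let ?\<omega> = "\<omega>x \<times> Omega_y Y"
  let ?W = "{0<..<T} \<times> ?\<omega>"
  have \<omega>x: "\<omega>x \<in> sets borel" using \<omega>(2) by simp
  have \<omega>b: "?\<omega> \<in> sets borel" by (intro borel_Times \<omega>x Omega_y_borel)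
  have \<omega>\<Omega>: "?\<omega> \<subseteq> Omega L Y" using \<omega>(1) by (auto simp: Omega_def)
  have Wb: "?W \<in> sets borel" by (intro borel_Times \<omega>b) simp
  \<comment> \<open>Extending the control by zero to all times and the whole plane lets Fubini
    provide its energy \<open>Gf s\<close> at almost every time.\<close>
  define w where "w z = indicator ?W z *\<^sub>R u z" for z
  have wL: "w \<in> L2 lborel" unfolding w_def using u Wb by (intro L2_extend) (auto simp: controls_def)
  have psf2: "pair_sigma_finite (lborel :: real measure) (lborel :: (real \<times> real) measure)" ..
  have wi: "integrable (lborel \<Otimes>\<^sub>M lborel) (\<lambda>z. (cmod (w z))\<^sup>2)"
    using L2D(2)[OF wL] by (simp add: lborel_prod)
  define Gf where "Gf s = (LINT p|lborel. (cmod (w (s, p)))\<^sup>2)" for s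
  have Gi: "integrable lborel Gf" unfolding Gf_def by (rule pair_sigma_finite.integrable_fst'[OF psf2 wi])
  have G0: "Gf s \<ge> 0" for s unfolding Gf_def by (simp add: integral_nonneg_AE)
  have aeG: "AE s in lborel. integrable lborel (\<lambda>p. (cmod (w (s, p)))\<^sup>2)" by (rule pair_sigma_finite.AE_integrable_fst'[OF psf2 wi])
  define us where "us s p = indicator ?\<omega> p * u (s, p)" for s p
  have us: "us s \<in> L2 M \<and> (L2_norm M (us s))\<^sup>2 = Gf s"
    if s: "0 < s" "s < T" "integrable lborel (\<lambda>p. (cmod (w (s, p)))\<^sup>2)" for s
  proof -
    have eq: "w (s, p) = us s p" for p using s by (simp add: w_def us_def indicator_def)
    have "w \<in> borel_measurable (lborel \<Otimes>\<^sub>M lborel)" using L2D(1)[OF wL] by (simp add: lborel_prod)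
    then have "(\<lambda>p. w (s, p)) \<in> borel_measurable lborel" by (rule measurable_Pair2) simp
    then have m: "us s \<in> borel_measurable lborel" unfolding eq by simp
    have z: "indicator (Omega L Y) p * (cmod (us s p))\<^sup>2 = (cmod (us s p))\<^sup>2" for p
      using \<omega>\<Omega> by (auto simp: us_def indicator_def)
    have i: "integrable M (\<lambda>p. (cmod (us s p))\<^sup>2)"
      using s(3) Omega_borel unfolding eq by (subst integrable_restrict_space) (auto simp: z)
    have "us s \<in> L2 M" using measurable_restrict_space1[OF m] i by (simp add: L2_def)
    moreover have "(L2_norm M (us s))\<^sup>2 = Gf s"
      unfolding Gf_def eq L2_norm_def using Omega_borel
      by (subst integral_restrict_space) (auto simp: z integral_nonneg_AE)
    ultimately show ?thesis by blast
  qed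
  have fT: "f T \<in> L2 M" using f T by (auto simp: duhamel_solution_def)
  obtain I where I: "has_L2_integral (lebesgue_on {0..T}) M (\<lambda>s. S (T - s) (us s)) I"
    and fTI: "AE p in M. f T p = S T f0 p + I p"
    using f T unfolding duhamel_solution_def us_def by force
  have IL: "I \<in> L2 M" using I by (simp add: has_L2_integral_def)
  have SL: "S T f0 \<in> L2 M" using T f0 by (intro S_L2) auto
  \<comment> \<open>\<open>K0\<close> is the bound for the integral of \<open>1 + Gf\<close> over
    \<open>[0, T]\<close>; the 1 comes from estimating the norm of \<open>us s\<close>, whose square
    is \<open>Gf s\<close>, by \<open>1 + Gf s\<close>.\<close>
  define K0 where "K0 = T + (LINT s|lborel. Gf s)"
  have K0: "K0 \<ge> 0" using T G0 by (simp add: K0_def integral_nonneg_AE)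
  define K where "K = decay_const T * (L2_norm M f0 + K0) + exp (cc * T) * K0"
  have dc: "decay_const T \<ge> 0" using T by (intro decay_const_nonneg) simp
  have K: "K \<ge> 0" unfolding K_def by (intro add_nonneg_nonneg mult_nonneg_nonneg dc K0 L2_norm_nonneg) simp
  have "exp (- l * T) * \<bar>IP f0 g\<bar> \<le> K * (\<delta> + L2_norm M (\<lambda>p. indicator ?\<omega> p *\<^sub>R g p))"
    if g: "g \<in> test_functions L Y" and est: "\<And>\<phi>. \<phi> \<in> test_functions L Y \<Longrightarrow> \<bar>BB \<phi> g - l * IP \<phi> g\<bar> \<le> \<delta> * (1 + Qc \<phi>)"
      and l: "- cc \<le> l" and \<delta>: "0 \<le> \<delta>" for g l \<delta>
  proof -
    have gL: "g \<in> L2 M" by (rule test_L2[OF g])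
    let ?g = "\<lambda>p. indicator ?\<omega> p *\<^sub>R g p"
    have gmL: "?g \<in> L2 M"
    proof -
      have sM: "?\<omega> \<in> sets M" using \<omega>b \<omega>\<Omega> by (auto simp: sets_restrict_space intro!: image_eqI[of _ _ ?\<omega>])
      have "?g \<in> borel_measurable M" "integrable M (\<lambda>p. indicator ?\<omega> p *\<^sub>R (cmod (g p))\<^sup>2)"
        by (rule borel_measurable_scaleR[OF borel_measurable_indicator[OF sM] L2D(1)[OF gL]],
            rule integrable_mult_indicator[OF sM L2D(2)[OF gL]])
      moreover have "indicator ?\<omega> p *\<^sub>R (cmod (g p))\<^sup>2 = (cmod (?g p))\<^sup>2" for p by (simp add: indicator_def)
      ultimately show ?thesis by (simp add: L2_def)
    qed
    define W where "W = L2_norm M ?g"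
    have W: "W \<ge> 0" by (simp add: W_def L2_norm_nonneg)
    define C where "C = exp (cc * T) * W + \<delta> * decay_const T"
    have C: "C \<ge> 0" using W \<delta> dc by (simp add: C_def)
    have "\<bar>IP I g\<bar> \<le> C * K0"
    proof (rule has_L2_integral_inner_bound[OF I gL, where k="\<lambda>s. C * (1 + Gf s)"])
      \<comment> \<open>The control lives on the open time interval, hence the two end points are
        removed.\<close>
      have ae1: "AE s in lborel. s \<noteq> 0" "AE s in lborel. s \<noteq> T" by (rule AE_lborel_singleton)+
      have "AE s in lborel. 0 \<le> s \<and> s \<le> T \<longrightarrow> S (T - s) (us s) \<in> L2 M \<and> \<bar>IP (S (T - s) (us s)) g\<bar> \<le> C * (1 + Gf s)"
        using aeG ae1
      proof eventually_elim
        case (elim s)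
        show ?case
        proof
          assume s: "0 \<le> s \<and> s \<le> T"
          then have s': "0 < s" "s < T" using elim by auto
          have uL: "us s \<in> L2 M" and un: "(L2_norm M (us s))\<^sup>2 = Gf s" using us[OF s' elim(1)] by auto
          have un': "L2_norm M (us s) \<le> 1 + Gf s"
            using un L2_norm_nonneg[of M "us s"] zero_le_power2[of "L2_norm M (us s) - 1"] by (simp add: power2_diff)
          have "IP (us s) g = IP (us s) ?g"
            unfolding IP_def by (intro Bochner_Integration.integral_cong refl) (simp add: us_def indicator_def)
          then have a: "\<bar>IP (us s) g\<bar> \<le> L2_norm M (us s) * W" using abs_IP_le[OF uL gmL] by (simp add: W_def)
          \<comment> \<open>The decay in \<open>T - s\<close> is given up here: smallness will come
            from \<open>\<delta>\<close> and from \<open>W\<close>, the size of \<open>g\<close> on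
            the control region.\<close>
          have e: "exp (- l * (T - s)) \<le> exp (cc * T)"
          proof -
            have "(- l) * (T - s) \<le> cc * (T - s)" using l s' by (intro mult_right_mono) auto
            also have "\<dots> \<le> cc * T" using cc_pos s' by (intro mult_left_mono) auto
            finally show ?thesis by simp
          qed
          have "\<bar>IP (S (T - s) (us s)) g\<bar> \<le> exp (- l * (T - s)) * \<bar>IP (us s) g\<bar> + \<delta> * decay_const T * L2_norm M (us s)"
            using semigroup_quasimode[OF g est l \<delta>, of "T - s" T "us s"] s' uL
              abs_triangle_ineq2[of "IP (S (T - s) (us s)) g" "exp (- l * (T - s)) * IP (us s) g"]
            by (simp add: abs_mult)
          also have "\<dots> \<le> exp (cc * T) * (L2_norm M (us s) * W) + \<delta> * decay_const T * L2_norm M (us s)"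
            using e a \<delta> dc L2_norm_nonneg[of M "us s"] by (intro add_mono mult_mono) auto
          also have "\<dots> = C * L2_norm M (us s)" by (simp add: C_def algebra_simps)
          also have "\<dots> \<le> C * (1 + Gf s)" using un' C by (intro mult_left_mono)
          finally show "S (T - s) (us s) \<in> L2 M \<and> \<bar>IP (S (T - s) (us s)) g\<bar> \<le> C * (1 + Gf s)"
            using S_L2[OF _ uL] s' by simp
        qed
      qed
      then have "AE s in lebesgue. s \<in> {0..T} \<longrightarrow> S (T - s) (us s) \<in> L2 M \<and> \<bar>IP (S (T - s) (us s)) g\<bar> \<le> C * (1 + Gf s)"
        by (intro AE_completion) simp
      then show "AE s in lebesgue_on {0..T}. S (T - s) (us s) \<in> L2 M \<and> \<bar>IP (S (T - s) (us s)) g\<bar> \<le> C * (1 + Gf s)"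
        by (subst AE_restrict_space_iff) auto
      have iI: "integrable lborel (indicator {0..T} :: real \<Rightarrow> real)" using T by (intro integrable_real_indicator) (auto simp: emeasure_lborel_Icc)
      have "Gf \<in> borel_measurable lborel" using Gi by simp
      then have "(\<lambda>s. C * (1 + Gf s)) \<in> borel_measurable lborel" by measurable
      then show "(\<lambda>s. C * (1 + Gf s)) \<in> borel_measurable (lebesgue_on {0..T})"
        by (intro measurable_restrict_space1 measurable_completion)
      show "0 \<le> C * (1 + Gf s)" for s using C G0 by (simp add: add_nonneg_nonneg)
      have "(\<integral>\<^sup>+ s. ennreal (C * (1 + Gf s)) \<partial>lebesgue_on {0..T}) = (\<integral>\<^sup>+ s. ennreal (C * (1 + Gf s)) * indicator {0..T} s \<partial>lebesgue)"
        by (rule nn_integral_restrict_space) simp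
      also have "\<dots> = (\<integral>\<^sup>+ s. ennreal (C * (1 + Gf s)) * indicator {0..T} s \<partial>lborel)"
        by (rule nn_integral_completion)
      also have "\<dots> \<le> (\<integral>\<^sup>+ s. ennreal (C * (indicator {0..T} s + Gf s)) \<partial>lborel)"
        using C G0 by (intro nn_integral_mono) (auto simp: indicator_def)
      also have "\<dots> = ennreal (LINT s|lborel. C * (indicator {0..T} s + Gf s))"
        using C G0 by (intro nn_integral_eq_integral Bochner_Integration.integrable_mult_right
            Bochner_Integration.integrable_add Gi iI) auto
      also have "(LINT s|lborel. C * (indicator {0..T} s + Gf s)) = C * K0"
      proof -
        have "(LINT s|lborel. indicator {0..T} s + Gf s) = K0" using Gi iI T by (simp add: K0_def)
        then show ?thesis by simp
      qed
      finally show "(\<integral>\<^sup>+ s. ennreal (C * (1 + Gf s)) \<partial>lebesgue_on {0..T}) \<le> ennreal (C * K0)" .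
      show "0 \<le> C * K0" using C K0 by simp
    qed
    moreover have "IP (S T f0) g + IP I g = 0"
    proof -
      have "J (\<lambda>p. S T f0 p + I p) = J (f T)" using fTI SL IL fT by (subst J_eq_iff) (auto intro: L2_add elim: eventually_mono)
      moreover have "J (f T) = J (\<lambda>p. 0)" using z fT by (subst J_eq_iff) (auto intro: L2_zero)
      moreover have "J (\<lambda>p. 0) = 0" using J_norm[OF L2_zero] by (simp add: L2_norm_def)
      ultimately have "(J (S T f0) + J I) \<bullet> J g = 0" using J_add[OF SL IL] by simp
      then show ?thesis using SL IL gL by (simp add: inner_add_left J_inner)
    qed
    moreover have "\<bar>IP (S T f0) g - exp (- l * T) * IP f0 g\<bar> \<le> \<delta> * decay_const T * L2_norm M f0"
      using T by (intro semigroup_quasimode[OF g est l \<delta>] f0) auto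
    ultimately have "exp (- l * T) * \<bar>IP f0 g\<bar> \<le> C * K0 + \<delta> * decay_const T * L2_norm M f0"
      using abs_mult[of "exp (- l * T)" "IP f0 g"] by (simp add: abs_le_iff) linarith
    also have "\<dots> \<le> K * (\<delta> + W)"
    proof -
      have "0 \<le> exp (cc * T) * K0 * \<delta>" "0 \<le> decay_const T * L2_norm M f0 * W" "0 \<le> decay_const T * K0 * W"
        using K0 \<delta> dc W L2_norm_nonneg[of M f0] by auto
      then show ?thesis unfolding K_def C_def by (simp add: algebra_simps)
    qed
    finally show ?thesis by (simp add: W_def)
  qed
  with K show ?thesis by blast
qed

end

section \<open>Near-minimisers in the variable x\<close>

lemma integrable_indicator_Icc: "integrable lborel (indicat_real {a..b :: real})"
  by (rule integrable_real_indicator) (auto simp: emeasure_lborel_Icc_eq)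

lemma bump_testsD: "u \<in> bump_tests A \<Longrightarrow> smooth UNIV u"
  by (simp add: bump_tests_def)

lemma smooth_UNIV_DERIV: "smooth UNIV u \<Longrightarrow> (u has_real_derivative deriv u x) (at x)"
  by (rule smooth_DERIV) auto

lemma smooth_UNIV_continuous: "smooth UNIV u \<Longrightarrow> continuous_on A u" "smooth UNIV u \<Longrightarrow> continuous_on A (deriv u)"
  by (rule continuous_on_subset[OF smooth_continuous_on], auto intro: smooth_deriv)+

lemma deriv_comb:
  assumes "smooth UNIV u" "smooth UNIV v"
  shows "deriv (\<lambda>x. u x + s * v x) = (\<lambda>x. deriv u x + s * deriv v x)"
proof
  fix x
  show "deriv (\<lambda>x. u x + s * v x) x = deriv u x + s * deriv v x"
    by (rule DERIV_imp_deriv) (intro DERIV_add DERIV_cmult smooth_UNIV_DERIV assms)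
qed

lemma smooth_comb: "smooth A u \<Longrightarrow> smooth A v \<Longrightarrow> smooth A (\<lambda>x. u x + s * v x)"
  by (intro smooth_add smooth_mult smooth_const)

lemma bump_tests_comb:
  assumes "u \<in> bump_tests A" "v \<in> bump_tests A"
  shows "(\<lambda>x. u x + s * v x) \<in> bump_tests A"
proof -
  obtain K K' where "compact K" "K \<subseteq> A" "\<And>x. x \<notin> K \<Longrightarrow> u x = 0" "compact K'" "K' \<subseteq> A" "\<And>x. x \<notin> K' \<Longrightarrow> v x = 0"
    using assms by (auto simp: bump_tests_def)
  then show ?thesis using assms
    by (auto simp: bump_tests_def intro!: smooth_comb exI[of _ "K \<union> K'"] compact_Un)
qed

lemma deriv_zero_off_compact:
  assumes "compact (K :: real set)" "\<And>x. x \<notin> K \<Longrightarrow> u x = (0 :: real)" "x \<notin> K"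
  shows "deriv u x = 0"
proof -
  have "open (- K)" using assms(1) by (simp add: compact_imp_closed open_Compl)
  have "(u has_real_derivative 0) (at x)"
    by (rule has_field_derivative_transform_within_open[OF DERIV_const[of 0] \<open>open (- K)\<close>]) (use assms in auto)
  then show ?thesis by (rule DERIV_imp_deriv)
qed

text \<open>The weight may be smooth on \<open>A\<close> only, as the product is glued with 0 off
  the support of \<open>u\<close>; this admits \<open>r\<close> and the Agmon weight.\<close>

lemma bump_tests_weight:
  assumes A: "open A" and w: "smooth A w" and u: "u \<in> bump_tests A"
  shows "(\<lambda>x. w x * u x) \<in> bump_tests A"
proof -
  obtain K where K: "compact K" "K \<subseteq> A" "\<And>x. x \<notin> K \<Longrightarrow> u x = 0" using u by (auto simp: bump_tests_def)
  have o: "open (- K)" using K(1) by (simp add: compact_imp_closed open_Compl)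
  have "smooth A (\<lambda>x. w x * u x)" by (rule smooth_mult[OF w smooth_subset[OF bump_testsD[OF u]]]) simp
  moreover have "smooth (- K) (\<lambda>x. w x * u x)" by (rule smooth_cong[OF o _ smooth_const[of _ 0]]) (use K in auto)
  ultimately have "smooth (A \<union> - K) (\<lambda>x. w x * u x)" by (rule smooth_Un[OF A o])
  moreover have "A \<union> - K = UNIV" using K(2) by auto
  ultimately show ?thesis using K by (auto simp: bump_tests_def)
qed

lemma bump_tests_deriv:
  assumes u: "u \<in> bump_tests A"
  shows "deriv u \<in> bump_tests A"
proof -
  obtain K where K: "compact K" "K \<subseteq> A" "\<And>x. x \<notin> K \<Longrightarrow> u x = 0" using u by (auto simp: bump_tests_def)
  then show ?thesis using deriv_zero_off_compact[OF K(1,3)] smooth_deriv[OF bump_testsD[OF u]]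
    by (auto simp: bump_tests_def)
qed

lemma bump_in_tests: "l < u \<Longrightarrow> {l..u} \<subseteq> A \<Longrightarrow> bump l u \<in> bump_tests A"
  using bump_eq_0 by (auto simp: bump_tests_def smooth_bump intro!: exI[of _ "{l..u}"])

lemma smooth_cosh: "smooth A u \<Longrightarrow> smooth A (\<lambda>x. cosh (u x))"
proof -
  assume u: "smooth A u"
  have "smooth A (\<lambda>x. exp (u x) * (1/2) + exp (- u x) * (1/2))"
    by (intro smooth_add smooth_mult smooth_const smooth_compose[OF smooth_exp[of UNIV]] smooth_minus u) auto
  moreover have "cosh (u x) = exp (u x) * (1/2) + exp (- u x) * (1/2)" for x by (simp add: cosh_def)
  ultimately show ?thesis by simp
qed

text \<open>\<open>cosh\<close> replaces the exponential of an absolute value in Agmon's weight: it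
  is smooth also where the exponent changes sign, comparable with that exponential, and still
  dominates its derivative.\<close>

lemma cosh_bounds: "cosh (x::real) \<le> exp \<bar>x\<bar>" "exp \<bar>x\<bar> / 2 \<le> cosh x" "\<bar>sinh x\<bar> \<le> cosh x"
proof -
  have e: "exp x > 0" "exp (- x) > 0" by auto
  have "exp (-x) \<le> exp \<bar>x\<bar>" "exp x \<le> exp \<bar>x\<bar>" by auto
  then have "exp x + exp (- x) \<le> 2 * exp \<bar>x\<bar>" by linarith
  then show "cosh (x::real) \<le> exp \<bar>x\<bar>" by (simp add: cosh_def)
  have "exp \<bar>x\<bar> = exp x \<or> exp \<bar>x\<bar> = exp (- x)" by (simp add: abs_if)
  then show "exp \<bar>x\<bar> / 2 \<le> cosh x" using e unfolding cosh_def by (auto simp: field_simps)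
  show "\<bar>sinh x\<bar> \<le> cosh x" using e unfolding cosh_def sinh_def by (auto simp: abs_le_iff field_simps)
qed

section \<open>The form on a line in x and a trial function\<close>

context grushin_setting
begin

abbreviation "Tx \<equiv> bump_tests {-L<..<L}"

lemma Mx_integrable:
  assumes w: "w \<in> borel_measurable Mx" "\<And>x. \<bar>x\<bar> < L \<Longrightarrow> \<bar>w x\<bar> \<le> C" and f: "continuous_on {-L..L} f"
  shows "integrable Mx (\<lambda>x. w x * f x :: real)"
proof -
  have "bounded (f ` {-L..L})" by (intro compact_imp_bounded compact_continuous_image f) auto
  then obtain B where bnd: "\<forall>z\<in>f ` {-L..L}. norm z \<le> B" unfolding bounded_iff by blast
  then have B: "\<bar>f x\<bar> \<le> B" if "\<bar>x\<bar> < L" for x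
  proof -
    have "x \<in> {-L..L}" using that by auto
    from bspec[OF bnd imageI[OF this]] show ?thesis by simp
  qed
  have C: "C \<ge> 0" using w(2)[of 0] L_pos abs_ge_zero[of "w 0"] by simp
  show ?thesis
  proof (rule integrableI_bounded_set[where A="{-L<..<L}" and B="C * B"])
    show "(\<lambda>x. w x * f x) \<in> borel_measurable Mx"
      by (intro borel_measurable_times w(1) borel_restrict_continuous[OF continuous_on_subset[OF f]]) auto
    show "{-L<..<L} \<in> sets Mx" using sets.top[of Mx] by (simp only: space_Mx)
    show "emeasure Mx {-L<..<L} < \<infinity>" using L_pos by (subst emeasure_restrict_space) auto
    show "AE x in Mx. x \<in> {-L<..<L} \<longrightarrow> norm (w x * f x) \<le> C * B"
      using w(2) B C by (intro AE_I2) (auto simp: abs_mult space_Mx intro!: mult_mono)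
  qed (auto simp: space_Mx intro!: AE_I2)
qed

lemma Mx_integrable_cont: "continuous_on {-L..L} f \<Longrightarrow> integrable Mx (\<lambda>x. f x :: real)"
  using Mx_integrable[of "\<lambda>_. 1" 1 f] by simp

text \<open>The potential of the fibre operator in \<open>x\<close>; \<open>\<mu>\<close> is the
  spectral parameter of \<open>- d/dy (r^2 d/dy)\<close>, later \<open>n^2\<close>.\<close>

definition pot :: "real \<Rightarrow> real \<Rightarrow> real" where "pot \<mu> x = \<mu> * (q x)\<^sup>2 + V0 x"

lemma pot_measurable: "pot \<mu> \<in> borel_measurable Mx"
  unfolding pot_def using q_measurable V0(1) by measurable

lemma pot_bounds: "\<mu> \<ge> 0 \<Longrightarrow> \<bar>x\<bar> < L \<Longrightarrow> \<mu> * (q x)\<^sup>2 - CV \<le> pot \<mu> x \<and> pot \<mu> x \<le> \<mu> * Cq\<^sup>2 + CV"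
  using V0(2)[of x] mult_left_mono[of "(q x)\<^sup>2" "Cq\<^sup>2" \<mu>] Cq(3)[of x] by (auto simp: pot_def abs_le_iff abs_less_iff)

lemma pot_abs: "\<mu> \<ge> 0 \<Longrightarrow> \<bar>x\<bar> < L \<Longrightarrow> \<bar>pot \<mu> x\<bar> \<le> \<mu> * Cq\<^sup>2 + CV"
proof -
  assume a: "\<mu> \<ge> 0" "\<bar>x\<bar> < L"
  have "0 \<le> \<mu> * (q x)\<^sup>2" "0 \<le> \<mu> * Cq\<^sup>2" using a by auto
  with pot_bounds[OF a] CV(1) show ?thesis unfolding abs_le_iff by linarith
qed

definition bx where "bx u v = (LINT x|Mx. u x * v x :: real)"
definition hx where "hx \<mu> u v = (LINT x|Mx. deriv u x * deriv v x + pot \<mu> x * (u x * v x))"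

lemma x_integrable:
  assumes "smooth UNIV u" "smooth UNIV v" "\<mu> \<ge> 0"
  shows "integrable Mx (\<lambda>x. u x * v x)" "integrable Mx (\<lambda>x. deriv u x * deriv v x)"
    "integrable Mx (\<lambda>x. pot \<mu> x * (u x * v x))" "integrable Mx (\<lambda>x. deriv u x * deriv v x + pot \<mu> x * (u x * v x))"
proof -
  show 1: "integrable Mx (\<lambda>x. u x * v x)" "integrable Mx (\<lambda>x. deriv u x * deriv v x)"
    by (intro Mx_integrable_cont continuous_intros smooth_UNIV_continuous assms)+
  show 2: "integrable Mx (\<lambda>x. pot \<mu> x * (u x * v x))"
    by (rule Mx_integrable[OF pot_measurable pot_abs[OF assms(3)]])
      (auto intro!: continuous_on_mult smooth_UNIV_continuous(1)[OF assms(1)] smooth_UNIV_continuous(1)[OF assms(2)])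
  show "integrable Mx (\<lambda>x. deriv u x * deriv v x + pot \<mu> x * (u x * v x))"
    using 1 2 by simp
qed

lemma bx_sym: "bx u v = bx v u" and hx_sym: "hx \<mu> u v = hx \<mu> v u"
  by (simp_all add: bx_def hx_def mult.commute)

lemma bx_comb: "smooth UNIV u \<Longrightarrow> smooth UNIV v \<Longrightarrow> smooth UNIV w \<Longrightarrow> bx (\<lambda>x. u x + s * v x) w = bx u w + s * bx v w"
  unfolding bx_def using x_integrable(1)[of u w 0] x_integrable(1)[of v w 0]
  by (subst integral_linear_comb) (auto intro!: Bochner_Integration.integral_cong simp: algebra_simps)

lemma hx_comb: "\<mu> \<ge> 0 \<Longrightarrow> smooth UNIV u \<Longrightarrow> smooth UNIV v \<Longrightarrow> smooth UNIV w \<Longrightarrow> hx \<mu> (\<lambda>x. u x + s * v x) w = hx \<mu> u w + s * hx \<mu> v w"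
  unfolding hx_def using x_integrable(4)[of u w \<mu>] x_integrable(4)[of v w \<mu>]
  by (subst integral_linear_comb) (auto intro!: Bochner_Integration.integral_cong simp: algebra_simps deriv_comb)

lemma bx_nonneg: "0 \<le> bx u u" by (simp add: bx_def integral_nonneg_AE)

lemma hx_lower:
  assumes "\<mu> \<ge> 0" "smooth UNIV u"
  shows "(LINT x|Mx. (deriv u x)\<^sup>2) - CV * bx u u \<le> hx \<mu> u u"
proof -
  have "(LINT x|Mx. (deriv u x)\<^sup>2) - CV * bx u u = (LINT x|Mx. deriv u x * deriv u x - CV * (u x * u x))"
    using x_integrable(1,2)[OF assms(2,2,1)] by (simp add: bx_def power2_eq_square)
  also have "\<dots> \<le> hx \<mu> u u" unfolding hx_def
  proof (rule integral_mono)
    fix x assume "x \<in> space Mx"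
    then have "\<bar>x\<bar> < L" by (auto simp: space_Mx)
    moreover have "0 \<le> \<mu> * (q x)\<^sup>2" using assms(1) by simp
    ultimately have "- CV \<le> pot \<mu> x" using pot_bounds[OF assms(1), of x] by linarith
    from mult_right_mono[OF this, of "u x * u x"]
    show "deriv u x * deriv u x - CV * (u x * u x) \<le> deriv u x * deriv u x + pot \<mu> x * (u x * u x)" by simp
  qed (use x_integrable[OF assms(2,2,1)] in auto)
  finally show ?thesis .
qed

text \<open>The bottom of the Dirichlet spectrum of the fibre operator, as an infimum over test
  functions, among which there may be no minimiser.\<close>

definition lam :: "real \<Rightarrow> real" where
  "lam \<mu> = Inf ((\<lambda>u. hx \<mu> u u / bx u u) ` {u \<in> Tx. bx u u > 0})"

lemma hx_ge: "\<mu> \<ge> 0 \<Longrightarrow> smooth UNIV u \<Longrightarrow> - CV * bx u u \<le> hx \<mu> u u"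
proof -
  assume a: "\<mu> \<ge> 0" "smooth UNIV u"
  have "0 \<le> (LINT x|Mx. (deriv u x)\<^sup>2)" by (rule integral_nonneg_AE) simp
  with hx_lower[OF a] show ?thesis by linarith
qed

lemma lam_bdd: "\<mu> \<ge> 0 \<Longrightarrow> bdd_below ((\<lambda>u. hx \<mu> u u / bx u u) ` {u \<in> Tx. bx u u > 0})"
  unfolding bdd_below_def
  by (intro exI[of _ "- CV"]) (auto simp: le_divide_eq intro!: hx_ge[simplified] bump_testsD)

lemma lam_le: "\<mu> \<ge> 0 \<Longrightarrow> u \<in> Tx \<Longrightarrow> lam \<mu> * bx u u \<le> hx \<mu> u u"
proof (cases "bx u u > 0")
  case True
  assume "\<mu> \<ge> 0" "u \<in> Tx"
  then have "lam \<mu> \<le> hx \<mu> u u / bx u u" unfolding lam_def using True by (intro cInf_lower lam_bdd) auto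
  then show ?thesis using True by (simp add: le_divide_eq)
next
  case False
  assume "\<mu> \<ge> 0" "u \<in> Tx"
  moreover have "bx u u = 0" using False bx_nonneg[of u] by simp
  ultimately show ?thesis using hx_ge[of \<mu> u] bump_testsD[of u] by simp
qed

lemma tests_scale: "u \<in> bump_tests A \<Longrightarrow> (\<lambda>x. c * u x) \<in> bump_tests A"
  using bump_tests_comb[of u A u "c - 1"] by (simp add: algebra_simps)

lemma bx_scale: "bx (\<lambda>x. c * u x) (\<lambda>x. c * u x) = c\<^sup>2 * bx u u"
  unfolding bx_def by (subst Bochner_Integration.integral_mult_right_zero[symmetric])
    (auto intro!: Bochner_Integration.integral_cong simp: power2_eq_square algebra_simps)

lemma hx_scale: "smooth UNIV u \<Longrightarrow> hx \<mu> (\<lambda>x. c * u x) (\<lambda>x. c * u x) = c\<^sup>2 * hx \<mu> u u"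
proof -
  assume u: "smooth UNIV u"
  have d: "deriv (\<lambda>x. c * u x) = (\<lambda>x. c * deriv u x)"
  proof
    fix x show "deriv (\<lambda>x. c * u x) x = c * deriv u x"
      by (rule DERIV_imp_deriv) (intro DERIV_cmult smooth_UNIV_DERIV u)
  qed
  show ?thesis unfolding hx_def d by (subst Bochner_Integration.integral_mult_right_zero[symmetric])
    (auto intro!: Bochner_Integration.integral_cong simp: power2_eq_square algebra_simps)
qed

text \<open>The trial function is a Gaussian, the ground state for \<open>q(x) = \<beta> x\<close>, cut off at a fixed
  distance; since Gaussians decrease away from 0, the cut-off costs only \<open>O(1)\<close>.\<close>

lemma trial:
  assumes a: "0 < a" "a < L" and \<beta>: "\<beta> > 0" and qb: "\<And>x. \<bar>x\<bar> \<le> a \<Longrightarrow> \<bar>q x\<bar> \<le> \<beta> * \<bar>x\<bar>"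
  shows "\<exists>C. \<forall>n\<ge>0. \<exists>u\<in>Tx. bx u u > 0 \<and> hx (n\<^sup>2) u u \<le> (\<beta> * n + C) * bx u u"
proof -
  define ct where "ct = bump (-a) a"
  have s_ct: "smooth UNIV ct" by (simp add: ct_def smooth_bump)
  have ct0: "ct x = 0" if "x \<notin> {-a..a}" for x using bump_eq_0[of "-a" a x] a that by (simp add: ct_def)
  have d_ct0: "deriv ct x = 0" if "x \<notin> {-a..a}" for x using deriv_zero_off_compact[of "{-a..a}" ct x] ct0 that by auto
  \<comment> \<open>The argument of \<open>flat 0\<close> is the minimum of
    \<open>(x + a) * (a - x)\<close> over \<open>\<bar>x\<bar> \<le> a / 2\<close>.\<close>
  define c0 where "c0 = flat 0 (3 / 4 * a\<^sup>2)"
  have c0: "c0 > 0" using a by (simp add: c0_def flat_def)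
  have ct_c: "ct x \<ge> c0" if "\<bar>x\<bar> \<le> a / 2" for x
  proof -
    have "x\<^sup>2 \<le> (a/2)\<^sup>2" using that a by (simp add: abs_le_square_iff[symmetric])
    then have *: "3 / 4 * a\<^sup>2 \<le> (x + a) * (a - x)" by (simp add: power2_eq_square algebra_simps)
    moreover have "0 < 3 / 4 * a\<^sup>2" using a by simp
    ultimately have "0 < (x + a) * (a - x)" by linarith
    moreover have "1 / ((x + a) * (a - x)) \<le> 1 / (3 / 4 * a\<^sup>2)" using * a by (intro divide_left_mono mult_pos_pos calculation) auto
    ultimately show ?thesis using a by (simp add: ct_def bump_def c0_def flat_def)
  qed
  have "bounded (deriv ct ` {-a..a})"
    by (intro compact_imp_bounded compact_continuous_image smooth_UNIV_continuous s_ct) auto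
  then obtain B where bnd: "\<forall>z\<in>deriv ct ` {-a..a}. norm z \<le> B" unfolding bounded_iff by blast
  have dB: "(deriv ct x)\<^sup>2 \<le> B\<^sup>2 * indicator {-a..a} x" for x
  proof (cases "x \<in> {-a..a}")
    case True
    then have "\<bar>deriv ct x\<bar> \<le> \<bar>B\<bar>" using bspec[OF bnd imageI[OF True]] by simp
    then show ?thesis using True by (simp add: abs_le_square_iff[symmetric])
  qed (simp add: d_ct0)
  define C where "C = CV + 2 * B\<^sup>2 / c0\<^sup>2"
  have "\<exists>u\<in>Tx. bx u u > 0 \<and> hx (n\<^sup>2) u u \<le> (\<beta> * n + C) * bx u u" if n: "n \<ge> 0" for n
  proof -
    define G where "G x = exp (- (\<beta> * n / 2) * x\<^sup>2)" for x
    have sG: "smooth UNIV G" unfolding G_def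
      by (intro smooth_compose[OF smooth_exp[of UNIV]] smooth_mult smooth_const smooth_power smooth_ident) auto
    have dG: "(G has_real_derivative - (\<beta> * n * x) * G x) (at x)" for x
      unfolding G_def by (auto intro!: derivative_eq_intros)
    define u where "u x = G x * ct x" for x
    have uT: "u \<in> Tx" unfolding u_def
      by (rule bump_tests_weight) (use a sG in \<open>auto simp: ct_def intro!: bump_in_tests smooth_subset[OF sG]\<close>)
    have su: "smooth UNIV u" by (rule bump_testsD[OF uT])
    have du: "deriv u x = - (\<beta> * n * x) * G x * ct x + G x * deriv ct x" for x
      unfolding u_def by (rule DERIV_imp_deriv, rule DERIV_cong[OF DERIV_mult[OF dG smooth_UNIV_DERIV[OF s_ct]]]) simp
    have cG: "continuous_on A G" for A using smooth_UNIV_continuous(1)[OF sG] .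
    have c_ct: "continuous_on A ct" "continuous_on A (deriv ct)" for A using smooth_UNIV_continuous[OF s_ct] by auto
    \<comment> \<open>For the potential \<open>(\<beta> n x)^2\<close> the energy density of
      \<open>u\<close> equals \<open>\<beta> n u^2 + G^2 (ct')^2\<close> plus the derivative of
      \<open>?e\<close>, which integrates to 0.\<close>
    let ?e = "\<lambda>x. - (\<beta> * n * x) * (u x)\<^sup>2"
    let ?e' = "\<lambda>x. - (\<beta> * n) * (u x)\<^sup>2 - (\<beta> * n * x) * (2 * u x * deriv u x)"
    have e0: "(LINT x|Mx. ?e' x) = 0"
    proof (rule integral_compact_derivative_zero[where K="{-a..a}" and u="?e" and l="-L" and h=L])
      show "(?e has_real_derivative ?e' x) (at x)" for x
        by (rule derivative_eq_intros smooth_UNIV_DERIV[OF su] refl | simp add: algebra_simps)+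
      show "continuous_on {-L<..<L} ?e'" by (intro continuous_intros smooth_UNIV_continuous su)
      have "u x = 0" if "x \<notin> {-a..a}" for x using ct0[OF that] by (simp add: u_def)
      then show "x \<notin> {-a..a} \<Longrightarrow> ?e x = 0" "x \<notin> {-a..a} \<Longrightarrow> ?e' x = 0" for x by auto
    qed (use a L_pos in auto)
    have ie: "integrable Mx ?e'" by (intro Mx_integrable_cont continuous_intros smooth_UNIV_continuous su)
    have ig: "integrable Mx (\<lambda>x. (G x)\<^sup>2 * (deriv ct x)\<^sup>2)" by (intro Mx_integrable_cont continuous_intros cG c_ct)
    have iu: "integrable Mx (\<lambda>x. (u x)\<^sup>2)" by (intro Mx_integrable_cont continuous_intros smooth_UNIV_continuous su)
    have bxu: "bx u u = (LINT x|Mx. (u x)\<^sup>2)" by (simp add: bx_def power2_eq_square)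
    have "hx (n\<^sup>2) u u \<le> (LINT x|Mx. ?e' x + (\<beta> * n + CV) * (u x)\<^sup>2 + (G x)\<^sup>2 * (deriv ct x)\<^sup>2)"
      unfolding hx_def
    proof (rule integral_mono)
      show "integrable Mx (\<lambda>x. deriv u x * deriv u x + pot (n\<^sup>2) x * (u x * u x))"
        using x_integrable(4)[OF su su, of "n\<^sup>2"] by simp
      show "integrable Mx (\<lambda>x. ?e' x + (\<beta> * n + CV) * (u x)\<^sup>2 + (G x)\<^sup>2 * (deriv ct x)\<^sup>2)"
        using ie ig iu by simp
      fix x
      have "(q x)\<^sup>2 * (u x)\<^sup>2 \<le> (\<beta> * x)\<^sup>2 * (u x)\<^sup>2"
      proof (cases "\<bar>x\<bar> \<le> a")
        case True
        have "(q x)\<^sup>2 \<le> (\<beta> * x)\<^sup>2" using qb[OF True] \<beta> by (simp add: abs_le_square_iff[symmetric] abs_mult)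
        then show ?thesis by (rule mult_right_mono) simp
      next
        case False
        then have "x \<notin> {-a..a}" by auto
        from ct0[OF this] show ?thesis by (simp add: u_def)
      qed
      then have "n\<^sup>2 * ((q x)\<^sup>2 * (u x)\<^sup>2) \<le> n\<^sup>2 * ((\<beta> * x)\<^sup>2 * (u x)\<^sup>2)" by (rule mult_left_mono) simp
      moreover have "V0 x * (u x)\<^sup>2 \<le> CV * (u x)\<^sup>2" using V0(2)[of x] by (intro mult_right_mono) auto
      moreover have "deriv u x * deriv u x + n\<^sup>2 * ((\<beta> * x)\<^sup>2 * (u x)\<^sup>2) = ?e' x + (\<beta> * n) * (u x)\<^sup>2 + (G x)\<^sup>2 * (deriv ct x)\<^sup>2"
        unfolding du u_def by (simp add: power2_eq_square algebra_simps)
      ultimately show "deriv u x * deriv u x + pot (n\<^sup>2) x * (u x * u x) \<le> ?e' x + (\<beta> * n + CV) * (u x)\<^sup>2 + (G x)\<^sup>2 * (deriv ct x)\<^sup>2"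
        unfolding pot_def by (simp add: power2_eq_square algebra_simps)
    qed
    also have "\<dots> = (\<beta> * n + CV) * bx u u + (LINT x|Mx. (G x)\<^sup>2 * (deriv ct x)\<^sup>2)"
      using ie ig iu e0 by (simp add: bxu)
    finally have 1: "hx (n\<^sup>2) u u \<le> (\<beta> * n + CV) * bx u u + (LINT x|Mx. (G x)\<^sup>2 * (deriv ct x)\<^sup>2)" .
    let ?I = "\<lambda>a. LINT x|lborel. indicator {-a..a} x * (G x)\<^sup>2"
    have iG: "integrable lborel (\<lambda>x. indicator {-b..b} x * (G x)\<^sup>2)" for b
      using borel_integrable_compact[of "{-b..b}" "\<lambda>x. (G x)\<^sup>2"] by (simp add: cG continuous_intros)
    have "(LINT x|Mx. (G x)\<^sup>2 * (deriv ct x)\<^sup>2) \<le> (LINT x|Mx. B\<^sup>2 * (indicator {-a..a} x * (G x)\<^sup>2))"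
    proof (rule integral_mono[OF ig])
      show "integrable Mx (\<lambda>x. B\<^sup>2 * (indicator {-a..a} x * (G x)\<^sup>2))"
        by (intro Bochner_Integration.integrable_mult_right Mx_integrable[of _ 1] continuous_intros cG)
          (auto simp: indicator_def intro!: measurable_restrict_space1)
      show "(G x)\<^sup>2 * (deriv ct x)\<^sup>2 \<le> B\<^sup>2 * (indicator {-a..a} x * (G x)\<^sup>2)" for x
        using mult_left_mono[OF dB[of x], of "(G x)\<^sup>2"] by (simp add: mult.commute mult.left_commute)
    qed
    also have "\<dots> = B\<^sup>2 * ?I a"
    proof -
      have "(LINT x|Mx. indicator {-a..a} x * (G x)\<^sup>2) = (LINT x|lborel. indicator {-L<..<L} x *\<^sub>R (indicator {-a..a} x * (G x)\<^sup>2))"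
        by (rule integral_restrict_space) simp
      also have "\<dots> = ?I a" using a by (intro Bochner_Integration.integral_cong) (auto simp: indicator_def)
      finally show ?thesis by simp
    qed
    finally have 2: "(LINT x|Mx. (G x)\<^sup>2 * (deriv ct x)\<^sup>2) \<le> B\<^sup>2 * ?I a" .
    \<comment> \<open>Substituting \<open>2 * x\<close>: as \<open>G (2 * x) \<le> G x\<close>, the
      mass on \<open>[-a, a]\<close> is at most twice that on \<open>[-a/2, a/2]\<close>, where the
      cut-off is at least \<open>c0\<close>. The resulting constant does not depend on
      \<open>n\<close>.\<close>
    have "?I a = \<bar>2\<bar> *\<^sub>R (LINT x|lborel. indicator {-a..a} (0 + 2 * x) * (G (0 + 2 * x))\<^sup>2)"
      by (rule lborel_integral_real_affine) simp
    also have "\<dots> \<le> 2 * ?I (a / 2)"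
    proof -
      have "(LINT x|lborel. indicator {-a..a} (0 + 2 * x) * (G (0 + 2 * x))\<^sup>2) \<le> ?I (a / 2)"
      proof (rule integral_mono)
        show "integrable lborel (\<lambda>x. indicator {-a..a} (0 + 2 * x) * (G (0 + 2 * x))\<^sup>2)"
          by (rule lborel_integrable_real_affine[OF iG]) simp
        fix x :: real
        have "G (2 * x) \<le> G x" using \<beta> n by (simp add: G_def power2_eq_square mult_nonneg_nonneg)
        then have "(G (2 * x))\<^sup>2 \<le> (G x)\<^sup>2" by (rule power_mono) (simp add: G_def)
        then show "indicator {-a..a} (0 + 2 * x) * (G (0 + 2 * x))\<^sup>2 \<le> indicator {-(a/2)..a/2} x * (G x)\<^sup>2"
          by (auto simp: indicator_def)
      qed (rule iG)
      then show ?thesis by simp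
    qed
    finally have 3: "?I a \<le> 2 * ?I (a / 2)" .
    have "c0\<^sup>2 * ?I (a / 2) = (LINT x|lborel. c0\<^sup>2 * (indicator {-(a/2)..a/2} x * (G x)\<^sup>2))" by simp
    also have "\<dots> \<le> (LINT x|lborel. indicator {-L<..<L} x *\<^sub>R (u x)\<^sup>2)"
    proof (rule integral_mono)
      show "integrable lborel (\<lambda>x. indicator {-L<..<L} x *\<^sub>R (u x)\<^sup>2)"
        using iu by (subst integrable_restrict_space[symmetric]) auto
      fix x
      show "c0\<^sup>2 * (indicator {-(a/2)..a/2} x * (G x)\<^sup>2) \<le> indicator {-L<..<L} x *\<^sub>R (u x)\<^sup>2"
      proof (cases "\<bar>x\<bar> \<le> a / 2")
        case True
        have "c0\<^sup>2 \<le> (ct x)\<^sup>2" using ct_c[OF True] c0 by (intro power_mono) auto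
        from mult_right_mono[OF this, of "(G x)\<^sup>2"] show ?thesis
          using True a by (auto simp: indicator_def u_def power_mult_distrib mult.commute)
      qed (auto simp: indicator_def)
    qed (use iG in simp)
    also have "\<dots> = bx u u" unfolding bxu by (rule integral_restrict_space[symmetric]) simp
    finally have 4: "c0\<^sup>2 * ?I (a / 2) \<le> bx u u" .
    have pos: "0 < ?I (a / 2)"
    proof -
      define e where "e = (exp (- (\<beta> * n / 2) * (a/2)\<^sup>2))\<^sup>2"
      have "0 < a * e" using a by (simp add: e_def)
      also have "a * e = (LINT x|lborel. e * indicator {-(a/2)..a/2} x)" using a by simp
      also have "\<dots> \<le> ?I (a / 2)"
      proof (rule integral_mono)
        fix x :: real
        show "e * indicator {-(a/2)..a/2} x \<le> indicator {-(a/2)..a/2} x * (G x)\<^sup>2"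
        proof (cases "\<bar>x\<bar> \<le> a / 2")
          case True
          then have "x\<^sup>2 \<le> (a/2)\<^sup>2" using a by (simp add: abs_le_square_iff[symmetric])
          then have "(\<beta> * n / 2) * x\<^sup>2 \<le> (\<beta> * n / 2) * (a/2)\<^sup>2" using \<beta> n by (intro mult_left_mono) auto
          then have "exp (- (\<beta> * n / 2) * (a/2)\<^sup>2) \<le> G x" by (simp add: G_def)
          then have "e \<le> (G x)\<^sup>2" unfolding e_def by (intro power_mono) auto
          then show ?thesis by (auto simp: indicator_def)
        qed (auto simp: indicator_def)
      qed (use iG integrable_indicator_Icc in auto)
      finally show ?thesis .
    qed
    have b0: "bx u u > 0" using 4 pos c0 by (meson less_le_trans mult_pos_pos zero_less_power)
    have "B\<^sup>2 * ?I a \<le> B\<^sup>2 * (2 * ?I (a/2))" using 3 by (intro mult_left_mono) auto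
    also have "\<dots> \<le> B\<^sup>2 * (2 * (bx u u / c0\<^sup>2))"
      using 4 c0 by (intro mult_left_mono) (auto simp: le_divide_eq mult.commute)
    finally have "hx (n\<^sup>2) u u \<le> (\<beta> * n + C) * bx u u"
      using 1 2 by (simp add: C_def algebra_simps)
    with uT b0 show ?thesis by blast
  qed
  then show ?thesis by blast
qed

end

section \<open>Near-minimisers and Agmon's estimate\<close>

context grushin_setting
begin

lemma lam_ge: "\<mu> \<ge> 0 \<Longrightarrow> u \<in> Tx \<Longrightarrow> bx u u > 0 \<Longrightarrow> - CV \<le> lam \<mu>"
  unfolding lam_def
proof (rule cInf_greatest)
  assume "\<mu> \<ge> 0" "u \<in> Tx" "bx u u > 0"
  then show "(\<lambda>u. hx \<mu> u u / bx u u) ` {u \<in> Tx. bx u u > 0} \<noteq> {}" by blast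
  fix x assume "x \<in> (\<lambda>u. hx \<mu> u u / bx u u) ` {u \<in> Tx. bx u u > 0}"
  then obtain v where v: "v \<in> Tx" "bx v v > 0" "x = hx \<mu> v v / bx v v" by blast
  have "- CV * bx v v \<le> hx \<mu> v v" by (rule hx_ge[OF \<open>\<mu> \<ge> 0\<close> bump_testsD[OF v(1)]])
  with v show "- CV \<le> x" by (simp add: le_divide_eq)
qed

definition Qx where "Qx \<mu> u v = hx \<mu> u v - lam \<mu> * bx u v"

lemma Qx_nonneg: "\<mu> \<ge> 0 \<Longrightarrow> u \<in> Tx \<Longrightarrow> 0 \<le> Qx \<mu> u u"
  using lam_le by (simp add: Qx_def)

text \<open>Subtracting \<open>lam \<mu>\<close> makes the form nonnegative. If
  \<open>Qx \<mu> u u\<close> is small, this inequality is the approximate weak eigenvalue equation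
  for \<open>u\<close>, tested with \<open>v\<close>.\<close>

lemma Qx_CS:
  assumes \<mu>: "\<mu> \<ge> 0" and u: "u \<in> Tx" and v: "v \<in> Tx"
  shows "(Qx \<mu> u v)\<^sup>2 \<le> Qx \<mu> u u * Qx \<mu> v v"
proof -
  note su = bump_testsD[OF u] and sv = bump_testsD[OF v]
  have "0 \<le> Qx \<mu> u u + 2 * s * Qx \<mu> u v + s\<^sup>2 * Qx \<mu> v v" for s
  proof -
    let ?w = "\<lambda>x. u x + s * v x"
    have w: "?w \<in> Tx" by (rule bump_tests_comb[OF u v])
    note sw = bump_testsD[OF w]
    have "Qx \<mu> ?w ?w = Qx \<mu> u u + 2 * s * Qx \<mu> u v + s\<^sup>2 * Qx \<mu> v v"
      unfolding Qx_def hx_comb[OF \<mu> su sv sw] bx_comb[OF su sv sw] hx_sym[of \<mu> u ?w] hx_sym[of \<mu> v ?w]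
        bx_sym[of u ?w] bx_sym[of v ?w] hx_comb[OF \<mu> su sv su] hx_comb[OF \<mu> su sv sv] bx_comb[OF su sv su]
        bx_comb[OF su sv sv] hx_sym[of \<mu> v u] bx_sym[of v u]
      by (simp add: power2_eq_square algebra_simps)
    then show ?thesis using Qx_nonneg[OF \<mu> w] by simp
  qed
  then show ?thesis by (rule discriminant_bound) (rule Qx_nonneg[OF \<mu> v])
qed

lemma near_minimiser_x:
  assumes \<mu>: "\<mu> \<ge> 0" and ne: "u \<in> Tx" "bx u u > 0" and \<delta>: "\<delta> > 0"
  shows "\<exists>\<psi>\<in>Tx. bx \<psi> \<psi> = 1 \<and> hx \<mu> \<psi> \<psi> \<le> lam \<mu> + \<delta>"
proof -
  let ?S = "(\<lambda>u. hx \<mu> u u / bx u u) ` {u \<in> Tx. bx u u > 0}"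
  have "?S \<noteq> {}" using ne by blast
  moreover have "Inf ?S < lam \<mu> + \<delta>" using \<delta> by (simp add: lam_def)
  ultimately have "\<exists>s\<in>?S. s < lam \<mu> + \<delta>" by (rule cInf_lessD)
  then obtain v where v: "v \<in> Tx" "bx v v > 0" "hx \<mu> v v / bx v v < lam \<mu> + \<delta>" by auto
  let ?c = "1 / sqrt (bx v v)"
  have c2: "?c\<^sup>2 = 1 / bx v v" using v(2) by (simp add: power_divide)
  show ?thesis
  proof (intro bexI[of _ "\<lambda>x. ?c * v x"] conjI)
    show "bx (\<lambda>x. ?c * v x) (\<lambda>x. ?c * v x) = 1" unfolding bx_scale c2 using v(2) by simp
    show "hx \<mu> (\<lambda>x. ?c * v x) (\<lambda>x. ?c * v x) \<le> lam \<mu> + \<delta>"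
      unfolding hx_scale[OF bump_testsD[OF v(1)]] c2 using v(3) by simp
    show "(\<lambda>x. ?c * v x) \<in> Tx" by (rule tests_scale[OF v(1)])
  qed
qed

text \<open>The primitive of \<open>q\<close> that vanishes at 0; starting both integrals at
  \<open>-L\<close> makes it differentiable across 0. Where \<open>q\<close> vanishes only at 0, its
  absolute value is the Agmon distance.\<close>

definition Pq :: "real \<Rightarrow> real" where
  "Pq x = integral {-L..x} q - integral {-L..0} q"

lemma Pq_0: "Pq 0 = 0" by (simp add: Pq_def)

lemma Pq_within: "x \<in> {-L..L} \<Longrightarrow> (Pq has_real_derivative q x) (at x within {-L..L})"
  unfolding Pq_def using integral_has_real_derivative[OF q_cont, of x] by (auto intro!: derivative_eq_intros)

lemma Pq_DERIV: "\<bar>x\<bar> < L \<Longrightarrow> (Pq has_real_derivative q x) (at x)"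
  using Pq_within[of x] at_within_interior[of x "{-L..L}"] by (auto simp: abs_less_iff)

lemma Pq_cont: "continuous_on {-L..L} Pq"
  using Pq_within by (rule DERIV_continuous_on)

lemma Pq_smooth: "smooth {-L<..<L} Pq"
  by (rule smooth_antideriv[of _ _ q]) (auto intro!: Pq_DERIV smooth_fun_on_imp_smooth[OF q_smooth])

lemma cosh_Pq_cont: "continuous_on {-L..L} (\<lambda>x. cosh (k * Pq x))"
  unfolding cosh_def by (intro continuous_intros Pq_cont) auto

text \<open>Agmon's estimate: testing the weak equation of a near-minimiser \<open>\<psi>\<close> with \<open>W\<^sup>2 \<psi>\<close>, where
  \<open>|W'| \<le> \<sigma> n |q| W\<close>, leaves the potential \<open>(1 - \<sigma>\<^sup>2) n\<^sup>2 q\<^sup>2\<close>, which dominates away from 0.\<close>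

lemma agmon:
  assumes \<sigma>: "0 < \<sigma>" "\<sigma> < 1" and n: "n \<ge> 0"
    and gap: "\<And>x. \<rho> \<le> \<bar>x\<bar> \<Longrightarrow> \<bar>x\<bar> < L \<Longrightarrow> lam (n\<^sup>2) + CV + 1 \<le> (1 - \<sigma>\<^sup>2) * n\<^sup>2 * (q x)\<^sup>2"
    and core: "\<And>x. \<bar>x\<bar> < \<rho> \<Longrightarrow> \<bar>x\<bar> < L \<Longrightarrow> \<bar>Pq x\<bar> \<le> \<eta>"
  shows "\<exists>\<delta>0>0. \<forall>\<psi>\<in>Tx. bx \<psi> \<psi> = 1 \<longrightarrow> hx (n\<^sup>2) \<psi> \<psi> \<le> lam (n\<^sup>2) + \<delta>0 \<longrightarrow>
    (LINT x|Mx. indicator {x. \<rho> \<le> \<bar>x\<bar>} x * (cosh (\<sigma> * n * Pq x) * \<psi> x)\<^sup>2) \<le> 1 + (lam (n\<^sup>2) + CV) * exp (2 * \<sigma> * n * \<eta>)"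
proof -
  define \<kappa> where "\<kappa> = \<sigma> * n"
  have \<kappa>: "\<kappa> \<ge> 0" using \<sigma> n by (simp add: \<kappa>_def)
  define W where "W x = cosh (\<kappa> * Pq x)" for x
  define W' where "W' x = sinh (\<kappa> * Pq x) * (\<kappa> * q x)" for x
  have WD: "(W has_real_derivative W' x) (at x)" if "\<bar>x\<bar> < L" for x
    unfolding W_def W'_def by (intro has_field_derivative_cosh DERIV_cmult Pq_DERIV that)
  have Ws: "smooth {-L<..<L} (\<lambda>x. (W x)\<^sup>2)"
    unfolding W_def by (intro smooth_power smooth_cosh smooth_mult smooth_const Pq_smooth)
  have Wc: "continuous_on {-L..L} W" unfolding W_def by (rule cosh_Pq_cont)
  have "bounded (Pq ` {-L..L})" by (intro compact_imp_bounded compact_continuous_image Pq_cont) auto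
  then obtain Pm where bnd: "\<forall>z\<in>Pq ` {-L..L}. norm z \<le> Pm" unfolding bounded_iff by blast
  define Wm where "Wm = exp (\<kappa> * Pm)"
  have Wb: "W x \<le> Wm" "0 < W x" "\<bar>W' x\<bar> \<le> \<kappa> * Cq * Wm" "\<bar>W' x\<bar> \<le> \<kappa> * \<bar>q x\<bar> * W x" if "\<bar>x\<bar> < L" for x
  proof -
    have "x \<in> {-L..L}" using that by auto
    then have P: "\<bar>Pq x\<bar> \<le> Pm" and qx: "\<bar>q x\<bar> \<le> Cq" using bspec[OF bnd imageI] Cq(2) by auto
    have "W x \<le> exp \<bar>\<kappa> * Pq x\<bar>" unfolding W_def by (rule cosh_bounds)
    also have "\<dots> \<le> Wm" using mult_left_mono[OF P \<kappa>] \<kappa> by (simp add: Wm_def abs_mult)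
    finally show 1: "W x \<le> Wm" .
    show "0 < W x" by (simp add: W_def)
    have "\<bar>W' x\<bar> = \<bar>sinh (\<kappa> * Pq x)\<bar> * (\<kappa> * \<bar>q x\<bar>)" using \<kappa> by (simp add: W'_def abs_mult)
    also have "\<dots> \<le> W x * (\<kappa> * \<bar>q x\<bar>)" unfolding W_def using \<kappa> by (intro mult_right_mono cosh_bounds) auto
    finally show 2: "\<bar>W' x\<bar> \<le> \<kappa> * \<bar>q x\<bar> * W x" by (simp add: mult.commute mult.left_commute)
    also have "\<dots> \<le> \<kappa> * Cq * Wm" using \<kappa> qx 1 \<open>0 < W x\<close> by (intro mult_mono mult_nonneg_nonneg) (auto intro: mult_left_mono order_trans[OF abs_ge_zero qx])
    finally show "\<bar>W' x\<bar> \<le> \<kappa> * Cq * Wm" .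
  qed
  define \<Lambda> where "\<Lambda> = lam (n\<^sup>2) + CV"
  define a1 where "a1 = 2 * Wm * (\<kappa> * Cq * Wm)"
  define a2 where "a2 = Wm\<^sup>2"
  \<comment> \<open>\<open>B\<close> bounds \<open>Qx\<close> at \<open>W^2 \<psi>\<close>,
    uniformly in the near-minimisers. It is huge in \<open>n\<close>, but \<open>\<delta>0\<close>
    may depend on \<open>n\<close>, and \<open>\<delta>0 * B \<le> 1\<close> reduces the error of
    the weak equation to 1.\<close>
  define B where "B = 2 * a1\<^sup>2 + 2 * a2\<^sup>2 * (\<bar>\<Lambda>\<bar> + 1) + (n\<^sup>2 * Cq\<^sup>2 + 2 * CV) * a2\<^sup>2"
  have B: "B \<ge> 0" using CV(1) by (simp add: B_def)
  define \<delta>0 where "\<delta>0 = 1 / (B + 1)"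
  have \<delta>0: "\<delta>0 > 0" "\<delta>0 \<le> 1" "\<delta>0 * B \<le> 1" using B by (auto simp: \<delta>0_def divide_le_eq)
  have "(LINT x|Mx. indicator {x. \<rho> \<le> \<bar>x\<bar>} x * (cosh (\<sigma> * n * Pq x) * \<psi> x)\<^sup>2) \<le> 1 + \<Lambda> * exp (2 * \<sigma> * n * \<eta>)"
    if \<psi>: "\<psi> \<in> Tx" "bx \<psi> \<psi> = 1" "hx (n\<^sup>2) \<psi> \<psi> \<le> lam (n\<^sup>2) + \<delta>0" for \<psi>
  proof -
    note s\<psi> = bump_testsD[OF \<psi>(1)]
    have \<Lambda>: "\<Lambda> \<ge> 0" using lam_ge[of "n\<^sup>2" \<psi>] \<psi> by (simp add: \<Lambda>_def)
    define \<xi> where "\<xi> x = (W x)\<^sup>2 * \<psi> x" for x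
    have \<xi>: "\<xi> \<in> Tx" unfolding \<xi>_def by (rule bump_tests_weight[OF _ Ws \<psi>(1)]) simp
    note s\<xi> = bump_testsD[OF \<xi>]
    have d\<xi>: "deriv \<xi> x = 2 * W x * W' x * \<psi> x + (W x)\<^sup>2 * deriv \<psi> x" if "\<bar>x\<bar> < L" for x
      unfolding \<xi>_def using WD[OF that] smooth_UNIV_DERIV[OF s\<psi>]
      by (intro DERIV_imp_deriv) (auto intro!: derivative_eq_intros)
    have i1: "integrable Mx (\<lambda>x. (\<psi> x)\<^sup>2)" "integrable Mx (\<lambda>x. (deriv \<psi> x)\<^sup>2)"
      using x_integrable(1,2)[OF s\<psi> s\<psi>, of 0] by (simp_all add: power2_eq_square)
    have b1: "(LINT x|Mx. (\<psi> x)\<^sup>2) = 1" using \<psi>(2) by (simp add: bx_def power2_eq_square)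
    have dd: "(LINT x|Mx. (deriv \<psi> x)\<^sup>2) \<le> \<Lambda> + 1"
      using hx_lower[of "n\<^sup>2" \<psi>] s\<psi> \<psi>(2,3) \<delta>0(2) by (simp add: \<Lambda>_def)
    have Q\<xi>: "Qx (n\<^sup>2) \<xi> \<xi> \<le> B"
    proof -
      have lamCV: "- lam (n\<^sup>2) \<le> CV" using \<Lambda> by (simp add: \<Lambda>_def)
      have "Qx (n\<^sup>2) \<xi> \<xi> = (LINT x|Mx. (deriv \<xi> x * deriv \<xi> x + pot (n\<^sup>2) x * (\<xi> x * \<xi> x)) + (- lam (n\<^sup>2)) * (\<xi> x * \<xi> x))"
        unfolding Qx_def hx_def bx_def
        using integral_linear_comb[OF x_integrable(4)[OF s\<xi> s\<xi>, of "n\<^sup>2"] x_integrable(1)[OF s\<xi> s\<xi>, of 0], of "- lam (n\<^sup>2)"] by simp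
      also have "\<dots> \<le> (LINT x|Mx. (2 * a1\<^sup>2 + (n\<^sup>2 * Cq\<^sup>2 + 2 * CV) * a2\<^sup>2) * (\<psi> x)\<^sup>2 + 2 * a2\<^sup>2 * (deriv \<psi> x)\<^sup>2)"
      proof (rule integral_mono)
        show "integrable Mx (\<lambda>x. (deriv \<xi> x * deriv \<xi> x + pot (n\<^sup>2) x * (\<xi> x * \<xi> x)) + (- lam (n\<^sup>2)) * (\<xi> x * \<xi> x))"
          by (intro Bochner_Integration.integrable_add Bochner_Integration.integrable_mult_right x_integrable s\<xi>) auto
        show "integrable Mx (\<lambda>x. (2 * a1\<^sup>2 + (n\<^sup>2 * Cq\<^sup>2 + 2 * CV) * a2\<^sup>2) * (\<psi> x)\<^sup>2 + 2 * a2\<^sup>2 * (deriv \<psi> x)\<^sup>2)"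
          using i1 by simp
        fix x assume "x \<in> space Mx"
        then have x: "\<bar>x\<bar> < L" by (auto simp: space_Mx)
        have W2: "\<bar>(W x)\<^sup>2\<bar> \<le> a2" using Wb[OF x] by (auto simp: a2_def intro!: power_mono)
        have WW: "\<bar>2 * W x * W' x\<bar> \<le> a1"
          using Wb[OF x] mult_mono[of "2 * W x" "2 * Wm" "\<bar>W' x\<bar>" "\<kappa> * Cq * Wm"] by (simp add: a1_def abs_mult)
        have "(deriv \<xi> x)\<^sup>2 \<le> 2 * (2 * W x * W' x * \<psi> x)\<^sup>2 + 2 * ((W x)\<^sup>2 * deriv \<psi> x)\<^sup>2"
          unfolding d\<xi>[OF x] using zero_le_power2[of "2 * W x * W' x * \<psi> x - (W x)\<^sup>2 * deriv \<psi> x"]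
          by (simp add: power2_sum power2_diff)
        also have "\<dots> = 2 * (2 * W x * W' x)\<^sup>2 * (\<psi> x)\<^sup>2 + 2 * ((W x)\<^sup>2)\<^sup>2 * (deriv \<psi> x)\<^sup>2" by (simp add: power_mult_distrib)
        also have "\<dots> \<le> 2 * a1\<^sup>2 * (\<psi> x)\<^sup>2 + 2 * a2\<^sup>2 * (deriv \<psi> x)\<^sup>2"
          using power_mono[OF WW, of 2] power_mono[OF W2, of 2] by (intro add_mono mult_right_mono) (auto simp: power2_abs)
        finally have A: "(deriv \<xi> x)\<^sup>2 \<le> 2 * a1\<^sup>2 * (\<psi> x)\<^sup>2 + 2 * a2\<^sup>2 * (deriv \<psi> x)\<^sup>2" .
        have "(\<xi> x)\<^sup>2 = ((W x)\<^sup>2)\<^sup>2 * (\<psi> x)\<^sup>2" by (simp add: \<xi>_def power_mult_distrib)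
        also have "\<dots> \<le> a2\<^sup>2 * (\<psi> x)\<^sup>2" using power_mono[OF W2, of 2] by (intro mult_right_mono) (auto simp: power2_abs)
        finally have x2: "(\<xi> x)\<^sup>2 \<le> a2\<^sup>2 * (\<psi> x)\<^sup>2" .
        have "(pot (n\<^sup>2) x - lam (n\<^sup>2)) * (\<xi> x)\<^sup>2 \<le> (n\<^sup>2 * Cq\<^sup>2 + 2 * CV) * (\<xi> x)\<^sup>2"
          using pot_bounds[of "n\<^sup>2" x] x lamCV by (intro mult_right_mono) auto
        also have "\<dots> \<le> (n\<^sup>2 * Cq\<^sup>2 + 2 * CV) * (a2\<^sup>2 * (\<psi> x)\<^sup>2)" using x2 CV(1) by (intro mult_left_mono) auto
        finally show "(deriv \<xi> x * deriv \<xi> x + pot (n\<^sup>2) x * (\<xi> x * \<xi> x)) + (- lam (n\<^sup>2)) * (\<xi> x * \<xi> x)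
          \<le> (2 * a1\<^sup>2 + (n\<^sup>2 * Cq\<^sup>2 + 2 * CV) * a2\<^sup>2) * (\<psi> x)\<^sup>2 + 2 * a2\<^sup>2 * (deriv \<psi> x)\<^sup>2"
          using A unfolding power2_eq_square[of "deriv \<xi> x"] power2_eq_square[of "\<xi> x"] by (simp only: ring_distribs mult.assoc)
      qed
      also have "\<dots> = 2 * a1\<^sup>2 + (n\<^sup>2 * Cq\<^sup>2 + 2 * CV) * a2\<^sup>2 + 2 * a2\<^sup>2 * (LINT x|Mx. (deriv \<psi> x)\<^sup>2)"
        using i1 b1 by simp
      also have "\<dots> \<le> 2 * a1\<^sup>2 + (n\<^sup>2 * Cq\<^sup>2 + 2 * CV) * a2\<^sup>2 + 2 * a2\<^sup>2 * (\<bar>\<Lambda>\<bar> + 1)"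
        using dd \<Lambda> by (intro add_left_mono mult_left_mono) auto
      finally show ?thesis by (simp add: B_def)
    qed
    have Q1: "Qx (n\<^sup>2) \<psi> \<xi> \<le> 1"
    proof -
      have "Qx (n\<^sup>2) \<psi> \<psi> \<le> \<delta>0" using \<psi> by (simp add: Qx_def)
      then have "(Qx (n\<^sup>2) \<psi> \<xi>)\<^sup>2 \<le> \<delta>0 * B"
        using Qx_CS[OF _ \<psi>(1) \<xi>, of "n\<^sup>2"] mult_mono[OF _ Q\<xi>, of "Qx (n\<^sup>2) \<psi> \<psi>" \<delta>0] Qx_nonneg[OF _ \<xi>, of "n\<^sup>2"] \<delta>0(1) by simp
      also have "\<dots> \<le> 1\<^sup>2" using \<delta>0(3) by simp
      finally show ?thesis by (rule power2_le_imp_le) simp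
    qed
    let ?E = "exp (2 * \<sigma> * n * \<eta>)"
    let ?i = "\<lambda>x. indicator {x. \<rho> \<le> \<bar>x\<bar>} x * (W x * \<psi> x)\<^sup>2"
    have cW: "continuous_on {-L..L} (\<lambda>x. (W x * \<psi> x)\<^sup>2)"
      by (intro continuous_intros Wc smooth_UNIV_continuous s\<psi>)
    have ii: "integrable Mx ?i"
    proof (rule Mx_integrable[OF _ _ cW, of _ 1])
      have "{x::real. \<rho> \<le> \<bar>x\<bar>} \<in> sets borel" by measurable
      then show "indicat_real {x. \<rho> \<le> \<bar>x\<bar>} \<in> borel_measurable Mx" by (intro measurable_restrict_space1) auto
    qed (auto simp: indicator_def)
    have "(LINT x|Mx. ?i x) - \<Lambda> * ?E = (LINT x|Mx. ?i x - \<Lambda> * ?E * (\<psi> x)\<^sup>2)"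
      using ii i1 b1 by simp
    also have "\<dots> \<le> (LINT x|Mx. (deriv \<psi> x * deriv \<xi> x + pot (n\<^sup>2) x * (\<psi> x * \<xi> x)) + (- lam (n\<^sup>2)) * (\<psi> x * \<xi> x))"
    proof (rule integral_mono)
      show "integrable Mx (\<lambda>x. ?i x - \<Lambda> * ?E * (\<psi> x)\<^sup>2)" using ii i1 by simp
      show "integrable Mx (\<lambda>x. (deriv \<psi> x * deriv \<xi> x + pot (n\<^sup>2) x * (\<psi> x * \<xi> x)) + (- lam (n\<^sup>2)) * (\<psi> x * \<xi> x))"
        by (intro Bochner_Integration.integrable_add Bochner_Integration.integrable_mult_right x_integrable s\<xi> s\<psi>) auto
      fix x assume "x \<in> space Mx"
      then have x: "\<bar>x\<bar> < L" by (auto simp: space_Mx)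
      let ?e = "(W x * \<psi> x)\<^sup>2"
      have prod: "\<psi> x * \<xi> x = ?e" by (simp add: \<xi>_def power2_eq_square)
      have "(W' x)\<^sup>2 \<le> (\<kappa> * \<bar>q x\<bar> * W x)\<^sup>2" using power_mono[OF Wb(4)[OF x], of 2] by simp
      then have "(W' x)\<^sup>2 * (\<psi> x)\<^sup>2 \<le> (\<kappa> * \<bar>q x\<bar> * W x)\<^sup>2 * (\<psi> x)\<^sup>2" by (rule mult_right_mono) simp
      also have "\<dots> = \<sigma>\<^sup>2 * n\<^sup>2 * (q x)\<^sup>2 * ?e" by (simp add: \<kappa>_def power_mult_distrib)
      finally have W'e: "(W' x)\<^sup>2 * (\<psi> x)\<^sup>2 \<le> \<sigma>\<^sup>2 * n\<^sup>2 * (q x)\<^sup>2 * ?e" .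
      \<comment> \<open>The identity
        \<open>\<psi>' (W^2 \<psi>)' = ((W \<psi>)')^2 - (W' \<psi>)^2\<close>: only the last term
        is negative, and it takes the part \<open>\<sigma>^2\<close> of the potential.\<close>
      have "deriv \<psi> x * deriv \<xi> x = (W x * deriv \<psi> x + W' x * \<psi> x)\<^sup>2 - (W' x)\<^sup>2 * (\<psi> x)\<^sup>2"
        unfolding d\<xi>[OF x] by (simp add: power2_eq_square algebra_simps)
      then have 1: "deriv \<psi> x * deriv \<xi> x \<ge> - (\<sigma>\<^sup>2 * n\<^sup>2 * (q x)\<^sup>2 * ?e)"
        using W'e zero_le_power2[of "W x * deriv \<psi> x + W' x * \<psi> x"] by linarith
      have "(n\<^sup>2 * (q x)\<^sup>2 - CV) * ?e \<le> pot (n\<^sup>2) x * ?e" using pot_bounds[of "n\<^sup>2" x] x by (intro mult_right_mono) auto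
      then have "((1 - \<sigma>\<^sup>2) * n\<^sup>2 * (q x)\<^sup>2 - \<Lambda>) * ?e \<le> (deriv \<psi> x * deriv \<xi> x + pot (n\<^sup>2) x * ?e) + (- lam (n\<^sup>2)) * ?e"
        using 1 by (simp add: \<Lambda>_def algebra_simps)
      \<comment> \<open>Off the core the gap leaves at least \<open>?e\<close>. In the core nothing
        is gained, but \<open>W\<close> is at most \<open>exp (\<kappa> * \<eta>)\<close> there, so
        the loss is at most \<open>\<Lambda> * ?E * (\<psi> x)^2\<close>.\<close>
      moreover have "?i x - \<Lambda> * ?E * (\<psi> x)\<^sup>2 \<le> ((1 - \<sigma>\<^sup>2) * n\<^sup>2 * (q x)\<^sup>2 - \<Lambda>) * ?e"
      proof (cases "\<rho> \<le> \<bar>x\<bar>")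
        case True
        have "1 * ?e \<le> ((1 - \<sigma>\<^sup>2) * n\<^sup>2 * (q x)\<^sup>2 - \<Lambda>) * ?e"
          using gap[OF True x] by (intro mult_right_mono) (auto simp: \<Lambda>_def)
        moreover have "0 \<le> \<Lambda> * ?E * (\<psi> x)\<^sup>2" using \<Lambda> by simp
        ultimately show ?thesis using True by simp
      next
        case False
        have "W x \<le> exp \<bar>\<kappa> * Pq x\<bar>" unfolding W_def by (rule cosh_bounds)
        also have "\<dots> \<le> exp (\<kappa> * \<eta>)" using core[of x] False x \<kappa> by (simp add: abs_mult mult_left_mono)
        finally have "(W x)\<^sup>2 \<le> (exp (\<kappa> * \<eta>))\<^sup>2" using Wb(2)[OF x] by (intro power_mono) auto
        also have "\<dots> = ?E" by (simp add: \<kappa>_def exp_double[symmetric] algebra_simps)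
        finally have "(W x)\<^sup>2 * (\<psi> x)\<^sup>2 \<le> ?E * (\<psi> x)\<^sup>2" by (rule mult_right_mono) simp
        from mult_left_mono[OF this \<Lambda>] have "\<Lambda> * ?e \<le> \<Lambda> * ?E * (\<psi> x)\<^sup>2" by (simp add: power_mult_distrib mult.assoc)
        moreover have "0 \<le> (1 - \<sigma>\<^sup>2) * n\<^sup>2 * (q x)\<^sup>2 * ?e"
        proof -
          have "\<sigma>\<^sup>2 \<le> 1" using \<sigma> by (simp add: power_le_one)
          then show ?thesis by simp
        qed
        ultimately show ?thesis using False by (simp add: algebra_simps)
      qed
      ultimately show "?i x - \<Lambda> * ?E * (\<psi> x)\<^sup>2 \<le> (deriv \<psi> x * deriv \<xi> x + pot (n\<^sup>2) x * (\<psi> x * \<xi> x)) + (- lam (n\<^sup>2)) * (\<psi> x * \<xi> x)"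
        unfolding prod by linarith
    qed
    also have "\<dots> = Qx (n\<^sup>2) \<psi> \<xi>"
      unfolding Qx_def hx_def bx_def
      using integral_linear_comb[OF x_integrable(4)[OF s\<psi> s\<xi>, of "n\<^sup>2"] x_integrable(1)[OF s\<psi> s\<xi>, of 0], of "- lam (n\<^sup>2)"] by simp
    finally have "(LINT x|Mx. ?i x) \<le> 1 + \<Lambda> * ?E" using Q1 by simp
    then show ?thesis by (simp add: W_def \<kappa>_def)
  qed
  with \<delta>0(1) show ?thesis unfolding \<Lambda>_def by blast
qed

end

section \<open>Quasimodes in the variable y\<close>

lemma deriv_periodic:
  assumes "smooth UNIV u" "\<And>y. u (y + c) = (u y :: real)"
  shows "deriv u (y + c) = deriv u y"
proof -
  have "(u has_real_derivative deriv u (y + c)) (at (y + c))" by (rule smooth_UNIV_DERIV[OF assms(1)])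
  then have "((\<lambda>x. u (x + c)) has_real_derivative deriv u (y + c)) (at y)" by (simp add: DERIV_shift)
  then have "(u has_real_derivative deriv u (y + c)) (at y)" using assms(2) by simp
  then show ?thesis by (rule DERIV_imp_deriv[symmetric])
qed

definition y_tests :: "y_domain \<Rightarrow> (real \<Rightarrow> real) set" where
  "y_tests Y = (if Y = Circle then {u. smooth UNIV u \<and> (\<forall>y. u (y + 2 * pi) = u y)} else bump_tests (Yo Y))"

context grushin_setting
begin

abbreviation "TY \<equiv> y_tests Y"

lemmas TY_def = y_tests_def

lemma TY_smooth: "u \<in> TY \<Longrightarrow> smooth UNIV u"
  by (auto simp: TY_def dest: bump_testsD split: if_splits)

lemma TY_periodic: "u \<in> TY \<Longrightarrow> Y = Circle \<Longrightarrow> u (y + 2 * pi) = u y"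
  by (simp add: TY_def)

lemma TY_comb: "u \<in> TY \<Longrightarrow> v \<in> TY \<Longrightarrow> (\<lambda>y. u y + s * v y) \<in> TY"
  by (auto simp: TY_def intro: smooth_comb bump_tests_comb)

lemma TY_deriv: "u \<in> TY \<Longrightarrow> deriv u \<in> TY"
  by (auto simp: TY_def intro: smooth_deriv bump_tests_deriv deriv_periodic)

lemma TY_support:
  assumes u: "u \<in> TY"
  shows "\<exists>K. compact K \<and> K \<subseteq> Yo Y \<and> (Y = Circle \<longrightarrow> K = {0..2 * pi}) \<and> (Y \<noteq> Circle \<longrightarrow> (\<forall>y. y \<notin> K \<longrightarrow> u y = 0))
    \<and> (\<forall>y\<in>Omega_y Y. y \<notin> K \<longrightarrow> u y = 0)"
proof (cases "Y = Circle")
  case True then show ?thesis by (auto simp: Yo_def intro!: exI[of _ "{0..2 * pi}"])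
next
  case False then show ?thesis using u by (auto simp: TY_def bump_tests_def)
qed

lemma My_integrable:
  assumes w: "continuous_on (Yo Y) w" and K: "compact K" "K \<subseteq> Yo Y" and z: "\<And>y. y \<in> Omega_y Y \<Longrightarrow> y \<notin> K \<Longrightarrow> w y = (0::real)"
  shows "integrable My w"
proof -
  have "bounded (w ` K)" by (intro compact_imp_bounded compact_continuous_image K continuous_on_subset[OF w])
  then obtain B where bnd: "\<forall>z\<in>w ` K. norm z \<le> B" unfolding bounded_iff by blast
  show ?thesis
  proof (rule integrableI_bounded_set[where A="Omega_y Y \<inter> K" and B=B])
    show "w \<in> borel_measurable My" by (rule measurable_weight_y[OF w])
    show "Omega_y Y \<inter> K \<in> sets My" using K(1) by (auto simp: sets_restrict_space intro!: borel_compact)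
    have "emeasure My (Omega_y Y \<inter> K) = emeasure lborel (Omega_y Y \<inter> K)" by (subst emeasure_restrict_space) auto
    also have "\<dots> \<le> emeasure lborel K" using K(1) by (intro emeasure_mono) (auto intro: borel_compact)
    also have "\<dots> < \<infinity>" by (rule emeasure_compact_finite[OF K(1)])
    finally show "emeasure My (Omega_y Y \<inter> K) < \<infinity>" .
    show "AE y in My. y \<in> Omega_y Y \<inter> K \<longrightarrow> norm (w y) \<le> B" using bnd by (intro AE_I2) auto
    show "AE y in My. y \<notin> Omega_y Y \<inter> K \<longrightarrow> w y = 0" using z by (intro AE_I2) (auto simp: space_My)
  qed
qed

definition iy where "iy u v = (LINT y|My. u y * v y :: real)"
definition ay where "ay u v = (LINT y|My. (r y)\<^sup>2 * (deriv u y * deriv v y))"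
text \<open>With this choice the operator \<open>R\<close> of the pair \<open>py\<close>,
  \<open>iy\<close> is the resolvent \<open>(1 + A)^-1\<close> for
  \<open>A = - d/dy (r^2 d/dy)\<close>, so large spectral values of \<open>A\<close> become values
  of \<open>R\<close> near 0.\<close>

definition py where "py u v = ay u v + iy u v"

lemma y_integrable:
  assumes u: "u \<in> TY" and v: "v \<in> TY"
  shows "integrable My (\<lambda>y. u y * v y)" "integrable My (\<lambda>y. (r y)\<^sup>2 * (deriv u y * deriv v y))"
proof -
  obtain K where K: "compact K" "K \<subseteq> Yo Y" "\<And>y. y \<in> Omega_y Y \<Longrightarrow> y \<notin> K \<Longrightarrow> u y = 0"
    using TY_support[OF u] by blast
  obtain K' where K': "compact K'" "K' \<subseteq> Yo Y" "\<And>y. y \<in> Omega_y Y \<Longrightarrow> y \<notin> K' \<Longrightarrow> deriv u y = 0"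
    using TY_support[OF TY_deriv[OF u]] by blast
  show "integrable My (\<lambda>y. u y * v y)"
    by (rule My_integrable[OF _ K(1,2)])
      (auto intro!: continuous_on_mult[OF smooth_UNIV_continuous(1)[OF TY_smooth[OF u]] smooth_UNIV_continuous(1)[OF TY_smooth[OF v]]] simp: K(3))
  show "integrable My (\<lambda>y. (r y)\<^sup>2 * (deriv u y * deriv v y))"
    by (rule My_integrable[OF _ K'(1,2)])
      (auto intro!: continuous_on_mult[OF continuous_on_power[OF r_continuous(1)] continuous_on_mult[OF
        smooth_UNIV_continuous(2)[OF TY_smooth[OF u]] smooth_UNIV_continuous(2)[OF TY_smooth[OF v]]]] simp: K'(3))
qed

lemma iy_comb: "u \<in> TY \<Longrightarrow> v \<in> TY \<Longrightarrow> w \<in> TY \<Longrightarrow> iy (\<lambda>y. u y + s * v y) w = iy u w + s * iy v w"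
  unfolding iy_def using y_integrable(1)[of u w] y_integrable(1)[of v w]
  by (subst integral_linear_comb) (auto intro!: Bochner_Integration.integral_cong simp: algebra_simps)

lemma ay_comb: "u \<in> TY \<Longrightarrow> v \<in> TY \<Longrightarrow> w \<in> TY \<Longrightarrow> ay (\<lambda>y. u y + s * v y) w = ay u w + s * ay v w"
  unfolding ay_def using y_integrable(2)[of u w] y_integrable(2)[of v w]
  by (subst integral_linear_comb)
    (auto intro!: Bochner_Integration.integral_cong simp: algebra_simps deriv_comb[OF TY_smooth TY_smooth])

lemma iy_sym: "iy u v = iy v u" and ay_sym: "ay u v = ay v u"
  by (simp_all add: iy_def ay_def mult.commute)

sublocale FP: form_pair TY "\<lambda>s u v y. u y + s * v y" py iy
proof (rule form_pair.intro)
  fix u v w s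
  show "u \<in> TY \<Longrightarrow> v \<in> TY \<Longrightarrow> (\<lambda>y. u y + s * v y) \<in> TY" by (rule TY_comb)
  show "u \<in> TY \<Longrightarrow> v \<in> TY \<Longrightarrow> w \<in> TY \<Longrightarrow> iy (\<lambda>y. u y + s * v y) w = iy u w + s * iy v w" by (rule iy_comb)
  show "u \<in> TY \<Longrightarrow> v \<in> TY \<Longrightarrow> w \<in> TY \<Longrightarrow> py (\<lambda>y. u y + s * v y) w = py u w + s * py v w"
    by (simp add: py_def iy_comb ay_comb algebra_simps)
  show "iy u v = iy v u" by (rule iy_sym)
  show "py u v = py v u" by (simp add: py_def iy_sym[of u v] ay_sym[of u v])
  show "0 \<le> iy u u" by (simp add: iy_def integral_nonneg_AE)
  have "0 \<le> ay u u" by (simp add: ay_def integral_nonneg_AE)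
  then show "iy u u \<le> py u u" by (simp add: py_def)
qed

lemma iy_nonneg: "0 \<le> iy u u" by (simp add: iy_def integral_nonneg_AE)

text \<open>The operator \<open>1 + A\<close> with the derivative expanded. It furnishes for each
  \<open>z\<close> an exact preimage under \<open>R\<close>, as \<open>approx_eigenvector\<close>
  requires.\<close>

definition Aop :: "(real \<Rightarrow> real) \<Rightarrow> real \<Rightarrow> real" where
  "Aop z y = z y + (- 1) * ((2 * r y * deriv r y) * deriv z y + 1 * ((r y)\<^sup>2 * deriv (deriv z) y))"

lemma TY_weight:
  assumes w: "smooth (Yo Y) w" "\<And>y. Y = Circle \<Longrightarrow> w (y + 2 * pi) = w y" and u: "u \<in> TY"
  shows "(\<lambda>y. w y * u y) \<in> TY"
proof (cases "Y = Circle")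
  case True
  then have "smooth UNIV w" using w(1) by (simp add: Yo_def)
  then show ?thesis using u w(2) True by (auto simp: TY_def intro: smooth_mult)
next
  case False
  then show ?thesis using u bump_tests_weight[OF open_Yo w(1)] by (simp add: TY_def)
qed

lemma Aop:
  assumes z: "z \<in> TY"
  shows "Aop z \<in> TY" and "v \<in> TY \<Longrightarrow> iy (Aop z) v = py z v"
proof -
  note z1 = TY_deriv[OF z] note z2 = TY_deriv[OF z1]
  have rs: "smooth (Yo Y) r" "smooth (Yo Y) (deriv r)" by (rule r_smooth, rule smooth_deriv[OF r_smooth open_Yo])
  have per: "r (y + 2 * pi) = r y" "deriv r (y + 2 * pi) = deriv r y" if "Y = Circle" for y
  proof -
    show *: "r (y + 2 * pi) = r y" for y by (rule r_periodic[OF that])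
    have "smooth UNIV r" using r_smooth that by (simp add: Yo_def)
    from deriv_periodic[OF this *] show "deriv r (y + 2 * pi) = deriv r y" .
  qed
  have t1: "(\<lambda>y. (2 * r y * deriv r y) * deriv z y) \<in> TY"
    by (rule TY_weight[OF _ _ z1]) (auto intro!: smooth_mult smooth_const rs simp: per)
  have t2: "(\<lambda>y. (r y)\<^sup>2 * deriv (deriv z) y) \<in> TY"
    by (rule TY_weight[OF _ _ z2]) (auto intro!: smooth_power rs simp: per)
  have t3: "(\<lambda>y. (2 * r y * deriv r y) * deriv z y + 1 * ((r y)\<^sup>2 * deriv (deriv z) y)) \<in> TY" by (rule TY_comb[OF t1 t2])
  show "Aop z \<in> TY" using TY_comb[OF z t3, of "-1"] by (simp add: Aop_def[abs_def])
  assume v: "v \<in> TY"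
  let ?D = "\<lambda>y. ((2 * r y * deriv r y) * deriv z y + 1 * ((r y)\<^sup>2 * deriv (deriv z) y)) * v y + (r y)\<^sup>2 * (deriv z y * deriv v y)"
  obtain K where K: "compact K" "K \<subseteq> Yo Y" "\<And>y. Y \<noteq> Circle \<Longrightarrow> y \<notin> K \<Longrightarrow> v y = 0"
    using TY_support[OF v] by blast
  have "(LINT y|My. ?D y) = 0"
  proof (rule integral_y_derivative_zero[OF K(1,2), where u="\<lambda>y. (r y)\<^sup>2 * deriv z y * v y"])
    show "((\<lambda>y. (r y)\<^sup>2 * deriv z y * v y) has_real_derivative ?D y) (at y)" if "y \<in> Yo Y" for y
    proof -
      have 2: "((\<lambda>y. (r y)\<^sup>2) has_real_derivative 2 * r y * deriv r y) (at y)"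
        using smooth_DERIV[OF r_smooth open_Yo that] by (auto intro!: derivative_eq_intros)
      show ?thesis
        using DERIV_mult[OF DERIV_mult[OF 2 smooth_UNIV_DERIV[OF TY_smooth[OF z1]]] smooth_UNIV_DERIV[OF TY_smooth[OF v]]]
        by (rule DERIV_cong) (simp add: algebra_simps)
    qed
    show "continuous_on (Yo Y) ?D"
      by (intro continuous_on_add continuous_on_mult continuous_on_power continuous_on_const r_continuous
        smooth_UNIV_continuous TY_smooth z1 z2 z v)
    show "Y \<noteq> Circle \<Longrightarrow> y \<notin> K \<Longrightarrow> (r y)\<^sup>2 * deriv z y * v y = 0" for y using K(3) by simp
    show "?D y = 0" if "Y \<noteq> Circle" "y \<notin> K" for y
      using K(3)[OF that] deriv_zero_off_compact[OF K(1) K(3)[OF that(1)] that(2)] by simp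
    show "(r (2 * pi))\<^sup>2 * deriv z (2 * pi) * v (2 * pi) = (r 0)\<^sup>2 * deriv z 0 * v 0" if "Y = Circle"
      using per(1)[OF that, of 0] TY_periodic[OF z1 that, of 0] TY_periodic[OF v that, of 0] by simp
  qed
  have i: "integrable My (\<lambda>y. z y * v y)" "integrable My (\<lambda>y. ((2 * r y * deriv r y) * deriv z y + 1 * ((r y)\<^sup>2 * deriv (deriv z) y)) * v y)"
    "integrable My (\<lambda>y. (r y)\<^sup>2 * (deriv z y * deriv v y))"
    using y_integrable(1)[OF z v] y_integrable(1)[OF t3 v] y_integrable(2)[OF z v] by auto
  have "iy (Aop z) v = (LINT y|My. z y * v y + (- 1) * (((2 * r y * deriv r y) * deriv z y + 1 * ((r y)\<^sup>2 * deriv (deriv z) y)) * v y))"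
    unfolding iy_def Aop_def by (intro Bochner_Integration.integral_cong refl) (simp only: ring_distribs mult.assoc)
  also have "\<dots> = iy z v + (- 1) * (LINT y|My. ((2 * r y * deriv r y) * deriv z y + 1 * ((r y)\<^sup>2 * deriv (deriv z) y)) * v y)"
    unfolding iy_def by (rule integral_linear_comb[symmetric, OF i(1,2)])
  also have "(LINT y|My. ((2 * r y * deriv r y) * deriv z y + 1 * ((r y)\<^sup>2 * deriv (deriv z) y)) * v y) = - ay z v"
    using \<open>(LINT y|My. ?D y) = 0\<close> Bochner_Integration.integral_add[OF i(2,3)] by (simp add: ay_def)
  finally show "iy (Aop z) v = py z v" by (simp add: py_def)
qed

text \<open>One of \<open>sin (k y) u\<close>, \<open>cos (k y) u\<close> has a large Rayleigh quotient, as their energies add up to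
  at least \<open>k\<^sup>2\<close> times the energy of \<open>r u\<close>.\<close>

lemma TY_unbounded:
  assumes \<theta>: "\<theta> > 0"
  shows "\<exists>z\<in>TY. iy z z < \<theta> * py z z"
proof -
  define u0 where "u0 = (if Y = Circle then (\<lambda>_. 1) else if Y = Interval then bump 1 2 else bump 0 1)"
  have u0: "u0 \<in> TY"
    using pi_gt3 by (cases Y) (auto simp: u0_def TY_def Yo_def smooth_const intro!: bump_in_tests)
  note su = TY_smooth[OF u0]
  obtain K where K: "compact K" "K \<subseteq> Yo Y" "\<And>y. y \<in> Omega_y Y \<Longrightarrow> y \<notin> K \<Longrightarrow> u0 y = 0" "Y = Circle \<Longrightarrow> K = {0..2*pi}"
    using TY_support[OF u0] by blast
  obtain l h where lh: "l < h" "{l<..<h} \<subseteq> Omega_y Y" "\<And>y. y \<in> {l<..<h} \<Longrightarrow> u0 y > 0"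
  proof (cases Y)
    case Interval
    show ?thesis by (rule that[of 1 2]) (use Interval pi_gt3 in \<open>auto simp: u0_def intro: bump_pos\<close>)
  next
    case Circle
    show ?thesis by (rule that[of 0 1]) (use Circle pi_gt3 in \<open>auto simp: u0_def\<close>)
  next
    case Line
    show ?thesis by (rule that[of 0 1]) (use Line in \<open>auto simp: u0_def intro: bump_pos\<close>)
  qed
  have "K \<noteq> {}"
  proof
    assume "K = {}"
    have m: "(l + h) / 2 \<in> {l<..<h}" using lh(1) by auto
    then have "(l + h) / 2 \<in> Omega_y Y" using lh(2) by blast
    then show False using K(3) \<open>K = {}\<close> lh(3)[OF m] by simp
  qed
  \<comment> \<open>\<open>r\<close> may tend to 0 at the ends of the interval; on the compact set
    \<open>K\<close> it has a positive minimum.\<close>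
  then obtain y0 where y0: "y0 \<in> K" "\<And>y. y \<in> K \<Longrightarrow> r y0 \<le> r y"
    using continuous_attains_inf[OF K(1) _ continuous_on_subset[OF r_continuous(1) K(2)]] by blast
  define r0 where "r0 = r y0"
  have r0: "r0 > 0" unfolding r0_def by (rule r_pos) (use y0(1) K(2) in auto)
  have B0: "iy u0 u0 > 0"
  proof (rule ccontr)
    assume "\<not> ?thesis"
    then have "(LINT y|My. u0 y * u0 y) = 0" using iy_nonneg[of u0] unfolding iy_def by linarith
    then have "AE y in My. u0 y * u0 y = 0"
      using integral_nonneg_eq_0_iff_AE[OF y_integrable(1)[OF u0 u0]] by auto
    then have "AE y in lborel. y \<in> Omega_y Y \<longrightarrow> u0 y = 0" by (subst (asm) AE_restrict_space_iff) auto
    then have "AE y in lborel. y \<notin> {l<..<h}" by eventually_elim (use lh(2,3) in force)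
    then have "emeasure lborel {l<..<h} = 0"
      using AE_iff_measurable[of "{l<..<h}" lborel "\<lambda>y. y \<notin> {l<..<h}"]
      by (simp add: greaterThanLessThan_def greaterThan_def lessThan_def Int_def)
    then show False using lh(1) by simp
  qed
  \<comment> \<open>An integer frequency keeps \<open>sin (k y)\<close> and \<open>cos (k y)\<close>
    periodic on the circle.\<close>
  obtain k :: nat where k: "1 / (\<theta> * r0\<^sup>2) < real k" using reals_Archimedean2 by blast
  have k1: "1 < \<theta> * (r0\<^sup>2 * (real k)\<^sup>2)"
  proof -
    have "0 < 1 / (\<theta> * r0\<^sup>2)" using \<theta> r0 by simp
    then have "real k > 0" using k by linarith
    then have "real k \<ge> 1" by simp
    then have "real k \<le> (real k)\<^sup>2" by (simp add: power2_eq_square)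
    then have "1 / (\<theta> * r0\<^sup>2) < (real k)\<^sup>2" using k by linarith
    then show ?thesis using \<theta> r0 by (simp add: field_simps)
  qed
  define zs where "zs y = sin (real k * y) * u0 y" for y
  define zc where "zc y = cos (real k * y) * u0 y" for y
  have sk: "smooth A (\<lambda>y. sin (real k * y))" "smooth A (\<lambda>y. cos (real k * y))" for A
    by (rule smooth_compose[OF smooth_sin[of UNIV]], auto intro!: smooth_mult smooth_const smooth_ident)
      (rule smooth_compose[OF smooth_cos[of UNIV]], auto intro!: smooth_mult smooth_const smooth_ident)
  have pk: "sin (real k * (y + 2 * pi)) = sin (real k * y)" "cos (real k * (y + 2 * pi)) = cos (real k * y)" for y
  proof -
    have "real k * (y + 2 * pi) = real k * y + 2 * real k * pi" by (simp add: algebra_simps)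
    then show "sin (real k * (y + 2 * pi)) = sin (real k * y)" "cos (real k * (y + 2 * pi)) = cos (real k * y)"
      using sin_2npi[of k] cos_2npi[of k] by (simp_all add: sin_add cos_add)
  qed
  have zT: "zs \<in> TY" "zc \<in> TY" unfolding zs_def zc_def by (rule TY_weight[OF sk(1) pk(1) u0], rule TY_weight[OF sk(2) pk(2) u0])
  have d: "deriv zs y = real k * cos (real k * y) * u0 y + sin (real k * y) * deriv u0 y"
    "deriv zc y = - real k * sin (real k * y) * u0 y + cos (real k * y) * deriv u0 y" for y
    unfolding zs_def zc_def using smooth_UNIV_DERIV[OF su, of y]
    by (auto intro!: DERIV_imp_deriv derivative_eq_intros)
  have dsum: "(deriv zs y)\<^sup>2 + (deriv zc y)\<^sup>2 = (real k)\<^sup>2 * (u0 y)\<^sup>2 + (deriv u0 y)\<^sup>2" for y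
  proof -
    have "(deriv zs y)\<^sup>2 + (deriv zc y)\<^sup>2 = ((real k)\<^sup>2 * (u0 y)\<^sup>2 + (deriv u0 y)\<^sup>2) * ((sin (real k * y))\<^sup>2 + (cos (real k * y))\<^sup>2)"
      unfolding d by algebra
    then show ?thesis by simp
  qed
  have bsum: "iy zs zs + iy zc zc = iy u0 u0"
  proof -
    have "zs y * zs y + zc y * zc y = u0 y * u0 y" for y
    proof -
      have "zs y * zs y + zc y * zc y = ((sin (real k * y))\<^sup>2 + (cos (real k * y))\<^sup>2) * (u0 y * u0 y)"
        unfolding zs_def zc_def by algebra
      then show ?thesis by simp
    qed
    then show ?thesis unfolding iy_def
      by (simp add: Bochner_Integration.integral_add[symmetric] y_integrable zT)
  qed
  have asum: "r0\<^sup>2 * (real k)\<^sup>2 * iy u0 u0 \<le> ay zs zs + ay zc zc"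
  proof -
    have "r0\<^sup>2 * (real k)\<^sup>2 * iy u0 u0 = (LINT y|My. r0\<^sup>2 * (real k)\<^sup>2 * (u0 y * u0 y))" by (simp add: iy_def)
    also have "\<dots> \<le> (LINT y|My. (r y)\<^sup>2 * (deriv zs y * deriv zs y) + (r y)\<^sup>2 * (deriv zc y * deriv zc y))"
    proof (rule integral_mono)
      show "integrable My (\<lambda>y. r0\<^sup>2 * (real k)\<^sup>2 * (u0 y * u0 y))" using y_integrable(1)[OF u0 u0] by simp
      show "integrable My (\<lambda>y. (r y)\<^sup>2 * (deriv zs y * deriv zs y) + (r y)\<^sup>2 * (deriv zc y * deriv zc y))"
        by (intro Bochner_Integration.integrable_add y_integrable zT)
      fix y assume "y \<in> space My"
      then have y: "y \<in> Omega_y Y" by (simp add: space_My)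
      have "(r y)\<^sup>2 * (deriv zs y * deriv zs y) + (r y)\<^sup>2 * (deriv zc y * deriv zc y) = (r y)\<^sup>2 * ((deriv zs y)\<^sup>2 + (deriv zc y)\<^sup>2)"
        by (simp add: power2_eq_square algebra_simps)
      also have "\<dots> \<ge> (r y)\<^sup>2 * ((real k)\<^sup>2 * (u0 y)\<^sup>2)" unfolding dsum by (intro mult_left_mono) auto
      also have "(r y)\<^sup>2 * ((real k)\<^sup>2 * (u0 y)\<^sup>2) \<ge> r0\<^sup>2 * ((real k)\<^sup>2 * (u0 y)\<^sup>2)"
      proof (cases "y \<in> K")
        case True
        have "r0\<^sup>2 \<le> (r y)\<^sup>2" using y0(2)[OF True] r0 by (intro power_mono) (auto simp: r0_def)
        then show ?thesis by (intro mult_right_mono) auto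
      qed (use K(3)[OF y] in simp)
      finally show "r0\<^sup>2 * (real k)\<^sup>2 * (u0 y * u0 y) \<le> (r y)\<^sup>2 * (deriv zs y * deriv zs y) + (r y)\<^sup>2 * (deriv zc y * deriv zc y)"
        by (simp add: power2_eq_square mult.assoc)
    qed
    also have "\<dots> = ay zs zs + ay zc zc" unfolding ay_def by (intro Bochner_Integration.integral_add y_integrable zT)
    finally show ?thesis .
  qed
  have "iy zs zs < \<theta> * py zs zs \<or> iy zc zc < \<theta> * py zc zc"
  proof (rule ccontr)
    assume "\<not> ?thesis"
    then have "\<theta> * (py zs zs + py zc zc) \<le> iy u0 u0" using bsum by (simp add: ring_distribs)
    moreover have "\<theta> * (r0\<^sup>2 * (real k)\<^sup>2 * iy u0 u0) \<le> \<theta> * (py zs zs + py zc zc)"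
      using asum iy_nonneg[of zs] iy_nonneg[of zc] \<theta> by (intro mult_left_mono) (auto simp: py_def)
    ultimately have "(\<theta> * (r0\<^sup>2 * (real k)\<^sup>2)) * iy u0 u0 \<le> 1 * iy u0 u0" by (simp add: mult.assoc)
    then show False using k1 B0 by simp
  qed
  with zT show ?thesis by blast
qed

text \<open>Spectral mapping: a value \<open>t\<close> of the resolvent corresponds to
  \<open>\<mu> = 1 / t - 1\<close>, and \<open>t < \<theta>\<close> means
  \<open>\<mu> > \<bar>m0\<bar>\<close>. One \<open>\<mu>\<close> serves all accuracies, since
  \<open>\<delta>\<close> will have to beat factors that grow with \<open>\<mu>\<close>.\<close>

lemma y_quasimode:
  shows "\<exists>\<mu>\<ge>m0. \<forall>\<delta>>0. \<exists>\<phi>\<in>TY. iy \<phi> \<phi> = 1 \<and> (\<forall>\<xi>\<in>TY. \<bar>ay \<phi> \<xi> - \<mu> * iy \<phi> \<xi>\<bar> \<le> \<delta> * sqrt (py \<xi> \<xi>))"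
proof -
  define \<theta> where "\<theta> = 1 / (\<bar>m0\<bar> + 1)"
  have \<theta>: "\<theta> > 0" by (simp add: \<theta>_def)
  obtain z where z: "z \<in> TY" "iy z z < \<theta> * py z z" using TY_unbounded[OF \<theta>] by blast
  obtain t where t: "0 < t" "t < \<theta>" and ap: "\<And>\<delta>. \<delta> > 0 \<Longrightarrow> \<exists>v\<in>TY. py v v > 0 \<and>
    (\<forall>\<xi>\<in>TY. \<bar>iy v \<xi> - t * py v \<xi>\<bar> \<le> \<delta> * sqrt (py v v) * sqrt (py \<xi> \<xi>))"
    using FP.approx_eigenvector[OF \<theta> z(1) Aop(1)[OF z(1)] Aop(2)[OF z(1)] z(2)] by blast
  define \<mu> where "\<mu> = 1 / t - 1"
  have "1 / \<theta> < 1 / t" using t by (intro divide_strict_left_mono) auto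
  then have \<mu>: "\<mu> \<ge> m0" by (simp add: \<mu>_def \<theta>_def)
  have "\<exists>\<phi>\<in>TY. iy \<phi> \<phi> = 1 \<and> (\<forall>\<xi>\<in>TY. \<bar>ay \<phi> \<xi> - \<mu> * iy \<phi> \<xi>\<bar> \<le> \<delta> * sqrt (py \<xi> \<xi>))" if \<delta>: "\<delta> > 0" for \<delta>
  proof -
    \<comment> \<open>The first entry keeps \<open>iy v v\<close> above
      \<open>t / 2 * py v v\<close>, so that normalising in \<open>iy\<close> costs at most
      \<open>sqrt (2 / t)\<close>; the second pays for this factor and for the division by
      \<open>t\<close>.\<close>
    define e where "e = min (t / 2) (\<delta> * t / sqrt (2 / t))"
    have e: "e > 0" "e \<le> t / 2" "e \<le> \<delta> * t / sqrt (2 / t)"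
    proof -
      show "e > 0" using t \<delta> by (simp add: e_def)
      show "e \<le> t / 2" "e \<le> \<delta> * t / sqrt (2 / t)" unfolding e_def by (rule min.cobounded1, rule min.cobounded2)
    qed
    obtain v where v: "v \<in> TY" "py v v > 0" and va: "\<And>\<xi>. \<xi> \<in> TY \<Longrightarrow> \<bar>iy v \<xi> - t * py v \<xi>\<bar> \<le> e * sqrt (py v v) * sqrt (py \<xi> \<xi>)"
      using ap[OF e(1)] by blast
    have "\<bar>iy v v - t * py v v\<bar> \<le> e * py v v" using va[OF v(1)] v(2) by (simp add: mult.assoc)
    also have "\<dots> \<le> t / 2 * py v v" using e(2) v(2) by (intro mult_right_mono) auto
    finally have pv: "t / 2 * py v v \<le> iy v v" by linarith
    then have bv: "iy v v > 0" using t v(2) by (smt (verit) mult_pos_pos half_gt_zero)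
    define c where "c = 1 / sqrt (iy v v)"
    have c: "c > 0" "c\<^sup>2 = 1 / iy v v" using bv by (auto simp: c_def power_divide)
    define \<phi> where "\<phi> = (\<lambda>y. v y + (c - 1) * v y)"
    have \<phi>T: "\<phi> \<in> TY" unfolding \<phi>_def by (rule TY_comb[OF v(1) v(1)])
    have b\<phi>: "iy \<phi> \<xi> = c * iy v \<xi>" and a\<phi>: "ay \<phi> \<xi> = c * ay v \<xi>" if "\<xi> \<in> TY" for \<xi>
      unfolding \<phi>_def iy_comb[OF v(1) v(1) that] ay_comb[OF v(1) v(1) that] by (simp_all add: algebra_simps)
    have "iy \<phi> \<phi> = 1" using b\<phi>[OF \<phi>T] b\<phi>[OF v(1)] iy_sym[of v \<phi>] c bv by (simp add: power2_eq_square mult.assoc[symmetric])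
    moreover have "\<bar>ay \<phi> \<xi> - \<mu> * iy \<phi> \<xi>\<bar> \<le> \<delta> * sqrt (py \<xi> \<xi>)" if \<xi>: "\<xi> \<in> TY" for \<xi>
    proof -
      have "ay \<phi> \<xi> - \<mu> * iy \<phi> \<xi> = - (c / t) * (iy v \<xi> - t * py v \<xi>)"
        unfolding a\<phi>[OF \<xi>] b\<phi>[OF \<xi>] \<mu>_def py_def using t by (simp add: field_simps)
      then have "\<bar>ay \<phi> \<xi> - \<mu> * iy \<phi> \<xi>\<bar> = c / t * \<bar>iy v \<xi> - t * py v \<xi>\<bar>"
        using c t by (simp add: abs_mult)
      also have "\<dots> \<le> c / t * (e * sqrt (py v v) * sqrt (py \<xi> \<xi>))" using va[OF \<xi>] c t by (intro mult_left_mono) auto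
      also have "\<dots> = (c * sqrt (py v v)) * e / t * sqrt (py \<xi> \<xi>)" by simp
      also have "\<dots> \<le> sqrt (2 / t) * e / t * sqrt (py \<xi> \<xi>)"
      proof (intro mult_right_mono divide_right_mono)
        have "py v v / iy v v \<le> 2 / t" using pv bv t by (simp add: field_simps)
        from real_sqrt_le_mono[OF this] show "c * sqrt (py v v) \<le> sqrt (2 / t)" by (simp add: c_def real_sqrt_divide)
      qed (use e t FP.p_nonneg[OF \<xi>] in auto)
      also have "\<dots> \<le> \<delta> * sqrt (py \<xi> \<xi>)"
      proof (rule mult_right_mono)
        show "sqrt (2 / t) * e / t \<le> \<delta>" using e(3) t by (simp add: field_simps)
      qed (use FP.p_nonneg[OF \<xi>] in auto)
      finally show ?thesis .
    qed
    ultimately show ?thesis using \<phi>T by blast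
  qed
  with \<mu> show ?thesis by blast
qed

end

section \<open>Product quasimodes\<close>

lemma higher_deriv_DERIV: "smooth UNIV u \<Longrightarrow> ((deriv ^^ i) u has_real_derivative (deriv ^^ Suc i) u x) (at x)"
  using smooth_UNIV_DERIV[OF smooth_higher_deriv] by simp

definition tens :: "(real \<Rightarrow> real) \<Rightarrow> (real \<Rightarrow> real) \<Rightarrow> nat \<Rightarrow> nat \<Rightarrow> real \<times> real \<Rightarrow> complex" where
  "tens u v i j p = of_real ((deriv ^^ i) u (fst p) * (deriv ^^ j) v (snd p))"

lemma jet_tens:
  assumes u: "smooth UNIV u" and v: "smooth UNIV v"
  shows "jet (tens u v)"
  unfolding jet_def
proof (intro allI)
  fix i j and p :: "real \<times> real"
  have 1: "((\<lambda>p. (deriv ^^ i) u (fst p)) has_derivative (\<lambda>h. (deriv ^^ Suc i) u (fst p) * fst h)) (at p)"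
    using has_derivative_compose[OF has_derivative_fst[OF has_derivative_ident], of "(deriv ^^ i) u" "(*) ((deriv ^^ Suc i) u (fst p))" p UNIV]
      higher_deriv_DERIV[OF u, of i "fst p"] by (simp add: has_field_derivative_def)
  have 2: "((\<lambda>p. (deriv ^^ j) v (snd p)) has_derivative (\<lambda>h. (deriv ^^ Suc j) v (snd p) * snd h)) (at p)"
    using has_derivative_compose[OF has_derivative_snd[OF has_derivative_ident], of "(deriv ^^ j) v" "(*) ((deriv ^^ Suc j) v (snd p))" p UNIV]
      higher_deriv_DERIV[OF v, of j "snd p"] by (simp add: has_field_derivative_def)
  have "((\<lambda>p. complex_of_real ((deriv ^^ i) u (fst p) * (deriv ^^ j) v (snd p))) has_derivative
    (\<lambda>h. complex_of_real ((deriv ^^ i) u (fst p) * ((deriv ^^ Suc j) v (snd p) * snd h) + (deriv ^^ Suc i) u (fst p) * fst h * (deriv ^^ j) v (snd p)))) (at p)"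
    by (rule has_derivative_of_real[OF has_derivative_mult[OF 1 2]])
  then show "(tens u v i j has_derivative (\<lambda>(h, k). h *\<^sub>R tens u v (Suc i) j p + k *\<^sub>R tens u v i (Suc j) p)) (at p)"
    unfolding tens_def[abs_def]
    by (rule has_derivative_eq_rhs) (auto simp: fun_eq_iff scaleR_conv_of_real algebra_simps)
qed

lemma higher_deriv_zero_off_compact:
  assumes "compact (K :: real set)" "\<And>x. x \<notin> K \<Longrightarrow> u x = (0 :: real)"
  shows "x \<notin> K \<Longrightarrow> (deriv ^^ i) u x = 0"
proof (induction i arbitrary: x)
  case (Suc i)
  then show ?case using deriv_zero_off_compact[OF assms(1), of "(deriv ^^ i) u"] by simp
qed (simp add: assms)

lemma higher_deriv_periodic:
  assumes "smooth UNIV u" "\<And>y. u (y + c) = (u y :: real)"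
  shows "(deriv ^^ i) u (y + c) = (deriv ^^ i) u y"
proof (induction i arbitrary: y)
  case (Suc i)
  then show ?case using deriv_periodic[OF smooth_higher_deriv[OF assms(1)], of i] by simp
qed (simp add: assms)

text \<open>Quasimodes are real, so a pairing with one sees only the real part of a test function;
  the restrictions of that part to lines are real test functions of one variable.\<close>

lemma jet_Re: "jet D \<Longrightarrow> jet (\<lambda>i j p. complex_of_real (Re (D i j p)))"
  unfolding jet_def
proof (intro allI)
  fix i j p
  assume "\<forall>i j p. (D i j has_derivative (\<lambda>(h, k). h *\<^sub>R D (Suc i) j p + k *\<^sub>R D i (Suc j) p)) (at p)"
  then have "(D i j has_derivative (\<lambda>(h, k). h *\<^sub>R D (Suc i) j p + k *\<^sub>R D i (Suc j) p)) (at p)" by blast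
  then have "((\<lambda>p. complex_of_real (Re (D i j p))) has_derivative
      (\<lambda>h. complex_of_real (Re ((\<lambda>(h, k). h *\<^sub>R D (Suc i) j p + k *\<^sub>R D i (Suc j) p) h)))) (at p)"
    by (intro has_derivative_of_real has_derivative_Re)
  then show "((\<lambda>p. complex_of_real (Re (D i j p))) has_derivative
      (\<lambda>(h, k). h *\<^sub>R complex_of_real (Re (D (Suc i) j p)) + k *\<^sub>R complex_of_real (Re (D i (Suc j) p)))) (at p)"
    by (rule has_derivative_eq_rhs) (auto simp: fun_eq_iff scaleR_conv_of_real)
qed

context grushin_setting
begin

lemma tens_jet_of:
  assumes u: "u \<in> Tx" and v: "v \<in> TY"
  shows "\<exists>Kx Ky. jet_of (tens u v 0 0) (tens u v) Kx Ky"
proof -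
  note su = bump_testsD[OF u] and sv = TY_smooth[OF v]
  obtain Kx where Kx: "compact Kx" "Kx \<subseteq> {-L<..<L}" "\<And>x. x \<notin> Kx \<Longrightarrow> u x = 0" using u by (auto simp: bump_tests_def)
  obtain Ky where Ky: "compact Ky" "Ky \<subseteq> Yo Y" "Y = Circle \<Longrightarrow> Ky = {0..2*pi}" "\<And>y. Y \<noteq> Circle \<Longrightarrow> y \<notin> Ky \<Longrightarrow> v y = 0"
    using TY_support[OF v] by blast
  have zx: "tens u v i j (x, y) = 0" if "x \<notin> Kx" for i j x y
    using higher_deriv_zero_off_compact[OF Kx(1,3) that] by (simp add: tens_def)
  have zy: "tens u v i j (x, y) = 0" if "Y \<noteq> Circle" "y \<notin> Ky" for i j x y
    using higher_deriv_zero_off_compact[OF Ky(1) Ky(4)[OF that(1)] that(2)] by (simp add: tens_def)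
  have per: "tens u v i j (x, y + 2 * pi) = tens u v i j (x, y)" if "Y = Circle" for i j x y
    using higher_deriv_periodic[OF sv, of "2 * pi" j y] TY_periodic[OF v that] by (simp add: tens_def)
  have "jet_of (tens u v 0 0) (tens u v) Kx Ky"
    unfolding jet_of_def using jet_tens[OF su sv] Kx(1,2) Ky(1,2,3) zx zy per by blast
  then show ?thesis by blast
qed

lemma jet_of_Re:
  assumes D: "jet_of \<phi> D Kx Ky"
  shows "jet_of (\<lambda>p. complex_of_real (Re (\<phi> p))) (\<lambda>i j p. complex_of_real (Re (D i j p))) Kx Ky"
  using D jet_Re[OF jet_ofD(2)[OF D]] unfolding jet_of_def by (simp add: fun_eq_iff)

lemma slice_x:
  assumes D: "jet_of \<phi> D Kx Ky"
  shows "(\<lambda>x. Re (D 0 0 (x, y))) \<in> Tx" and "deriv (\<lambda>x. Re (D 0 0 (x, y))) = (\<lambda>x. Re (D 1 0 (x, y)))"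
proof -
  have d: "((\<lambda>x. Re (D i 0 (x, y))) has_real_derivative Re (D (Suc i) 0 (x, y))) (at x)" for i x
    using bounded_linear.has_vector_derivative[OF bounded_linear_Re jet_x[OF jet_ofD(2)[OF D], of i 0 y x]]
    by (simp add: has_real_derivative_iff_has_vector_derivative)
  have "ck n UNIV (\<lambda>x. Re (D i 0 (x, y)))" for n i
  proof (induction n arbitrary: i)
    case (Suc n)
    from d[of i] Suc[of "Suc i"] show ?case unfolding ck.simps
      by (intro exI[of _ "\<lambda>x. Re (D (Suc i) 0 (x, y))"] conjI ballI)
  qed simp
  then have "smooth UNIV (\<lambda>x. Re (D 0 0 (x, y)))" by (simp add: smooth_def)
  moreover have "D 0 0 (x, y) = 0" if "x \<notin> Kx" for x using D that unfolding jet_of_def by blast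
  ultimately show "(\<lambda>x. Re (D 0 0 (x, y))) \<in> Tx"
    using jet_ofD(3,4)[OF D] by (auto simp: bump_tests_def intro!: exI[of _ Kx])
  show "deriv (\<lambda>x. Re (D 0 0 (x, y))) = (\<lambda>x. Re (D 1 0 (x, y)))"
    using d[of 0] by (auto simp: fun_eq_iff intro!: DERIV_imp_deriv)
qed

lemma slice_y:
  assumes D: "jet_of \<phi> D Kx Ky"
  shows "(\<lambda>y. Re (D 0 0 (x, y))) \<in> TY" and "deriv (\<lambda>y. Re (D 0 0 (x, y))) = (\<lambda>y. Re (D 0 1 (x, y)))"
proof -
  have d: "((\<lambda>y. Re (D 0 i (x, y))) has_real_derivative Re (D 0 (Suc i) (x, y))) (at y)" for i y
    using bounded_linear.has_vector_derivative[OF bounded_linear_Re jet_y[OF jet_ofD(2)[OF D], of 0 i x y]]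
    by (simp add: has_real_derivative_iff_has_vector_derivative)
  have "ck n UNIV (\<lambda>y. Re (D 0 i (x, y)))" for n i
  proof (induction n arbitrary: i)
    case (Suc n)
    from d[of i] Suc[of "Suc i"] show ?case unfolding ck.simps
      by (intro exI[of _ "\<lambda>y. Re (D 0 (Suc i) (x, y))"] conjI ballI)
  qed simp
  then have s: "smooth UNIV (\<lambda>y. Re (D 0 0 (x, y)))" by (simp add: smooth_def)
  show "(\<lambda>y. Re (D 0 0 (x, y))) \<in> TY"
  proof (cases "Y = Circle")
    case True
    then show ?thesis using s jet_of_periodic[OF D True] by (simp add: TY_def)
  next
    case False
    then have "D 0 0 (x, y) = 0" if "y \<notin> Ky" for y using D that unfolding jet_of_def by blast
    then show ?thesis using s False jet_ofD(5,6)[OF D] by (auto simp: TY_def bump_tests_def intro!: exI[of _ Ky])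
  qed
  show "deriv (\<lambda>y. Re (D 0 0 (x, y))) = (\<lambda>y. Re (D 0 1 (x, y)))"
    using d[of 0] by (auto simp: fun_eq_iff intro!: DERIV_imp_deriv)
qed

lemma Qx_integral:
  assumes "\<mu> \<ge> 0" "smooth UNIV u" "smooth UNIV v"
  shows "Qx \<mu> u v = (LINT x|Mx. (deriv u x * deriv v x + pot \<mu> x * (u x * v x)) + (- lam \<mu>) * (u x * v x))"
  unfolding Qx_def hx_def bx_def
  using integral_linear_comb[OF x_integrable(4)[OF assms(2,3,1)] x_integrable(1)[OF assms(2,3), of 0], of "- lam \<mu>"] by simp

text \<open>The part of the form in \<open>x\<close> is treated on each line \<open>y = const\<close> and the part in \<open>y\<close> on each line
  \<open>x = const\<close>; the factor \<open>q\<^sup>2\<close> is what makes the latter integrable against the form.\<close>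

lemma tensor_quasimode:
  assumes \<mu>: "\<mu> \<ge> 0" and \<delta>: "\<delta> \<ge> 0" and u: "u \<in> Tx" "bx u u = 1" "Qx \<mu> u u \<le> \<delta>\<^sup>2" and lm: "- CV \<le> lam \<mu>"
    and v: "v \<in> TY" "iy v v = 1" "\<And>\<xi>. \<xi> \<in> TY \<Longrightarrow> \<bar>ay v \<xi> - \<mu> * iy v \<xi>\<bar> \<le> \<delta> * sqrt (py \<xi> \<xi>)"
    and f: "f \<in> test_functions L Y"
  shows "\<bar>BB f (tens u v 0 0) - lam \<mu> * IP f (tens u v 0 0)\<bar> \<le> \<delta> * (2 + 2 * Cq\<^sup>2 + 2 * CV + \<mu> * Cq\<^sup>2) * (1 + Qc f)"
proof -
  note su = bump_testsD[OF u(1)]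
  obtain D0 Kx Ky where D0: "jet_of f D0 Kx Ky" using test_jet[OF f] by blast
  define D where "D = (\<lambda>i j p. complex_of_real (Re (D0 i j p)))"
  have D: "jet_of (\<lambda>p. complex_of_real (Re (f p))) D Kx Ky" unfolding D_def by (rule jet_of_Re[OF D0])
  obtain Kx' Ky' where G: "jet_of (tens u v 0 0) (tens u v) Kx' Ky'" using tens_jet_of[OF u(1) v(1)] by blast
  define a where "a p = Re (D0 1 0 p)" for p
  define b where "b p = Re (D0 0 1 p)" for p
  define c where "c p = Re (D0 0 0 p)" for p
  have Fy: "(\<lambda>x. c (x, y)) \<in> Tx" "deriv (\<lambda>x. c (x, y)) = (\<lambda>x. a (x, y))" for y
    unfolding a_def b_def c_def by (rule slice_x[OF D0])+
  have Fx: "(\<lambda>y. c (x, y)) \<in> TY" "deriv (\<lambda>y. c (x, y)) = (\<lambda>y. b (x, y))" for x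
    unfolding a_def b_def c_def by (rule slice_y[OF D0])+
  have inn: "D0 i j p \<bullet> tens u v k l p = Re (D0 i j p) * ((deriv ^^ k) u (fst p) * (deriv ^^ l) v (snd p))" for i j k l p
    by (simp add: tens_def inner_complex_def)
  have innD: "D i j p \<bullet> D k l p = Re (D0 i j p) * Re (D0 k l p)" for i j k l p
    by (simp add: D_def inner_complex_def)
  note iG = jet_integrable[OF D0 G, unfolded inn] and iD = jet_integrable[OF D D, unfolded innD]
  \<comment> \<open>The term \<open>\<mu> q^2 c u v\<close> is added in \<open>H1\<close>, where it
    completes the potential of the fibre operator, and subtracted in \<open>H2\<close>, where it
    completes the quasimode equation in \<open>y\<close>.\<close>
  define H1 where "H1 p = v (snd p) * ((deriv u (fst p) * a p + pot \<mu> (fst p) * (u (fst p) * c p)) + (- lam \<mu>) * (u (fst p) * c p))" for p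
  define H2 where "H2 p = (q (fst p))\<^sup>2 * u (fst p) * ((r (snd p))\<^sup>2 * (deriv v (snd p) * b p) + (- \<mu>) * (v (snd p) * c p))" for p
  have i1: "integrable M (\<lambda>p. a p * (deriv u (fst p) * v (snd p)))" using iG(1)[of 1 0 1 0] by (simp add: a_def)
  have i2: "integrable M (\<lambda>p. V0 (fst p) * (c p * (u (fst p) * v (snd p))))" using iG(2)[of 0 0 0 0] by (simp add: c_def)
  have i3: "integrable M (\<lambda>p. (q (fst p))\<^sup>2 * (c p * (u (fst p) * v (snd p))))" using iG(3)[of 0 0 0 0] by (simp add: c_def)
  have i4: "integrable M (\<lambda>p. c p * (u (fst p) * v (snd p)))" using iG(1)[of 0 0 0 0] by (simp add: c_def)
  have i5: "integrable M (\<lambda>p. (q (fst p))\<^sup>2 * (r (snd p))\<^sup>2 * (b p * (u (fst p) * deriv v (snd p))))" using iG(4)[of 0 1 0 1] by (simp add: b_def)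
  have H1e: "H1 = (\<lambda>p. a p * (deriv u (fst p) * v (snd p)) + V0 (fst p) * (c p * (u (fst p) * v (snd p)))
      + \<mu> * ((q (fst p))\<^sup>2 * (c p * (u (fst p) * v (snd p)))) - lam \<mu> * (c p * (u (fst p) * v (snd p))))"
    by (auto simp: H1_def pot_def fun_eq_iff algebra_simps)
  have H2e: "H2 = (\<lambda>p. (q (fst p))\<^sup>2 * (r (snd p))\<^sup>2 * (b p * (u (fst p) * deriv v (snd p))) - \<mu> * ((q (fst p))\<^sup>2 * (c p * (u (fst p) * v (snd p)))))"
    by (auto simp: H2_def fun_eq_iff algebra_simps)
  have H1i: "integrable M H1" unfolding H1e
    by (intro Bochner_Integration.integrable_diff Bochner_Integration.integrable_add Bochner_Integration.integrable_mult_right i1 i2 i3 i4)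
  have H2i: "integrable M H2" unfolding H2e
    by (intro Bochner_Integration.integrable_diff Bochner_Integration.integrable_mult_right i3 i5)
  have tot: "BB f (tens u v 0 0) - lam \<mu> * IP f (tens u v 0 0) = (LINT p|M. H1 p) + (LINT p|M. H2 p)"
  proof -
    have e1: "D0 1 0 p \<bullet> tens u v 1 0 p = a p * (deriv u (fst p) * v (snd p))"
      "D0 0 1 p \<bullet> tens u v 0 1 p = b p * (u (fst p) * deriv v (snd p))"
      "D0 0 0 p \<bullet> tens u v 0 0 p = c p * (u (fst p) * v (snd p))" for p
      unfolding inn by (simp_all add: a_def b_def c_def)
    have "IP f (tens u v 0 0) = (LINT p|M. c p * (u (fst p) * v (snd p)))"
      unfolding IP_def jet_ofD(1)[OF D0, symmetric] e1 ..
    moreover have "BB f (tens u v 0 0) = (LINT p|M. a p * (deriv u (fst p) * v (snd p))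
        + (q (fst p))\<^sup>2 * (r (snd p))\<^sup>2 * (b p * (u (fst p) * deriv v (snd p))) + V0 (fst p) * (c p * (u (fst p) * v (snd p))))"
      unfolding BB_jet(1)[OF D0 G] e1 ..
    ultimately show ?thesis
      unfolding H1e H2e using i1 i2 i3 i4 i5 by simp
  qed
  define E where "E = (LINT p|M. (a p)\<^sup>2 + (q (fst p))\<^sup>2 * (r (snd p))\<^sup>2 * (b p)\<^sup>2 + (c p)\<^sup>2)"
  have j1: "integrable M (\<lambda>p. (a p)\<^sup>2)" using iD(1)[of 1 0 1 0] by (simp add: a_def power2_eq_square)
  have j2: "integrable M (\<lambda>p. (q (fst p))\<^sup>2 * (r (snd p))\<^sup>2 * (b p)\<^sup>2)" using iD(4)[of 0 1 0 1] by (simp add: b_def power2_eq_square)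
  have j3: "integrable M (\<lambda>p. (c p)\<^sup>2)" using iD(1)[of 0 0 0 0] by (simp add: c_def power2_eq_square)
  have j4: "integrable M (\<lambda>p. V0 (fst p) * (c p)\<^sup>2)" using iD(2)[of 0 0 0 0] by (simp add: c_def power2_eq_square)
  have j5: "integrable M (\<lambda>p. (q (fst p))\<^sup>2 * (c p)\<^sup>2)" using iD(3)[of 0 0 0 0] by (simp add: c_def power2_eq_square)
  have E0: "E \<ge> 0" unfolding E_def by (rule integral_nonneg_AE) auto
  have EQ: "E \<le> Qc f"
  proof -
    have re: "(Re z)\<^sup>2 \<le> z \<bullet> z" for z :: complex by (simp add: inner_complex_def power2_eq_square)
    have "E \<le> (LINT p|M. D0 1 0 p \<bullet> D0 1 0 p + (q (fst p))\<^sup>2 * (r (snd p))\<^sup>2 * (D0 0 1 p \<bullet> D0 0 1 p) + D0 0 0 p \<bullet> D0 0 0 p)"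
      unfolding E_def
    proof (rule integral_mono)
      show "integrable M (\<lambda>p. D0 1 0 p \<bullet> D0 1 0 p + (q (fst p))\<^sup>2 * (r (snd p))\<^sup>2 * (D0 0 1 p \<bullet> D0 0 1 p) + D0 0 0 p \<bullet> D0 0 0 p)"
        by (intro Bochner_Integration.integrable_add jet_integrable[OF D0 D0])
      show "(a p)\<^sup>2 + (q (fst p))\<^sup>2 * (r (snd p))\<^sup>2 * (b p)\<^sup>2 + (c p)\<^sup>2
        \<le> D0 1 0 p \<bullet> D0 1 0 p + (q (fst p))\<^sup>2 * (r (snd p))\<^sup>2 * (D0 0 1 p \<bullet> D0 0 1 p) + D0 0 0 p \<bullet> D0 0 0 p" for p
        unfolding a_def b_def c_def by (intro add_mono mult_left_mono re) auto
    qed (intro Bochner_Integration.integrable_add j1 j2 j3)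
    with energy_le_Qc[OF D0] show ?thesis by simp
  qed
  have half: "\<bar>x\<bar> * (\<delta> * sqrt y) \<le> \<delta> / 2 * (x\<^sup>2 + y)" if "y \<ge> 0" for x y
  proof -
    have "2 * \<bar>x\<bar> * sqrt y \<le> x\<^sup>2 + y" using sum_squares_bound[of "\<bar>x\<bar>" "sqrt y"] that by simp
    from mult_left_mono[OF this, of "\<delta> / 2"] \<delta> show ?thesis by (simp add: algebra_simps)
  qed
  have B1: "\<bar>LINT p|M. H1 p\<bar> \<le> \<delta> / 2 * (1 + (1 + \<mu> * Cq\<^sup>2 + 2 * CV) * E)"
  proof -
    let ?Fy = "\<lambda>y x. c (x, y)"
    have inner: "(LINT x|Mx. H1 (x, y)) = v y * Qx \<mu> u (?Fy y)" for y
      unfolding Qx_integral[OF \<mu> su bump_testsD[OF Fy(1)]] Fy(2) H1_def by simp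
    define R where "R p = (a p)\<^sup>2 + V0 (fst p) * (c p)\<^sup>2 + \<mu> * ((q (fst p))\<^sup>2 * (c p)\<^sup>2) - lam \<mu> * (c p)\<^sup>2" for p
    have Ri: "integrable M R" unfolding R_def
      by (intro Bochner_Integration.integrable_diff Bochner_Integration.integrable_add Bochner_Integration.integrable_mult_right j1 j3 j4 j5)
    have QR: "Qx \<mu> (?Fy y) (?Fy y) = (LINT x|Mx. R (x, y))" for y
      unfolding Qx_integral[OF \<mu> bump_testsD[OF Fy(1)] bump_testsD[OF Fy(1)]] Fy(2) R_def
      by (intro Bochner_Integration.integral_cong refl) (simp add: pot_def power2_eq_square algebra_simps)
    have vi: "integrable My (\<lambda>y. (v y)\<^sup>2)" using y_integrable(1)[OF v(1) v(1)] by (simp add: power2_eq_square)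
    have qi: "integrable My (\<lambda>y. Qx \<mu> (?Fy y) (?Fy y))" unfolding QR by (rule fubini(4)[OF Ri])
    have "\<bar>LINT p|M. H1 p\<bar> = \<bar>LINT y|My. v y * Qx \<mu> u (?Fy y)\<bar>" unfolding fubini(2)[OF H1i] inner ..
    also have "\<dots> \<le> (LINT y|My. \<bar>v y * Qx \<mu> u (?Fy y)\<bar>)" by (rule integral_abs_bound)
    also have "\<dots> \<le> (LINT y|My. \<delta> / 2 * ((v y)\<^sup>2 + Qx \<mu> (?Fy y) (?Fy y)))"
    proof (rule integral_mono)
      show "integrable My (\<lambda>y. \<bar>v y * Qx \<mu> u (?Fy y)\<bar>)" using fubini(4)[OF H1i] unfolding inner by (rule integrable_abs)
      show "integrable My (\<lambda>y. \<delta> / 2 * ((v y)\<^sup>2 + Qx \<mu> (?Fy y) (?Fy y)))" using vi qi by simp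
      fix y
      have n: "0 \<le> Qx \<mu> (?Fy y) (?Fy y)" by (rule Qx_nonneg[OF \<mu> Fy(1)])
      have "(Qx \<mu> u (?Fy y))\<^sup>2 \<le> Qx \<mu> u u * Qx \<mu> (?Fy y) (?Fy y)" by (rule Qx_CS[OF \<mu> u(1) Fy(1)])
      also have "\<dots> \<le> \<delta>\<^sup>2 * Qx \<mu> (?Fy y) (?Fy y)" using u(3) n by (rule mult_right_mono)
      finally have "sqrt ((Qx \<mu> u (?Fy y))\<^sup>2) \<le> sqrt (\<delta>\<^sup>2 * Qx \<mu> (?Fy y) (?Fy y))" by (rule real_sqrt_le_mono)
      then have "\<bar>Qx \<mu> u (?Fy y)\<bar> \<le> \<delta> * sqrt (Qx \<mu> (?Fy y) (?Fy y))" using \<delta> by (simp add: real_sqrt_mult)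
      then have "\<bar>v y\<bar> * \<bar>Qx \<mu> u (?Fy y)\<bar> \<le> \<bar>v y\<bar> * (\<delta> * sqrt (Qx \<mu> (?Fy y) (?Fy y)))" by (rule mult_left_mono) simp
      also have "\<dots> \<le> \<delta> / 2 * ((v y)\<^sup>2 + Qx \<mu> (?Fy y) (?Fy y))" by (rule half[OF n])
      finally show "\<bar>v y * Qx \<mu> u (?Fy y)\<bar> \<le> \<delta> / 2 * ((v y)\<^sup>2 + Qx \<mu> (?Fy y) (?Fy y))" by (simp add: abs_mult)
    qed
    also have "\<dots> = \<delta> / 2 * (1 + (LINT y|My. Qx \<mu> (?Fy y) (?Fy y)))"
      using vi qi v(2) by (simp add: iy_def power2_eq_square)
    also have "(LINT y|My. Qx \<mu> (?Fy y) (?Fy y)) = (LINT p|M. R p)" unfolding QR by (rule fubini(2)[OF Ri, symmetric])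
    \<comment> \<open>\<open>lam \<mu> \<ge> - CV\<close> bounds the zeroth-order coefficient by
      \<open>\<mu> * Cq^2 + 2 * CV\<close>, so the part of the form in \<open>x\<close> is
      controlled by the full energy of \<open>f\<close>.\<close>
    also have "(LINT p|M. R p) \<le> (LINT p|M. (1 + \<mu> * Cq\<^sup>2 + 2 * CV) * ((a p)\<^sup>2 + (q (fst p))\<^sup>2 * (r (snd p))\<^sup>2 * (b p)\<^sup>2 + (c p)\<^sup>2))"
    proof (rule integral_mono[OF Ri])
      show "integrable M (\<lambda>p. (1 + \<mu> * Cq\<^sup>2 + 2 * CV) * ((a p)\<^sup>2 + (q (fst p))\<^sup>2 * (r (snd p))\<^sup>2 * (b p)\<^sup>2 + (c p)\<^sup>2))"
        by (intro Bochner_Integration.integrable_add Bochner_Integration.integrable_mult_right j1 j2 j3)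
      fix p assume "p \<in> space M"
      then have p: "\<bar>fst p\<bar> < L" unfolding space_M by (auto simp: Omega_def)
      let ?C = "1 + \<mu> * Cq\<^sup>2 + 2 * CV"
      have C1: "?C \<ge> 1" using \<mu> CV(1) by simp
      have "(V0 (fst p) + \<mu> * (q (fst p))\<^sup>2 - lam \<mu>) * (c p)\<^sup>2 \<le> ?C * (c p)\<^sup>2"
        using pot_bounds[OF \<mu> p] lm by (intro mult_right_mono) (auto simp: pot_def)
      moreover have "1 * (a p)\<^sup>2 \<le> ?C * (a p)\<^sup>2" using C1 by (intro mult_right_mono) auto
      moreover have "0 \<le> ?C * ((q (fst p))\<^sup>2 * (r (snd p))\<^sup>2 * (b p)\<^sup>2)" using C1 by (intro mult_nonneg_nonneg) auto
      ultimately show "R p \<le> ?C * ((a p)\<^sup>2 + (q (fst p))\<^sup>2 * (r (snd p))\<^sup>2 * (b p)\<^sup>2 + (c p)\<^sup>2)"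
        unfolding R_def by (simp add: ring_distribs mult.assoc)
    qed
    also have "\<dots> = (1 + \<mu> * Cq\<^sup>2 + 2 * CV) * E" by (simp add: E_def)
    finally show ?thesis using \<delta> by (simp add: mult_left_mono)
  qed
  have B2: "\<bar>LINT p|M. H2 p\<bar> \<le> \<delta> / 2 * (Cq\<^sup>2 + (1 + Cq\<^sup>2) * E)"
  proof -
    let ?F = "\<lambda>x y. c (x, y)"
    have inner: "(LINT y|My. H2 (x, y)) = (q x)\<^sup>2 * u x * (ay v (?F x) - \<mu> * iy v (?F x))" for x
    proof -
      have "ay v (?F x) - \<mu> * iy v (?F x) = (LINT y|My. (r y)\<^sup>2 * (deriv v y * b (x, y)) + (- \<mu>) * (v y * c (x, y)))"
        using integral_linear_comb[OF y_integrable(2)[OF v(1) Fx(1)] y_integrable(1)[OF v(1) Fx(1)], of x "- \<mu>" x]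
        by (simp add: ay_def iy_def Fx(2))
      then show ?thesis by (simp add: H2_def)
    qed
    define R where "R p = (q (fst p))\<^sup>2 * (r (snd p))\<^sup>2 * (b p)\<^sup>2 + (q (fst p))\<^sup>2 * (c p)\<^sup>2" for p
    have Ri: "integrable M R" unfolding R_def by (intro Bochner_Integration.integrable_add j2 j5)
    have PR: "(q x)\<^sup>2 * py (?F x) (?F x) = (LINT y|My. R (x, y))" for x
    proof -
      have "py (?F x) (?F x) = (LINT y|My. (r y)\<^sup>2 * (b (x, y) * b (x, y)) + c (x, y) * c (x, y))"
        unfolding py_def ay_def iy_def Fx(2)
        using y_integrable[OF Fx(1) Fx(1), of x x] by (simp add: Fx(2))
      then have "(q x)\<^sup>2 * py (?F x) (?F x) = (LINT y|My. (q x)\<^sup>2 * ((r y)\<^sup>2 * (b (x, y) * b (x, y)) + c (x, y) * c (x, y)))" by simp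
      also have "\<dots> = (LINT y|My. R (x, y))"
        unfolding R_def by (intro Bochner_Integration.integral_cong refl) (simp add: power2_eq_square algebra_simps)
      finally show ?thesis .
    qed
    have qm: "(\<lambda>x. (q x)\<^sup>2) \<in> borel_measurable Mx" using q_measurable by measurable
    have ui: "integrable Mx (\<lambda>x. (q x)\<^sup>2 * (u x)\<^sup>2)" "integrable Mx (\<lambda>x. (u x)\<^sup>2)"
    proof -
      show "integrable Mx (\<lambda>x. (q x)\<^sup>2 * (u x)\<^sup>2)"
      proof (rule Mx_integrable[OF qm])
        show "\<bar>(q x)\<^sup>2\<bar> \<le> Cq\<^sup>2" if "\<bar>x\<bar> < L" for x using Cq(3)[of x] that by (simp add: abs_less_iff)
      qed (intro continuous_on_power smooth_UNIV_continuous su)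
      show "integrable Mx (\<lambda>x. (u x)\<^sup>2)" using x_integrable(1)[OF su su, of 0] by (simp add: power2_eq_square)
    qed
    have pi: "integrable Mx (\<lambda>x. (q x)\<^sup>2 * py (?F x) (?F x))" unfolding PR by (rule fubini(3)[OF Ri])
    have "\<bar>LINT p|M. H2 p\<bar> = \<bar>LINT x|Mx. (q x)\<^sup>2 * u x * (ay v (?F x) - \<mu> * iy v (?F x))\<bar>" unfolding fubini(1)[OF H2i] inner ..
    also have "\<dots> \<le> (LINT x|Mx. \<bar>(q x)\<^sup>2 * u x * (ay v (?F x) - \<mu> * iy v (?F x))\<bar>)" by (rule integral_abs_bound)
    also have "\<dots> \<le> (LINT x|Mx. \<delta> / 2 * ((q x)\<^sup>2 * (u x)\<^sup>2 + (q x)\<^sup>2 * py (?F x) (?F x)))"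
    proof (rule integral_mono)
      show "integrable Mx (\<lambda>x. \<bar>(q x)\<^sup>2 * u x * (ay v (?F x) - \<mu> * iy v (?F x))\<bar>)"
        using fubini(3)[OF H2i] unfolding inner by (rule integrable_abs)
      show "integrable Mx (\<lambda>x. \<delta> / 2 * ((q x)\<^sup>2 * (u x)\<^sup>2 + (q x)\<^sup>2 * py (?F x) (?F x)))" using ui pi by simp
      fix x
      have n: "0 \<le> py (?F x) (?F x)" by (rule FP.p_nonneg[OF Fx(1)])
      have "\<bar>u x\<bar> * \<bar>ay v (?F x) - \<mu> * iy v (?F x)\<bar> \<le> \<bar>u x\<bar> * (\<delta> * sqrt (py (?F x) (?F x)))"
        by (rule mult_left_mono[OF v(3)[OF Fx(1)]]) simp
      also have "\<dots> \<le> \<delta> / 2 * ((u x)\<^sup>2 + py (?F x) (?F x))" by (rule half[OF n])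
      finally have "(q x)\<^sup>2 * (\<bar>u x\<bar> * \<bar>ay v (?F x) - \<mu> * iy v (?F x)\<bar>) \<le> (q x)\<^sup>2 * (\<delta> / 2 * ((u x)\<^sup>2 + py (?F x) (?F x)))"
        by (rule mult_left_mono) simp
      moreover have "\<bar>(q x)\<^sup>2 * u x * (ay v (?F x) - \<mu> * iy v (?F x))\<bar> = (q x)\<^sup>2 * (\<bar>u x\<bar> * \<bar>ay v (?F x) - \<mu> * iy v (?F x)\<bar>)"
        by (simp add: abs_mult)
      moreover have "(q x)\<^sup>2 * (\<delta> / 2 * ((u x)\<^sup>2 + py (?F x) (?F x))) = \<delta> / 2 * ((q x)\<^sup>2 * (u x)\<^sup>2 + (q x)\<^sup>2 * py (?F x) (?F x))"
        by (simp add: algebra_simps)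
      ultimately show "\<bar>(q x)\<^sup>2 * u x * (ay v (?F x) - \<mu> * iy v (?F x))\<bar> \<le> \<delta> / 2 * ((q x)\<^sup>2 * (u x)\<^sup>2 + (q x)\<^sup>2 * py (?F x) (?F x))"
        by linarith
    qed
    also have "\<dots> = \<delta> / 2 * ((LINT x|Mx. (q x)\<^sup>2 * (u x)\<^sup>2) + (LINT p|M. R p))"
      using ui pi by (simp add: PR fubini(1)[OF Ri])
    also have "\<dots> \<le> \<delta> / 2 * (Cq\<^sup>2 + (1 + Cq\<^sup>2) * E)"
    proof (intro mult_left_mono add_mono)
      have "(LINT x|Mx. (q x)\<^sup>2 * (u x)\<^sup>2) \<le> (LINT x|Mx. Cq\<^sup>2 * (u x)\<^sup>2)"
        by (rule integral_mono[OF ui(1)]) (use ui(2) Cq(3) in \<open>auto simp: space_Mx intro!: mult_right_mono\<close>)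
      also have "\<dots> = Cq\<^sup>2" using u(2) by (simp add: bx_def power2_eq_square)
      finally show "(LINT x|Mx. (q x)\<^sup>2 * (u x)\<^sup>2) \<le> Cq\<^sup>2" .
      have "(LINT p|M. R p) \<le> (LINT p|M. (1 + Cq\<^sup>2) * ((a p)\<^sup>2 + (q (fst p))\<^sup>2 * (r (snd p))\<^sup>2 * (b p)\<^sup>2 + (c p)\<^sup>2))"
      proof (rule integral_mono[OF Ri])
        show "integrable M (\<lambda>p. (1 + Cq\<^sup>2) * ((a p)\<^sup>2 + (q (fst p))\<^sup>2 * (r (snd p))\<^sup>2 * (b p)\<^sup>2 + (c p)\<^sup>2))"
          by (intro Bochner_Integration.integrable_add Bochner_Integration.integrable_mult_right j1 j2 j3)
        fix p assume "p \<in> space M"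
        then have "(q (fst p))\<^sup>2 \<le> Cq\<^sup>2" unfolding space_M by (intro Cq(3)) (auto simp: Omega_def)
        then have "(q (fst p))\<^sup>2 * (c p)\<^sup>2 \<le> Cq\<^sup>2 * (c p)\<^sup>2" by (rule mult_right_mono) simp
        moreover have "0 \<le> (1 + Cq\<^sup>2) * (a p)\<^sup>2" "0 \<le> Cq\<^sup>2 * ((q (fst p))\<^sup>2 * (r (snd p))\<^sup>2 * (b p)\<^sup>2)" "0 \<le> (c p)\<^sup>2" by auto
        ultimately show "R p \<le> (1 + Cq\<^sup>2) * ((a p)\<^sup>2 + (q (fst p))\<^sup>2 * (r (snd p))\<^sup>2 * (b p)\<^sup>2 + (c p)\<^sup>2)"
          unfolding R_def ring_distribs mult_1_left by linarith
      qed
      then show "(LINT p|M. R p) \<le> (1 + Cq\<^sup>2) * E" by (simp add: E_def)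
    qed (use \<delta> in simp)
    finally show ?thesis .
  qed
  let ?K = "2 + 2 * Cq\<^sup>2 + 2 * CV + \<mu> * Cq\<^sup>2"
  have "\<bar>BB f (tens u v 0 0) - lam \<mu> * IP f (tens u v 0 0)\<bar> \<le> \<bar>LINT p|M. H1 p\<bar> + \<bar>LINT p|M. H2 p\<bar>"
    unfolding tot by (rule abs_triangle_ineq)
  also have "\<dots> \<le> \<delta> / 2 * (1 + (1 + \<mu> * Cq\<^sup>2 + 2 * CV) * E) + \<delta> / 2 * (Cq\<^sup>2 + (1 + Cq\<^sup>2) * E)" using B1 B2 by (rule add_mono)
  also have "\<dots> = \<delta> * ((1 + Cq\<^sup>2) / 2 + (2 + \<mu> * Cq\<^sup>2 + 2 * CV + Cq\<^sup>2) / 2 * E)" by (simp add: field_simps)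
  also have "\<dots> \<le> \<delta> * (?K * (1 + E))"
  proof (rule mult_left_mono[OF _ \<delta>])
    have m: "0 \<le> \<mu> * Cq\<^sup>2" using \<mu> by simp
    have "(1 + Cq\<^sup>2) / 2 \<le> ?K" using m CV(1) by simp
    moreover have "(2 + \<mu> * Cq\<^sup>2 + 2 * CV + Cq\<^sup>2) / 2 * E \<le> ?K * E" using m CV(1) E0 by (intro mult_right_mono) auto
    ultimately have "(1 + Cq\<^sup>2) / 2 + (2 + \<mu> * Cq\<^sup>2 + 2 * CV + Cq\<^sup>2) / 2 * E \<le> ?K + ?K * E" by (rule add_mono)
    also have "\<dots> = ?K * (1 + E)" by (simp add: ring_distribs)
    finally show "(1 + Cq\<^sup>2) / 2 + (2 + \<mu> * Cq\<^sup>2 + 2 * CV + Cq\<^sup>2) / 2 * E \<le> ?K * (1 + E)" .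
  qed
  also have "\<dots> \<le> \<delta> * (?K * (1 + Qc f))"
    using EQ \<delta> \<mu> CV(1) by (intro mult_left_mono) auto
  finally show ?thesis by (simp add: mult.assoc)
qed

lemma tensor_norms:
  assumes u: "u \<in> Tx" "bx u u = 1" and v: "v \<in> TY" "iy v v = 1" and \<omega>: "\<omega>x \<in> sets borel"
  shows "tens u v 0 0 \<in> test_functions L Y" "IP (tens u v 0 0) (tens u v 0 0) = 1"
    "(L2_norm M (\<lambda>p. indicator (\<omega>x \<times> Omega_y Y) p *\<^sub>R tens u v 0 0 p))\<^sup>2 = (LINT x|Mx. indicator \<omega>x x * (u x)\<^sup>2)"
proof -
  obtain Kx Ky where G: "jet_of (tens u v 0 0) (tens u v) Kx Ky" using tens_jet_of[OF u(1) v(1)] by blast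
  show t: "tens u v 0 0 \<in> test_functions L Y" by (rule test_of_jet[OF G])
  have inn: "tens u v 0 0 p \<bullet> tens u v 0 0 p = (u (fst p))\<^sup>2 * (v (snd p))\<^sup>2" for p
    by (simp add: tens_def inner_complex_def power2_eq_square)
  have gen: "(LINT p|M. indicator A (fst p) * (tens u v 0 0 p \<bullet> tens u v 0 0 p)) = (LINT x|Mx. indicator A x * (u x)\<^sup>2)"
    if A: "A \<in> sets borel" for A :: "real set"
  proof -
    have m: "indicat_real A \<in> borel_measurable Mx" using A by (intro measurable_restrict_space1) auto
    have i: "integrable M (\<lambda>p. indicator A (fst p) * (tens u v 0 0 p \<bullet> tens u v 0 0 p))"
      using weighted_integrable[OF G G m, of 1 "\<lambda>_. 1" 0 0 0 0] by (simp add: indicator_def)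
    have "(LINT p|M. indicator A (fst p) * (tens u v 0 0 p \<bullet> tens u v 0 0 p)) = (LINT x|Mx. LINT y|My. indicator A x * (u x)\<^sup>2 * (v y * v y))"
      using fubini(1)[OF i] unfolding inn by (simp add: power2_eq_square mult.assoc)
    also have "\<dots> = (LINT x|Mx. indicator A x * (u x)\<^sup>2)" using v(2) by (simp add: iy_def)
    finally show ?thesis .
  qed
  show "IP (tens u v 0 0) (tens u v 0 0) = 1"
    using gen[of UNIV] u(2) by (simp add: IP_def bx_def power2_eq_square)
  have "(L2_norm M (\<lambda>p. indicator (\<omega>x \<times> Omega_y Y) p *\<^sub>R tens u v 0 0 p))\<^sup>2
    = (LINT p|M. indicator \<omega>x (fst p) * (tens u v 0 0 p \<bullet> tens u v 0 0 p))"
    unfolding L2_norm_IP IP_def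
    by (rule Bochner_Integration.integral_cong[OF refl]) (unfold space_M, auto simp: Omega_def indicator_def)
  with gen[OF \<omega>] show "(L2_norm M (\<lambda>p. indicator (\<omega>x \<times> Omega_y Y) p *\<^sub>R tens u v 0 0 p))\<^sup>2 = (LINT x|Mx. indicator \<omega>x x * (u x)\<^sup>2)" by simp
qed

end

section \<open>Concentrating quasimodes\<close>

context grushin_setting
begin

lemma q_sign:
  assumes nz: "\<And>x. x \<in> I \<Longrightarrow> q x \<noteq> 0" and I: "I \<subseteq> {-L..L}" "connected I"
  shows "(\<forall>x\<in>I. q x > 0) \<or> (\<forall>x\<in>I. q x < 0)"
proof (rule ccontr)
  assume "\<not> ?thesis"
  then obtain a b where ab: "a \<in> I" "b \<in> I" "q a \<le> 0" "q b \<ge> 0" by (auto simp: not_less)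
  have "connected (q ` I)" by (rule connected_continuous_image[OF continuous_on_subset[OF q_cont I(1)] I(2)])
  then have "0 \<in> q ` I" by (rule connectedD_interval[of _ "q a" "q b"]) (use ab in auto)
  with nz show False by auto
qed

text \<open>On either side of 0 the continuous, nonvanishing \<open>q\<close> has one sign, so
  absolute values may be taken inside or outside the integral.\<close>

lemma d_agm_Pq:
  assumes nz: "\<And>x. x \<in> {-L..L} \<Longrightarrow> x \<noteq> 0 \<Longrightarrow> q x \<noteq> 0" and x: "x \<in> {-L..L}"
  shows "d_agm q x = \<bar>Pq x\<bar>"
proof -
  let ?a = "min 0 x" and ?b = "max 0 x"
  have L0: "0 < L" by (rule L_pos)
  have sub: "{?a..?b} \<subseteq> {-L..L}" using x L0 by auto
  have qi: "q integrable_on {c..d}" if "{c..d} \<subseteq> {-L..L}" for c d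
    by (rule integrable_continuous_real[OF continuous_on_subset[OF q_cont that]])
  have P: "\<bar>Pq x\<bar> = \<bar>integral {?a..?b} q\<bar>"
  proof (cases "x \<ge> 0")
    case True
    have "integral {-L..0} q + integral {0..x} q = integral {-L..x} q"
      by (rule Henstock_Kurzweil_Integration.integral_combine) (use True x L0 in \<open>auto intro!: qi\<close>)
    then show ?thesis using True by (simp add: Pq_def)
  next
    case False
    have "integral {-L..x} q + integral {x..0} q = integral {-L..0} q"
      by (rule Henstock_Kurzweil_Integration.integral_combine) (use False x L0 in \<open>auto intro!: qi\<close>)
    then show ?thesis using False by (simp add: Pq_def)
  qed
  have "(\<forall>s\<in>{?a..?b} - {0}. q s > 0) \<or> (\<forall>s\<in>{?a..?b} - {0}. q s < 0)"
  proof (rule q_sign)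
    have "{?a..?b} - {0} = (if x \<ge> 0 then {0<..x} else {x..<0})" by auto
    then show "connected ({?a..?b} - {0})" by simp
  qed (use nz sub in blast)+
  then have "integral {?a..?b} (\<lambda>s. \<bar>q s\<bar>) = \<bar>integral {?a..?b} q\<bar>"
  proof
    assume p: "\<forall>s\<in>{?a..?b} - {0}. q s > 0"
    have "integral {?a..?b} (\<lambda>s. \<bar>q s\<bar>) = integral {?a..?b} q"
      by (rule integral_spike[of "{0}"]) (use p in force)+
    moreover have "integral {?a..?b} (\<lambda>s. \<bar>q s\<bar>) \<ge> 0"
      by (rule integral_nonneg) (auto intro!: integrable_continuous_real continuous_intros continuous_on_subset[OF q_cont sub])
    ultimately show ?thesis by simp
  next
    assume p: "\<forall>s\<in>{?a..?b} - {0}. q s < 0"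
    have "integral {?a..?b} (\<lambda>s. \<bar>q s\<bar>) = integral {?a..?b} (\<lambda>s. - q s)"
      by (rule integral_spike[of "{0}"]) (use p in force)+
    moreover have "integral {?a..?b} (\<lambda>s. \<bar>q s\<bar>) \<ge> 0"
      by (rule integral_nonneg) (auto intro!: integrable_continuous_real continuous_intros continuous_on_subset[OF q_cont sub])
    ultimately show ?thesis by simp
  qed
  with P show ?thesis by (simp add: d_agm_def)
qed

text \<open>By the mean value theorem a second zero of \<open>Pq\<close> would force a zero of
  \<open>q\<close> strictly between it and 0.\<close>

lemma Pq_nonzero:
  assumes nz: "\<And>x. x \<in> {-L..L} \<Longrightarrow> x \<noteq> 0 \<Longrightarrow> q x \<noteq> 0" and x: "x \<in> {-L..L}" "x \<noteq> 0"
  shows "Pq x \<noteq> 0"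
proof
  assume z: "Pq x = 0"
  let ?a = "min 0 x" and ?b = "max 0 x"
  have ab: "?a < ?b" using x(2) by auto
  have sub: "{?a..?b} \<subseteq> {-L..L}" using x L_pos by auto
  have d: "(Pq has_real_derivative q s) (at s)" if "?a < s" "s < ?b" for s
    by (rule Pq_DERIV) (use that sub x L_pos in \<open>auto simp: abs_less_iff min_def max_def split: if_splits\<close>)
  have "\<exists>l s. ?a < s \<and> s < ?b \<and> DERIV Pq s :> l \<and> Pq ?b - Pq ?a = (?b - ?a) * l"
    by (rule MVT[OF ab continuous_on_subset[OF Pq_cont sub]]) (use d real_differentiable_def in blast)
  then obtain l s where s: "?a < s" "s < ?b" "DERIV Pq s :> l" "Pq ?b - Pq ?a = (?b - ?a) * l" by blast
  have "l = q s" by (rule DERIV_unique[OF s(3) d[OF s(1,2)]])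
  moreover have "Pq ?b - Pq ?a = 0" using z Pq_0 by (auto simp: min_def max_def)
  moreover have "q s \<noteq> 0" by (rule nz) (use s sub x in \<open>auto simp: min_def max_def split: if_splits\<close>)
  ultimately show False using s(4) ab by simp
qed

text \<open>Compactness of the closed interval turns positivity off 0 into a uniform bound; it
  serves both for \<open>q^2\<close> and for the Agmon distance.\<close>

lemma away_compact:
  assumes f: "continuous_on {-L..L} f" and pos: "\<And>x. x \<in> {-L..L} \<Longrightarrow> x \<noteq> 0 \<Longrightarrow> f x > (0 :: real)" and \<rho>: "\<rho> > 0"
  shows "\<exists>m>0. \<forall>x\<in>{-L..L}. \<rho> \<le> \<bar>x\<bar> \<longrightarrow> m \<le> f x"
proof (cases "{-L..L} \<inter> {x. \<rho> \<le> \<bar>x\<bar>} = {}")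
  case True
  then show ?thesis by (intro exI[of _ 1]) auto
next
  case False
  let ?K = "{-L..L} \<inter> {x. \<rho> \<le> \<bar>x\<bar>}"
  have "closed {x::real. \<rho> \<le> \<bar>x\<bar>}" by (intro closed_Collect_le continuous_intros)
  then have "compact ?K" by (rule compact_Int_closed[OF compact_Icc])
  then obtain z where z: "z \<in> ?K" "\<And>x. x \<in> ?K \<Longrightarrow> f z \<le> f x"
    using continuous_attains_inf[OF _ False continuous_on_subset[OF f]] by blast
  have "f z > 0" by (rule pos) (use z(1) \<rho> in auto)
  with z(2) show ?thesis by (intro exI[of _ "f z"]) auto
qed

lemma infdist_away:
  assumes "infdist (0::real) A > 0"
  shows "x \<in> A \<Longrightarrow> infdist 0 A \<le> \<bar>x\<bar>"
  using infdist_le[of x A 0] by simp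

lemma d_agm_set_bounds:
  assumes nz: "\<And>x. x \<in> {-L..L} \<Longrightarrow> x \<noteq> 0 \<Longrightarrow> q x \<noteq> 0" and \<omega>: "\<omega>x \<subseteq> {-L<..<L}" "\<omega>x \<noteq> {}" "infdist 0 \<omega>x > 0"
  shows "d_agm_set q \<omega>x > 0" and "x \<in> \<omega>x \<Longrightarrow> d_agm_set q \<omega>x \<le> \<bar>Pq x\<bar>"
proof -
  have e: "d_agm q x = \<bar>Pq x\<bar>" if "x \<in> \<omega>x" for x by (rule d_agm_Pq[OF nz]) (use \<omega>(1) that in auto)
  obtain m where m: "m > 0" "\<And>x. x \<in> {-L..L} \<Longrightarrow> infdist 0 \<omega>x \<le> \<bar>x\<bar> \<Longrightarrow> m \<le> \<bar>Pq x\<bar>"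
    using away_compact[OF continuous_on_rabs[OF Pq_cont] _ \<omega>(3)] Pq_nonzero[OF nz] by (metis zero_less_abs_iff)
  have "m \<le> (INF x\<in>\<omega>x. d_agm q x)"
    by (rule cINF_greatest[OF \<omega>(2)]) (use e m(2) infdist_away[OF \<omega>(3)] \<omega>(1) in force)
  then show "d_agm_set q \<omega>x > 0" using m(1) by (simp add: d_agm_set_def)
  assume x: "x \<in> \<omega>x"
  have "bdd_below (d_agm q ` \<omega>x)" by (rule bdd_belowI2[of _ 0]) (simp add: e)
  then show "d_agm_set q \<omega>x \<le> \<bar>Pq x\<bar>" unfolding d_agm_set_def e[OF x, symmetric] by (rule cINF_lower) (rule x)
qed

text \<open>The slope at 0 bounds \<open>q\<close> only near 0 and up to a slightly larger
  \<open>\<beta>'\<close>, which is all that a trial function cut off near 0 sees. The case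
  \<open>\<beta> = 0\<close> is that of higher vanishing order.\<close>

lemma q_linear_bound:
  assumes q0: "q 0 = 0" and d: "(q has_real_derivative \<beta>) (at 0)" and \<beta>: "0 \<le> \<beta>" "\<beta> < \<beta>'"
  shows "\<exists>a. 0 < a \<and> a < L \<and> (\<forall>x. \<bar>x\<bar> \<le> a \<longrightarrow> \<bar>q x\<bar> \<le> \<beta>' * \<bar>x\<bar>)"
proof -
  have "((\<lambda>x. q x / x) \<longlongrightarrow> \<beta>) (at 0)" using d q0 by (simp add: DERIV_def)
  then have "\<forall>\<^sub>F x in at 0. dist (q x / x) \<beta> < \<beta>' - \<beta>" using \<beta>(2) by (intro tendstoD) auto
  then obtain b where b: "b > 0" "\<And>x. x \<noteq> 0 \<Longrightarrow> \<bar>x\<bar> < b \<Longrightarrow> \<bar>q x / x - \<beta>\<bar> < \<beta>' - \<beta>"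
    by (auto simp: eventually_at dist_real_def)
  define a where "a = min b L / 2"
  have a: "0 < a" "a < b" "a < L" using b(1) L_pos by (auto simp: a_def min_def)
  have "\<bar>q x\<bar> \<le> \<beta>' * \<bar>x\<bar>" if "\<bar>x\<bar> \<le> a" for x
  proof (cases "x = 0")
    case False
    then have "\<bar>q x / x - \<beta>\<bar> < \<beta>' - \<beta>" using b(2) that a by auto
    then have "\<bar>q x / x\<bar> \<le> \<beta>'" using \<beta>(1) by linarith
    then show ?thesis using False by (simp add: abs_divide divide_le_eq)
  qed (simp add: q0)
  with a show ?thesis by blast
qed

lemma Pq_small:
  assumes "\<eta> > 0" shows "\<exists>\<rho>>0. \<forall>x. \<bar>x\<bar> < \<rho> \<longrightarrow> \<bar>Pq x\<bar> \<le> \<eta>"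
proof -
  have "isCont Pq 0" using Pq_DERIV[of 0] L_pos by (intro DERIV_isCont) auto
  then have "\<forall>\<^sub>F x in at 0. dist (Pq x) (Pq 0) < \<eta>" unfolding isCont_def using assms by (rule tendstoD)
  then obtain b where b: "b > 0" "\<And>x. x \<noteq> 0 \<Longrightarrow> \<bar>x\<bar> < b \<Longrightarrow> \<bar>Pq x\<bar> < \<eta>"
    by (auto simp: eventually_at dist_real_def Pq_0)
  have "\<bar>Pq x\<bar> \<le> \<eta>" if "\<bar>x\<bar> < b" for x using b(2)[OF _ that] assms Pq_0 by (cases "x = 0") auto
  with b(1) show ?thesis by blast
qed

text \<open>On the control region the weight is at least \<open>exp (k * d) / 2\<close>; the quarter
  is the square of this half.\<close>

lemma agmon_small:
  assumes ag: "(LINT x|Mx. indicator {x. \<rho> \<le> \<bar>x\<bar>} x * (cosh (k * Pq x) * \<psi> x)\<^sup>2) \<le> A" and k: "k \<ge> 0"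
    and \<omega>: "\<omega>x \<in> sets borel" "\<And>x. x \<in> \<omega>x \<Longrightarrow> \<rho> \<le> \<bar>x\<bar>" "\<And>x. x \<in> \<omega>x \<Longrightarrow> d \<le> \<bar>Pq x\<bar>" and \<psi>: "\<psi> \<in> Tx"
  shows "exp (2 * k * d) / 4 * (LINT x|Mx. indicator \<omega>x x * (\<psi> x)\<^sup>2) \<le> A"
proof -
  have c\<psi>: "continuous_on {-L..L} \<psi>" by (rule smooth_UNIV_continuous(1)[OF bump_testsD[OF \<psi>]])
  have "(LINT x|Mx. exp (2 * k * d) / 4 * (indicator \<omega>x x * (\<psi> x)\<^sup>2)) \<le> (LINT x|Mx. indicator {x. \<rho> \<le> \<bar>x\<bar>} x * (cosh (k * Pq x) * \<psi> x)\<^sup>2)"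
  proof (rule integral_mono)
    show "integrable Mx (\<lambda>x. exp (2 * k * d) / 4 * (indicator \<omega>x x * (\<psi> x)\<^sup>2))"
    proof (intro Bochner_Integration.integrable_mult_right Mx_integrable[where C = 1])
      show "indicat_real \<omega>x \<in> borel_measurable Mx" using \<omega>(1) by (intro measurable_restrict_space1) auto
    qed (auto simp: indicator_def intro!: continuous_intros c\<psi>)
    show "integrable Mx (\<lambda>x. indicator {x. \<rho> \<le> \<bar>x\<bar>} x * (cosh (k * Pq x) * \<psi> x)\<^sup>2)"
    proof (rule Mx_integrable[where C = 1])
      have "{x::real. \<rho> \<le> \<bar>x\<bar>} \<in> sets borel" by measurable
      then show "indicat_real {x. \<rho> \<le> \<bar>x\<bar>} \<in> borel_measurable Mx" by (intro measurable_restrict_space1) auto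
    qed (auto simp: indicator_def intro!: continuous_intros c\<psi> cosh_Pq_cont)
    fix x
    show "exp (2 * k * d) / 4 * (indicator \<omega>x x * (\<psi> x)\<^sup>2) \<le> indicator {x. \<rho> \<le> \<bar>x\<bar>} x * (cosh (k * Pq x) * \<psi> x)\<^sup>2"
    proof (cases "x \<in> \<omega>x")
      case True
      have "k * d \<le> \<bar>k * Pq x\<bar>" using k \<omega>(3)[OF True] by (simp add: abs_mult mult_left_mono)
      then have "exp (k * d) / 2 \<le> exp \<bar>k * Pq x\<bar> / 2" by simp
      also have "\<dots> \<le> cosh (k * Pq x)" by (rule cosh_bounds)
      finally have "(exp (k * d) / 2)\<^sup>2 \<le> (cosh (k * Pq x))\<^sup>2" by (intro power_mono) auto
      moreover have "(exp (k * d) / 2)\<^sup>2 = exp (2 * k * d) / 4" by (simp add: power_divide exp_double[symmetric] mult.assoc)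
      ultimately have "exp (2 * k * d) / 4 * (\<psi> x)\<^sup>2 \<le> (cosh (k * Pq x))\<^sup>2 * (\<psi> x)\<^sup>2" by (intro mult_right_mono) auto
      then show ?thesis using True \<omega>(2)[OF True] by (simp add: power_mult_distrib)
    qed simp
  qed
  with ag show ?thesis by simp
qed

text \<open>The exponential factors combine to \<open>exp (n (\<beta>' T - \<sigma> (d - \<kappa>)))\<close>, which beats every power of \<open>n\<close>.\<close>

lemma concentrated_quasimode:
  assumes nz: "\<And>x. x \<in> {-L..L} \<Longrightarrow> x \<noteq> 0 \<Longrightarrow> q x \<noteq> 0" and q0: "q 0 = 0"
    and dq: "(q has_real_derivative \<beta>) (at 0)" and \<beta>: "0 \<le> \<beta>"
    and \<omega>: "\<omega>x \<subseteq> {-L<..<L}" "open \<omega>x" "\<omega>x \<noteq> {}" "infdist 0 \<omega>x > 0"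
    and T: "T > 0" "T * \<beta> < d_agm_set q \<omega>x" and \<epsilon>: "\<epsilon> > 0"
  shows "\<exists>g l \<delta>. g \<in> test_functions L Y \<and> IP g g = 1 \<and> - cc \<le> l \<and> 0 \<le> \<delta> \<and>
    (\<forall>f\<in>test_functions L Y. \<bar>BB f g - l * IP f g\<bar> \<le> \<delta> * (1 + Qc f)) \<and>
    exp (l * T) * (\<delta> + L2_norm M (\<lambda>p. indicator (\<omega>x \<times> Omega_y Y) p *\<^sub>R g p)) * (1 + sqrt (Qc g)) \<le> \<epsilon>"
proof -
  define d where "d = d_agm_set q \<omega>x"
  \<comment> \<open>The gap \<open>d - T * \<beta>\<close> is \<open>4 * \<kappa>\<close>. One
    \<open>\<kappa>\<close> each is spent on replacing \<open>\<beta>\<close> by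
    \<open>\<beta>'\<close>, on the factor \<open>\<sigma> < 1\<close> in the Agmon weight and on
    the core where \<open>\<bar>Pq x\<bar> \<le> \<kappa>\<close>; the fourth is the remaining decay
    rate.\<close>
  define \<kappa> where "\<kappa> = (d - T * \<beta>) / 4"
  define \<beta>' where "\<beta>' = \<beta> + \<kappa> / T"
  define \<sigma> where "\<sigma> = 1 - \<kappa> / d"
  have \<kappa>: "\<kappa> > 0" using T(2) by (simp add: \<kappa>_def d_def)
  have Tb: "0 \<le> T * \<beta>" using T(1) \<beta> by simp
  have d0: "d > 0" "\<kappa> \<le> d / 4" using T(2) Tb by (auto simp: d_def \<kappa>_def)
  have \<sigma>: "0 < \<sigma>" "\<sigma> < 1" "\<sigma> * d = d - \<kappa>" using \<kappa> d0 by (auto simp: \<sigma>_def field_simps)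
  have \<beta>': "\<beta> < \<beta>'" "0 < \<beta>'" "\<beta>' * T = \<beta> * T + \<kappa>" using \<kappa> T(1) \<beta> Tb by (auto simp: \<beta>'_def field_simps intro: add_pos_nonneg)
  have rate: "\<beta>' * T + \<sigma> * \<kappa> - \<sigma> * d \<le> - \<kappa>"
  proof -
    have "\<sigma> * \<kappa> \<le> 1 * \<kappa>" using \<sigma> \<kappa> by (intro mult_right_mono) auto
    moreover have "4 * \<kappa> = d - \<beta> * T" by (simp add: \<kappa>_def)
    ultimately show ?thesis unfolding \<sigma>(3) \<beta>'(3) by linarith
  qed
  obtain a where a: "0 < a" "a < L" "\<And>x. \<bar>x\<bar> \<le> a \<Longrightarrow> \<bar>q x\<bar> \<le> \<beta>' * \<bar>x\<bar>" using q_linear_bound[OF q0 dq \<beta> \<beta>'(1)] by blast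
  obtain C0 where C0: "\<And>n. n \<ge> 0 \<Longrightarrow> \<exists>u\<in>Tx. bx u u > 0 \<and> hx (n\<^sup>2) u u \<le> (\<beta>' * n + C0) * bx u u" using trial[OF a(1,2) \<beta>'(2) a(3)] by blast
  define C where "C = max C0 0"
  obtain \<rho>0 where \<rho>0: "\<rho>0 > 0" "\<And>x. \<bar>x\<bar> < \<rho>0 \<Longrightarrow> \<bar>Pq x\<bar> \<le> \<kappa>" using Pq_small[OF \<kappa>] by blast
  define \<rho> where "\<rho> = min \<rho>0 (infdist 0 \<omega>x)"
  have \<rho>: "\<rho> > 0" "\<And>x. \<bar>x\<bar> < \<rho> \<Longrightarrow> \<bar>Pq x\<bar> \<le> \<kappa>" "\<And>x. x \<in> \<omega>x \<Longrightarrow> \<rho> \<le> \<bar>x\<bar>"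
    using \<rho>0 \<omega>(4) infdist_away[OF \<omega>(4)] by (auto simp: \<rho>_def min_le_iff_disj)
  obtain m where m: "m > 0" "\<And>x. x \<in> {-L..L} \<Longrightarrow> \<rho> \<le> \<bar>x\<bar> \<Longrightarrow> m \<le> (q x)\<^sup>2"
    using away_compact[OF continuous_on_power[OF q_cont] _ \<rho>(1), of 2] nz by (metis zero_less_power2)
  define s where "s = (1 - \<sigma>\<^sup>2) * m"
  have s: "s > 0" using \<sigma> m(1) by (simp add: s_def power_less_one_iff)
  \<comment> \<open>\<open>B n\<close> bounds both \<open>1 + l + CV\<close> and
    \<open>1 + sqrt (Qc g)\<close>. It is at most \<open>K * (1 + \<kappa> * n / 3)\<close>, and the
    cube of the bracket is at most \<open>exp (\<kappa> * n)\<close>: two of its factors pay for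
    \<open>(B n)^2\<close>, the third supplies smallness as \<open>n\<close> grows.\<close>
  define B where "B n = 3 + 2 * (\<beta>' * n + C + cc)" for n
  define K where "K = 3 + 2 * (C + cc) + 6 * \<beta>' / \<kappa>"
  have C: "C \<ge> 0" "C0 \<le> C" and cc: "cc \<ge> 1" using CV(1) by (auto simp: C_def cc_def)
  have K: "K > 0" using C cc \<beta>' \<kappa> by (auto simp: K_def intro!: add_pos_pos add_pos_nonneg)
  have B: "0 < B n" "B n \<le> K * (1 + \<kappa> * n / 3)" if "n \<ge> 0" for n
  proof -
    have n: "0 \<le> \<beta>' * n" using that \<beta>' by simp
    show "0 < B n" using n C cc by (simp add: B_def)
    have "K * (1 + \<kappa> * n / 3) = B n + 6 * \<beta>' / \<kappa> + (3 + 2 * (C + cc)) * (\<kappa> * n / 3)"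
      using \<kappa> by (simp add: B_def K_def field_simps)
    moreover have "0 \<le> 6 * \<beta>' / \<kappa>" "0 \<le> (3 + 2 * (C + cc)) * (\<kappa> * n / 3)" using that \<kappa> \<beta>' C cc by auto
    ultimately show "B n \<le> K * (1 + \<kappa> * n / 3)" by linarith
  qed
  \<comment> \<open>The second entry makes the potential dominate off the core, the third makes the
    exponential term at most \<open>\<epsilon> / 2\<close>.\<close>
  define N where "N = Max {1, K * (1 + \<kappa> / 3) / s, 6 * exp (C * T) * K\<^sup>2 / (\<kappa> * \<epsilon>)}"
  have N: "1 \<le> N" "K * (1 + \<kappa> / 3) / s \<le> N" "6 * exp (C * T) * K\<^sup>2 / (\<kappa> * \<epsilon>) \<le> N" by (auto simp: N_def)
  obtain \<mu> where \<mu>: "\<mu> \<ge> N\<^sup>2" and yq: "\<And>\<delta>. \<delta> > 0 \<Longrightarrow> \<exists>\<phi>\<in>TY. iy \<phi> \<phi> = 1 \<and> (\<forall>\<xi>\<in>TY. \<bar>ay \<phi> \<xi> - \<mu> * iy \<phi> \<xi>\<bar> \<le> \<delta> * sqrt (py \<xi> \<xi>))"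
    using y_quasimode[of "N\<^sup>2"] by blast
  define n where "n = sqrt \<mu>"
  have \<mu>0: "\<mu> \<ge> 0" using \<mu> zero_le_power2[of N] by linarith
  have nN: "n \<ge> N" "n\<^sup>2 = \<mu>" using \<mu> \<mu>0 by (auto simp: n_def real_le_rsqrt)
  have n: "n \<ge> N" "n\<^sup>2 = \<mu>" "n \<ge> 1" using nN N(1) by auto
  then have n0: "n \<ge> 0" by simp
  obtain u0 where u0: "u0 \<in> Tx" "bx u0 u0 > 0" "hx \<mu> u0 u0 \<le> (\<beta>' * n + C0) * bx u0 u0" using C0[OF n0] n(2) by blast
  define l where "l = lam \<mu>"
  have lC: "- CV \<le> l" unfolding l_def by (rule lam_ge[OF \<mu>0 u0(1,2)])
  have "l * bx u0 u0 \<le> (\<beta>' * n + C0) * bx u0 u0" using lam_le[OF \<mu>0 u0(1)] u0(3) by (simp add: l_def)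
  then have "l \<le> \<beta>' * n + C0" using u0(2) by simp
  then have lB: "l \<le> \<beta>' * n + C" using C by simp
  have lcc: "- cc \<le> l" using lC by (simp add: cc_def)
  have gap: "l + CV + 1 \<le> (1 - \<sigma>\<^sup>2) * n\<^sup>2 * (q x)\<^sup>2" if "\<rho> \<le> \<bar>x\<bar>" "\<bar>x\<bar> < L" for x
  proof -
    have "0 \<le> \<beta>' * n" using \<beta>'(2) n0 by simp
    then have "l + CV + 1 \<le> B n" using lB cc C by (simp add: B_def cc_def)
    also have "\<dots> \<le> K * (1 + \<kappa> * n / 3)" by (rule B(2)[OF n0])
    also have "\<dots> \<le> K * ((1 + \<kappa> / 3) * n)" using n(3) K by (intro mult_left_mono) (auto simp: algebra_simps)
    also have "\<dots> \<le> (N * s) * n" using N(2) s n0 by (simp add: mult.assoc[symmetric] divide_le_eq mult_right_mono)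
    also have "\<dots> \<le> (n * s) * n" using n(1) s n0 by (intro mult_right_mono) auto
    also have "\<dots> = (1 - \<sigma>\<^sup>2) * n\<^sup>2 * m" by (simp add: s_def power2_eq_square)
    also have "\<dots> \<le> (1 - \<sigma>\<^sup>2) * n\<^sup>2 * (q x)\<^sup>2"
    proof (rule mult_left_mono)
      show "m \<le> (q x)\<^sup>2" by (rule m(2)) (use that in \<open>simp_all add: abs_less_iff\<close>)
    qed (use \<sigma> in \<open>simp add: power_le_one\<close>)
    finally show ?thesis .
  qed
  obtain \<delta>0 where \<delta>0: "\<delta>0 > 0" and ag: "\<And>\<psi>. \<psi> \<in> Tx \<Longrightarrow> bx \<psi> \<psi> = 1 \<Longrightarrow> hx \<mu> \<psi> \<psi> \<le> l + \<delta>0 \<Longrightarrow>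
    (LINT x|Mx. indicator {x. \<rho> \<le> \<bar>x\<bar>} x * (cosh (\<sigma> * n * Pq x) * \<psi> x)\<^sup>2) \<le> 1 + (l + CV) * exp (2 * \<sigma> * n * \<kappa>)"
    using agmon[OF \<sigma>(1,2) n0, of \<rho> \<kappa>] gap \<rho>(2) unfolding n(2) l_def by blast
  define G where "G = 2 + 2 * Cq\<^sup>2 + 2 * CV + \<mu> * Cq\<^sup>2"
  have G: "G > 0" using CV(1) \<mu>0 by (auto simp: G_def intro!: add_pos_nonneg)
  \<comment> \<open>The accuracy is chosen after \<open>n\<close> and \<open>l\<close>, against
    \<open>exp (l * T)\<close>. The bound \<open>1/2\<close> allows \<open>\<delta> * Qc g\<close>
    to be absorbed when the quasimode estimate is applied to \<open>g\<close> itself in order to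
    bound \<open>Qc g\<close>.\<close>
  define \<delta> where "\<delta> = min (1/2) (\<epsilon> / (2 * exp (l * T) * B n))"
  have Bn: "B n > 0" by (rule B(1)[OF n0])
  have \<delta>: "\<delta> > 0" "\<delta> \<le> 1/2" "\<delta> \<le> \<epsilon> / (2 * exp (l * T) * B n)" using Bn \<epsilon> by (auto simp: \<delta>_def)
  \<comment> \<open>\<open>G\<close> is the loss in forming the product, a constant once
    \<open>\<mu>\<close> is fixed.\<close>
  define \<delta>1 where "\<delta>1 = \<delta> / G"
  have \<delta>1: "\<delta>1 > 0" "\<delta>1 * G = \<delta>" using \<delta> G by (auto simp: \<delta>1_def)
  obtain \<psi> where \<psi>: "\<psi> \<in> Tx" "bx \<psi> \<psi> = 1" "hx \<mu> \<psi> \<psi> \<le> lam \<mu> + min \<delta>0 (\<delta>1\<^sup>2)"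
    using near_minimiser_x[OF \<mu>0 u0(1,2), of "min \<delta>0 (\<delta>1\<^sup>2)"] \<delta>0 \<delta>1(1) by auto
  have Q\<psi>: "Qx \<mu> \<psi> \<psi> \<le> \<delta>1\<^sup>2" using \<psi>(2,3) by (simp add: Qx_def)
  obtain \<phi> where \<phi>: "\<phi> \<in> TY" "iy \<phi> \<phi> = 1" "\<And>\<xi>. \<xi> \<in> TY \<Longrightarrow> \<bar>ay \<phi> \<xi> - \<mu> * iy \<phi> \<xi>\<bar> \<le> \<delta>1 * sqrt (py \<xi> \<xi>)"
    using yq[OF \<delta>1(1)] by blast
  define g where "g = tens \<psi> \<phi> 0 0"
  have \<omega>b: "\<omega>x \<in> sets borel" using \<omega>(2) by simp
  note tn = tensor_norms[OF \<psi>(1,2) \<phi>(1,2) \<omega>b, folded g_def]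
  have est: "\<bar>BB f g - l * IP f g\<bar> \<le> \<delta> * (1 + Qc f)" if "f \<in> test_functions L Y" for f
    using tensor_quasimode[OF \<mu>0 less_imp_le[OF \<delta>1(1)] \<psi>(1,2) Q\<psi> lC[unfolded l_def] \<phi> that, folded G_def g_def l_def]
    unfolding \<delta>1(2) .
  have Qg: "1 + sqrt (Qc g) \<le> B n"
  proof -
    have Q0: "Qc g \<ge> 0" by (rule Qc_nonneg[OF tn(1)])
    have "Qc g = BB g g + cc" using tn(2) by (simp add: Bc_def)
    moreover have "BB g g \<le> l + \<delta> * (1 + Qc g)" using est[OF tn(1)] tn(2) by (simp add: abs_le_iff)
    moreover have "\<delta> * (1 + Qc g) \<le> 1 / 2 * (1 + Qc g)" using \<delta>(2) Q0 by (intro mult_right_mono) auto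
    ultimately have "Qc g \<le> 2 * (l + cc) + 1" by simp
    moreover have "sqrt (Qc g) \<le> 1 + Qc g" using Q0 by (intro real_le_lsqrt) (auto simp: power2_eq_square algebra_simps)
    ultimately show ?thesis using lB by (simp add: B_def)
  qed
  define w where "w = L2_norm M (\<lambda>p. indicator (\<omega>x \<times> Omega_y Y) p *\<^sub>R g p)"
  have w0: "w \<ge> 0" unfolding w_def by (rule L2_norm_nonneg)
  have w: "w \<le> B n * exp (\<sigma> * n * (\<kappa> - d))"
  proof -
    let ?E = "exp (2 * \<sigma> * n * \<kappa>)"
    have "exp (2 * (\<sigma> * n) * d) / 4 * w\<^sup>2 \<le> 1 + (l + CV) * ?E"
      unfolding w_def tn(3)
    proof (rule agmon_small[OF _ _ \<omega>b \<rho>(3) _ \<psi>(1)])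
      show "(LINT x|Mx. indicator {x. \<rho> \<le> \<bar>x\<bar>} x * (cosh (\<sigma> * n * Pq x) * \<psi> x)\<^sup>2) \<le> 1 + (l + CV) * ?E"
        by (rule ag[OF \<psi>(1,2)]) (use \<psi>(3) in \<open>simp add: l_def\<close>)
      show "d \<le> \<bar>Pq x\<bar>" if "x \<in> \<omega>x" for x unfolding d_def by (rule d_agm_set_bounds(2)[OF nz \<omega>(1,3,4) that])
    qed (use \<sigma> n0 in auto)
    also have "\<dots> \<le> (1 + (l + CV)) * ?E"
    proof -
      have "1 \<le> ?E" using \<sigma> n0 \<kappa> by simp
      then show ?thesis by (simp add: ring_distribs)
    qed
    also have "\<dots> \<le> (B n / 2) * ?E" using lB cc C by (intro mult_right_mono) (auto simp: B_def cc_def)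
    finally have "w\<^sup>2 \<le> 4 * (B n / 2) * (?E / exp (2 * (\<sigma> * n) * d))" by (simp add: field_simps)
    also have "?E / exp (2 * (\<sigma> * n) * d) = (exp (\<sigma> * n * (\<kappa> - d)))\<^sup>2"
      by (simp add: exp_diff[symmetric] exp_double[symmetric] algebra_simps)
    also have "4 * (B n / 2) * (exp (\<sigma> * n * (\<kappa> - d)))\<^sup>2 \<le> (B n)\<^sup>2 * (exp (\<sigma> * n * (\<kappa> - d)))\<^sup>2"
    proof (rule mult_right_mono)
      have "2 \<le> B n" using lB lcc by (simp add: B_def)
      then show "4 * (B n / 2) \<le> (B n)\<^sup>2" by (simp add: power2_eq_square)
    qed simp
    also have "\<dots> = (B n * exp (\<sigma> * n * (\<kappa> - d)))\<^sup>2" by (simp add: power_mult_distrib)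
    finally show ?thesis by (rule power2_le_imp_le) (use Bn in simp)
  qed
  have "exp (l * T) * w * B n \<le> exp ((\<beta>' * n + C) * T) * (B n * exp (\<sigma> * n * (\<kappa> - d))) * B n"
    using w w0 Bn lB T(1) by (intro mult_mono mult_right_mono) auto
  also have "\<dots> = (B n)\<^sup>2 * (exp (C * T) * exp (n * (\<beta>' * T + \<sigma> * \<kappa> - \<sigma> * d)))"
    by (simp add: exp_add[symmetric] power2_eq_square algebra_simps)
  also have "\<dots> \<le> (K * (1 + \<kappa> * n / 3))\<^sup>2 * (exp (C * T) * exp (n * (- \<kappa>)))"
    using B[OF n0] mult_left_mono[OF rate n0] by (intro mult_mono power_mono) auto
  also have "\<dots> \<le> \<epsilon> / 2"
  proof -
    define y where "y = 1 + \<kappa> * n / 3"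
    have y: "y > 0" "\<kappa> * n / 3 \<le> y" using \<kappa> n0 by (auto simp: y_def add_pos_nonneg)
    have "y \<le> exp (\<kappa> * n / 3)" unfolding y_def by (rule exp_ge_add_one_self)
    then have "y ^ 3 \<le> exp (\<kappa> * n / 3) ^ 3" using y by (intro power_mono) auto
    also have "\<dots> = exp (\<kappa> * n)" by (simp add: exp_of_nat_mult[symmetric])
    finally have ye: "y ^ 3 * exp (n * (- \<kappa>)) \<le> 1" by (simp add: exp_minus field_simps)
    have "6 * exp (C * T) * K\<^sup>2 / (\<kappa> * \<epsilon>) \<le> n" using N(3) n(1) by simp
    then have "6 * exp (C * T) * K\<^sup>2 \<le> n * (\<kappa> * \<epsilon>)" using \<kappa> \<epsilon> by (simp add: divide_le_eq)
    then have "exp (C * T) * K\<^sup>2 \<le> \<kappa> * n / 3 * (\<epsilon> / 2)" by (simp add: algebra_simps)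
    also have "\<dots> \<le> y * (\<epsilon> / 2)" using y \<epsilon> by (intro mult_right_mono) auto
    finally have "(exp (C * T) * K\<^sup>2) * (y\<^sup>2 * exp (n * (- \<kappa>))) \<le> (y * (\<epsilon> / 2)) * (y\<^sup>2 * exp (n * (- \<kappa>)))"
      by (intro mult_right_mono) auto
    also have "\<dots> = \<epsilon> / 2 * (y ^ 3 * exp (n * (- \<kappa>)))" by (simp add: power2_eq_square power3_eq_cube)
    also have "\<dots> \<le> \<epsilon> / 2 * 1" using ye \<epsilon> by (intro mult_left_mono) auto
    finally show ?thesis unfolding y_def[symmetric] power_mult_distrib by (simp add: mult_ac)
  qed
  finally have t1: "exp (l * T) * w * B n \<le> \<epsilon> / 2" .
  have t2: "exp (l * T) * \<delta> * B n \<le> \<epsilon> / 2" using \<delta>(3) Bn by (simp add: pos_le_divide_eq algebra_simps)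
  have "exp (l * T) * (\<delta> + w) * (1 + sqrt (Qc g)) \<le> exp (l * T) * (\<delta> + w) * B n"
    using Qg \<delta>(1) w0 by (intro mult_left_mono) auto
  also have "\<dots> \<le> \<epsilon>" using t1 t2 by (simp add: ring_distribs)
  finally show ?thesis
    using tn(1,2) lcc \<delta>(1) est unfolding w_def by (intro exI[of _ g] exI[of _ l] exI[of _ \<delta>]) auto
qed

end

section \<open>A state which cannot be steered to zero\<close>

context grushin_semigroup
begin

lemma zero_test: "h \<in> test_functions L Y \<Longrightarrow> (\<lambda>p. 0) \<in> test_functions L Y"
  using test_diff[of h h] by simp

lemma Bc_zero: "h \<in> test_functions L Y \<Longrightarrow> Bc (\<lambda>p. 0) h = 0"
  using Bc_comb[OF zero_test zero_test, of h h h 1] by simp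

text \<open>A gliding hump: the \<open>k\<close>-th quasimode is added with a coefficient \<open>c\<close> comparable to its
  observability defect times \<open>k\<close>, and later terms are too small to disturb its pairing with the sum.\<close>

lemma hump_step:
  assumes quasi: "\<And>\<epsilon>. \<epsilon> > 0 \<Longrightarrow> \<exists>g l \<delta>. g \<in> test_functions L Y \<and> IP g g = 1 \<and> P g l \<delta> \<and> R g l \<delta> * (1 + sqrt (Qc g)) \<le> \<epsilon>"
    and R: "\<And>g l \<delta>. P g l \<delta> \<Longrightarrow> 0 \<le> R g l \<delta>"
    and F: "F \<in> test_functions L Y" and c: "(c::real) > 0"
  shows "\<exists>F' c'. F' \<in> test_functions L Y \<and> 0 < c' \<and> c' \<le> c / 3 \<and> IP (\<lambda>p. F' p - F p) (\<lambda>p. F' p - F p) = c'\<^sup>2 \<and>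
    sqrt (Qc (\<lambda>p. F' p - F p)) \<le> (1/2) ^ k \<and>
    (\<exists>g l \<delta>. g \<in> test_functions L Y \<and> IP g g = 1 \<and> P g l \<delta> \<and> c' \<le> \<bar>IP F' g\<bar> \<and> real (Suc k) * R g l \<delta> \<le> c')"
proof -
  define e where "e = min (c / 3) ((1/2) ^ k)"
  have e: "e > 0" "e \<le> c / 3" "e \<le> (1/2) ^ k" using c by (auto simp: e_def)
  obtain g l \<delta> where g: "g \<in> test_functions L Y" "IP g g = 1" "P g l \<delta>" "R g l \<delta> * (1 + sqrt (Qc g)) \<le> e / real (Suc k)"
    using quasi[of "e / real (Suc k)"] e(1) by auto
  have Q0: "sqrt (Qc g) \<ge> 0" using Qc_nonneg[OF g(1)] by simp
  \<comment> \<open>Dividing by \<open>1 + sqrt (Qc g)\<close> keeps the new term below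
    \<open>e\<close> in the form norm and in \<open>L2\<close> alike; the defect requested from
    \<open>quasi\<close> is smaller by just this factor.\<close>
  define c' where "c' = e / (1 + sqrt (Qc g))"
  have c'e: "c' * (1 + sqrt (Qc g)) = e" using Q0 add_pos_nonneg[OF zero_less_one Q0] by (simp add: c'_def)
  have c': "c' > 0" using e(1) Q0 by (simp add: c'_def add_pos_nonneg)
  have "c' + c' * sqrt (Qc g) = e" using c'e by (simp add: ring_distribs)
  moreover have "0 \<le> c' * sqrt (Qc g)" using c' Q0 by simp
  ultimately have le: "c' \<le> e" "c' * sqrt (Qc g) \<le> e" using c' by linarith+
  \<comment> \<open>The sign is that of the pairing already present, so the two contributions cannot
    cancel.\<close>
  define s where "s = (if IP F g \<ge> 0 then c' else - c')"
  have s: "s\<^sup>2 = c'\<^sup>2" "\<bar>s\<bar> = c'" using c' by (auto simp: s_def)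
  define F' where "F' p = F p + s *\<^sub>R g p" for p
  have F'T: "F' \<in> test_functions L Y" unfolding F'_def by (rule test_comb[OF F g(1)])
  have dF: "(\<lambda>p. F' p - F p) = (\<lambda>p. 0 + s *\<^sub>R g p)" by (simp add: F'_def)
  have z: "IP (\<lambda>p. 0) h = 0" for h by (simp add: IP_def)
  have "IP (\<lambda>p. F' p - F p) (\<lambda>p. F' p - F p) = c'\<^sup>2"
    unfolding dF IP_square[OF L2_zero test_L2[OF g(1)]] z g(2) s(1) by simp
  moreover have "sqrt (Qc (\<lambda>p. F' p - F p)) \<le> (1/2) ^ k"
  proof -
    
    have "sqrt (Qc (\<lambda>p. F' p - F p)) = c' * sqrt (Qc g)"
      unfolding dF Qc_comb[OF zero_test[OF F] g(1)] Bc_zero[OF zero_test[OF F]] Bc_zero[OF g(1)] s(1) using c' by (simp add: real_sqrt_mult)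
    with le(2) e(3) show ?thesis by simp
  qed
  moreover have "c' \<le> \<bar>IP F' g\<bar>"
  proof -
    have "IP F' g = IP F g + s" unfolding F'_def IP_comb[OF test_L2[OF F] test_L2[OF g(1)] test_L2[OF g(1)]] g(2) by simp
    then show ?thesis using c' by (auto simp: s_def split: if_splits)
  qed
  moreover have "real (Suc k) * R g l \<delta> \<le> c'"
  proof -
    have "real (Suc k) * (R g l \<delta> * (1 + sqrt (Qc g))) \<le> e" using g(4) by (simp add: pos_le_divide_eq mult.commute)
    then have "(real (Suc k) * R g l \<delta>) * (1 + sqrt (Qc g)) \<le> c' * (1 + sqrt (Qc g))" unfolding c'e by (simp add: mult.assoc)
    then show ?thesis by (rule mult_right_le_imp_le) (rule add_pos_nonneg[OF zero_less_one Q0])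
  qed
  ultimately show ?thesis using F'T c' le(1) e(2) g(1-3) by (intro exI[of _ F'] exI[of _ c']) (auto intro: order_trans)
qed

text \<open>The increments are summable in the form norm, hence the limit lies in the form domain.
  The coefficients \<open>c\<close> shrink by a factor 3, so the later terms change the pairing with
  the current quasimode by at most half of its size. What is left, \<open>c (Suc n) / 2\<close>,
  exceeds a given multiple of the defect for large \<open>n\<close>.\<close>

lemma gliding_hump:
  assumes quasi: "\<And>\<epsilon>. \<epsilon> > 0 \<Longrightarrow> \<exists>g l \<delta>. g \<in> test_functions L Y \<and> IP g g = 1 \<and> P g l \<delta> \<and> R g l \<delta> * (1 + sqrt (Qc g)) \<le> \<epsilon>"
    and R: "\<And>g l \<delta>. P g l \<delta> \<Longrightarrow> 0 \<le> R g l \<delta>"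
  shows "\<exists>f0\<in>form_domain L Y q r V. \<forall>K. \<exists>g l \<delta>. g \<in> test_functions L Y \<and> P g l \<delta> \<and> K * R g l \<delta> < \<bar>IP f0 g\<bar>"
proof -
  have "\<exists>f. \<forall>n. (fst (f n) \<in> test_functions L Y \<and> snd (f n) > 0) \<and>
    (snd (f (Suc n)) \<le> snd (f n) / 3 \<and>
     IP (\<lambda>p. fst (f (Suc n)) p - fst (f n) p) (\<lambda>p. fst (f (Suc n)) p - fst (f n) p) = (snd (f (Suc n)))\<^sup>2 \<and>
     sqrt (Qc (\<lambda>p. fst (f (Suc n)) p - fst (f n) p)) \<le> (1/2) ^ n \<and>
     (\<exists>g l \<delta>. g \<in> test_functions L Y \<and> IP g g = 1 \<and> P g l \<delta> \<and> snd (f (Suc n)) \<le> \<bar>IP (fst (f (Suc n))) g\<bar> \<and> real (Suc n) * R g l \<delta> \<le> snd (f (Suc n))))"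
  proof (rule dependent_nat_choice[of "\<lambda>n x. fst x \<in> test_functions L Y \<and> (snd x :: real) > 0"
      "\<lambda>n x y. snd y \<le> snd x / 3 \<and> IP (\<lambda>p. fst y p - fst x p) (\<lambda>p. fst y p - fst x p) = (snd y)\<^sup>2 \<and>
        sqrt (Qc (\<lambda>p. fst y p - fst x p)) \<le> (1/2) ^ n \<and>
        (\<exists>g l \<delta>. g \<in> test_functions L Y \<and> IP g g = 1 \<and> P g l \<delta> \<and> snd y \<le> \<bar>IP (fst y) g\<bar> \<and> real (Suc n) * R g l \<delta> \<le> snd y)"])
    obtain g where g: "g \<in> test_functions L Y" using quasi[of 1] by auto
    show "\<exists>x. fst x \<in> test_functions L Y \<and> (snd x :: real) > 0" by (rule exI[of _ "(g, 1)"]) (use g in simp)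
    fix x :: "(real \<times> real \<Rightarrow> complex) \<times> real" and n
    assume x: "fst x \<in> test_functions L Y \<and> snd x > 0"
    obtain F' c' where "F' \<in> test_functions L Y \<and> 0 < c' \<and> c' \<le> snd x / 3 \<and> IP (\<lambda>p. F' p - fst x p) (\<lambda>p. F' p - fst x p) = c'\<^sup>2 \<and>
      sqrt (Qc (\<lambda>p. F' p - fst x p)) \<le> (1/2) ^ n \<and>
      (\<exists>g l \<delta>. g \<in> test_functions L Y \<and> IP g g = 1 \<and> P g l \<delta> \<and> c' \<le> \<bar>IP F' g\<bar> \<and> real (Suc n) * R g l \<delta> \<le> c')"
      using hump_step[OF quasi R conjunct1[OF x] conjunct2[OF x], of n] by blast
    then show "\<exists>y. (fst y \<in> test_functions L Y \<and> snd y > 0) \<and> (snd y \<le> snd x / 3 \<and> IP (\<lambda>p. fst y p - fst x p) (\<lambda>p. fst y p - fst x p) = (snd y)\<^sup>2 \<and>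
        sqrt (Qc (\<lambda>p. fst y p - fst x p)) \<le> (1/2) ^ n \<and>
        (\<exists>g l \<delta>. g \<in> test_functions L Y \<and> IP g g = 1 \<and> P g l \<delta> \<and> snd y \<le> \<bar>IP (fst y) g\<bar> \<and> real (Suc n) * R g l \<delta> \<le> snd y))"
      by (intro exI[of _ "(F', c')"]) simp
  qed
  then obtain f where f: "\<And>n. fst (f n) \<in> test_functions L Y" "\<And>n. snd (f n) > 0" "\<And>n. snd (f (Suc n)) \<le> snd (f n) / 3"
    and f2: "\<And>n. IP (\<lambda>p. fst (f (Suc n)) p - fst (f n) p) (\<lambda>p. fst (f (Suc n)) p - fst (f n) p) = (snd (f (Suc n)))\<^sup>2"
    and f3: "\<And>n. sqrt (Qc (\<lambda>p. fst (f (Suc n)) p - fst (f n) p)) \<le> (1/2) ^ n"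
    and f4: "\<And>n. \<exists>g l \<delta>. g \<in> test_functions L Y \<and> IP g g = 1 \<and> P g l \<delta> \<and> snd (f (Suc n)) \<le> \<bar>IP (fst (f (Suc n))) g\<bar> \<and> real (Suc n) * R g l \<delta> \<le> snd (f (Suc n))"
    by blast
  define F where "F n = fst (f n)" for n
  define c where "c n = snd (f n)" for n
  note f = f[folded F_def c_def] and f2 = f2[folded F_def c_def] and f3 = f3[folded F_def c_def] and f4 = f4[folded F_def c_def]
  note fL = test_L2[OF f(1)]
  have "norm (J (F (Suc n)) - J (F n)) \<le> c (Suc n)" for n
  proof -
    have "norm (J (F (Suc n)) - J (F n)) = sqrt ((c (Suc n))\<^sup>2)"
      unfolding J_diff[OF fL fL, symmetric] J_norm[OF L2_diff[OF fL fL]] L2_norm_sqrt f2 ..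
    then show ?thesis using f(2)[of "Suc n"] by simp
  qed
  then obtain l where l: "(\<lambda>n. J (F n)) \<longlonglongrightarrow> l" "\<And>n. norm (l - J (F n)) \<le> 3 / 2 * c (Suc n)"
    using geometric_Cauchy_limit[of "\<lambda>n. J (F n)" "\<lambda>n. c (Suc n)"] f(3) by blast
  define f0 where "f0 = rep_l2 l"
  have f0: "f0 \<in> L2 M" unfolding f0_def by (rule rep_L2_M)
  \<comment> \<open>A limit of functions supported in \<Omega> is one: the projection
    \<open>U 0\<close> is continuous and fixes every \<open>J (F n)\<close>.\<close>
  have lJ: "J f0 = l"
  proof -
    interpret bounded_linear "U 0" by (rule sg.lin) simp
    have "J (rep_l2 (J (F n))) = J (F n)" for n
      by (subst J_eq_iff) (auto intro: rep_L2_M fL rep_J)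
    then have "(\<lambda>n. J (F n)) \<longlonglongrightarrow> U 0 l" using tendsto[OF l(1)] by (simp add: U_0)
    then have "U 0 l = l" by (rule LIMSEQ_unique[OF _ l(1)])
    then show ?thesis unfolding f0_def U_0 .
  qed
  have dist: "L2_norm M (\<lambda>p. F n p - f0 p) = norm (l - J (F n))" for n
    unfolding J_norm[OF L2_diff[OF fL f0], symmetric] J_diff[OF fL f0] lJ by (rule norm_minus_commute)
  have "f0 \<in> form_domain L Y q r V"
  proof (rule form_domainI[OF f0 f(1)])
    have "(\<lambda>n. norm (l - J (F n))) \<longlonglongrightarrow> norm (l - l)" by (intro tendsto_intros l(1))
    then show "(\<lambda>n. L2_norm M (\<lambda>p. F n p - f0 p)) \<longlonglongrightarrow> 0" unfolding dist by simp
    have tri: "sqrt (Qc (\<lambda>p. f p - h p)) \<le> sqrt (Qc (\<lambda>p. f p - g p)) + sqrt (Qc (\<lambda>p. g p - h p))"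
      if "f \<in> test_functions L Y" "g \<in> test_functions L Y" "h \<in> test_functions L Y" for f g h
      using sqrt_Qc_triangle[OF test_diff[OF that(1,3)] test_diff[OF that(2,3)]] by simp
    have part: "sqrt (Qc (\<lambda>p. F (n + k) p - F n p)) \<le> 2 * (1/2) ^ n - 2 * (1/2) ^ (n + k)" for n k
    proof (induction k)
      case 0
      show ?case by (simp add: Bc_zero[OF zero_test[OF f(1)]])
    next
      case (Suc k)
      have "sqrt (Qc (\<lambda>p. F (n + Suc k) p - F n p)) \<le> sqrt (Qc (\<lambda>p. F (Suc (n + k)) p - F (n + k) p)) + sqrt (Qc (\<lambda>p. F (n + k) p - F n p))"
        using tri[OF f(1) f(1) f(1)] by simp
      also have "\<dots> \<le> (1/2) ^ (n + k) + (2 * (1/2) ^ n - 2 * (1/2) ^ (n + k))" by (intro add_mono f3 Suc)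
      finally show ?case by simp
    qed
    have mono: "sqrt (Qc (\<lambda>p. F m p - F n p)) \<le> 2 * (1/2) ^ n" if "n \<le> m" for m n
    proof -
      have "0 \<le> (1/2::real) ^ m" by simp
      then show ?thesis using part[of n "m - n"] that by (simp only: le_add_diff_inverse)
    qed
    have sym: "Qc (\<lambda>p. F m p - F n p) = Qc (\<lambda>p. F n p - F m p)" for m n
      using Qc_comb[OF zero_test[OF f(1)] test_diff[OF f(1) f(1)], of "-1" n m]
      by (simp add: Bc_zero[OF zero_test[OF f(1)]] Bc_zero[OF test_diff[OF f(1) f(1)]])
    fix e :: real assume e: "e > 0"
    obtain N where N: "(1/2) ^ N < e / 2" using real_arch_pow_inv[of "e/2" "1/2"] e by auto
    have "sqrt (Qc (\<lambda>p. F m p - F n p)) < e" if mn: "m \<ge> N" "n \<ge> N" for m n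
    proof -
      have "(1/2::real) ^ min m n \<le> (1/2) ^ N" using mn by (intro power_decreasing) auto
      moreover have "sqrt (Qc (\<lambda>p. F m p - F n p)) \<le> 2 * (1/2) ^ min m n"
        using mono[of m n] mono[of n m] sym[of m n] by (cases "m \<le> n") (auto simp: min_def)
      ultimately show ?thesis using N by linarith
    qed
    then show "\<exists>N. \<forall>m\<ge>N. \<forall>n\<ge>N. sqrt (Qc (\<lambda>p. F m p - F n p)) < e" by blast
  qed
  moreover have "\<exists>g l \<delta>. g \<in> test_functions L Y \<and> P g l \<delta> \<and> K * R g l \<delta> < \<bar>IP f0 g\<bar>" for K
  proof -
    obtain n :: nat where n: "2 * \<bar>K\<bar> < real n" using reals_Archimedean2 by blast
    obtain g l' \<delta> where g: "g \<in> test_functions L Y" "IP g g = 1" "P g l' \<delta>" "c (Suc n) \<le> \<bar>IP (F (Suc n)) g\<bar>" "real (Suc n) * R g l' \<delta> \<le> c (Suc n)"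
      using f4[of n] by blast
    note gL = test_L2[OF g(1)]
    have "\<bar>IP (\<lambda>p. F (Suc n) p - f0 p) g\<bar> \<le> L2_norm M (\<lambda>p. F (Suc n) p - f0 p) * L2_norm M g"
      by (rule abs_IP_le[OF L2_diff[OF fL f0] gL])
    also have "\<dots> \<le> 3 / 2 * c (Suc (Suc n))" using l(2)[of "Suc n"] g(2) by (simp add: dist L2_norm_sqrt[of g])
    also have "\<dots> \<le> c (Suc n) / 2" using f(3)[of "Suc n"] by simp
    finally have half: "c (Suc n) / 2 \<le> \<bar>IP f0 g\<bar>" using g(4) unfolding IP_diff[OF fL f0 gL] by linarith
    have "K * R g l' \<delta> < c (Suc n) / 2"
    proof (cases "R g l' \<delta> > 0")
      case True
      then have "2 * (K * R g l' \<delta>) < real (Suc n) * R g l' \<delta>"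
        using n by (simp add: mult.assoc[symmetric])
      then show ?thesis using g(5) by linarith
    next
      case False
      then have "R g l' \<delta> = 0" using R[OF g(3)] by simp
      then show ?thesis using f(2)[of "Suc n"] by simp
    qed
    with half g(1,3) show ?thesis by (meson less_le_trans)
  qed
  ultimately show ?thesis by blast
qed

text \<open>For a steered state the constant \<open>K\<close> exists before any \<open>g\<close> is
  chosen, whereas the gliding hump supplies a \<open>g\<close> whose pairing exceeds
  \<open>K\<close> times the defect.\<close>

lemma exists_not_steerable:
  assumes nz: "\<And>x. x \<in> {-L..L} \<Longrightarrow> x \<noteq> 0 \<Longrightarrow> q x \<noteq> 0" and q0: "q 0 = 0"
    and dq: "(q has_real_derivative \<beta>) (at 0)" and \<beta>: "0 \<le> \<beta>"
    and \<omega>: "\<omega>x \<subseteq> {-L<..<L}" "open \<omega>x" "\<omega>x \<noteq> {}" "infdist 0 \<omega>x > 0"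
    and T: "T > 0" "T * \<beta> < d_agm_set q \<omega>x"
  shows "\<exists>f0\<in>form_domain L Y q r V. cannot_be_steered_to_zero L Y S \<omega>x T f0"
proof -
  define P where "P g l \<delta> \<longleftrightarrow> - cc \<le> l \<and> 0 \<le> \<delta> \<and> (\<forall>f\<in>test_functions L Y. \<bar>BB f g - l * IP f g\<bar> \<le> \<delta> * (1 + Qc f))" for g l \<delta>
  define R where "R g l \<delta> = exp (l * T) * (\<delta> + L2_norm M (\<lambda>p. indicator (\<omega>x \<times> Omega_y Y) p *\<^sub>R g p))" for g :: "real \<times> real \<Rightarrow> complex" and l \<delta>
  have "\<exists>g l \<delta>. g \<in> test_functions L Y \<and> IP g g = 1 \<and> P g l \<delta> \<and> R g l \<delta> * (1 + sqrt (Qc g)) \<le> \<epsilon>" if "\<epsilon> > 0" for \<epsilon>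
    using concentrated_quasimode[OF nz q0 dq \<beta> \<omega> T that] unfolding P_def R_def by blast
  moreover have "0 \<le> R g l \<delta>" if "P g l \<delta>" for g l \<delta>
    using that by (simp add: P_def R_def L2_norm_nonneg)
  ultimately obtain f0 where f0: "f0 \<in> form_domain L Y q r V"
    and hump: "\<And>K. \<exists>g l \<delta>. g \<in> test_functions L Y \<and> P g l \<delta> \<and> K * R g l \<delta> < \<bar>IP f0 g\<bar>"
    using gliding_hump[of P R] by blast
  have "\<not> (AE p in M. f T p = 0)" if u: "u \<in> controls Y \<omega>x T" and f: "duhamel_solution L Y S \<omega>x T f0 u f" for u f
  proof
    assume z: "AE p in M. f T p = 0"
    obtain K where K: "\<And>g l \<delta>. g \<in> test_functions L Y \<Longrightarrow> P g l \<delta> \<Longrightarrow>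
        exp (- l * T) * \<bar>IP f0 g\<bar> \<le> K * (\<delta> + L2_norm M (\<lambda>p. indicator (\<omega>x \<times> Omega_y Y) p *\<^sub>R g p))"
      using steering_bound[OF T(1) \<omega>(1,2) form_domain_sequence(1)[OF f0] u f z] unfolding P_def by blast
    obtain g l \<delta> where g: "g \<in> test_functions L Y" "P g l \<delta>" "K * R g l \<delta> < \<bar>IP f0 g\<bar>" using hump by blast
    have "exp (l * T) * (exp (- l * T) * \<bar>IP f0 g\<bar>) \<le> K * R g l \<delta>"
      unfolding R_def using mult_left_mono[OF K[OF g(1,2)], of "exp (l * T)"] by (simp add: algebra_simps)
    then show False using g(3) by (simp add: mult.assoc[symmetric] exp_add[symmetric])
  qed
  with f0 show ?thesis unfolding cannot_be_steered_to_zero_def by blast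
qed

end


theorem theorem2p2:
  fixes L :: real and Y :: y_domain and \<gamma> :: nat
    and q r V :: "real \<Rightarrow> real" and \<omega>x :: "real set"
    and S :: "real \<Rightarrow> (real \<times> real \<Rightarrow> complex) \<Rightarrow> real \<times> real \<Rightarrow> complex"
  assumes "L > 0"
    and "\<gamma> \<ge> 1"
    and "smooth_fun_on {-L..L} q"
    and "\<forall>k<\<gamma>. (deriv ^^ k) q 0 = 0"
    and "(deriv ^^ \<gamma>) q 0 > 0"
    and "\<forall>x\<in>{-L..L}. x \<noteq> 0 \<longrightarrow> q x \<noteq> 0"
    and "admissible_r Y r"
    and "essentially_bounded_on {-L<..<L} V"
    and "\<omega>x \<subseteq> {-L<..<L}" and "open \<omega>x" and "\<omega>x \<noteq> {}"
    and "infdist 0 \<omega>x > 0"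
    and "semigroup_generated_by_minus (Omega_measure L Y) (friedrichs_extension L Y q r V) S"
  shows "(\<gamma> = 1 \<longrightarrow>
            (\<forall>T>0. T < d_agm_set q \<omega>x / deriv q 0 \<longrightarrow>
               (\<exists>f0 \<in> form_domain L Y q r V. cannot_be_steered_to_zero L Y S \<omega>x T f0))) \<and>
         (\<gamma> > 1 \<longrightarrow>
            (\<forall>T>0. \<exists>f0 \<in> form_domain L Y q r V. cannot_be_steered_to_zero L Y S \<omega>x T f0))"
proof -
  interpret grushin_semigroup L Y q r V S
    by (intro grushin_semigroup.intro grushin_setting.intro grushin_semigroup_axioms.intro assms)
  have nz: "q x \<noteq> 0" if "x \<in> {-L..L}" "x \<noteq> 0" for x using assms(6) that by blast
  have q0: "q 0 = 0" using spec[OF assms(4), of 0] assms(2) by simp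
  have dq: "(q has_real_derivative deriv q 0) (at 0)"
    by (rule smooth_DERIV[OF smooth_fun_on_imp_smooth[OF q_smooth, of "{-L<..<L}"]]) (use L_pos in auto)
  note \<omega> = assms(9-12)
  show ?thesis
  proof (intro conjI impI allI)
    fix T :: real assume "\<gamma> = 1" "T > 0" "T < d_agm_set q \<omega>x / deriv q 0"
    then show "\<exists>f0\<in>form_domain L Y q r V. cannot_be_steered_to_zero L Y S \<omega>x T f0"
      using exists_not_steerable[OF nz q0 dq _ \<omega>, of T] assms(5) by (simp add: pos_less_divide_eq)
  next
    fix T :: real assume T: "\<gamma> > 1" "T > 0"
    \<comment> \<open>With \<open>\<beta> = 0\<close> the condition on \<open>T\<close> becomes
      \<open>d_agm_set q \<omega>x > 0\<close>, which holds since the control region keeps away from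
      0.\<close>
    then have "deriv q 0 = 0" using spec[OF assms(4), of 1] by simp
    then show "\<exists>f0\<in>form_domain L Y q r V. cannot_be_steered_to_zero L Y S \<omega>x T f0"
      using exists_not_steerable[OF nz q0 dq _ \<omega>, of T] T d_agm_set_bounds(1)[OF nz \<omega>(1,3,4)] by simp
  qed
qed

end
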